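(* Let $F$ be a TC vector field on the closed unit disk $D^2\subset\mathbb{R}^2$ with topological center at the origin $O$. For $r\in\{0,1,\ldots,\infty\}$ let $\mathcal{E}^{+}(F)^r$ and $\mathcal{E}_{\partial}(F)^r$ denote $\mathcal{E}^{+}(F)$ and $\mathcal{E}_{\partial}(F)$ endowed with the weak topology $\mathsf{W}^r$. Then for each $r\ge 0$ $$ \pi_n\bigl(\mathcal{E}^{+}(F)^r,\mathcal{E}_{\partial}(F)^r\bigr)= \begin{cases}\mathbb{Z}, & n=1,\\ 0, & \text{otherwise.}\end{cases} $$ Hence the inclusion $\mathcal{E}_{\partial}(F)\subset\mathcal{E}^{+}(F)$ induces isomorphisms $$\pi_n\mathcal{E}_{\partial}(F)^r\to\pi_n\mathcal{E}^{+}(F)^r,\qquad n\ge 2,$$ and there is an exact sequence $$0\to\pi_1\mathcal{E}_{\partial}(F)^r\to\pi_1\mathcal{E}^{+}(F)^r\to\mathbb{Z}\to\pi_0\mathcal{E}_{\partial}(F)^r\to\pi_0\mathcal{E}^{+}(F)^r\to 0.$$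
   Context: $D^2=\{x^2+y^2\le 1\}$ and $O$ is the origin. A $C^\infty$ vector field $F$ on $D^2$ is a TC vector field (with topological center at $O$) if: $O$ is the unique singular point of $F$; $F$ is tangent to $\partial D^2$, so that $\partial D^2$ is an orbit of $F$; and all other orbits of $F$ (different from $\{O\}$) are closed. $\mathcal{E}(F)$ is the semigroup (under composition) of all $C^\infty$ maps $h:D^2\to D^2$ such that $h(o)=o$ for every orbit $o$ of $F$ (in particular $h(O)=O$) and $h$ is a local diffeomorphism at $O$. $\mathcal{E}^{+}(F)\subset\mathcal{E}(F)$ consists of those $h$ whose Jacobian determinant at $O$ is positive. $\mathcal{E}_{\partial}(F)\subset\mathcal{E}^{+}(F)$ consists of those $h$ with $h(x)=x$ for all $x\in\partial D^2$. Weak topologies on $C^\infty(A,B)$: $\mathsf{W}^0$ is the compact open topology; for finite $r$, $\mathsf{W}^r$ is induced by the $r$-jet prolongation $C^\infty(A,B)\to C^\infty(A,J^r(A,B))$ from the compact open topology; $\mathsf{W}^\infty$ is generated by all $\mathsf{W}^r$, $0\le r<\infty$. Subsets carry the induced topologies. All homotopy groups and sets are taken with base point $\mathrm{id}_{D^2}$. Triviality of $\pi_0$ of the pair means that every path component of the larger space meets the smaller one. The sets $\pi_0$ of path components carry the semigroup structure induced by composition (for these semigroups they are in fact groups). *)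

theory Defs
  imports "HOL-Analysis.Analysis" "HOL-Algebra.Elementary_Groups"
begin

section \<open>Smooth maps on subsets of the plane\<close>

definition partial_within ::
    "(real^2) set \<Rightarrow> 2 \<Rightarrow> (real^2 \<Rightarrow> real^2) \<Rightarrow> real^2 \<Rightarrow> real^2" where
  "partial_within S i f x = frechet_derivative f (at x within S) (axis i 1)"

primrec iter_partial ::
    "(real^2) set \<Rightarrow> 2 list \<Rightarrow> (real^2 \<Rightarrow> real^2) \<Rightarrow> real^2 \<Rightarrow> real^2" where
  "iter_partial S [] f = f"
| "iter_partial S (i # is) f = partial_within S i (iter_partial S is f)"

text \<open>\<open>C\<^sup>\<infinity>\<close> on an arbitrary set: restriction of a \<open>C\<^sup>\<infinity>\<close> map defined on an open neighbourhood.\<close>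

definition smooth_on :: "(real^2) set \<Rightarrow> (real^2 \<Rightarrow> real^2) \<Rightarrow> bool" where
  "smooth_on S f \<longleftrightarrow>
     (\<exists>U g. open U \<and> S \<subseteq> U \<and> (\<forall>x\<in>S. g x = f x) \<and>
            (\<forall>is. iter_partial U is g differentiable_on U))"

definition local_diffeo_at :: "(real^2 \<Rightarrow> real^2) \<Rightarrow> real^2 \<Rightarrow> bool" where
  "local_diffeo_at h x \<longleftrightarrow>
     (\<exists>U V k. open U \<and> x \<in> U \<and> open V \<and> homeomorphism U V h k \<and>
              smooth_on U h \<and> smooth_on V k)"

abbreviation disk :: "(real^2) set" where
  "disk \<equiv> cball 0 1"

text \<open>Maps of the disk are represented by functions that are \<open>undefined\<close> off the disk, so that
  equality of representing functions is equality of maps.\<close>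

definition Cinf_disk :: "(real^2 \<Rightarrow> real^2) set" where
  "Cinf_disk = {h \<in> disk \<rightarrow>\<^sub>E disk. smooth_on disk h}"

abbreviation id_disk :: "real^2 \<Rightarrow> real^2" where
  "id_disk \<equiv> restrict (\<lambda>x. x) disk"

section \<open>Weak topologies\<close>

definition compact_open_topology :: "'a topology \<Rightarrow> 'b topology \<Rightarrow> ('a \<Rightarrow> 'b) topology" where
  "compact_open_topology X Y =
     topology_generated_by
       {{f \<in> extensional (topspace X). continuous_map X Y f \<and> f ` K \<subseteq> U} | K U.
          compactin X K \<and> openin Y U}"

text \<open>A \<open>k\<close>-jet at a point of the disk is given by its source and its partial derivatives
  \<open>\<partial>\<^sub>1\<^sup>a \<partial>\<^sub>2\<^sup>b\<close> with \<open>a + b \<le> k\<close>; the target is the entry \<open>(0, 0)\<close>.  We use the jet space with values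
  in the plane: the jets of maps into the disk form a subspace of it.  The derivatives of a smooth
  map are uniquely determined within the disk, also at its boundary points, and agree there
  with those of any smooth extension.\<close>

type_synonym jet = "(real^2) \<times> (nat \<times> nat \<Rightarrow> real^2)"

definition jet_space :: "nat \<Rightarrow> jet topology" where
  "jet_space k =
     prod_topology (top_of_set disk) (product_topology (\<lambda>_. euclidean) {(a, b). a + b \<le> k})"

definition jet_prolongation :: "nat \<Rightarrow> (real^2 \<Rightarrow> real^2) \<Rightarrow> real^2 \<Rightarrow> jet" where
  "jet_prolongation k f =
     (\<lambda>x\<in>disk. (x, \<lambda>(a, b)\<in>{(a, b). a + b \<le> k}.
                      iter_partial disk (replicate a 1 @ replicate b 2) f x))"

definition weak_topology_fin :: "nat \<Rightarrow> (real^2 \<Rightarrow> real^2) topology" where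
  "weak_topology_fin k =
     (if k = 0 then subtopology (compact_open_topology (top_of_set disk) (top_of_set disk)) Cinf_disk
      else pullback_topology Cinf_disk (jet_prolongation k)
             (compact_open_topology (top_of_set disk) (jet_space k)))"

definition weak_topology :: "enat \<Rightarrow> (real^2 \<Rightarrow> real^2) topology" where
  "weak_topology r =
     (case r of enat k \<Rightarrow> weak_topology_fin k
      | \<infinity> \<Rightarrow> topology_generated_by (\<Union>k. {U. openin (weak_topology_fin k) U}))"

section \<open>TC vector fields and their orbit-preserving maps\<close>

text \<open>Vector fields on the disk tangent to the boundary circle are complete, hence every maximal
  integral curve is defined on the whole real line.\<close>

definition integral_curve :: "(real^2 \<Rightarrow> real^2) \<Rightarrow> (real \<Rightarrow> real^2) \<Rightarrow> bool" where
  "integral_curve F \<gamma> \<longleftrightarrow>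
     (\<forall>t. \<gamma> t \<in> disk \<and> (\<gamma> has_vector_derivative F (\<gamma> t)) (at t))"

definition orbit_of :: "(real^2 \<Rightarrow> real^2) \<Rightarrow> real^2 \<Rightarrow> (real^2) set" where
  "orbit_of F x = {\<gamma> t | \<gamma> t. integral_curve F \<gamma> \<and> \<gamma> 0 = x}"

definition orbits :: "(real^2 \<Rightarrow> real^2) \<Rightarrow> (real^2) set set" where
  "orbits F = orbit_of F ` disk"

text \<open>Closed means periodic.  Constant curves are not excluded here, but in a TC vector field they
  only occur at the origin.\<close>

definition closed_orbit :: "(real^2 \<Rightarrow> real^2) \<Rightarrow> (real^2) set \<Rightarrow> bool" where
  "closed_orbit F c \<longleftrightarrow>
     (\<exists>\<gamma> T. integral_curve F \<gamma> \<and> T > 0 \<and> (\<forall>t. \<gamma> (t + T) = \<gamma> t) \<and> c = range \<gamma>)"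

definition TC_vector_field :: "(real^2 \<Rightarrow> real^2) \<Rightarrow> bool" where
  "TC_vector_field F \<longleftrightarrow>
     smooth_on disk F \<and>
     (\<forall>x\<in>disk. F x = 0 \<longleftrightarrow> x = 0) \<and>
     (\<forall>x\<in>sphere 0 1. F x \<bullet> x = 0) \<and>
     (\<forall>c\<in>orbits F. c \<noteq> {0} \<longrightarrow> closed_orbit F c)"

definition E_maps :: "(real^2 \<Rightarrow> real^2) \<Rightarrow> (real^2 \<Rightarrow> real^2) set" where
  "E_maps F = {h \<in> Cinf_disk. (\<forall>c\<in>orbits F. h ` c = c) \<and> local_diffeo_at h 0}"

definition E_plus :: "(real^2 \<Rightarrow> real^2) \<Rightarrow> (real^2 \<Rightarrow> real^2) set" where
  "E_plus F = {h \<in> E_maps F. det (jacobian h (at 0)) > 0}"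

definition E_bdry :: "(real^2 \<Rightarrow> real^2) \<Rightarrow> (real^2 \<Rightarrow> real^2) set" where
  "E_bdry F = {h \<in> E_plus F. \<forall>x\<in>sphere 0 1. h x = x}"

section \<open>Homotopy groups and sets\<close>

definition cube :: "nat \<Rightarrow> (nat \<Rightarrow> real) topology" where
  "cube n = product_topology (\<lambda>_. top_of_set {0..1}) {..<n}"

definition cube_boundary :: "nat \<Rightarrow> (nat \<Rightarrow> real) set" where
  "cube_boundary n = {s \<in> topspace (cube n). \<exists>i<n. s i = 0 \<or> s i = 1}"

text \<open>The closure of the complement, in the boundary of the cube, of the face on which the last
  coordinate vanishes.\<close>

definition cube_box :: "nat \<Rightarrow> (nat \<Rightarrow> real) set" where
  "cube_box n = {s \<in> topspace (cube n). \<exists>i<n. s i = 1 \<or> (s i = 0 \<and> Suc i \<noteq> n)}"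

text \<open>Only the values on the cube matter in the following relations (so each class contains all
  extensions of its members off the cube).\<close>

definition homotopic_spheroids ::
    "nat \<Rightarrow> 'a topology \<Rightarrow> 'a \<Rightarrow> ((nat \<Rightarrow> real) \<Rightarrow> 'a) \<Rightarrow> ((nat \<Rightarrow> real) \<Rightarrow> 'a) \<Rightarrow> bool" where
  "homotopic_spheroids n X p = homotopic_with (\<lambda>f. f ` cube_boundary n \<subseteq> {p}) (cube n) X"

definition homotopic_rel_spheroids ::
    "nat \<Rightarrow> 'a topology \<Rightarrow> 'a set \<Rightarrow> 'a \<Rightarrow> ((nat \<Rightarrow> real) \<Rightarrow> 'a) \<Rightarrow> ((nat \<Rightarrow> real) \<Rightarrow> 'a) \<Rightarrow> bool" where
  "homotopic_rel_spheroids n X A p =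
     homotopic_with (\<lambda>f. f ` cube_boundary n \<subseteq> A \<and> f ` cube_box n \<subseteq> {p}) (cube n) X"

definition concat_spheroids ::
    "((nat \<Rightarrow> real) \<Rightarrow> 'a) \<Rightarrow> ((nat \<Rightarrow> real) \<Rightarrow> 'a) \<Rightarrow> (nat \<Rightarrow> real) \<Rightarrow> 'a" where
  "concat_spheroids f g s =
     (if s 0 \<le> 1/2 then f (s(0 := 2 * s 0)) else g (s(0 := 2 * s 0 - 1)))"

text \<open>Used for \<open>n \<ge> 1\<close> only.\<close>

definition homotopy_group ::
    "nat \<Rightarrow> 'a topology \<Rightarrow> 'a \<Rightarrow> ((nat \<Rightarrow> real) \<Rightarrow> 'a) set monoid" where
  "homotopy_group n X p =
     \<lparr>carrier = {f. homotopic_spheroids n X p f f} // {(f, g). homotopic_spheroids n X p f g},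
      monoid.mult =
        (\<lambda>\<alpha> \<beta>. {h. \<exists>f\<in>\<alpha>. \<exists>g\<in>\<beta>. homotopic_spheroids n X p (concat_spheroids f g) h}),
      one = {h. homotopic_spheroids n X p (\<lambda>_. p) h}\<rparr>"

definition rel_homotopy_set ::
    "nat \<Rightarrow> 'a topology \<Rightarrow> 'a set \<Rightarrow> 'a \<Rightarrow> ((nat \<Rightarrow> real) \<Rightarrow> 'a) set set" where
  "rel_homotopy_set n X A p =
     {f. homotopic_rel_spheroids n X A p f f} // {(f, g). homotopic_rel_spheroids n X A p f g}"

definition rel_trivial_class ::
    "nat \<Rightarrow> 'a topology \<Rightarrow> 'a set \<Rightarrow> 'a \<Rightarrow> ((nat \<Rightarrow> real) \<Rightarrow> 'a) set" where
  "rel_trivial_class n X A p = {h. homotopic_rel_spheroids n X A p (\<lambda>_. p) h}"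

text \<open>For a topological monoid \<open>X\<close> with operation \<open>m\<close> and unit \<open>p\<close>, and a submonoid \<open>A\<close>, pointwise
  application of \<open>m\<close> turns the sets \<open>\<pi>\<^sub>0(X)\<close> and \<open>\<pi>\<^sub>1(X, A, p)\<close> into monoids.\<close>

definition pi0_monoid ::
    "'a topology \<Rightarrow> ('a \<Rightarrow> 'a \<Rightarrow> 'a) \<Rightarrow> 'a \<Rightarrow> 'a set monoid" where
  "pi0_monoid X m p =
     \<lparr>carrier = path_components_of X,
      monoid.mult = (\<lambda>C D. {z. \<exists>x\<in>C. \<exists>y\<in>D. path_component_of X (m x y) z}),
      one = {z. path_component_of X p z}\<rparr>"

definition rel_pi1_monoid ::
    "'a topology \<Rightarrow> 'a set \<Rightarrow> ('a \<Rightarrow> 'a \<Rightarrow> 'a) \<Rightarrow> 'a \<Rightarrow> ((nat \<Rightarrow> real) \<Rightarrow> 'a) set monoid" where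
  "rel_pi1_monoid X A m p =
     \<lparr>carrier = rel_homotopy_set 1 X A p,
      monoid.mult =
        (\<lambda>\<alpha> \<beta>. {h. \<exists>f\<in>\<alpha>. \<exists>g\<in>\<beta>. homotopic_rel_spheroids 1 X A p (\<lambda>s. m (f s) (g s)) h}),
      one = rel_trivial_class 1 X A p\<rparr>"

text \<open>The maps of the long exact sequence of a pair.  The inclusions send a class to the class, in
  the larger set, of its members.  The boundary map evaluates a relative path at the vertex \<open>0\<close> of
  \<open>[0, 1]\<close>, its end point in \<open>A\<close>.\<close>

definition pi_incl ::
    "nat \<Rightarrow> 'a topology \<Rightarrow> 'a \<Rightarrow> ((nat \<Rightarrow> real) \<Rightarrow> 'a) set \<Rightarrow> ((nat \<Rightarrow> real) \<Rightarrow> 'a) set" where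
  "pi_incl n X p \<alpha> = {g. \<exists>f\<in>\<alpha>. homotopic_spheroids n X p f g}"

definition pi0_incl :: "'a topology \<Rightarrow> 'a set \<Rightarrow> 'a set" where
  "pi0_incl X C = {y. \<exists>x\<in>C. path_component_of X x y}"

definition pi1_to_rel ::
    "'a topology \<Rightarrow> 'a set \<Rightarrow> 'a \<Rightarrow> ((nat \<Rightarrow> real) \<Rightarrow> 'a) set \<Rightarrow> ((nat \<Rightarrow> real) \<Rightarrow> 'a) set" where
  "pi1_to_rel X A p \<alpha> = {g. \<exists>f\<in>\<alpha>. homotopic_rel_spheroids 1 X A p f g}"

definition rel_pi1_boundary ::
    "'a topology \<Rightarrow> 'a set \<Rightarrow> ((nat \<Rightarrow> real) \<Rightarrow> 'a) set \<Rightarrow> 'a set" where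
  "rel_pi1_boundary X A \<alpha> =
     {y. \<exists>f\<in>\<alpha>. path_component_of (subtopology X A) (f (\<lambda>i\<in>{..<1}. 0)) y}"

definition exact_at ::
    "('a, 'm) monoid_scheme \<Rightarrow> ('a \<Rightarrow> 'b) \<Rightarrow> ('b, 'n) monoid_scheme \<Rightarrow> ('b \<Rightarrow> 'c) \<Rightarrow>
     ('c, 'k) monoid_scheme \<Rightarrow> bool" where
  "exact_at G f H g K \<longleftrightarrow> f ` carrier G = kernel H K g"

end

theory Submission
  imports Defs
begin

text \<open>Away from the centre, a map \<open>h\<close> in \<open>E_plus F\<close> is a shift \<open>h x = \<Phi> (x, a x)\<close> along the flow
  \<open>\<Phi>\<close> of \<open>F\<close>.  Because the Jacobian at the centre is positive, \<open>h x / x\<close> (in complex notation) has a continuous logarithm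
  on the punctured disk, and such an \<open>a\<close> is determined by \<open>h\<close> and a real \<open>s\<close> with \<open>h (1, 0) = exp (2 \<pi> \<i> s)\<close>; it is as smooth
  as \<open>h\<close> and depends continuously on \<open>(h, s)\<close>.  With a cutoff \<open>\<mu>\<close> that vanishes near the centre and is \<open>1\<close> near the
  boundary, \<open>(t, x) \<mapsto> \<Phi> (x, (1 - t \<mu> x) a x)\<close> deforms the infinite cyclic cover \<open>{(h, s)}\<close> of \<open>E_plus F\<close> onto
  \<open>E_bdry F\<close>.  Hence \<open>E_bdry F\<close> is the homotopy fibre of \<open>h \<mapsto> h (1, 0)\<close> into the circle, and everything
  follows by lifting homotopies along this cover.\<close>

section \<open>Families of maps with jointly continuous derivatives\<close>

text \<open>The centre is the main obstacle. Nothing is assumed about the linear part of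
  \<open>F\<close> there: periods may be unbounded near \<open>0\<close>, and the shift function of
  a map need not be continuous at \<open>0\<close>. So shift functions are altered only away from
  the centre, and near it a map already known to be smooth is kept. On the punctured disk two facts
  about the orbits suffice: the minimal period is continuous, and every orbit winds exactly once
  around the centre. The boundary circle is a second obstacle, since smoothness on the disk means
  smooth extendability beyond it; implicit functions are therefore solved on neighbourhoods of
  closed annuli. Third, members of \<open>E_plus F\<close> need not be injective. They form a monoid
  only, and inverses exist up to homotopy, built from the local inverse at the centre. Nor is
  evaluation at \<open>(1, 0)\<close> multiplicative: it merely ignores a left factor from
  \<open>E_bdry F\<close>. Products of paths are therefore reparametrised so that one factor moves
  at a time, which makes their winding numbers add up.\<close>

abbreviation lc :: "('a::euclidean_space \<Rightarrow> 'b::real_vector) \<Rightarrow> 'a \<Rightarrow> 'b" where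
  "lc D \<equiv> \<lambda>v. \<Sum>b\<in>Basis. (v \<bullet> b) *\<^sub>R D b"

abbreviation "derivs T S f D \<equiv> \<forall>p\<in>topspace T. \<forall>x\<in>S. (f p has_derivative lc (\<lambda>b. D b p x)) (at x within S)"

text \<open>The partial derivatives in \<open>x\<close> up to order \<open>k\<close> exist and are jointly continuous in the parameter and \<open>x\<close>.  Continuity of a
  family of maps for \<open>weak_topology_fin k\<close> takes this form.\<close>

primrec Ck :: "nat \<Rightarrow> 'p topology \<Rightarrow> 'a::euclidean_space set \<Rightarrow> ('p \<Rightarrow> 'a \<Rightarrow> 'b::real_normed_vector) \<Rightarrow> bool"
where
  "Ck 0 T S f \<longleftrightarrow> continuous_map (prod_topology T (top_of_set S)) euclidean (\<lambda>z. f (fst z) (snd z))"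
| "Ck (Suc k) T S f \<longleftrightarrow>
     continuous_map (prod_topology T (top_of_set S)) euclidean (\<lambda>z. f (fst z) (snd z)) \<and>
     (\<exists>D. derivs T S f D \<and> (\<forall>b\<in>Basis. Ck k T S (D b)))"

lemma Ck_0: "Ck k T S f \<Longrightarrow> Ck 0 T S f" by (cases k) auto

lemma Ck_SucI:
  assumes "Ck 0 T S f"
    and "\<And>p x. p \<in> topspace T \<Longrightarrow> x \<in> S \<Longrightarrow>
      (f p has_derivative lc (\<lambda>b. D b p x)) (at x within S)"
    and "\<And>b. b \<in> Basis \<Longrightarrow> Ck k T S (D b)"
  shows "Ck (Suc k) T S f" using assms by auto

lemma Ck_SucE:
  assumes "Ck (Suc k) T S f"
  obtains D where "derivs T S f D"
    and "\<And>b. b \<in> Basis \<Longrightarrow> Ck k T S (D b)" using assms by auto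

lemma Ck_mono_aux: "Ck (Suc k) T S f \<Longrightarrow> Ck k T S f"
proof (induction k arbitrary: f)
  case 0 then show ?case using Ck_0 by blast
next
  case (Suc k)
  from Suc.prems obtain D where "derivs T S f D"
    and "\<And>b. b \<in> Basis \<Longrightarrow> Ck (Suc k) T S (D b)" by (rule Ck_SucE) blast
  with Suc show ?case by (intro Ck_SucI[where D = D]) (use Ck_0 in blast)+
qed

lemma Ck_mono: "Ck k T S f \<Longrightarrow> j \<le> k \<Longrightarrow> Ck j T S f"
  by (induction k arbitrary: j) (auto simp: le_Suc_eq simp del: Ck.simps intro: Ck_mono_aux)

lemma Ck_cong:
  assumes "Ck k T S f" "\<And>p x. p \<in> topspace T \<Longrightarrow> x \<in> S \<Longrightarrow> f p x = g p x"
  shows "Ck k T S g"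
proof -
  have "continuous_map (prod_topology T (top_of_set S)) euclidean (\<lambda>z. g (fst z) (snd z))" using Ck_0[OF assms(1)] assms(2)
    by (auto elim!: continuous_map_eq)
  moreover have "(g p has_derivative lc (\<lambda>b. D b p x)) (at x within S)"
    if "p \<in> topspace T" "x \<in> S"
      "(f p has_derivative lc (\<lambda>b. D b p x)) (at x within S)" for p x D
    using that(3) by (rule has_derivative_transform[rotated 2]) (use that assms(2) in auto)
  ultimately show ?thesis using assms(1) by (cases k) fastforce+
qed

lemma continuous_map_prod_mono:
  assumes "continuous_map (prod_topology T (top_of_set S)) Z f" "continuous_map T' T h" "S' \<subseteq> S"
  shows "continuous_map (prod_topology T' (top_of_set S')) Z (\<lambda>z. f (h (fst z), snd z))"
proof -
  have "continuous_map (prod_topology T' (top_of_set S')) (prod_topology T (top_of_set S)) (\<lambda>z. (h (fst z), snd z))"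
    unfolding continuous_map_pairwise o_def fst_conv snd_conv
  proof
    show "continuous_map (prod_topology T' (top_of_set S')) T (\<lambda>x. h (fst x))"
      using continuous_map_compose[OF continuous_map_fst assms(2)] by (simp add: o_def)
    show "continuous_map (prod_topology T' (top_of_set S')) (top_of_set S) snd" using assms(3) continuous_map_snd[of T' "top_of_set S'"]
      by (auto simp: continuous_map_in_subtopology)
  qed
  from continuous_map_compose[OF this assms(1)] show ?thesis by (simp add: o_def)
qed

lemma Ck_restrict:
  assumes "Ck k T S f" "continuous_map T' T h" "S' \<subseteq> S"
  shows "Ck k T' S' (\<lambda>p. f (h p))" using assms(1)
proof (induction k arbitrary: f)
  case 0
  then show ?case using continuous_map_prod_mono[OF _ assms(2,3)] by fastforce
next
  case (Suc k)
  have h: "h p \<in> topspace T" if "p \<in> topspace T'" for p using assms(2) that by (auto simp: continuous_map_def)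
  from Suc.prems obtain D where D: "derivs T S f D"
    and D': "\<And>b. b \<in> Basis \<Longrightarrow> Ck k T S (D b)" by (rule Ck_SucE) blast
  show ?case
  proof (rule Ck_SucI[where D = "\<lambda>b p. D b (h p)"])
    show "Ck 0 T' S' (\<lambda>p. f (h p))" using continuous_map_prod_mono[OF _ assms(2,3)] Ck_0[OF Suc.prems] by fastforce
  qed (use D h assms(3) Suc.IH[OF D'] in "blast intro: has_derivative_subset")+
qed

lemma Ck_subset: "Ck k T S f \<Longrightarrow> S' \<subseteq> S \<Longrightarrow> Ck k T S' f" using Ck_restrict[of k T S f T id S'] by (simp add: o_def)

lemma Ck_param: "Ck k T S f \<Longrightarrow> continuous_map T' T h \<Longrightarrow> Ck k T' S (\<lambda>p. f (h p))" using Ck_restrict by blast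

lemma C0_pair:
  "Ck 0 T S f \<Longrightarrow> Ck 0 T S g \<Longrightarrow> Ck 0 T S (\<lambda>p x. (f p x, g p x))"
  unfolding Ck.simps prod_topology_euclidean[symmetric] by (rule continuous_map_pairedI)

lemma C0_comp_on:
  assumes "Ck 0 T S f" "continuous_on U h" "\<And>p x. p \<in> topspace T \<Longrightarrow> x \<in> S \<Longrightarrow> f p x \<in> U"
  shows "Ck 0 T S (\<lambda>p x. h (f p x))"
proof -
  have "continuous_map (prod_topology T (top_of_set S)) (top_of_set U) (\<lambda>z. f (fst z) (snd z))"
    using assms by (auto simp: continuous_map_in_subtopology)
  from continuous_map_compose[OF this, of euclidean h] show ?thesis using assms(2) by (simp add: o_def)
qed

lemma C0_comp: "Ck 0 T S f \<Longrightarrow> continuous_on UNIV h \<Longrightarrow> Ck 0 T S (\<lambda>p x. h (f p x))" using C0_comp_on by blast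

lemma C0_comp2:
  assumes "Ck 0 T S f" "Ck 0 T S g" "continuous_on UNIV (\<lambda>z. h (fst z) (snd z))"
  shows "Ck 0 T S (\<lambda>p x. h (f p x) (g p x))" using C0_comp[OF C0_pair[OF assms(1,2)] assms(3)] by simp

lemma Ck_const:
  assumes "continuous_map T euclidean c" shows "Ck k T S (\<lambda>p x. c p)" using assms
proof (induction k arbitrary: c)
  case 0
  then show ?case using continuous_map_compose[OF continuous_map_fst 0] by (simp add: o_def)
next
  case (Suc k)
  show ?case
  proof (rule Ck_SucI[where D = "\<lambda>b p x. 0"])
    show "Ck 0 T S (\<lambda>p x. c p)" using continuous_map_compose[OF continuous_map_fst Suc.prems] by (simp add: o_def)
  qed (auto intro!: Suc)
qed

lemma Ck_const' [simp]: "Ck k T S (\<lambda>p x. c)" by (rule Ck_const) simp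

lemma Ck_id [simp]: "Ck k T S (\<lambda>p x. x)"
proof -
  have 0: "Ck 0 T S (\<lambda>p x. x)" using continuous_map_snd[of T "top_of_set S"] by (simp add: continuous_map_in_subtopology)
  show ?thesis
  proof (cases k)
    case (Suc j)
    show ?thesis unfolding Suc
    proof (rule Ck_SucI[where D = "\<lambda>b p x. b"])
      fix p and x :: 'b
      have "((\<lambda>x. x) has_derivative (\<lambda>v. v)) (at x within S)" by simp
      moreover have "(\<lambda>v::'b. v) = (lc (\<lambda>b. b))" by (simp add: euclidean_representation)
      ultimately show "((\<lambda>x. x) has_derivative lc (\<lambda>b. b)) (at x within S)" by metis
    qed (use 0 in simp_all)
  qed (use 0 in simp)
qed

lemma Ck_linear:
  assumes "bounded_linear L" "Ck k T S f"
  shows "Ck k T S (\<lambda>p x. L (f p x))" using assms(2)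
proof (induction k arbitrary: f)
  case 0
  then show ?case using C0_comp assms(1) linear_continuous_on by blast
next
  case (Suc k)
  interpret bounded_linear L by fact
  from Suc.prems obtain D where D: "derivs T S f D"
    and D': "\<And>b. b \<in> Basis \<Longrightarrow> Ck k T S (D b)" by (rule Ck_SucE) blast
  show ?case
  proof (rule Ck_SucI[where D = "\<lambda>b p x. L (D b p x)"])
    show "Ck 0 T S (\<lambda>p x. L (f p x))" using C0_comp[OF Ck_0[OF Suc.prems]] assms(1) linear_continuous_on by blast
    fix p x assume "p \<in> topspace T" "x \<in> S"
    from has_derivative[OF D[rule_format, OF this]]
    show "((\<lambda>x. L (f p x)) has_derivative lc (\<lambda>b. L (D b p x))) (at x within S)" by (simp add: sum scaleR)
  qed (use Suc.IH D' in blast)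
qed

lemma Ck_add:
  assumes "Ck k T S f" "Ck k T S g"
  shows "Ck k T S (\<lambda>p x. f p x + g p x)" using assms
proof (induction k arbitrary: f g)
  case 0
  have "continuous_on UNIV (\<lambda>z. fst z + snd z :: 'c)" by (intro continuous_intros)
  from C0_comp2[OF 0 this] show ?case by simp
next
  case (Suc k)
  from Suc.prems(1) obtain D where D: "derivs T S f D"
    and D': "\<And>b. b \<in> Basis \<Longrightarrow> Ck k T S (D b)" by (rule Ck_SucE) blast
  from Suc.prems(2) obtain E where E: "derivs T S g E"
    and E': "\<And>b. b \<in> Basis \<Longrightarrow> Ck k T S (E b)" by (rule Ck_SucE) blast
  show ?case
  proof (rule Ck_SucI[where D = "\<lambda>b p x. D b p x + E b p x"])
    have "continuous_on UNIV (\<lambda>z. fst z + snd z :: 'c)" by (intro continuous_intros)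
    from C0_comp2[OF Ck_0[OF Suc.prems(1)] Ck_0[OF Suc.prems(2)] this]
    show "Ck 0 T S (\<lambda>p x. f p x + g p x)" by simp
    fix p x assume "p \<in> topspace T" "x \<in> S"
    from has_derivative_add[OF D[rule_format, OF this] E[rule_format, OF this]]
    show "((\<lambda>x. f p x + g p x) has_derivative lc (\<lambda>b. (D b p x + E b p x))) (at x within S)" by (simp add: scaleR_add_right sum.distrib)
  qed (use Suc.IH D' E' in blast)
qed

lemma Ck_sum:
  assumes "\<And>i. i \<in> I \<Longrightarrow> Ck k T S (f i)"
  shows "Ck k T S (\<lambda>p x. \<Sum>i\<in>I. f i p x)" using assms by (induction I rule: infinite_finite_induct) (auto intro: Ck_add)

lemma Ck_bilinear:
  assumes "bounded_bilinear prd" "Ck k T S f" "Ck k T S g"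
  shows "Ck k T S (\<lambda>p x. prd (f p x) (g p x))" using assms(2,3)
proof (induction k arbitrary: f g)
  case 0
  interpret bounded_bilinear prd by fact
  have "continuous_on UNIV (\<lambda>z. prd (fst z) (snd z))" by (intro continuous_on continuous_intros)
  from C0_comp2[OF 0 this] show ?case by simp
next
  case (Suc k)
  interpret bounded_bilinear prd by fact
  from Suc.prems(1) obtain D where D: "derivs T S f D"
    and D': "\<And>b. b \<in> Basis \<Longrightarrow> Ck k T S (D b)" by (rule Ck_SucE) blast
  from Suc.prems(2) obtain E where E: "derivs T S g E"
    and E': "\<And>b. b \<in> Basis \<Longrightarrow> Ck k T S (E b)" by (rule Ck_SucE) blast
  show ?case
  proof (rule Ck_SucI[where D = "\<lambda>b p x. prd (f p x) (E b p x) + prd (D b p x) (g p x)"])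
    have "continuous_on UNIV (\<lambda>z. prd (fst z) (snd z))" by (intro continuous_on continuous_intros)
    from C0_comp2[OF Ck_0[OF Suc.prems(1)] Ck_0[OF Suc.prems(2)] this]
    show "Ck 0 T S (\<lambda>p x. prd (f p x) (g p x))" by simp
    fix p x assume "p \<in> topspace T" "x \<in> S"
    from FDERIV[OF D[rule_format, OF this] E[rule_format, OF this]]
    show "((\<lambda>x. prd (f p x) (g p x)) has_derivative (lc (\<lambda>b. (prd (f p x) (E b p x) + prd (D b p x) (g p x))))) (at x within S)"
      by (simp add: scaleR_add_right sum.distrib sum_left sum_right scaleR_left scaleR_right)
  qed (intro Ck_add Suc.IH D' E' Ck_mono_aux[OF Suc.prems(1)] Ck_mono_aux[OF Suc.prems(2)]; assumption)
qed

lemmas Ck_mult = Ck_bilinear[OF bounded_bilinear_mult]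
  and Ck_scaleR = Ck_bilinear[OF bounded_bilinear_scaleR]
  and Ck_inner = Ck_bilinear[OF bounded_bilinear_inner]
  and Ck_minus = Ck_linear[OF bounded_linear_minus[OF bounded_linear_ident]]
  and Ck_fst = Ck_linear[OF bounded_linear_fst]

lemma Ck_diff: "Ck k T S f \<Longrightarrow> Ck k T S g \<Longrightarrow> Ck k T S (\<lambda>p x. f p x - g p x)"
  using Ck_add[of k T S f "\<lambda>p x. - g p x"] Ck_minus[of k T S g] by simp

lemma Ck_Pair: "Ck k T S f \<Longrightarrow> Ck k T S g \<Longrightarrow> Ck k T S (\<lambda>p x. (f p x, g p x))"
proof -
  assume "Ck k T S f" "Ck k T S g"
  then have "Ck k T S (\<lambda>p x. (f p x, 0) + (0, g p x))"
    by (intro Ck_add Ck_linear[where L = "\<lambda>x. (x, 0)"] Ck_linear[where L = "\<lambda>x. (0, x)"]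
        bounded_linear_Pair bounded_linear_ident bounded_linear_zero)
  then show ?thesis by simp
qed

lemma C0_compose:
  assumes "Ck 0 T U g" "Ck 0 T S f" and fU: "\<And>p x. p \<in> topspace T \<Longrightarrow> x \<in> S \<Longrightarrow> f p x \<in> U"
  shows "Ck 0 T S (\<lambda>p x. g p (f p x))"
proof -
  have "continuous_map (prod_topology T (top_of_set S)) (prod_topology T (top_of_set U)) (\<lambda>z. (fst z, f (fst z) (snd z)))" using assms(2) fU
    by (auto simp: continuous_map_pairwise o_def continuous_map_in_subtopology continuous_map_fst)
  from continuous_map_compose[OF this assms(1)[unfolded Ck.simps]] show ?thesis by (simp add: o_def)
qed

text \<open>By the chain rule each partial derivative is a sum of products of partials of
  \<open>f\<close> with composites of the same kind, the partials of \<open>g\<close> in place of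
  \<open>g\<close>. Hence the induction keeps \<open>f\<close> and leaves \<open>g\<close>
  arbitrary.\<close>

lemma Ck_compose:
  fixes f :: "'p \<Rightarrow> 'a::euclidean_space \<Rightarrow> 'c::euclidean_space"
  assumes "Ck k T U g" "Ck k T S f" and fU: "\<And>p x. p \<in> topspace T \<Longrightarrow> x \<in> S \<Longrightarrow> f p x \<in> U"
  shows "Ck k T S (\<lambda>p x. g p (f p x))" using assms(1,2)
proof (induction k arbitrary: g)
  case 0
  then show ?case using C0_compose fU by blast
next
  case (Suc k)
  from Suc.prems(2) obtain D where D: "derivs T S f D"
    and D': "\<And>b. b \<in> Basis \<Longrightarrow> Ck k T S (D b)" by (rule Ck_SucE) blast
  from Suc.prems(1) obtain E where E: "derivs T U g E"
    and E': "\<And>b. b \<in> Basis \<Longrightarrow> Ck k T U (E b)" by (rule Ck_SucE) blast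
  show ?case
  proof (rule Ck_SucI[where D = "\<lambda>b p x. \<Sum>c\<in>Basis. (D b p x \<bullet> c) *\<^sub>R E c p (f p x)"])
    show "Ck 0 T S (\<lambda>p x. g p (f p x))" using C0_compose[OF Ck_0[OF Suc.prems(1)] Ck_0[OF Suc.prems(2)]] fU by blast
    fix p x assume px: "p \<in> topspace T" "x \<in> S"
    have "(g p has_derivative lc (\<lambda>b. E b p (f p x))) (at (f p x) within (f p ` S))"
      using E[rule_format, OF px(1) fU[OF px]] by (rule has_derivative_subset) (use px fU in auto)
    from has_derivative_in_compose[OF D[rule_format, OF px] this]
    have *: "((\<lambda>x. g p (f p x)) has_derivative (\<lambda>v. \<Sum>c\<in>Basis. ((lc (\<lambda>b. D b p x) v) \<bullet> c) *\<^sub>R E c p (f p x))) (at x within S)" .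
    have "(lc (\<lambda>c. E c p (f p x)) (lc (\<lambda>b. D b p x) v))
       = (lc (\<lambda>b. (lc (\<lambda>c. E c p (f p x)) (D b p x))) v)" for v by (simp add: inner_sum_left scaleR_sum_left scaleR_sum_right) (rule sum.swap)
    with * show "((\<lambda>x. g p (f p x)) has_derivative (lc (\<lambda>b. (lc (\<lambda>c. E c p (f p x)) (D b p x))))) (at x within S)" by simp
  next
    fix b :: 'a assume b: "b \<in> Basis"
    show "Ck k T S (\<lambda>p x. \<Sum>c\<in>Basis. (D b p x \<bullet> c) *\<^sub>R E c p (f p x))"
      by (intro Ck_sum Ck_scaleR Ck_inner D' b Ck_const' Suc.IH E' Ck_mono_aux[OF Suc.prems(2)])
  qed
qed

text \<open>The derivative of the reciprocal contains the reciprocal itself, needed one order lower,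
  so the induction hypothesis is about the same \<open>f\<close>.\<close>

lemma Ck_inverse:
  fixes f :: "'p \<Rightarrow> 'a::euclidean_space \<Rightarrow> real"
  assumes "Ck k T S f" and nz: "\<And>p x. p \<in> topspace T \<Longrightarrow> x \<in> S \<Longrightarrow> f p x \<noteq> 0"
  shows "Ck k T S (\<lambda>p x. inverse (f p x))" using assms(1)
proof (induction k)
  have *: "continuous_on (- {0}) (inverse :: real \<Rightarrow> real)" by (intro continuous_intros) auto
  have 00: "Ck 0 T S (\<lambda>p x. inverse (f p x))" if "Ck 0 T S f" by (rule C0_comp_on[OF that *]) (use nz in auto)
  {
    case 0 then show ?case using 00 by blast
  next
    case (Suc k)
    from Suc.prems(1) obtain D where D: "derivs T S f D"
      and D': "\<And>b. b \<in> Basis \<Longrightarrow> Ck k T S (D b)" by (rule Ck_SucE) blast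
    show ?case
    proof (rule Ck_SucI[where D = "\<lambda>b p x. - (inverse (f p x) * D b p x * inverse (f p x))"])
      show "Ck 0 T S (\<lambda>p x. inverse (f p x))" using 00 Ck_0[OF Suc.prems] by blast
      fix p x assume px: "p \<in> topspace T" "x \<in> S"
      from Deriv.has_derivative_inverse[OF nz[OF px] D[rule_format, OF px]]
      show "((\<lambda>x. inverse (f p x)) has_derivative (lc (\<lambda>b. (- (inverse (f p x) * D b p x * inverse (f p x)))))) (at x within S)"
        by (simp add: sum_distrib_left sum_distrib_right sum_negf mult_ac)
    next
      fix b :: 'a assume "b \<in> Basis"
      then show "Ck k T S (\<lambda>p x. - (inverse (f p x) * D b p x * inverse (f p x)))" by (intro Ck_minus Ck_mult D' Suc.IH Ck_mono_aux[OF Suc.prems])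
    qed
  }
qed

lemma Ck_divide:
  fixes f g :: "'p \<Rightarrow> 'a::euclidean_space \<Rightarrow> real"
  assumes "Ck k T S f" "Ck k T S g" "\<And>p x. p \<in> topspace T \<Longrightarrow> x \<in> S \<Longrightarrow> g p x \<noteq> 0"
  shows "Ck k T S (\<lambda>p x. f p x / g p x)" unfolding divide_inverse by (intro Ck_mult Ck_inverse assms)

declare Ck.simps [simp del]

text \<open>On a set with boundary a derivative within the set may fail to be unique. Testing the
  real zero function suffices: the difference of two derivatives of a vector-valued map reduces to
  it by pairing with a fixed vector.\<close>

definition unique_derivs :: "'a::euclidean_space set \<Rightarrow> bool" where
  "unique_derivs S \<longleftrightarrow>
     (\<forall>x\<in>S. \<forall>L. ((\<lambda>_. 0::real) has_derivative L) (at x within S) \<longrightarrow> L = (\<lambda>_. 0))"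

lemma unique_derivsD:
  fixes f :: "'a::euclidean_space \<Rightarrow> 'b::real_inner"
  assumes "unique_derivs S" "x \<in> S" "(f has_derivative L) (at x within S)" "(f has_derivative M) (at x within S)"
  shows "L = M"
proof
  fix v
  let ?w = "L v - M v"
  have "((\<lambda>_. 0::real) has_derivative (\<lambda>v. (L v - M v) \<bullet> ?w)) (at x within S)"
    using has_derivative_inner_left[OF has_derivative_diff[OF assms(3,4)], of ?w] by simp
  then have "(\<lambda>v. (L v - M v) \<bullet> ?w) = (\<lambda>_. 0)" using assms(1,2) by (auto simp: unique_derivs_def)
  then show "L v = M v" by (metis inner_eq_zero_iff right_minus_eq)
qed

lemma unique_derivs_open: "open S \<Longrightarrow> unique_derivs S" unfolding unique_derivs_def
proof (intro ballI allI impI)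
  fix x and L :: "'a \<Rightarrow> real" assume "open S" "x \<in> S" "((\<lambda>_. 0) has_derivative L) (at x within S)"
  then have "((\<lambda>_. 0::real) has_derivative L) (at x)" using at_within_open[of x S] by metis
  from has_derivative_unique[OF this has_derivative_const] show "L = (\<lambda>_. 0)" .
qed

text \<open>Restricting to the segment from \<open>x\<close> to \<open>y\<close> shows that
  \<open>L (y - x)\<close> vanishes. As \<open>S\<close> contains a ball, every vector is a multiple
  of a difference of two such directions.\<close>

lemma unique_derivs_convex:
  fixes S :: "'a::euclidean_space set"
  assumes "convex S" "interior S \<noteq> {}"
  shows "unique_derivs S" unfolding unique_derivs_def
proof (intro ballI allI impI)
  fix x and L :: "'a \<Rightarrow> real" assume x: "x \<in> S" and L: "((\<lambda>_. 0) has_derivative L) (at x within S)"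
  interpret L: bounded_linear L using L by (rule has_derivative_bounded_linear)
  have seg: "L (y - x) = 0" if y: "y \<in> S" for y
  proof -
    have sub: "(\<lambda>t. x + t *\<^sub>R (y - x)) ` {0..1} \<subseteq> S" using assms(1) x y by (auto simp: convex_alt algebra_simps)
    have "((\<lambda>t. x + t *\<^sub>R (y - x)) has_derivative (\<lambda>t. t *\<^sub>R (y - x))) (at 0 within {0..1::real})"
      by (auto intro!: derivative_eq_intros)
    moreover have "((\<lambda>_. 0::real) has_derivative L) (at (x + 0 *\<^sub>R (y - x)) within (\<lambda>t. x + t *\<^sub>R (y - x)) ` {0..1})"
      using has_derivative_subset[OF L sub] by simp
    ultimately have "((\<lambda>_::real. 0::real) has_derivative (\<lambda>t. L (t *\<^sub>R (y - x)))) (at 0 within {0..1})"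
      by (rule has_derivative_in_compose)
    then have "(\<lambda>t. L (t *\<^sub>R (y - x))) = (\<lambda>t. 0)"
      by (intro frechet_derivative_unique_within_closed_interval[of 0 1 0 "\<lambda>_::real. 0::real"]) auto
    then show ?thesis by (metis scaleR_one)
  qed
  obtain a e where e: "e > 0" "ball a e \<subseteq> S" using assms(2) by (meson ex_in_conv mem_interior)
  show "L = (\<lambda>_. 0)"
  proof
    fix v :: 'a
    \<comment> \<open>Small enough for \<open>a + c *\<^sub>R v\<close> to stay in the ball; the
      summand \<open>1\<close> covers \<open>v = 0\<close>.\<close>
    define c where "c = e / 2 / (norm v + 1)"
    have n: "0 < norm v + 1" by (simp add: add_nonneg_pos)
    have c: "c > 0" unfolding c_def using e(1) n by simp
    have "c * norm v \<le> c * (norm v + 1)" using c by simp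
    also have "\<dots> = e / 2" unfolding c_def using n nonzero_eq_divide_eq[of "norm v + 1" "e / 2 / (norm v + 1)" "e / 2"] by simp
    finally have "c * norm v < e" using e(1) by linarith
    then have "a + c *\<^sub>R v \<in> ball a e" using c by (simp add: dist_norm)
    then have "L (a + c *\<^sub>R v - x) = 0" using e(2) by (intro seg) blast
    moreover have "L (a - x) = 0" using e(2) centre_in_ball[of a e] e(1) by (intro seg) blast
    moreover have "L (a + c *\<^sub>R v - x) = L (a - x) + c * L v" using L.add[of "a - x" "c *\<^sub>R v"] L.scaleR[of c v] by (simp add: algebra_simps)
    ultimately show "L v = 0" using c by simp
  qed
qed

lemma unique_derivs_disk: "unique_derivs disk" by (rule unique_derivs_convex) auto

lemma sum_Basis_inner_apply:
  fixes D :: "'a::euclidean_space \<Rightarrow> 'b::real_vector"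
  shows
  "b \<in> Basis \<Longrightarrow> (lc D b) = D b"
proof -
  assume b: "b \<in> Basis"
  have "(lc D b) = (\<Sum>c\<in>Basis. if c = b then D c else 0)" by (rule sum.cong) (auto simp: inner_Basis b)
  then show ?thesis using b by simp
qed

lemma has_derivative_openin:
  assumes "openin (top_of_set S) W" "x \<in> W"
  shows "(f has_derivative L) (at x within W) \<longleftrightarrow> (f has_derivative L) (at x within S)"
proof -
  obtain V where "open V" "W = S \<inter> V" using assms(1) by (metis openin_open)
  then have "at x within W = at x within S" using assms(2) by (intro at_within_nhd[of x V]) auto
  then show ?thesis by simp
qed

lemma continuous_map_openin_cover:
  assumes W: "\<And>p x. p \<in> topspace T \<Longrightarrow> x \<in> S \<Longrightarrow> \<exists>Q W. openin T Q \<and> openin (top_of_set S) W \<and> p \<in> Q \<and> x \<in> W \<and>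
     continuous_map (prod_topology (subtopology T Q) (top_of_set W)) Z f"
  shows "continuous_map (prod_topology T (top_of_set S)) Z f"
proof -
  define I where "I = {(Q, W). openin T Q \<and> openin (top_of_set S) W \<and>
     continuous_map (prod_topology (subtopology T Q) (top_of_set W)) Z f}"
  let ?P = "prod_topology T (top_of_set S)"
  have sub: "subtopology ?P (Q \<times> W) = prod_topology (subtopology T Q) (top_of_set W)"
    if "(Q, W) \<in> I" for Q W
  proof -
    have "subtopology (top_of_set S) W = top_of_set W"
      using that by (auto simp: I_def subtopology_subtopology dest!: openin_imp_subset intro!: arg_cong2[where f = subtopology])
    then show ?thesis by (simp add: subtopology_Times)
  qed
  show ?thesis
  proof (rule pasting_lemma[where I = I and T = "\<lambda>(Q, W). Q \<times> W" and f = "\<lambda>_. f"])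
    fix i assume i: "i \<in> I"
    obtain Q W where [simp]: "i = (Q, W)" by (cases i)
    show "openin ?P (case i of (Q, W) \<Rightarrow> Q \<times> W)" using i by (auto simp: I_def openin_prod_Times_iff)
    show "continuous_map (subtopology ?P (case i of (Q, W) \<Rightarrow> Q \<times> W)) Z f" using i sub[of Q W] by (simp add: I_def)
  next
    fix x assume "x \<in> topspace ?P"
    then show "\<exists>j. j \<in> I \<and> x \<in> (case j of (Q, W) \<Rightarrow> Q \<times> W) \<and> f x = f x"
      using W[of "fst x" "snd x"] unfolding I_def by auto blast
  qed auto
qed

text \<open>\<open>Ck\<close> only asserts that partial derivatives exist, so a choice has to be
  made that works on all pieces. Uniqueness identifies every local choice with
  \<open>frechet_derivative\<close>, which is defined globally.\<close>

lemma Ck_local: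
  fixes f :: "'p \<Rightarrow> 'a::euclidean_space \<Rightarrow> 'b::real_inner"
  assumes "unique_derivs S"
    and "\<And>p x. p \<in> topspace T \<Longrightarrow> x \<in> S \<Longrightarrow> \<exists>Q W. openin T Q \<and> openin (top_of_set S) W \<and> p \<in> Q \<and> x \<in> W \<and> Ck k (subtopology T Q) W f"
  shows "Ck k T S f" using assms(2)
proof (induction k arbitrary: f)
  case 0
  then show ?case unfolding Ck.simps by (rule continuous_map_openin_cover)
next
  case (Suc k)
  define D where "D b p x = frechet_derivative (f p) (at x within S) b" for b p x
  have *: "\<exists>Q W. openin T Q \<and> openin (top_of_set S) W \<and> p \<in> Q \<and> x \<in> W \<and>
       Ck 0 (subtopology T Q) W f \<and> (\<forall>b\<in>Basis. Ck k (subtopology T Q) W (D b)) \<and>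
       (\<forall>p\<in>Q. \<forall>x\<in>W. (f p has_derivative lc (\<lambda>b. D b p x)) (at x within S))"
    if px: "p \<in> topspace T" "x \<in> S" for p x
  proof -
    from Suc.prems[OF px] obtain Q W where QW: "openin T Q" "openin (top_of_set S) W" "p \<in> Q" "x \<in> W"
      and C: "Ck (Suc k) (subtopology T Q) W f" by blast
    have QT: "topspace (subtopology T Q) = Q" using QW(1) openin_subset by (metis topspace_subtopology_subset)
    from C obtain E where E0: "\<And>p x. p \<in> topspace (subtopology T Q) \<Longrightarrow> x \<in> W \<Longrightarrow>
      (f p has_derivative lc (\<lambda>b. E b p x)) (at x within W)"
    and E': "\<And>b. b \<in> Basis \<Longrightarrow> Ck k (subtopology T Q) W (E b)" by (rule Ck_SucE) blast
    have E: "(f p has_derivative lc (\<lambda>b. E b p x)) (at x within S)" if "p \<in> Q" "x \<in> W" for p x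
      using E0[unfolded QT, OF that] unfolding has_derivative_openin[OF QW(2) that(2)] .
    have DE: "D b p x = E b p x" if "p \<in> Q" "x \<in> W" "b \<in> Basis" for b p x
    proof -
      have "(f p has_derivative frechet_derivative (f p) (at x within S)) (at x within S)"
        using E[OF that(1,2)] differentiableI frechet_derivative_works by blast
      moreover have "x \<in> S" using QW(2) that(2) openin_imp_subset by blast
      ultimately have "frechet_derivative (f p) (at x within S) = (lc (\<lambda>b. E b p x))" by (intro unique_derivsD[OF assms(1) _ _ E[OF that(1,2)]])
      then show ?thesis using that(3) by (simp add: D_def sum_Basis_inner_apply)
    qed
    have c1: "\<forall>b\<in>Basis. Ck k (subtopology T Q) W (D b)"
    proof
      fix b :: 'a assume "b \<in> Basis"
      then show "Ck k (subtopology T Q) W (D b)" by (intro Ck_cong[OF E']) (use DE QT in simp_all)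
    qed
    have c2: "\<forall>p\<in>Q. \<forall>x\<in>W. (f p has_derivative lc (\<lambda>b. D b p x)) (at x within S)" using E DE by simp
    show ?thesis by (rule exI[of _ Q], rule exI[of _ W]) (intro conjI QW Ck_0[OF C] c1 c2)
  qed
  show ?case
  proof (rule Ck_SucI[where D = D])
    show "Ck 0 T S f" unfolding Ck.simps(1)
    proof (rule continuous_map_openin_cover)
      fix p x assume "p \<in> topspace T" "x \<in> S"
      from *[OF this] obtain Q W where "openin T Q" "openin (top_of_set S) W" "p \<in> Q" "x \<in> W"
        "Ck 0 (subtopology T Q) W f" by (elim exE conjE)
      then show "\<exists>Q W. openin T Q \<and> openin (top_of_set S) W \<and> p \<in> Q \<and> x \<in> W \<and>
         continuous_map (prod_topology (subtopology T Q) (top_of_set W)) euclidean (\<lambda>z. f (fst z) (snd z))" unfolding Ck.simps(1) by blast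
    qed
  next
    fix p x assume "p \<in> topspace T" "x \<in> S"
    from *[OF this] show "(f p has_derivative lc (\<lambda>b. D b p x)) (at x within S)" by auto
  next
    fix b :: 'a assume "b \<in> Basis"
    show "Ck k T S (D b)"
    proof (rule Suc.IH)
      fix p x assume "p \<in> topspace T" "x \<in> S"
      from *[OF this] obtain Q W where "openin T Q" "openin (top_of_set S) W" "p \<in> Q" "x \<in> W"
        "\<forall>b\<in>Basis. Ck k (subtopology T Q) W (D b)" by (elim exE conjE)
      with \<open>b \<in> Basis\<close> show "\<exists>Q W. openin T Q \<and> openin (top_of_set S) W \<and> p \<in> Q \<and> x \<in> W \<and> Ck k (subtopology T Q) W (D b)"
        by blast
    qed
  qed
qed

section \<open>Parameter dependence for ordinary differential equations\<close>

lemma antiderivative_exists: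
  fixes g :: "real \<Rightarrow> 'b::banach"
  assumes g: "continuous_on UNIV g"
  shows "\<exists>G. G 0 = c \<and> (\<forall>t. (G has_vector_derivative g t) (at t))"
proof -
  \<comment> \<open>An integral over an empty interval is zero, so one formula covers both signs of
    \<open>t\<close>.\<close>
  define G where "G t = integral {0..t} g - integral {t..0} g + c" for t
  have "(G has_vector_derivative g t) (at t)" for t
  proof -
    define N where "N = \<bar>t\<bar> + 1"
    have int: "g integrable_on {a..b}" for a b using g continuous_on_subset by (intro integrable_continuous_real) blast
    have eq: "integral {-N..s} g - integral {-N..0} g + c = G s" if s: "s \<in> {-N<..<N}" for s
    proof (cases "0 \<le> s")
      case True
      have "integral {-N..0} g + integral {0..s} g = integral {-N..s} g"
        using True s by (intro Henstock_Kurzweil_Integration.integral_combine int) (auto simp: N_def)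
      moreover have "integral {s..0} g = 0" using True by (cases "s = 0") auto
      ultimately show ?thesis by (simp add: G_def algebra_simps)
    next
      case False
      have "integral {-N..s} g + integral {s..0} g = integral {-N..0} g"
        using False s by (intro Henstock_Kurzweil_Integration.integral_combine int) (auto simp: N_def)
      moreover have "integral {0..s} g = 0" using False by auto
      ultimately show ?thesis by (simp add: G_def algebra_simps)
    qed
    have t: "t \<in> {-N<..<N}" by (auto simp: N_def)
    have "((\<lambda>u. integral {-N..u} g) has_vector_derivative g t) (at t within {-N..N})"
      using t continuous_on_subset[OF g] by (intro integral_has_vector_derivative) auto
    then have "((\<lambda>u. integral {-N..u} g) has_vector_derivative g t) (at t within {-N<..<N})" by (rule has_vector_derivative_within_subset) auto
    then have vd: "((\<lambda>u. integral {-N..u} g) has_vector_derivative g t) (at t)"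
      by (rule iffD1[OF has_vector_derivative_within_open[OF t open_greaterThanLessThan]])
    have D: "((\<lambda>u. integral {-N..u} g - integral {-N..0} g + c) has_vector_derivative g t) (at t)"
      using has_vector_derivative_add[OF has_vector_derivative_diff[OF vd has_vector_derivative_const] has_vector_derivative_const] by simp
    show ?thesis by (rule has_vector_derivative_transform_within_open[OF D open_greaterThanLessThan t]) (erule eq)
  qed
  then show ?thesis by (intro exI[of _ G]) (simp add: G_def)
qed

lemma vector_derivative_bound_pos:
  fixes G :: "real \<Rightarrow> 'b::real_normed_vector"
  assumes G: "\<And>s. (G has_vector_derivative g s) (at s)"
    and \<phi>: "\<And>s. (\<phi> has_real_derivative \<phi>' s) (at s)"
    and le: "\<And>s. 0 \<le> s \<Longrightarrow> s \<le> t \<Longrightarrow> norm (g s) \<le> \<phi>' s" and t: "0 \<le> t"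
  shows "norm (G t - G 0) \<le> \<phi> t - \<phi> 0"
proof (cases "t = 0")
  case False
  have "continuous_on {0..t} G" using G by (meson continuous_at_imp_continuous_on has_vector_derivative_continuous)
  moreover have "continuous_on {0..t} \<phi>" using \<phi> by (meson DERIV_isCont continuous_at_imp_continuous_on)
  ultimately show ?thesis using False t G \<phi> le
    by (intro differentiable_bound_general[of 0 t G \<phi> g \<phi>']) (auto simp: has_real_derivative_iff_has_vector_derivative)
qed simp

lemma reflect_derivative:
  assumes "\<And>s. (G has_vector_derivative g s) (at s)"
  shows "((\<lambda>s::real. G (- s)) has_vector_derivative - g (- s)) (at s)"
proof -
  have "((uminus :: real \<Rightarrow> real) has_vector_derivative -1) (at s)" by (auto intro!: derivative_eq_intros)
  from vector_diff_chain_at[OF this assms] show ?thesis by (simp add: o_def)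
qed

text \<open>This turns the bound on one Picard correction into the bound on the next and produces
  the factorial in the denominator. Negative times are reflected to positive ones.\<close>

lemma power_bound:
  fixes G :: "real \<Rightarrow> 'b::real_normed_vector"
  assumes G: "\<And>s. (G has_vector_derivative g s) (at s)" and G0: "G 0 = 0"
    and le: "\<And>s. \<bar>s\<bar> \<le> N \<Longrightarrow> norm (g s) \<le> B * \<bar>s\<bar> ^ n" and t: "\<bar>t\<bar> \<le> N"
  shows "norm (G t) \<le> B * \<bar>t\<bar> ^ Suc n / Suc n"
proof -
  have pos: "norm (H r) \<le> B * r ^ Suc n / Suc n"
    if H: "\<And>s. (H has_vector_derivative h s) (at s)" and "H 0 = 0" and r: "0 \<le> r" "r \<le> N"
    and h: "\<And>s. \<bar>s\<bar> \<le> N \<Longrightarrow> norm (h s) \<le> B * \<bar>s\<bar> ^ n" for H :: "real \<Rightarrow> 'b" and h r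
  proof -
    have "((\<lambda>s. B * s ^ Suc n / Suc n) has_real_derivative B * s ^ n) (at s)" for s by (rule derivative_eq_intros refl | simp)+
    moreover have "norm (h s) \<le> B * s ^ n" if "0 \<le> s" "s \<le> r" for s using h[of s] that r by simp
    ultimately have "norm (H r - H 0) \<le> B * r ^ Suc n / Suc n - B * 0 ^ Suc n / Suc n" by (intro vector_derivative_bound_pos[OF H]) (use r in auto)
    then show ?thesis using \<open>H 0 = 0\<close> by simp
  qed
  show ?thesis
  proof (cases "0 \<le> t")
    case True then show ?thesis using pos[OF G G0 True] le t by simp
  next
    case False
    have le': "norm (- g (- s)) \<le> B * \<bar>s\<bar> ^ n" if "\<bar>s\<bar> \<le> N" for s using le[of "- s"] that by simp
    have "norm (G (- (- t))) \<le> B * (- t) ^ Suc n / Suc n" by (rule pos[OF reflect_derivative[OF G] _ _ _ le']) (use False t G0 in auto)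
    then show ?thesis using False by simp
  qed
qed

text \<open>The norm of \<open>e\<close> need not be differentiable. It is dominated by
  \<open>m\<close>, the antiderivative of \<open>L * norm (e s) + d\<close> that starts at
  \<open>norm (e 0)\<close>, and \<open>m s * exp (- L * s) - d * s\<close> does not increase.
  Reflection covers negative times.\<close>

lemma gronwall:
  fixes e :: "real \<Rightarrow> 'b::banach"
  assumes e: "\<And>s. (e has_vector_derivative e' s) (at s)" and e': "continuous_on UNIV e'"
    and le: "\<And>s. \<bar>s\<bar> \<le> N \<Longrightarrow> norm (e' s) \<le> L * norm (e s) + d" and t: "\<bar>t\<bar> \<le> N"
    and L: "0 \<le> L" "0 \<le> d"
  shows "norm (e t) \<le> (norm (e 0) + d * \<bar>t\<bar>) * exp (L * \<bar>t\<bar>)"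
proof -
  have pos: "norm (e r) \<le> (norm (e 0) + d * r) * exp (L * r)"
    if e: "\<And>s. (e has_vector_derivative e' s) (at s)" and r: "0 \<le> r" "r \<le> N"
      and le: "\<And>s. \<bar>s\<bar> \<le> N \<Longrightarrow> norm (e' s) \<le> L * norm (e s) + d" for e e' :: "real \<Rightarrow> 'b" and r
  proof -
    have "continuous_on UNIV e" using e by (meson continuous_at_imp_continuous_on has_vector_derivative_continuous)
    then have "continuous_on UNIV (\<lambda>s. L * norm (e s) + d)" by (intro continuous_intros)
    then obtain m where m0: "m 0 = norm (e 0)" and m: "\<And>s. (m has_vector_derivative L * norm (e s) + d) (at s)"
      using antiderivative_exists[where c = "norm (e 0)"] by auto
    have m: "(m has_real_derivative L * norm (e s) + d) (at s)" for s using m by (simp add: has_real_derivative_iff_has_vector_derivative)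
    have em: "norm (e s) \<le> m s" if "0 \<le> s" "s \<le> r" for s
    proof -
      have "norm (e s - e 0) \<le> m s - m 0" by (rule vector_derivative_bound_pos[OF e m]) (use that r le in auto)
      then show ?thesis using m0 norm_triangle_sub[of "e s" "e 0"] by simp
    qed
    define q where "q s = m s * exp (- L * s) - d * s" for s
    have "q r \<le> q 0"
    proof (rule DERIV_nonpos_imp_nonincreasing[OF r(1)])
      fix s assume s: "0 \<le> s" "s \<le> r"
      have "(q has_real_derivative (L * norm (e s) + d - L * m s) * exp (- L * s) - d) (at s)"
        unfolding q_def by (rule derivative_eq_intros m refl | simp add: algebra_simps)+
      moreover have "(L * norm (e s) + d - L * m s) * exp (- L * s) - d \<le> 0"
      proof -
        have 1: "L * norm (e s) \<le> L * m s" using em[OF s] L by (intro mult_left_mono)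
        have 2: "exp (- L * s) \<le> 1" using L s by simp
        have "(L * norm (e s) + d - L * m s) * exp (- L * s) \<le> d * exp (- L * s)" using 1 by (intro mult_right_mono) auto
        also have "\<dots> \<le> d * 1" using 2 L by (intro mult_left_mono)
        finally show ?thesis by simp
      qed
      ultimately show "\<exists>y. (q has_real_derivative y) (at s) \<and> y \<le> 0" by blast
    qed
    then have "m r * exp (- L * r) \<le> norm (e 0) + d * r" by (simp add: q_def m0)
    then have "m r * exp (- L * r) * exp (L * r) \<le> (norm (e 0) + d * r) * exp (L * r)" by (intro mult_right_mono) auto
    then have "m r \<le> (norm (e 0) + d * r) * exp (L * r)" by (simp add: mult.assoc flip: exp_add)
    then show ?thesis using em[of r] r by simp
  qed
  show ?thesis
  proof (cases "0 \<le> t")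
    case True then show ?thesis using pos[OF e] le t by simp
  next
    case False
    have le': "norm (- e' (- s)) \<le> L * norm (e (- s)) + d" if "\<bar>s\<bar> \<le> N" for s using le[of "- s"] that by simp
    have "norm (e (- (- t))) \<le> (norm (e (- 0)) + d * (- t)) * exp (L * (- t))" by (rule pos[OF reflect_derivative[OF e] _ _ le']) (use False t in auto)
    then show ?thesis using False by simp
  qed
qed

text \<open>With a global Lipschitz bound the corrections of the iteration are dominated on
  \<open>{-N..N}\<close> by the terms of an exponential series. Iterates and derivatives converge
  uniformly there, so the limit solves the equation for all times.\<close>

lemma picard:
  fixes f :: "real \<Rightarrow> 'b::banach \<Rightarrow> 'b"
  assumes cont: "continuous_on UNIV (\<lambda>z. f (fst z) (snd z))"
    and lip: "\<And>t u v. norm (f t u - f t v) \<le> L * norm (u - v)" and L: "L \<ge> 0"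
  obtains u where "u 0 = c" "\<And>t. (u has_vector_derivative f t (u t)) (at t)"
proof -
  have cf: "continuous_on A (\<lambda>t. f t (y t))" if "continuous_on A y" for y A using continuous_on_compose2[OF cont, of A "\<lambda>t. (t, y t)"] that
    by (simp add: continuous_on_Pair)
  define I where "I g = (SOME G. G 0 = c \<and> (\<forall>t. (G has_vector_derivative g t) (at t)))" for g :: "real \<Rightarrow> 'b"
  have I: "I g 0 = c" "(I g has_vector_derivative g t) (at t)" if g: "continuous_on UNIV g" for g t
  proof -
    have "\<exists>G. G 0 = c \<and> (\<forall>t. (G has_vector_derivative g t) (at t))" by (rule antiderivative_exists[OF g])
    from someI_ex[OF this] show "I g 0 = c" "(I g has_vector_derivative g t) (at t)" unfolding I_def by auto
  qed
  define y where "y = rec_nat (\<lambda>t. c) (\<lambda>_ y. I (\<lambda>t. f t (y t)))"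
  have y0: "y 0 = (\<lambda>t. c)" and yS: "y (Suc n) = I (\<lambda>t. f t (y n t))" for n by (simp_all add: y_def)
  have yc: "continuous_on UNIV (y n)" for n
  proof (induction n)
    case (Suc n)
    then show ?case unfolding yS using I(2)[OF cf[OF Suc]] has_vector_derivative_continuous by (intro continuous_at_imp_continuous_on) blast
  qed (simp add: y0)
  have yd: "(y (Suc n) has_vector_derivative f t (y n t)) (at t)" for n t unfolding yS using I(2)[OF cf[OF yc]] .
  have yz: "y n 0 = c" for n by (cases n) (simp_all add: y0 yS I(1)[OF cf[OF yc]])
  have C: "\<exists>C\<ge>0. \<forall>t. \<bar>t\<bar> \<le> N \<longrightarrow> norm (f t c) \<le> C" for N
  proof -
    have "compact ((\<lambda>t. f t c) ` {-N..N})" by (intro compact_continuous_image cf continuous_intros) simp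
    then obtain C where "\<forall>x\<in>(\<lambda>t. f t c) ` {-N..N}. norm x \<le> C" using compact_imp_bounded bounded_iff by meson
    then show ?thesis by (intro exI[of _ "max C 0"]) (auto simp: abs_le_iff le_max_iff_disj)
  qed
  have step: "norm (y (Suc n) t - y n t) \<le> C * L ^ n * \<bar>t\<bar> ^ Suc n / fact (Suc n)"
    if C: "\<forall>t. \<bar>t\<bar> \<le> N \<longrightarrow> norm (f t c) \<le> C" and t: "\<bar>t\<bar> \<le> N" for N C n t using t
  proof (induction n arbitrary: t)
    case 0
    have "norm ((\<lambda>t. y (Suc 0) t - y 0 t) t) \<le> C * \<bar>t\<bar> ^ Suc 0 / Suc 0"
    proof (rule power_bound)
      show "((\<lambda>t. y (Suc 0) t - y 0 t) has_vector_derivative f s (y 0 s)) (at s)" for s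
        using has_vector_derivative_diff[OF yd[of 0 s] has_vector_derivative_const[of c]] by (simp add: y0)
    qed (use 0 C yz in "auto simp: y0")
    then show ?case by simp
  next
    case (Suc n)
    have "norm ((\<lambda>t. y (Suc (Suc n)) t - y (Suc n) t) t) \<le> (C * L ^ Suc n / fact (Suc n)) * \<bar>t\<bar> ^ Suc (Suc n) / Suc (Suc n)"
    proof (rule power_bound)
      show "((\<lambda>t. y (Suc (Suc n)) t - y (Suc n) t) has_vector_derivative f s (y (Suc n) s) - f s (y n s)) (at s)" for s
        by (intro has_vector_derivative_diff yd)
      fix s assume s: "\<bar>s\<bar> \<le> N"
      have "norm (f s (y (Suc n) s) - f s (y n s)) \<le> L * norm (y (Suc n) s - y n s)" by (rule lip)
      also have "\<dots> \<le> L * (C * L ^ n * \<bar>s\<bar> ^ Suc n / fact (Suc n))" using Suc.IH[OF s] L by (intro mult_left_mono)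
      finally show "norm (f s (y (Suc n) s) - f s (y n s)) \<le> (C * L ^ Suc n / fact (Suc n)) * \<bar>s\<bar> ^ Suc n" by (simp add: mult_ac)
    qed (use Suc.prems yz in auto)
    also have "\<dots> = C * L ^ Suc n * \<bar>t\<bar> ^ Suc (Suc n) / fact (Suc (Suc n))"
      by (subst fact_Suc[of "Suc n"]) (simp add: field_simps del: fact_Suc power_Suc)
    finally show ?case by simp
  qed
  have unif: "\<exists>l. uniform_limit {-N..N} y l sequentially" if N: "N \<ge> 0" for N
  proof -
    obtain C where C: "C \<ge> 0" "\<forall>t. \<bar>t\<bar> \<le> N \<longrightarrow> norm (f t c) \<le> C" using C by blast
    have "uniform_limit {-N..N} (\<lambda>n t. \<Sum>i<n. y (Suc i) t - y i t) (\<lambda>t. \<Sum>i. y (Suc i) t - y i t) sequentially"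
    proof (rule Weierstrass_m_test)
      fix n t assume "t \<in> {-N..N}"
      then have t: "\<bar>t\<bar> \<le> N" by auto
      have "norm (y (Suc n) t - y n t) \<le> C * L ^ n * \<bar>t\<bar> ^ Suc n / fact (Suc n)" by (rule step[OF C(2) t])
      also have "\<dots> \<le> C * L ^ n * N ^ Suc n / fact n"
        using C(1) L t N by (intro frac_le mult_left_mono power_mono mult_nonneg_nonneg zero_le_power fact_mono) auto
      also have "\<dots> = C * N * ((L * N) ^ n /\<^sub>R fact n)" by (simp add: power_mult_distrib field_simps)
      finally show "norm (y (Suc n) t - y n t) \<le> C * N * ((L * N) ^ n /\<^sub>R fact n)" .
    next
      show "summable (\<lambda>n. C * N * ((L * N) ^ n /\<^sub>R fact n))" by (intro summable_mult summable_exp_generic)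
    qed
    then have "uniform_limit {-N..N} (\<lambda>n t. (\<Sum>i<n. y (Suc i) t - y i t) + c) (\<lambda>t. (\<Sum>i. y (Suc i) t - y i t) + c) sequentially"
      by (intro uniform_limit_intros)
    moreover have "(\<Sum>i<n. y (Suc i) t - y i t) + c = y n t" for n t by (subst sum_lessThan_telescope) (simp add: y0)
    ultimately show ?thesis by auto
  qed
  \<comment> \<open>The pointwise limit does not mention \<open>N\<close>, so the uniform limits on
    the various intervals are restrictions of one function.\<close>
  define u where "u t = lim (\<lambda>n. y n t)" for t
  have ul: "uniform_limit {-N..N} y u sequentially" if N: "N \<ge> 0" for N
  proof -
    obtain l where l: "uniform_limit {-N..N} y l sequentially" using unif[OF N] by blast
    have "l t = u t" if "t \<in> {-N..N}" for t using tendsto_uniform_limitI[OF l that] by (simp add: u_def limI)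
    then show ?thesis using l uniform_limit_cong'[of "{-N..N}" y y l u] by simp
  qed
  show thesis
  proof (rule that[of u])
    show "u 0 = c" by (simp add: u_def yz)
    fix t :: real
    define N where "N = \<bar>t\<bar> + 1"
    have N: "N \<ge> 0" by (simp add: N_def)
    have "\<exists>g. \<forall>s\<in>{-N..N}. (\<lambda>n. y (Suc n) s) \<longlonglongrightarrow> g s \<and> (g has_derivative (\<lambda>h. h *\<^sub>R f s (u s))) (at s within {-N..N})"
    proof (rule has_derivative_sequence[where f' = "\<lambda>n s h. h *\<^sub>R f s (y n s)" and ?x0.0 = 0 and l = c])
      show "(y (Suc n) has_derivative (\<lambda>h. h *\<^sub>R f s (y n s))) (at s within {-N..N})" for n s
        using yd[of n s] unfolding has_vector_derivative_def by (rule has_derivative_at_withinI)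
      fix r :: real assume r: "r > 0"
      then have "\<forall>\<^sub>F n in sequentially. \<forall>s\<in>{-N..N}. dist (y n s) (u s) < r / (L + 1)"
        using uniform_limitD[OF ul[OF N], of "r / (L + 1)"] L by simp
      then show "\<forall>\<^sub>F n in sequentially. \<forall>s\<in>{-N..N}. \<forall>h. norm (h *\<^sub>R f s (y n s) - h *\<^sub>R f s (u s)) \<le> r * norm h"
      proof (rule eventually_mono, intro ballI allI)
        fix n s and h :: real assume *: "\<forall>s\<in>{-N..N}. dist (y n s) (u s) < r / (L + 1)" "s \<in> {-N..N}"
        then have "norm (y n s - u s) \<le> r / (L + 1)" by (force simp: dist_norm)
        then have "L * norm (y n s - u s) \<le> L * (r / (L + 1))" using L by (intro mult_left_mono)
        also have "\<dots> \<le> r" using L r by (simp add: field_simps)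
        finally have "\<bar>h\<bar> * norm (f s (y n s) - f s (u s)) \<le> \<bar>h\<bar> * r" using lip[of s "y n s" "u s"] by (intro mult_left_mono) auto
        then show "norm (h *\<^sub>R f s (y n s) - h *\<^sub>R f s (u s)) \<le> r * norm h" by (simp add: mult.commute flip: scaleR_right_diff_distrib)
      qed
    qed (use N yz in auto)
    then obtain g where g: "\<And>s. s \<in> {-N..N} \<Longrightarrow> (\<lambda>n. y (Suc n) s) \<longlonglongrightarrow> g s"
      "\<And>s. s \<in> {-N..N} \<Longrightarrow> (g has_derivative (\<lambda>h. h *\<^sub>R f s (u s))) (at s within {-N..N})" by blast
    have gu: "g s = u s" if "s \<in> {-N..N}" for s by (rule LIMSEQ_unique[OF g(1)[OF that] LIMSEQ_Suc[OF tendsto_uniform_limitI[OF ul[OF N] that]]])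
    have t: "t \<in> {-N<..<N}" "t \<in> {-N..N}" by (auto simp: N_def)
    have "(g has_derivative (\<lambda>h. h *\<^sub>R f t (u t))) (at t)"
      using has_derivative_subset[OF g(2)[OF t(2)], of "{-N<..<N}"] at_within_open[OF t(1)] by (simp add: subset_eq)
    then show "(u has_vector_derivative f t (u t)) (at t)"
      unfolding has_vector_derivative_def by (rule has_derivative_transform_within_open[OF _ _ t(1)]) (use gu in auto)
  qed
qed

section \<open>Dependence of solutions on parameters\<close>

abbreviation Cn :: "nat \<Rightarrow> 'a::euclidean_space set \<Rightarrow> ('a \<Rightarrow> 'b::real_normed_vector) \<Rightarrow> bool" where
  "Cn k S f \<equiv> Ck k (discrete_topology {()}) S (\<lambda>_. f)"

lemma Cn_Ck: "Cn k S f \<Longrightarrow> Ck k T S (\<lambda>_. f)"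
  by (rule Ck_param[of k "discrete_topology {()}" S "\<lambda>_. f" T "\<lambda>_. ()"]) (simp_all add: continuous_map_const)

lemma Cn_0_iff: "Cn 0 S f \<longleftrightarrow> continuous_on S f"
proof
  assume "Cn 0 S f"
  then have *: "continuous_map (prod_topology (discrete_topology {()}) (top_of_set S)) euclidean (\<lambda>z. f (snd z))" by (simp add: Ck.simps)
  have "continuous_map (top_of_set S) (prod_topology (discrete_topology {()}) (top_of_set S)) (\<lambda>x. ((), x))"
    by (simp add: continuous_map_paired continuous_map_const)
  from continuous_map_compose[OF this *] show "continuous_on S f" by (simp add: o_def)
next
  assume "continuous_on S f"
  then have "continuous_map (top_of_set S) euclidean f" by simp
  from continuous_map_compose[OF continuous_map_snd this] show "Cn 0 S f" by (simp add: Ck.simps o_def)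
qed

lemma Cn_continuous_on: "Cn k S f \<Longrightarrow> continuous_on S f" using Ck_0 Cn_0_iff by blast

lemma Cn_Suc_iff:
  "Cn (Suc k) S f \<longleftrightarrow> continuous_on S f \<and>
     (\<exists>D. (\<forall>x\<in>S. (f has_derivative lc (\<lambda>b. D b x)) (at x within S)) \<and>
          (\<forall>b\<in>Basis. Cn k S (D b)))"
proof
  assume f: "Cn (Suc k) S f"
  from f obtain D where D: "\<And>p x. p \<in> topspace (discrete_topology {()}) \<Longrightarrow> x \<in> S \<Longrightarrow>
      (f has_derivative lc (\<lambda>b. D b p x)) (at x within S)"
    and D': "\<And>b. b \<in> Basis \<Longrightarrow> Ck k (discrete_topology {()}) S (D b)" by (rule Ck_SucE) blast
  have "D b = (\<lambda>_. D b ())" for b by auto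
  with D' have "\<And>b. b \<in> Basis \<Longrightarrow> Cn k S (D b ())" by metis
  with D[of "()"] Cn_continuous_on[OF f] show "continuous_on S f \<and>
     (\<exists>D. (\<forall>x\<in>S. (f has_derivative lc (\<lambda>b. D b x)) (at x within S)) \<and>
          (\<forall>b\<in>Basis. Cn k S (D b)))" by (intro conjI exI[of _ "\<lambda>b. D b ()"]) auto
next
  assume "continuous_on S f \<and>
     (\<exists>D. (\<forall>x\<in>S. (f has_derivative lc (\<lambda>b. D b x)) (at x within S)) \<and>
          (\<forall>b\<in>Basis. Cn k S (D b)))"
  then obtain D where "continuous_on S f"
     "\<forall>x\<in>S. (f has_derivative lc (\<lambda>b. D b x)) (at x within S)"
     "\<forall>b\<in>Basis. Cn k S (D b)" by (elim conjE exE)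
  then show "Cn (Suc k) S f" by (intro Ck_SucI[where D = "\<lambda>b _. D b"]) (auto simp: Cn_0_iff)
qed

text \<open>Uniform continuity on the compact set \<open>cball p0 1 \<times> {-N..N}\<close> gives
  one radius for all times up to \<open>N\<close>.\<close>

lemma uniform_tube:
  fixes g :: "'p::euclidean_space \<times> real \<Rightarrow> 'c::metric_space"
  assumes g: "continuous_on UNIV g" and "a > 0"
  shows "\<exists>d>0. \<forall>p. dist p p0 < d \<longrightarrow> (\<forall>t. \<bar>t\<bar> \<le> N \<longrightarrow> dist (g (p, t)) (g (p0, t)) < a)"
proof -
  have "uniformly_continuous_on (cball p0 1 \<times> {-N..N}) g" by (intro compact_uniformly_continuous continuous_on_subset[OF g] compact_Times) auto
  then obtain d where d: "d > 0"
    "\<And>x y. x \<in> cball p0 1 \<times> {-N..N} \<Longrightarrow> y \<in> cball p0 1 \<times> {-N..N} \<Longrightarrow> dist y x < d \<Longrightarrow> dist (g y) (g x) < a"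
    unfolding uniformly_continuous_on_def using \<open>a > 0\<close> by metis
  show ?thesis
  proof (intro exI[of _ "min d 1"] conjI allI impI)
    fix p t assume "dist p p0 < min d 1" "\<bar>t\<bar> \<le> N"
    then show "dist (g (p, t)) (g (p0, t)) < a" by (intro d(2)) (auto simp: dist_Pair_Pair dist_commute)
  qed (use d in auto)
qed

text \<open>On a small ball around \<open>z\<close> the partial derivatives are uniformly close to
  their values at \<open>z\<close>, and the mean value inequality turns this into a remainder
  estimate with one radius for the whole compact set.\<close>

lemma uniform_differentiability:
  fixes f :: "'e::euclidean_space \<Rightarrow> 'b::real_normed_vector"
  assumes D: "\<And>x. (f has_derivative lc (\<lambda>b. D b x)) (at x)"
    and cD: "\<And>b. b \<in> Basis \<Longrightarrow> continuous_on UNIV (D b)"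
    and K: "compact K" and g: "g > 0"
  shows "\<exists>c>0. \<forall>z\<in>K. \<forall>v. norm v < c \<longrightarrow> norm (f (z + v) - f z - (lc (\<lambda>b. D b z) v)) \<le> g * norm v"
proof -
  obtain a R where R: "K \<subseteq> cball a R" using compact_imp_bounded[OF K] bounded_subset_cball by blast
  \<comment> \<open>Each of the \<open>DIM('e)\<close> partial derivatives contributes at most
    \<open>r * norm v\<close>.\<close>
  define r where "r = g / DIM('e)"
  have r: "r > 0" using g by (simp add: r_def)
  have "\<forall>b\<in>Basis. \<exists>c>0. \<forall>x\<in>cball a (R+1). \<forall>y\<in>cball a (R+1). dist y x < c \<longrightarrow> dist (D b y) (D b x) < r"
  proof
    fix b :: 'e assume "b \<in> Basis"
    then have "uniformly_continuous_on (cball a (R+1)) (D b)" by (intro compact_uniformly_continuous continuous_on_subset[OF cD]) auto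
    then show "\<exists>c>0. \<forall>x\<in>cball a (R+1). \<forall>y\<in>cball a (R+1). dist y x < c \<longrightarrow> dist (D b y) (D b x) < r"
      using r unfolding uniformly_continuous_on_def by blast
  qed
  then obtain c where c: "\<And>b. b \<in> Basis \<Longrightarrow> c b > 0"
     "\<And>b x y. b \<in> Basis \<Longrightarrow> x \<in> cball a (R+1) \<Longrightarrow> y \<in> cball a (R+1) \<Longrightarrow> dist y x < c b \<Longrightarrow> dist (D b y) (D b x) < r"
    by metis
  define d where "d = min 1 (Min (c ` Basis))"
  have d: "d > 0" "d \<le> 1" "\<And>b. b \<in> Basis \<Longrightarrow> d \<le> c b" using c(1) by (auto simp: d_def min_le_iff_disj)
  show ?thesis
  proof (intro exI[of _ d] conjI ballI allI impI)
    fix z v :: 'e assume z: "z \<in> K" and v: "norm v < d"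
    let ?S = "ball z d"
    have S: "x \<in> cball a (R+1)" "z \<in> cball a (R + 1)" if "x \<in> ?S" for x
    proof -
      have "dist a z \<le> R" using R z by auto
      then show "x \<in> cball a (R+1)" "z \<in> cball a (R + 1)" using that d dist_triangle[of a x z] by auto
    qed
    have "norm (f (z + v) - f z - (lc (\<lambda>b. D b z)) (z + v - z)) \<le> norm (z + v - z) * g"
    proof (rule differentiable_bound_linearization[where S = ?S and f' = "\<lambda>x v. \<Sum>b\<in>Basis. (v \<bullet> b) *\<^sub>R D b x"])
      fix t :: real assume "t \<in> {0..1}"
      then have "\<bar>t\<bar> * norm v \<le> 1 * norm v" by (intro mult_right_mono) auto
      then show "z + t *\<^sub>R (z + v - z) \<in> ?S" using v by (simp add: dist_norm)
    next
      fix x assume x: "x \<in> ?S"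
      show "onorm ((lc (\<lambda>b. D b x)) - (lc (\<lambda>b. D b z))) \<le> g"
      proof (rule onorm_bound)
        fix v :: 'e
        have "norm (((lc (\<lambda>b. D b x)) - (lc (\<lambda>b. D b z))) v)
          = norm (lc (\<lambda>b. (D b x - D b z)) v)" by (simp add: sum_subtractf scaleR_diff_right)
        also have "\<dots> \<le> (\<Sum>b\<in>(Basis::'e set). norm v * r)"
        proof (rule sum_norm_le)
          fix b :: 'e assume b: "b \<in> Basis"
          have "dist (D b x) (D b z) < r" by (rule c(2)[OF b]) (use S[OF x] x d(3)[OF b] in "auto simp: dist_commute")
          then show "norm ((v \<bullet> b) *\<^sub>R (D b x - D b z)) \<le> norm v * r"
            unfolding norm_scaleR dist_norm by (intro mult_mono) (auto simp: Basis_le_norm b)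
        qed
        also have "\<dots> = g * norm v" by (simp add: r_def)
        finally show "norm (((lc (\<lambda>b. D b x)) - (lc (\<lambda>b. D b z))) v) \<le> g * norm v" .
      qed (use g in simp)
    qed (use d D in "auto intro: has_derivative_at_withinI")
    then show "norm (f (z + v) - f z - (lc (\<lambda>b. D b z) v)) \<le> g * norm v" by (simp add: mult.commute)
  qed (use d in auto)
qed

lemma sum_Basis_prod:
  fixes G :: "'a::euclidean_space \<times> 'b::euclidean_space \<Rightarrow> 'c::real_normed_vector"
  shows "(\<Sum>b\<in>Basis. G b) = (\<Sum>i\<in>Basis. G (i, 0)) + (\<Sum>j\<in>Basis. G (0, j))"
proof -
  have "(Basis :: ('a \<times> 'b) set) = (\<lambda>u. (u, 0)) ` Basis \<union> (\<lambda>v. (0, v)) ` Basis" by (simp add: Basis_prod_def)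
  moreover have "((\<lambda>u. (u, 0)) ` Basis) \<inter> ((\<lambda>v. (0, v)) ` Basis) = ({} :: ('a \<times> 'b) set)" by auto
  then have "sum G ((\<lambda>u. (u, 0)) ` Basis \<union> (\<lambda>v. (0, v)) ` Basis)
     = sum G ((\<lambda>u. (u, 0)) ` Basis) + sum G ((\<lambda>v. (0, v)) ` Basis)" by (intro sum.union_disjoint) auto
  ultimately show ?thesis by (simp add: sum.reindex inj_on_def)
qed

text \<open>Difference quotients in the direction \<open>w\<close> are bounded by the Lipschitz
  constant, and the bound passes to the limit. It lets the linearised equation inherit the constant
  \<open>L\<close>.\<close>

lemma lipschitz_partial_bound:
  fixes f :: "'q::euclidean_space \<times> 'b::euclidean_space \<Rightarrow> 'b"
  assumes D: "(f has_derivative lc D) (at (q, u))"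
    and lip: "\<And>q u v. norm (f (q, u) - f (q, v)) \<le> L * norm (u - v)"
  shows "norm (lc (\<lambda>c. D (0, c)) w) \<le> L * norm w"
proof -
  have 1: "((\<lambda>h::real. (q, u + h *\<^sub>R w)) has_derivative (\<lambda>h. (0, h *\<^sub>R w))) (at 0)" by (auto intro!: derivative_eq_intros)
  have D': "(f has_derivative lc D) (at (q, u + 0 *\<^sub>R w))" using D by simp
  have "((\<lambda>h. f (q, u + h *\<^sub>R w)) has_derivative (\<lambda>h. \<Sum>b\<in>Basis. ((0, h *\<^sub>R w) \<bullet> b) *\<^sub>R D b)) (at 0)"
    using has_derivative_compose[OF 1 D'] by simp
  moreover have "(lc D (0, h *\<^sub>R w)) = h *\<^sub>R (lc (\<lambda>c. D (0, c)) w)" for h by (simp add: sum_Basis_prod scaleR_sum_right)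
  ultimately have D'': "((\<lambda>h. f (q, u + h *\<^sub>R w)) has_derivative (\<lambda>h. h *\<^sub>R (lc (\<lambda>c. D (0, c)) w))) (at 0)" by simp
  show ?thesis
  proof (rule field_le_epsilon)
    fix e :: real assume "e > 0"
    let ?W = "\<Sum>c\<in>Basis. (w \<bullet> c) *\<^sub>R D (0, c)"
    from D''[unfolded has_derivative_at_alt] \<open>e > 0\<close> obtain d where d: "d > 0"
      "\<And>y. norm (y - 0) < d \<Longrightarrow> norm (f (q, u + y *\<^sub>R w) - f (q, u + 0 *\<^sub>R w) - (y - 0) *\<^sub>R ?W) \<le> e * norm (y - 0)"
      by blast
    define h where "h = d / 2"
    have h: "h > 0" "h < d" using d by (auto simp: h_def)
    have "norm (f (q, u + h *\<^sub>R w) - f (q, u) - h *\<^sub>R ?W) \<le> e * h" using d(2)[of h] h by simp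
    moreover have "norm (f (q, u + h *\<^sub>R w) - f (q, u)) \<le> L * (h * norm w)" using lip[of q "u + h *\<^sub>R w" u] h by simp
    moreover have "norm (h *\<^sub>R ?W) = h * norm ?W" using h by simp
    ultimately have "h * norm ?W \<le> L * (h * norm w) + e * h" using norm_triangle_sub[of "h *\<^sub>R ?W" "f (q, u + h *\<^sub>R w) - f (q, u)"]
norm_minus_commute[of "h *\<^sub>R ?W" "f (q, u + h *\<^sub>R w) - f (q, u)"] by linarith
    then have "h * norm ?W \<le> h * (L * norm w + e)" by (simp add: algebra_simps)
    then show "norm ?W \<le> L * norm w + e" using h by (metis mult_le_cancel_left_pos)
  qed
qed

text \<open>Gronwall for the difference of the solutions with parameters \<open>p\<close> and
  \<open>p0\<close>: changing the state costs the rate \<open>L\<close>, while changing the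
  parameter along the fixed solution \<open>u (p0, t)\<close> costs an error that is uniformly small
  on \<open>{-N..N}\<close>.\<close>

lemma ode_continuous_dependence:
  fixes f :: "('p::euclidean_space \<times> real) \<times> 'b::euclidean_space \<Rightarrow> 'b"
  assumes f: "continuous_on UNIV f"
    and lip: "\<And>q u v. norm (f (q, u) - f (q, v)) \<le> L * norm (u - v)" and L: "L \<ge> 0"
    and ode: "\<And>p t. ((\<lambda>t. u (p, t)) has_vector_derivative f ((p, t), u (p, t))) (at t)"
    and ini: "continuous_on UNIV (\<lambda>p. u (p, 0))"
  shows "continuous_on UNIV u"
proof -
  have ct: "continuous_on UNIV (\<lambda>t. u (p, t))" for p using ode has_vector_derivative_continuous by (intro continuous_at_imp_continuous_on) blast
  have fu: "continuous_on UNIV (\<lambda>z. f (z, u (p, snd z)))" for p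
    by (intro continuous_on_compose2[OF f] continuous_on_Pair continuous_on_compose2[OF ct] continuous_intros) auto
  have ft: "continuous_on UNIV (\<lambda>t. f ((p, t), u (p, t)))" for p by (intro continuous_on_compose2[OF f] continuous_on_Pair ct continuous_intros) auto
  have "isCont u (p0, t0)" for p0 t0 unfolding continuous_at_eps_delta
  proof (intro allI impI)
    fix b :: real assume b: "b > 0"
    define N where "N = \<bar>t0\<bar> + 1"
    \<comment> \<open>An initial error \<open>r\<close> together with a forcing error
      \<open>r\<close> grows to at most \<open>r * E\<close> up to time \<open>N\<close>; the next
      definition makes this \<open>b / 2\<close>.\<close>
    define E where "E = (1 + N) * exp (L * N)"
    define r where "r = b / 2 / E"
    have N: "N > 0" by (simp add: N_def)
    then have E: "E > 0" by (simp add: E_def)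
    have r: "r > 0" unfolding r_def using b E by simp
    obtain a1 where a1: "a1 > 0" "\<And>p t. dist p p0 < a1 \<Longrightarrow> \<bar>t\<bar> \<le> N \<Longrightarrow> dist (f ((p, t), u (p0, t))) (f ((p0, t), u (p0, t))) < r"
      using uniform_tube[OF fu[of p0] r, of p0 N] by auto
    obtain a2 where a2: "a2 > 0" "\<And>p. dist p p0 < a2 \<Longrightarrow> dist (u (p, 0)) (u (p0, 0)) < r"
      using ini r unfolding continuous_on_iff by (metis UNIV_I)
    obtain a3 where a3: "a3 > 0" "\<And>t. dist t t0 < a3 \<Longrightarrow> dist (u (p0, t)) (u (p0, t0)) < b / 2"
      using ct b unfolding continuous_on_iff by (metis UNIV_I half_gt_zero)
    have main: "norm (u (p, t) - u (p0, t)) \<le> b / 2" if p: "dist p p0 < a1" "dist p p0 < a2" and t: "\<bar>t\<bar> \<le> N" for p t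
    proof -
      have "norm ((\<lambda>t. u (p, t) - u (p0, t)) t) \<le> (norm (u (p, 0) - u (p0, 0)) + r * \<bar>t\<bar>) * exp (L * \<bar>t\<bar>)"
      proof (rule gronwall[OF _ _ _ t L])
        show "((\<lambda>t. u (p, t) - u (p0, t)) has_vector_derivative f ((p, s), u (p, s)) - f ((p0, s), u (p0, s))) (at s)" for s
          by (intro has_vector_derivative_diff ode)
        show "continuous_on UNIV (\<lambda>s. f ((p, s), u (p, s)) - f ((p0, s), u (p0, s)))" by (intro continuous_on_diff ft)
        fix s assume s: "\<bar>s\<bar> \<le> N"
        have "norm (f ((p, s), u (p, s)) - f ((p, s), u (p0, s))) \<le> L * norm (u (p, s) - u (p0, s))" by (rule lip)
        moreover have "norm (f ((p, s), u (p0, s)) - f ((p0, s), u (p0, s))) < r" using a1(2)[OF p(1) s] by (simp add: dist_norm)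
        ultimately show "norm (f ((p, s), u (p, s)) - f ((p0, s), u (p0, s))) \<le> L * norm (u (p, s) - u (p0, s)) + r"
          using norm_triangle_ineq[of "f ((p, s), u (p, s)) - f ((p, s), u (p0, s))" "f ((p, s), u (p0, s)) - f ((p0, s), u (p0, s))"] by simp
      qed (use r in simp)
      also have "\<dots> \<le> (r + r * N) * exp (L * N)" using a2(2)[OF p(2)] t r L N
        by (intro mult_mono add_mono) (auto simp: dist_norm intro!: mult_left_mono add_nonneg_nonneg)
      also have "\<dots> = r * E" by (simp add: E_def algebra_simps)
      also have "\<dots> = b / 2" unfolding r_def using E by simp
      finally show ?thesis by simp
    qed
    define a where "a = min 1 (min a1 (min a2 a3))"
    have "dist (u z) (u (p0, t0)) < b" if "dist z (p0, t0) < a" for z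
    proof -
      obtain p t where z: "z = (p, t)" by (cases z)
      have "dist p p0 < a" "dist t t0 < a" using that dist_fst_le[of z "(p0, t0)"] dist_snd_le[of z "(p0, t0)"] by (auto simp: z)
      then have "dist p p0 < a1" "dist p p0 < a2" "\<bar>t\<bar> \<le> N" "dist t t0 < a3" by (auto simp: a_def N_def dist_real_def)
      then have "dist (u (p, t)) (u (p0, t)) \<le> b / 2" "dist (u (p0, t)) (u (p0, t0)) < b / 2" using main a3 by (auto simp: dist_norm)
      then show ?thesis unfolding z using dist_triangle[of "u (p, t)" "u (p0, t0)" "u (p0, t)"] by linarith
    qed
    moreover have "a > 0" using a1(1) a2(1) a3(1) by (simp add: a_def)
    ultimately show "\<exists>d>0. \<forall>x'. dist x' (p0, t0) < d \<longrightarrow> dist (u x') (u (p0, t0)) < b" by blast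
  qed
  then show ?thesis by (intro continuous_at_imp_continuous_on) auto
qed

lemma sum_Basis_Pair0:
  fixes D :: "'p::euclidean_space \<times> real \<Rightarrow> 'c::real_normed_vector"
  shows "(lc D v) = (lc (\<lambda>i. D (i, 0)) (fst v)) + snd v *\<^sub>R D (0, 1)" by (simp add: sum_Basis_prod inner_prod_def)

text \<open>The candidate derivative \<open>w\<close> solves the linearised equation. Linearising
  \<open>f\<close> uniformly along the compact graph of one solution, the error \<open>e\<close> of
  the linear approximation obeys a Gronwall inequality with forcing
  \<open>r * (1 + M) * norm h\<close>, where \<open>r\<close> can be made as small as
  desired.\<close>

lemma ode_differentiable:
  fixes f :: "('p::euclidean_space \<times> real) \<times> 'b::euclidean_space \<Rightarrow> 'b"
  assumes D: "\<And>z. (f has_derivative lc (\<lambda>b. D b z)) (at z)"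
    and cD: "\<And>b. b \<in> Basis \<Longrightarrow> continuous_on UNIV (D b)"
    and lip: "\<And>q u v. norm (f (q, u) - f (q, v)) \<le> L * norm (u - v)" and L: "L \<ge> 0"
    and ode: "\<And>p t. ((\<lambda>t. u (p, t)) has_vector_derivative f ((p, t), u (p, t))) (at t)"
    and uc: "continuous_on UNIV u"
    and ini: "\<And>p. ((\<lambda>p. u (p, 0)) has_derivative (lc (\<lambda>i. d i p))) (at p)"
    and w: "\<And>i p t. i \<in> Basis \<Longrightarrow> ((\<lambda>t. w i (p, t)) has_vector_derivative
        ((lc (\<lambda>c. D (0, c) ((p, t), u (p, t))) (w i (p, t))) + D ((i, 0), 0) ((p, t), u (p, t)))) (at t)"
    and wc: "\<And>i. i \<in> Basis \<Longrightarrow> continuous_on UNIV (w i)"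
    and w0: "\<And>i p. i \<in> Basis \<Longrightarrow> w i (p, 0) = d i p"
  shows "((\<lambda>p. u (p, t)) has_derivative (lc (\<lambda>i. w i (p, t)))) (at p)" unfolding has_derivative_at_alt
proof (intro conjI allI impI)
  show "bounded_linear (lc (\<lambda>i. w i (p, t)))" by (intro bounded_linear_sum bounded_linear_scaleR_const bounded_linear_inner_left)
next
  fix j :: real assume j: "j > 0"
  define N where "N = \<bar>t\<bar> + 1"
  have N: "N > 0" "\<bar>t\<bar> \<le> N" by (auto simp: N_def)
  have fc: "continuous_on UNIV f" using D by (intro continuous_at_imp_continuous_on) (auto intro: has_derivative_continuous)
  have ft: "continuous_on UNIV (\<lambda>t. f ((p, t), u (p, t)))" for p
    by (intro continuous_on_compose2[OF fc] continuous_on_Pair continuous_on_compose2[OF uc] continuous_intros) auto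
  have Dt: "continuous_on UNIV (\<lambda>t. D b ((p, t), u (p, t)))" if "b \<in> Basis" for p b
    by (intro continuous_on_compose2[OF cD[OF that]] continuous_on_Pair continuous_on_compose2[OF uc] continuous_intros) auto
  have wt: "continuous_on UNIV (\<lambda>t. w i (p, t))" if "i \<in> Basis" for p i by (intro continuous_on_compose2[OF wc[OF that]] continuous_intros) auto
  define W where "W h s = (lc (\<lambda>i. w i (p, s)) h)" for h s
  have "\<exists>M\<ge>0. \<forall>s h. \<bar>s\<bar> \<le> N \<longrightarrow> norm (W h s) \<le> M * norm h"
  proof -
    have "continuous_on {-N..N} (\<lambda>s. \<Sum>i\<in>Basis. norm (w i (p, s)))" by (intro continuous_intros continuous_on_subset[OF wt]) auto
    then have "compact ((\<lambda>s. \<Sum>i\<in>Basis. norm (w i (p, s))) ` {-N..N})" by (rule compact_continuous_image) simp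
    then obtain M where M: "\<And>s. s \<in> {-N..N} \<Longrightarrow> norm (\<Sum>i\<in>Basis. norm (w i (p, s))) \<le> M"
      using compact_imp_bounded by (fastforce simp: bounded_iff)
    have "norm (W h s) \<le> M * norm h" if "\<bar>s\<bar> \<le> N" for s h
    proof -
      have "norm (W h s) \<le> (\<Sum>i\<in>Basis. norm h * norm (w i (p, s)))"
        unfolding W_def by (rule sum_norm_le) (auto intro!: mult_right_mono Basis_le_norm)
      also have "\<dots> = norm h * (\<Sum>i\<in>Basis. norm (w i (p, s)))" by (simp add: sum_distrib_left)
      also have "\<dots> \<le> norm h * M" using M[of s] that by (intro mult_left_mono) (auto simp: abs_le_iff)
      finally show ?thesis by (simp add: mult.commute)
    qed
    moreover have "M \<ge> 0" using M[of 0] N by (smt (verit) atLeastAtMost_iff norm_ge_zero)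
    ultimately show ?thesis by blast
  qed
  then obtain M where M: "M \<ge> 0" "\<And>s h. \<bar>s\<bar> \<le> N \<Longrightarrow> norm (W h s) \<le> M * norm h" by blast
  define E where "E = (1 + (1 + M) * N) * exp ((L + 1) * N)"
  have E: "E > 0" unfolding E_def using M N by (intro mult_pos_pos add_pos_nonneg) auto
  \<comment> \<open>\<open>r \<le> 1\<close> lets the part of the remainder proportional to
    \<open>norm (e s)\<close> be absorbed by raising the rate from \<open>L\<close> to
    \<open>L + 1\<close>.\<close>
  define r where "r = min 1 (j / E)"
  have r: "r > 0" "r \<le> 1" unfolding r_def using j E by auto
  have K: "compact ((\<lambda>s. ((p, s), u (p, s))) ` {-N..N})"
    by (intro compact_continuous_image continuous_on_Pair continuous_on_compose2[OF uc] continuous_intros) auto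
  obtain a1 where a1: "a1 > 0" "\<And>s v. \<bar>s\<bar> \<le> N \<Longrightarrow> norm v < a1 \<Longrightarrow>
      norm (f (((p, s), u (p, s)) + v) - f ((p, s), u (p, s)) - (lc (\<lambda>b. D b ((p, s), u (p, s))) v)) \<le> r * norm v"
    using uniform_differentiability[OF D cD K r(1)] by (auto simp: abs_le_iff)
  obtain a2 where a2: "a2 > 0" "\<And>q s. dist q p < a2 \<Longrightarrow> \<bar>s\<bar> \<le> N \<Longrightarrow> dist (u (q, s)) (u (p, s)) < a1 / 2"
    using uniform_tube[OF uc, of "a1 / 2" p N] a1(1) by auto
  obtain a3 where a3: "a3 > 0" "\<And>q. norm (q - p) < a3 \<Longrightarrow>
      norm (u (q, 0) - u (p, 0) - (lc (\<lambda>i. d i p) (q - p))) \<le> r * norm (q - p)" using ini[of p, unfolded has_derivative_at_alt] r(1) by blast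
  define a where "a = min (a1 / 2) (min a2 a3)"
  have "norm (u (q, t) - u (p, t) - (lc (\<lambda>i. w i (p, t)) (q - p))) \<le> j * norm (q - p)" if q: "norm (q - p) < a" for q
  proof -
    define h where "h = q - p"
    have h: "norm h < a1 / 2" "norm h < a2" "norm h < a3" using q by (auto simp: a_def h_def)
    define e where "e s = u (q, s) - u (p, s) - W h s" for s
    define A where "A v s = (lc (\<lambda>c. D (0, c) ((p, s), u (p, s))) v)" for v s
    define e' where "e' s = f ((q, s), u (q, s)) - f ((p, s), u (p, s)) -
       (\<Sum>i\<in>Basis. (h \<bullet> i) *\<^sub>R (A (w i (p, s)) s + D ((i, 0), 0) ((p, s), u (p, s))))" for s
    have Alin: "A (v - v') s = A v s - A v' s" "A (lc g h) s = (lc (\<lambda>i. A (g i) s) h)" for v v' s and g :: "'p \<Rightarrow> 'b"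
    proof -
      interpret linear "\<lambda>v. A v s" unfolding A_def
        by (intro linear_compose_sum ballI bounded_linear.linear bounded_linear_scaleR_const bounded_linear_inner_left)
      show "A (v - v') s = A v s - A v' s" "A (lc g h) s = (lc (\<lambda>i. A (g i) s) h)" by (simp_all add: diff sum scale)
    qed
    have AL: "norm (A v s) \<le> L * norm v" for v s unfolding A_def by (rule lipschitz_partial_bound[OF D lip])
    have et: "norm (e t) \<le> (norm (e 0) + (r * (1 + M) * norm h) * \<bar>t\<bar>) * exp ((L + 1) * \<bar>t\<bar>)"
    proof (rule gronwall[OF _ _ _ N(2)])
      show "(e has_vector_derivative e' s) (at s)" for s unfolding e_def e'_def W_def A_def by (intro has_vector_derivative_diff ode has_vector_derivative_sum
            bounded_linear.has_vector_derivative[OF bounded_linear_scaleR_right] w)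
      show "continuous_on UNIV e'" unfolding e'_def A_def
        by (intro continuous_on_diff continuous_on_add continuous_on_sum continuous_on_scaleR continuous_on_inner ft wt Dt continuous_on_const)
          (auto simp: Basis_prod_def)
      fix s assume s: "\<bar>s\<bar> \<le> N"
      define \<Delta> where "\<Delta> = u (q, s) - u (p, s)"
      have \<Delta>: "norm \<Delta> < a1 / 2" using a2(2)[OF _ s, of q] h by (simp add: \<Delta>_def dist_norm h_def)
      have nv: "norm ((h, 0::real), \<Delta>) \<le> norm h + norm \<Delta>" using norm_Pair_le[of "(h, 0::real)" \<Delta>] norm_Pair_le[of h "0::real"] by simp
      have "norm (f (((p, s), u (p, s)) + ((h, 0), \<Delta>)) - f ((p, s), u (p, s)) - (lc (\<lambda>b. D b ((p, s), u (p, s))) ((h, 0), \<Delta>)))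
          \<le> r * norm ((h, 0::real), \<Delta>)" using h \<Delta> nv by (intro a1(2)[OF s]) linarith
      also have "\<dots> \<le> r * (norm h + norm \<Delta>)" using r nv by (intro mult_left_mono) auto
      also have "((p, s), u (p, s)) + ((h, 0), \<Delta>) = ((q, s), u (q, s))" by (simp add: h_def \<Delta>_def)
      also have "(lc (\<lambda>b. D b ((p, s), u (p, s))) ((h, 0), \<Delta>))
         = (lc (\<lambda>i. D ((i, 0), 0) ((p, s), u (p, s))) h) + A \<Delta> s" by (simp add: sum_Basis_prod A_def zero_prod_def)
      finally have R: "norm (f ((q, s), u (q, s)) - f ((p, s), u (p, s)) - ((lc (\<lambda>i. D ((i, 0), 0) ((p, s), u (p, s))) h) + A \<Delta> s)) \<le> r * (norm h + norm \<Delta>)" .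
      have e's: "e' s = (f ((q, s), u (q, s)) - f ((p, s), u (p, s)) - ((lc (\<lambda>i. D ((i, 0), 0) ((p, s), u (p, s))) h) + A \<Delta> s)) + A (e s) s"
        unfolding e'_def e_def W_def Alin \<Delta>_def by (simp add: scaleR_add_right sum.distrib algebra_simps)
      have "\<Delta> = e s + W h s" by (simp add: \<Delta>_def e_def)
      then have "norm \<Delta> \<le> norm (e s) + M * norm h" using norm_triangle_ineq[of "e s" "W h s"] M(2)[OF s, of h] by simp
      then have "r * (norm h + norm \<Delta>) \<le> r * (norm h + (norm (e s) + M * norm h))" using r by (intro mult_left_mono) auto
      moreover have "r * norm (e s) \<le> 1 * norm (e s)" using r by (intro mult_right_mono) auto
      ultimately have "r * (norm h + norm \<Delta>) \<le> norm (e s) + r * (1 + M) * norm h" by (simp add: algebra_simps)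
      then have "norm (e' s) \<le> (norm (e s) + r * (1 + M) * norm h) + L * norm (e s)"
        unfolding e's using norm_triangle_le[OF add_mono[OF R AL[of "e s" s]]] by linarith
      then show "norm (e' s) \<le> (L + 1) * norm (e s) + r * (1 + M) * norm h" by (simp add: algebra_simps)
    qed (use L M r in auto)
    have "e 0 = u (q, 0) - u (p, 0) - (lc (\<lambda>i. d i p) (q - p))" unfolding e_def W_def h_def by (simp add: w0)
    then have "norm (e 0) \<le> r * norm h" using a3(2)[of q] h by (simp add: h_def)
    then have "(norm (e 0) + (r * (1 + M) * norm h) * \<bar>t\<bar>) * exp ((L + 1) * \<bar>t\<bar>)
       \<le> (r * norm h + (r * (1 + M) * norm h) * N) * exp ((L + 1) * N)"
      using L M N r by (intro mult_mono add_mono mult_left_mono) (auto intro!: mult_left_mono add_nonneg_nonneg mult_nonneg_nonneg)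
    also have "\<dots> = (r * E) * norm h" by (simp add: E_def algebra_simps)
    also have "\<dots> \<le> j * norm h"
    proof (rule mult_right_mono)
      have "r * E \<le> (j / E) * E" using E by (intro mult_right_mono) (auto simp: r_def)
      then show "r * E \<le> j" using E by simp
    qed simp
    finally have "norm (e t) \<le> j * norm h" using et by linarith
    then show ?thesis by (simp add: e_def W_def h_def)
  qed
  moreover have "a > 0" using a1(1) a2(1) a3(1) by (simp add: a_def)
  ultimately show "\<exists>d>0. \<forall>y. norm (y - p) < d \<longrightarrow> norm (u (y, t) - u (p, t) - (lc (\<lambda>i. w i (p, t)) (y - p))) \<le> j * norm (y - p)" by blast
qed

lemma Cn_add: "Cn k S f \<Longrightarrow> Cn k S g \<Longrightarrow> Cn k S (\<lambda>x. f x + g x)" by (rule Ck_add)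

lemma Cn_compose: "Cn k U g \<Longrightarrow> Cn k S f \<Longrightarrow> (\<And>x. x \<in> S \<Longrightarrow> f x \<in> U) \<Longrightarrow> Cn k S (\<lambda>x. g (f x))"
  for f :: "'a::euclidean_space \<Rightarrow> 'c::euclidean_space" by (rule Ck_compose)

lemma Cn_id: "Cn k S (\<lambda>x. x)" by (rule Ck_id)

lemma Cn_bounded_linear: "bounded_linear L \<Longrightarrow> Cn k S L" by (rule Ck_linear[OF _ Ck_id])

text \<open>The derivative of the solution in a parameter solves a linear equation of the same shape,
  with the same Lipschitz constant, so that the order of differentiability can be raised by induction.\<close>

theorem ode_smooth:
  fixes f :: "('p::euclidean_space \<times> real) \<times> 'b::euclidean_space \<Rightarrow> 'b"
  assumes f: "Cn k UNIV f"
    and lip: "\<And>q u v. norm (f (q, u) - f (q, v)) \<le> L * norm (u - v)" and L: "L \<ge> 0"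
    and ode: "\<And>p t. ((\<lambda>t. u (p, t)) has_vector_derivative f ((p, t), u (p, t))) (at t)"
    and ini: "Cn k UNIV (\<lambda>p. u (p, 0))"
  shows "Cn k UNIV u" using f lip ode ini
proof (induction k arbitrary: f u)
  case 0
  then show ?case unfolding Cn_0_iff using ode_continuous_dependence[OF _ _ L] by blast
next
  case (Suc k)
  note f = Suc.prems(1) and lip = Suc.prems(2) and ode = Suc.prems(3) and ini = Suc.prems(4)
  have uk: "Cn k UNIV u" by (rule Suc.IH[OF Ck_mono_aux[OF f] lip ode Ck_mono_aux[OF ini]])
  from f[unfolded Cn_Suc_iff] obtain D where
    D0: "\<forall>z\<in>UNIV. (f has_derivative lc (\<lambda>b. D b z)) (at z)"
    and D0': "\<forall>b\<in>Basis. Cn k UNIV (D b)" by (elim conjE exE)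
  then have D: "\<And>z. (f has_derivative lc (\<lambda>b. D b z)) (at z)"
    and D': "\<And>b. b \<in> Basis \<Longrightarrow> Cn k UNIV (D b)" by blast+
  from ini[unfolded Cn_Suc_iff] obtain d where
    d: "\<And>p. ((\<lambda>p. u (p, 0)) has_derivative lc (\<lambda>b. d b p)) (at p)"
    and d': "\<And>b. b \<in> Basis \<Longrightarrow> Cn k UNIV (d b)" by auto
  \<comment> \<open>The coefficients of the linearised equation are evaluated along
    \<open>u\<close>, so \<open>f'\<close> is only as regular as \<open>u\<close>. Hence order
    \<open>k\<close> for \<open>u\<close> has to be established before the hypothesis is applied to
    \<open>w\<close>.\<close>
  define f' where "f' i z = (lc (\<lambda>c. D (0, c) (fst z, u (fst z))) (snd z)) + D ((i, 0), 0) (fst z, u (fst z))" for i z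
  have pair: "Cn k UNIV (\<lambda>z :: ('p \<times> real) \<times> 'b. (fst z, u (fst z)))"
    by (intro Ck_Pair Cn_compose[OF uk] Cn_bounded_linear bounded_linear_fst) auto
  have f'k: "Cn k UNIV (f' i)" if i: "i \<in> Basis" for i unfolding f'_def
    by (intro Cn_add Ck_sum Ck_scaleR Ck_inner Cn_compose[OF D'] Ck_const' pair Cn_bounded_linear bounded_linear_snd) (auto simp: i Basis_prod_def)
  have f'lip: "norm (f' i (q, v) - f' i (q, v')) \<le> L * norm (v - v')" for i q v v'
  proof -
    have "f' i (q, v) - f' i (q, v') = (lc (\<lambda>c. D (0, c) (q, u q)) (v - v'))" by (simp add: f'_def inner_diff_left scaleR_diff_left sum_subtractf)
    then show ?thesis using lipschitz_partial_bound[OF D lip] by metis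
  qed
  have "\<exists>w. \<forall>i\<in>Basis. \<forall>p. w i p 0 = d i p \<and> (\<forall>t. (w i p has_vector_derivative f' i ((p, t), w i p t)) (at t))"
  proof -
    have "\<exists>y. y 0 = d i p \<and> (\<forall>t. (y has_vector_derivative f' i ((p, t), y t)) (at t))" if i: "i \<in> Basis" for i p
    proof -
      have "continuous_on UNIV (\<lambda>z::real \<times> 'b. f' i ((p, fst z), snd z))"
        by (rule continuous_on_compose2[OF Cn_continuous_on[OF f'k[OF i]]]) (auto intro!: continuous_intros)
      then obtain y where "y 0 = d i p" "\<And>t. (y has_vector_derivative f' i ((p, t), y t)) (at t)"
        using picard[of "\<lambda>t v. f' i ((p, t), v)" L "d i p"] f'lip L by metis
      then show ?thesis by blast
    qed
    then show ?thesis by metis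
  qed
  then obtain w' where w': "\<And>i p. i \<in> Basis \<Longrightarrow> w' i p 0 = d i p"
    "\<And>i p t. i \<in> Basis \<Longrightarrow> (w' i p has_vector_derivative f' i ((p, t), w' i p t)) (at t)" by metis
  define w where "w i z = w' i (fst z) (snd z)" for i z
  have w: "((\<lambda>t. w i (p, t)) has_vector_derivative f' i ((p, t), w i (p, t))) (at t)" if "i \<in> Basis" for i p t
    using w'(2)[OF that] by (simp add: w_def)
  have w0: "w i (p, 0) = d i p" if "i \<in> Basis" for i p using w'(1)[OF that] by (simp add: w_def)
  have wk: "Cn k UNIV (w i)" if i: "i \<in> Basis" for i by (rule Suc.IH[OF f'k[OF i] f'lip w[OF i]]) (use d'[OF i] w0[OF i] in simp)
  have fk: "Cn k UNIV (\<lambda>q. f (q, u q))" by (intro Cn_compose[OF Ck_mono_aux[OF f]] Ck_Pair Cn_id uk) auto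
  have der: "((\<lambda>p. u (p, t)) has_derivative (lc (\<lambda>i. w i (p, t)))) (at p)" for p t
    by (rule ode_differentiable[OF D Cn_continuous_on[OF D'] lip L ode Cn_continuous_on[OF uk] d _ Cn_continuous_on[OF wk] w0]) (use w in "simp_all add: f'_def")
  \<comment> \<open>Partial derivatives give a total one as soon as one of them is continuous; here
    it is the time derivative \<open>f (z, u z)\<close>.\<close>
  have total: "(u has_derivative (\<lambda>v. (lc (\<lambda>i. w i z) (fst v)) + snd v *\<^sub>R f (z, u z))) (at z)" for z
  proof -
    have "((\<lambda>(p, t). u (p, t)) has_derivative (\<lambda>(tp, tt). (lc (\<lambda>i. w i (fst z, snd z)) tp) +
        blinfun_apply (blinfun_scaleR_left (f ((fst z, snd z), u (fst z, snd z)))) tt)) (at (fst z, snd z) within UNIV \<times> UNIV)"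
    proof (rule has_derivative_partialsI)
      show "((\<lambda>x. u (x, snd z)) has_derivative (lc (\<lambda>i. w i (fst z, snd z)))) (at (fst z))" by (rule der)
      show "((\<lambda>t. u (p, t)) has_derivative blinfun_apply (blinfun_scaleR_left (f ((p, t), u (p, t))))) (at t)" for p t
        using ode[of p t] by (simp add: has_vector_derivative_def)
      have "continuous_on UNIV (\<lambda>q. blinfun_scaleR_left (f (q, u q)))"
        using Cn_continuous_on[OF fk] by (intro bounded_linear.continuous_on[OF bounded_linear_blinfun_scaleR_left])
      then show "continuous (at (fst z, snd z) within UNIV \<times> UNIV) (\<lambda>(p, t). blinfun_scaleR_left (f ((p, t), u (p, t))))"
        by (cases z) (simp add: continuous_on_eq_continuous_at case_prod_unfold)
    qed auto
    then show ?thesis by (simp add: case_prod_unfold)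
  qed
  show ?case unfolding Cn_Suc_iff
  proof (intro conjI exI[of _ "\<lambda>b z. (lc (\<lambda>i. w i z) (fst b)) + snd b *\<^sub>R f (z, u z)"] ballI)
    show "continuous_on UNIV u" by (rule Cn_continuous_on[OF uk])
    fix z
    have "(\<Sum>b\<in>Basis. (v \<bullet> b) *\<^sub>R ((lc (\<lambda>i. w i z) (fst b)) + snd b *\<^sub>R f (z, u z)))
       = (lc (\<lambda>i. w i z) (fst v)) + snd v *\<^sub>R f (z, u z)" for v unfolding sum_Basis_Pair0 by (simp add: sum_Basis_inner_apply)
    then show "(u has_derivative (lc (\<lambda>b. ((lc (\<lambda>i. w i z) (fst b)) + snd b *\<^sub>R f (z, u z))))) (at z)" using total by simp
  next
    fix b :: "'p \<times> real" assume "b \<in> Basis"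
    show "Cn k UNIV (\<lambda>z. (lc (\<lambda>i. w i z) (fst b)) + snd b *\<^sub>R f (z, u z))" by (intro Cn_add Ck_sum Ck_scaleR Ck_const' wk fk)
  qed
qed

section \<open>Weak topologies\<close>

lemma Basis_axis2: "b \<in> (Basis :: (real^2) set) \<longleftrightarrow> (\<exists>i. b = axis i 1)" by (auto simp: Basis_vec_def)

lemma differentiable_on_has_derivative_partial:
  fixes f :: "'a::euclidean_space \<Rightarrow> 'b::real_normed_vector"
  assumes "f differentiable (at x within S)"
  shows "(f has_derivative lc (\<lambda>b. frechet_derivative f (at x within S) b)) (at x within S)"
proof -
  let ?L = "frechet_derivative f (at x within S)"
  have d: "(f has_derivative ?L) (at x within S)" using assms frechet_derivative_works by blast
  interpret bounded_linear ?L using d by (rule has_derivative_bounded_linear)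
  have "?L v = (lc (\<lambda>b. ?L b) v)" for v using sum[of "\<lambda>b. (v \<bullet> b) *\<^sub>R b" Basis] by (simp add: scaleR euclidean_representation)
  then have "?L = (lc (\<lambda>b. ?L b))" by blast
  with d show ?thesis by metis
qed

lemma Cn_of_iter_partial:
  assumes "\<And>is. iter_partial U is g differentiable_on U"
  shows "Cn k U (iter_partial U is g)"
proof (induction k arbitrary: "is")
  case 0
  show ?case unfolding Cn_0_iff using assms differentiable_imp_continuous_on by blast
next
  case (Suc k)
  let ?f = "iter_partial U is g"
  show ?case unfolding Cn_Suc_iff
  proof (intro conjI exI[of _ "\<lambda>b x. frechet_derivative ?f (at x within U) b"] ballI)
    show "continuous_on U ?f" using assms differentiable_imp_continuous_on by blast
    fix x assume "x \<in> U"
    then show "(?f has_derivative lc (\<lambda>b. frechet_derivative ?f (at x within U) b)) (at x within U)"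
      using assms by (intro differentiable_on_has_derivative_partial) (auto simp: differentiable_on_def)
  next
    fix b :: "real^2" assume "b \<in> Basis"
    then obtain i where "b = axis i 1" by (auto simp: Basis_axis2)
    then have "(\<lambda>x. frechet_derivative ?f (at x within U) b) = iter_partial U (i # is) g" by (simp add: partial_within_def fun_eq_iff)
    then show "Cn k U (\<lambda>x. frechet_derivative ?f (at x within U) b)" using Suc by metis
  qed
qed

text \<open>Uniqueness identifies the derivatives hidden in \<open>Ck\<close> with
  \<open>partial_within\<close>, in terms of which smoothness and jets are defined.\<close>

lemma Ck_SucE_partial:
  fixes f :: "'p \<Rightarrow> real^2 \<Rightarrow> real^2"
  assumes "Ck (Suc k) T S f" and S: "unique_derivs S"
  shows "\<And>p x. p \<in> topspace T \<Longrightarrow> x \<in> S \<Longrightarrow>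
      (f p has_derivative (\<lambda>v. \<Sum>i\<in>UNIV. (v $ i) *\<^sub>R partial_within S i (f p) x)) (at x within S)"
    and "Ck k T S (\<lambda>p. partial_within S i (f p))"
proof -
  from assms(1) obtain D where D: "derivs T S f D"
    and D': "\<And>b. b \<in> Basis \<Longrightarrow> Ck k T S (D b)" by (rule Ck_SucE) blast
  have eq: "partial_within S i (f p) x = D (axis i 1) p x" if "p \<in> topspace T" "x \<in> S" for i p x
  proof -
    have "f p differentiable (at x within S)" using D[rule_format, OF that] by (auto simp: differentiable_def)
    then have "(f p has_derivative frechet_derivative (f p) (at x within S)) (at x within S)" using frechet_derivative_works by blast
    from unique_derivsD[rule_format, OF S that(2) this D[rule_format, OF that]] show ?thesis unfolding partial_within_def by (simp add: sum_Basis_inner_apply)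
  qed
  have "(lc G v) = (\<Sum>i\<in>UNIV. (v $ i) *\<^sub>R G (axis i 1))" for G :: "real^2 \<Rightarrow> real^2" and v
    by (simp add: Basis_vec_def sum.UNION_disjoint axis_eq_axis inner_axis sum.reindex inj_on_def UN_singleton)
  with D eq show "\<And>p x. p \<in> topspace T \<Longrightarrow> x \<in> S \<Longrightarrow>
      (f p has_derivative (\<lambda>v. \<Sum>i\<in>UNIV. (v $ i) *\<^sub>R partial_within S i (f p) x)) (at x within S)" by simp
  show "Ck k T S (\<lambda>p. partial_within S i (f p))" by (rule Ck_cong[OF D'[of "axis i 1"]]) (simp_all add: eq)
qed

lemma Ck_iter_partial:
  assumes "Ck k T S f" "unique_derivs S" "length is \<le> k"
  shows "Ck (k - length is) T S (\<lambda>p. iter_partial S is (f p))" using assms(3)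
proof (induction "is")
  case (Cons i "is")
  then have "Ck (Suc (k - length (i # is))) T S (\<lambda>p. iter_partial S is (f p))" by (simp add: Suc_diff_Suc)
  from Ck_SucE_partial(2)[OF this assms(2), of i] show ?case by simp
qed (use assms in simp)

lemma Cn_iter_partial:
  assumes "\<And>k. Cn k S f" "unique_derivs S"
  shows "Cn k S (iter_partial S is f)" using Ck_iter_partial[OF assms(1)[of "k + length is"] assms(2), of "is"] by simp

lemma smooth_on_iff: "smooth_on S f \<longleftrightarrow> (\<exists>U g. open U \<and> S \<subseteq> U \<and> (\<forall>x\<in>S. g x = f x) \<and> (\<forall>k. Cn k U g))"
proof -
  have *: "(\<forall>is. iter_partial U is g differentiable_on U) \<longleftrightarrow> (\<forall>k. Cn k U g)" if "open U" for U g
  proof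
    assume "\<forall>is. iter_partial U is g differentiable_on U"
    then show "\<forall>k. Cn k U g" using Cn_of_iter_partial[of U g _ "[]"] by auto
  next
    assume g: "\<forall>k. Cn k U g"
    show "\<forall>is. iter_partial U is g differentiable_on U"
    proof
      fix "is"
      have "Cn 1 U (iter_partial U is g)" using g by (intro Cn_iter_partial unique_derivs_open that) auto
      from this[unfolded One_nat_def Cn_Suc_iff] show "iter_partial U is g differentiable_on U" by (auto simp: differentiable_on_def differentiable_def)
    qed
  qed
  show ?thesis unfolding smooth_on_def by (simp add: * cong: conj_cong)
qed

lemma smooth_on_Cn: "smooth_on S f \<Longrightarrow> Cn k S f"
proof -
  assume "smooth_on S f"
  then obtain U g where "S \<subseteq> U" "\<forall>x\<in>S. g x = f x" "\<forall>k. Cn k U g" unfolding smooth_on_iff by (elim exE conjE)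
  then show ?thesis by (intro Ck_cong[OF Ck_subset[of k _ U "\<lambda>_. g" S]]) auto
qed

text \<open>The second difference over the square of side \<open>h\<close> is \<open>h * h\<close>
  times a value of either mixed derivative, by the mean value theorem in the two possible orders. As
  \<open>h\<close> may be taken small, continuity at the origin forces equality.\<close>

lemma clairaut_real:
  fixes \<phi> :: "real \<Rightarrow> real \<Rightarrow> real"
  assumes r: "r > 0"
    and 1: "\<And>s t. \<bar>s\<bar> < r \<Longrightarrow> \<bar>t\<bar> < r \<Longrightarrow> ((\<lambda>s. \<phi> s t) has_real_derivative \<phi>1 s t) (at s)"
    and 2: "\<And>s t. \<bar>s\<bar> < r \<Longrightarrow> \<bar>t\<bar> < r \<Longrightarrow> ((\<lambda>t. \<phi> s t) has_real_derivative \<phi>2 s t) (at t)"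
    and 12: "\<And>s t. \<bar>s\<bar> < r \<Longrightarrow> \<bar>t\<bar> < r \<Longrightarrow> ((\<lambda>t. \<phi>1 s t) has_real_derivative \<phi>12 s t) (at t)"
    and 21: "\<And>s t. \<bar>s\<bar> < r \<Longrightarrow> \<bar>t\<bar> < r \<Longrightarrow> ((\<lambda>s. \<phi>2 s t) has_real_derivative \<phi>21 s t) (at s)"
    and c12: "isCont (\<lambda>z. \<phi>12 (fst z) (snd z)) (0, 0)" and c21: "isCont (\<lambda>z. \<phi>21 (fst z) (snd z)) (0, 0)"
  shows "\<phi>12 0 0 = \<phi>21 0 0"
proof (rule ccontr)
  assume ne: "\<phi>12 0 0 \<noteq> \<phi>21 0 0"
  define d where "d = \<bar>\<phi>12 0 0 - \<phi>21 0 0\<bar> / 2"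
  have d: "d > 0" using ne by (simp add: d_def)
  obtain d1 where d1: "d1 > 0" "\<And>z. dist z (0, 0) < d1 \<Longrightarrow> dist (\<phi>12 (fst z) (snd z)) (\<phi>12 0 0) < d"
    using c12 d unfolding continuous_at_eps_delta by (metis fst_conv snd_conv)
  obtain d2 where d2: "d2 > 0" "\<And>z. dist z (0, 0) < d2 \<Longrightarrow> dist (\<phi>21 (fst z) (snd z)) (\<phi>21 0 0) < d"
    using c21 d unfolding continuous_at_eps_delta by (metis fst_conv snd_conv)
  define h where "h = min r (min d1 d2) / 3"
  have h: "h > 0" "h < r" "2 * h < d1" "2 * h < d2" using r d1 d2 by (auto simp: h_def)
  have near: "dist (s, t) (0, 0) < d1" "dist (s, t) (0, 0) < d2" if "0 < s" "s < h" "0 < t" "t < h" for s t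
  proof -
    have "dist (s, t) (0, 0) \<le> \<bar>s\<bar> + \<bar>t\<bar>" unfolding dist_norm using norm_Pair_le[of s t] by simp
    then show "dist (s, t) (0, 0) < d1" "dist (s, t) (0, 0) < d2" using that h by linarith+
  qed
  have "\<exists>x. 0 < x \<and> x < h \<and> (\<phi> h h - \<phi> h 0) - (\<phi> 0 h - \<phi> 0 0) = (h - 0) * (\<phi>1 x h - \<phi>1 x 0)"
    by (rule MVT2[OF h(1)]) (use h r in "auto intro!: DERIV_diff 1")
  then obtain x where x: "0 < x" "x < h" "(\<phi> h h - \<phi> h 0) - (\<phi> 0 h - \<phi> 0 0) = h * (\<phi>1 x h - \<phi>1 x 0)" by auto
  have "\<exists>a. 0 < a \<and> a < h \<and> \<phi>1 x h - \<phi>1 x 0 = (h - 0) * \<phi>12 x a" by (rule MVT2[OF h(1)]) (use h r x in "auto intro!: 12")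
  then obtain a where a: "0 < a" "a < h" "\<phi>1 x h - \<phi>1 x 0 = h * \<phi>12 x a" by auto
  have "\<exists>a. 0 < a \<and> a < h \<and> (\<phi> h h - \<phi> 0 h) - (\<phi> h 0 - \<phi> 0 0) = (h - 0) * (\<phi>2 h a - \<phi>2 0 a)"
    by (rule MVT2[OF h(1)]) (use h r in "auto intro!: DERIV_diff 2")
  then obtain a' where a': "0 < a'" "a' < h" "(\<phi> h h - \<phi> 0 h) - (\<phi> h 0 - \<phi> 0 0) = h * (\<phi>2 h a' - \<phi>2 0 a')" by auto
  have "\<exists>x. 0 < x \<and> x < h \<and> \<phi>2 h a' - \<phi>2 0 a' = (h - 0) * \<phi>21 x a'" by (rule MVT2[OF h(1)]) (use h r a' in "auto intro!: 21")
  then obtain x' where x': "0 < x'" "x' < h" "\<phi>2 h a' - \<phi>2 0 a' = h * \<phi>21 x' a'" by auto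
  have "h * (h * \<phi>12 x a) = h * (h * \<phi>21 x' a')" using x(3) a'(3) unfolding a(3) x'(3) by linarith
  then have "\<phi>12 x a = \<phi>21 x' a'" using h by simp
  moreover have "dist (\<phi>12 x a) (\<phi>12 0 0) < d" "dist (\<phi>21 x' a') (\<phi>21 0 0) < d"
    using d1(2)[OF near(1)] d2(2)[OF near(2)] x a x' a' by fastforce+
  moreover have "2 * d = dist (\<phi>12 0 0) (\<phi>21 0 0)" by (simp add: d_def dist_real_def)
  ultimately show False using dist_triangle3[of "\<phi>12 0 0" "\<phi>21 0 0" "\<phi>12 x a"] by simp
qed

lemma partial_within_commute_open:
  fixes g :: "real^2 \<Rightarrow> real^2"
  assumes U: "open U" and g: "\<And>k. Cn k U g" and x: "x \<in> U"
  shows "partial_within U i (partial_within U j g) x = partial_within U j (partial_within U i g) x"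
proof -
  have ud: "unique_derivs U" using U by (rule unique_derivs_open)
  have p: "Cn k U (partial_within U i g)" for k i using Cn_iter_partial[OF g ud, of k "[i]"] by simp
  have pp: "Cn k U (partial_within U i (partial_within U j g))" for k i j using Cn_iter_partial[OF g ud, of k "[i,j]"] by simp
  have der: "((\<lambda>s. f (y + s *\<^sub>R axis i 1)) has_vector_derivative partial_within U i f (y + s *\<^sub>R axis i 1)) (at s)"
    if f: "\<And>k. Cn k U f" and y: "y + s *\<^sub>R axis i 1 \<in> U" for f y s i
  proof -
    have "(f has_derivative (\<lambda>v. \<Sum>k\<in>UNIV. (v $ k) *\<^sub>R partial_within U k f (y + s *\<^sub>R axis i 1))) (at (y + s *\<^sub>R axis i 1))"
      using Ck_SucE_partial(1)[OF f[of "Suc 0"] ud _ y, of "()"] unfolding at_within_open[OF y U] by simp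
    moreover have 1: "((\<lambda>s. y + s *\<^sub>R axis i 1) has_derivative (\<lambda>s. s *\<^sub>R axis i 1)) (at s)" by (auto intro!: derivative_eq_intros)
    ultimately have "((\<lambda>s. f (y + s *\<^sub>R axis i 1)) has_derivative (\<lambda>t. \<Sum>k\<in>UNIV. ((t *\<^sub>R axis i 1 :: real^2) $ k) *\<^sub>R partial_within U k f (y + s *\<^sub>R axis i 1))) (at s)"
      by (intro has_derivative_compose[OF 1])
    moreover have "(\<Sum>k\<in>UNIV. ((t *\<^sub>R axis i 1 :: real^2) $ k) *\<^sub>R partial_within U k f (y + s *\<^sub>R axis i 1)) = t *\<^sub>R partial_within U i f (y + s *\<^sub>R axis i 1)" for t
      by (subst sum.remove[of _ i]) (auto simp: axis_def intro!: sum.neutral)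
    ultimately show ?thesis by (simp add: has_vector_derivative_def)
  qed
  have comp: "((\<lambda>s. G s $ c) has_real_derivative G' $ c) F" if "(G has_vector_derivative G') F" for G :: "real \<Rightarrow> real^2" and G' F c
    using bounded_linear.has_vector_derivative[OF bounded_linear_vec_nth that, of c] by (simp add: has_real_derivative_iff_has_vector_derivative)
  obtain e where e: "e > 0" "ball x e \<subseteq> U" using U x openE by blast
  define z where "z s t = x + s *\<^sub>R axis j 1 + t *\<^sub>R axis i (1::real)" for s t
  have zU: "z s t \<in> U" if "\<bar>s\<bar> < e / 2" "\<bar>t\<bar> < e / 2" for s t
  proof -
    have "norm (s *\<^sub>R axis j 1 + t *\<^sub>R axis i (1::real) :: real^2) \<le> \<bar>s\<bar> + \<bar>t\<bar>" by (rule norm_triangle_le) simp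
    moreover have "dist x (z s t) = norm (s *\<^sub>R axis j 1 + t *\<^sub>R axis i (1::real) :: real^2)"
      unfolding dist_norm norm_minus_commute[of x] by (simp add: z_def)
    ultimately have "z s t \<in> ball x e" using that by simp
    then show ?thesis using e by blast
  qed
  have z': "z s t = (x + s *\<^sub>R axis j 1) + t *\<^sub>R axis i 1" "z s t = (x + t *\<^sub>R axis i 1) + s *\<^sub>R axis j 1" for s t
    by (simp_all add: z_def)
  have zc: "isCont (\<lambda>w. z (fst w) (snd w)) (0, 0)" unfolding z_def by (intro continuous_intros)
  have c: "isCont (\<lambda>w. h (z (fst w) (snd w)) $ c) (0, 0)" if "Cn 0 U h" for h :: "real^2 \<Rightarrow> real^2" and c
  proof -
    have "isCont h (z 0 0)" using that U x unfolding Cn_0_iff by (simp add: z_def continuous_on_eq_continuous_at)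
    then have "isCont (\<lambda>w. h (z (fst w) (snd w))) (0, 0)" using isCont_o2[OF zc, of h] by simp
    then show ?thesis by (intro continuous_intros)
  qed
  have "partial_within U i (partial_within U j g) (z 0 0) $ c = partial_within U j (partial_within U i g) (z 0 0) $ c" for c
  proof (rule clairaut_real[where r = "e/2" and \<phi> = "\<lambda>s t. g (z s t) $ c"
        and ?\<phi>1.0 = "\<lambda>s t. partial_within U j g (z s t) $ c" and ?\<phi>2.0 = "\<lambda>s t. partial_within U i g (z s t) $ c"
        and ?\<phi>12.0 = "\<lambda>s t. partial_within U i (partial_within U j g) (z s t) $ c"
        and ?\<phi>21.0 = "\<lambda>s t. partial_within U j (partial_within U i g) (z s t) $ c"])
    fix s t assume st: "\<bar>s\<bar> < e / 2" "\<bar>t\<bar> < e / 2"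
    show "((\<lambda>s. g (z s t) $ c) has_real_derivative partial_within U j g (z s t) $ c) (at s)"
      unfolding z'(2) using zU[OF st] by (intro comp der g) (simp add: z'(2))
    show "((\<lambda>t. g (z s t) $ c) has_real_derivative partial_within U i g (z s t) $ c) (at t)"
      unfolding z'(1) using zU[OF st] by (intro comp der g) (simp add: z'(1))
    show "((\<lambda>t. partial_within U j g (z s t) $ c) has_real_derivative partial_within U i (partial_within U j g) (z s t) $ c) (at t)"
      unfolding z'(1) using zU[OF st] by (intro comp der p) (simp add: z'(1))
    show "((\<lambda>s. partial_within U i g (z s t) $ c) has_real_derivative partial_within U j (partial_within U i g) (z s t) $ c) (at s)"
      unfolding z'(2) using zU[OF st] by (intro comp der p) (simp add: z'(2))
  qed (use e in "auto intro!: c pp")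
  then show ?thesis by (simp add: vec_eq_iff z_def)
qed

lemma partial_within_open_subset:
  assumes "open V" "V \<subseteq> S" "x \<in> V"
  shows "partial_within V i f x = partial_within S i f x" unfolding partial_within_def at_within_open_subset[OF assms(3,1,2)] at_within_open[OF assms(3,1)] ..

lemma partial_within_cong:
  assumes "\<And>x. x \<in> V \<Longrightarrow> f x = g x" "open V" "x \<in> V"
  shows "partial_within V i f x = partial_within V i g x"
proof -
  have "(f has_derivative L) (at x) \<longleftrightarrow> (g has_derivative L) (at x)" for L
    using has_derivative_transform_within_open[of f L x UNIV V g] has_derivative_transform_within_open[of g L x UNIV V f] assms by auto
  then show ?thesis unfolding partial_within_def frechet_derivative_def by (simp add: at_within_open[OF assms(3,2)])
qed

text \<open>Inside the disk this is the open case. A point of the boundary circle is a limit of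
  interior points, and both iterated derivatives are continuous on the closed disk.\<close>

lemma partial_within_commute_disk:
  fixes f :: "real^2 \<Rightarrow> real^2"
  assumes f: "\<And>k. Cn k disk f" and x: "x \<in> disk"
  shows "partial_within disk i (partial_within disk j f) x = partial_within disk j (partial_within disk i f) x"
proof -
  let ?B = "ball (0::real^2) 1"
  have f': "Cn k ?B f" for k by (rule Ck_subset[OF f]) auto
  have eq: "partial_within disk i (partial_within disk j f) y = partial_within ?B i (partial_within ?B j f) y"
    if "y \<in> ?B" for i j y
  proof -
    have "partial_within ?B i (partial_within disk j f) y = partial_within ?B i (partial_within ?B j f) y"
      by (intro partial_within_cong that partial_within_open_subset[symmetric]) auto
    then show ?thesis using partial_within_open_subset[of ?B disk y] that by fastforce
  qed
  have cont: "continuous_on disk (partial_within disk i (partial_within disk j f))" for i j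
    using Cn_iter_partial[OF f unique_derivs_disk, of 0 "[i,j]"] by (simp add: Cn_0_iff)
  have "partial_within disk i (partial_within disk j f) x - partial_within disk j (partial_within disk i f) x = 0"
  proof (rule continuous_constant_on_closure[of ?B "\<lambda>y. partial_within disk i (partial_within disk j f) y - partial_within disk j (partial_within disk i f) y"])
    show "continuous_on (closure ?B) (\<lambda>y. partial_within disk i (partial_within disk j f) y - partial_within disk j (partial_within disk i f) y)"
      by (simp add: cont continuous_on_diff)
    show "partial_within disk i (partial_within disk j f) y - partial_within disk j (partial_within disk i f) y = 0" if "y \<in> ?B" for y
      using partial_within_commute_open[OF open_ball f' that, of i j] eq[OF that] by simp
  qed (use x in simp)
  then show ?thesis by simp
qed

section \<open>The compact-open topology and continuity of jets\<close>

lemma Collect2_all: "(\<forall>W. W \<in> {N C U |C U. P C U} \<longrightarrow> Q W) \<longleftrightarrow> (\<forall>C U. P C U \<longrightarrow> Q (N C U))"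
  by blast

text \<open>The exponential law. For joint continuity, \<open>x\<close> is enclosed in a compact
  neighbourhood \<open>K \<inter> cball x e\<close> that \<open>f p\<close> maps into
  \<open>U\<close>; for the converse, the tube lemma thickens \<open>{p} \<times> C\<close> to a
  product of neighbourhoods.\<close>

lemma continuous_map_compact_open:
  fixes f :: "'p \<Rightarrow> 'a::euclidean_space \<Rightarrow> 'b"
  assumes K: "compact K"
  shows "continuous_map T (compact_open_topology (top_of_set K) Y) f \<longleftrightarrow>
    f ` topspace T \<subseteq> extensional K \<and> continuous_map (prod_topology T (top_of_set K)) Y (\<lambda>z. f (fst z) (snd z))"
    (is "?L \<longleftrightarrow> ?E \<and> ?R")
proof -
  let ?N = "\<lambda>C U. {f \<in> extensional (topspace (top_of_set K)). continuous_map (top_of_set K) Y f \<and> f ` C \<subseteq> U}"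
  have L: "?L \<longleftrightarrow> (\<forall>C U. compactin (top_of_set K) C \<and> openin Y U \<longrightarrow> openin T (f -` ?N C U \<inter> topspace T)) \<and>
      (\<forall>p\<in>topspace T. f p \<in> extensional K \<and> continuous_map (top_of_set K) Y (f p))"
  proof -
    have "\<Union>{?N C U |C U. compactin (top_of_set K) C \<and> openin Y U} = {f \<in> extensional K. continuous_map (top_of_set K) Y f}"
      by (auto intro!: exI[of _ "?N {} (topspace Y)"] exI[of _ "{}"] exI[of _ "topspace Y"])
    then have "f ` topspace T \<subseteq> \<Union>{?N C U |C U. compactin (top_of_set K) C \<and> openin Y U} \<longleftrightarrow>
       (\<forall>p\<in>topspace T. f p \<in> extensional K \<and> continuous_map (top_of_set K) Y (f p))" by auto
    moreover have "(\<forall>W. W \<in> {?N C U |C U. compactin (top_of_set K) C \<and> openin Y U} \<longrightarrow> openin T (f -` W \<inter> topspace T)) \<longleftrightarrow>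
       (\<forall>C U. compactin (top_of_set K) C \<and> openin Y U \<longrightarrow> openin T (f -` ?N C U \<inter> topspace T))" by (rule Collect2_all)
    ultimately show ?thesis unfolding compact_open_topology_def continuous_on_generated_topo_iff by (simp only:)
  qed
  show ?thesis
  proof
    assume ?L
    then have o: "\<And>C U. compactin (top_of_set K) C \<Longrightarrow> openin Y U \<Longrightarrow> openin T (f -` ?N C U \<inter> topspace T)"
      and e: "\<And>p. p \<in> topspace T \<Longrightarrow> f p \<in> extensional K"
      and c: "\<And>p. p \<in> topspace T \<Longrightarrow> continuous_map (top_of_set K) Y (f p)" unfolding L by blast+
    have ?R unfolding continuous_map_def
    proof (intro conjI allI impI)
      show "(\<lambda>z. f (fst z) (snd z)) \<in> topspace (prod_topology T (top_of_set K)) \<rightarrow> topspace Y"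
        using c by (auto simp: continuous_map_def Pi_iff)
      fix U assume U: "openin Y U"
      let ?W = "{z \<in> topspace (prod_topology T (top_of_set K)). f (fst z) (snd z) \<in> U}"
      show "openin (prod_topology T (top_of_set K)) ?W"
      proof (subst openin_subopen, intro ballI)
        fix z assume z: "z \<in> ?W"
        then obtain p x where px: "z = (p, x)" "p \<in> topspace T" "x \<in> K" "f p x \<in> U" by auto
        have "openin (top_of_set K) {x \<in> K. f p x \<in> U}" using openin_continuous_map_preimage[OF c[OF px(2)] U] by simp
        then obtain V where V: "open V" "{x \<in> K. f p x \<in> U} = K \<inter> V" by (auto simp: openin_open)
        with px obtain e where e: "e > 0" "cball x e \<subseteq> V" using open_contains_cball by (metis (no_types, lifting) IntD2 mem_Collect_eq)
        define C where "C = K \<inter> cball x e"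
        have C: "compactin (top_of_set K) C" unfolding C_def compactin_subtopology using K by (auto simp: compact_Int_closed)
        let ?Q = "f -` ?N C U \<inter> topspace T"
        have "p \<in> ?Q" using px \<open>p \<in> topspace T\<close> e(2) V(2) c[OF px(2)] \<open>\<And>p. p \<in> topspace T \<Longrightarrow> f p \<in> extensional K\<close>[OF px(2)]
          by (auto simp: C_def)
        moreover have "openin T ?Q" by (rule o[OF C U])
        moreover have "openin (top_of_set K) (K \<inter> ball x e)" by auto
        moreover have "?Q \<times> (K \<inter> ball x e) \<subseteq> ?W" by (auto simp: C_def)
        ultimately show "\<exists>T'. openin (prod_topology T (top_of_set K)) T' \<and> z \<in> T' \<and> T' \<subseteq> ?W"
          using px e(1) by (intro exI[of _ "?Q \<times> (K \<inter> ball x e)"]) (auto simp: openin_prod_Times_iff)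
      qed
    qed
    with e show "?E \<and> ?R" by blast
  next
    assume ER: "?E \<and> ?R"
    have c: "continuous_map (top_of_set K) Y (f p)" if "p \<in> topspace T" for p
    proof -
      have "continuous_map (top_of_set K) (prod_topology T (top_of_set K)) (\<lambda>x. (p, x))"
        using that by (simp add: continuous_map_paired continuous_map_const)
      from continuous_map_compose[OF this conjunct2[OF ER]] show ?thesis by (simp add: o_def)
    qed
    show ?L unfolding L
    proof (intro conjI allI impI ballI)
      fix C U assume CU: "compactin (top_of_set K) C \<and> openin Y U"
      show "openin T (f -` ?N C U \<inter> topspace T)"
      proof (subst openin_subopen, intro ballI)
        fix p assume p: "p \<in> f -` ?N C U \<inter> topspace T"
        let ?W = "{z \<in> topspace (prod_topology T (top_of_set K)). f (fst z) (snd z) \<in> U}"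
        have W: "openin (prod_topology T (top_of_set K)) ?W" using ER CU by (intro openin_continuous_map_preimage) auto
        have CK: "C \<subseteq> K" using CU compactin_subset_topspace by fastforce
        have sub: "{p} \<times> C \<subseteq> ?W" using p CK by auto
        obtain Q V where QV: "openin T Q" "{p} \<subseteq> Q" "C \<subseteq> V" "Q \<times> V \<subseteq> ?W"
          by (rule Wallace_theorem_prod_topology[OF _ _ W sub]) (use p CU in auto)
        have "Q \<subseteq> f -` ?N C U \<inter> topspace T"
        proof
          fix q assume q: "q \<in> Q"
          then have qT: "q \<in> topspace T" using openin_subset[OF QV(1)] by blast
          have "f q y \<in> U" if "y \<in> C" for y using subsetD[OF QV(4), of "(q, y)"] QV(3) q that by auto
          then have "f q ` C \<subseteq> U" by auto
          then show "q \<in> f -` ?N C U \<inter> topspace T" using qT c[OF qT] ER by auto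
        qed
        then show "\<exists>S. openin T S \<and> p \<in> S \<and> S \<subseteq> f -` ?N C U \<inter> topspace T" using QV by blast
      qed
    qed (use ER c in auto)
  qed
qed

lemma Cinf_disk_Cn: "h \<in> Cinf_disk \<Longrightarrow> Cn k disk h" by (simp add: Cinf_disk_def smooth_on_Cn)

text \<open>Jets list derivatives in a normal order, those in direction 2 innermost. A new outermost
  derivative in direction 2 is moved inwards past the \<open>a\<close> derivatives in direction
  1.\<close>

lemma iter_partial_replicate_snoc:
  assumes f: "\<And>k. Cn k disk f" and x: "x \<in> disk"
  shows "partial_within disk 2 (iter_partial disk (replicate a 1 @ replicate b 2) f) x
      = iter_partial disk (replicate a 1 @ replicate (Suc b) 2) f x" using x
proof (induction a arbitrary: x)
  case (Suc a)
  let ?g = "iter_partial disk (replicate a 1 @ replicate b 2) f"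
  have cong: "partial_within disk i u x = partial_within disk i v x"
    if "\<And>x. x \<in> disk \<Longrightarrow> u x = v x" for i u v
  proof -
    have "(u has_derivative L) (at x within disk) \<longleftrightarrow> (v has_derivative L) (at x within disk)" for L
      using has_derivative_transform[OF Suc.prems, of v u L] has_derivative_transform[OF Suc.prems, of u v L] that by metis
    then show ?thesis unfolding partial_within_def frechet_derivative_def by simp
  qed
  have "partial_within disk 2 (partial_within disk 1 ?g) x = partial_within disk 1 (partial_within disk 2 ?g) x"
    by (rule partial_within_commute_disk[OF Cn_iter_partial[OF f unique_derivs_disk] Suc.prems])
  also have "\<dots> = partial_within disk 1 (iter_partial disk (replicate a 1 @ replicate (Suc b) 2) f) x" by (rule cong) (rule Suc.IH)
  finally show ?case by simp
qed simp

text \<open>Jets contain normally ordered derivatives only. Since derivatives commute on the disk,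
  both partials of an ordered derivative are again ordered ones, so the induction never leaves the
  entries of the jet.\<close>

lemma Ck_iff_jets:
  fixes f :: "'p \<Rightarrow> real^2 \<Rightarrow> real^2"
  assumes f: "\<And>p. p \<in> topspace T \<Longrightarrow> f p \<in> Cinf_disk"
  shows "Ck k T disk f \<longleftrightarrow>
    (\<forall>a b. a + b \<le> k \<longrightarrow> Ck 0 T disk (\<lambda>p. iter_partial disk (replicate a 1 @ replicate b 2) (f p)))"
proof
  assume f: "Ck k T disk f"
  show "\<forall>a b. a + b \<le> k \<longrightarrow> Ck 0 T disk (\<lambda>p. iter_partial disk (replicate a 1 @ replicate b 2) (f p))"
    using Ck_iter_partial[OF f unique_derivs_disk, THEN Ck_0] by simp
next
  assume R: "\<forall>a b. a + b \<le> k \<longrightarrow> Ck 0 T disk (\<lambda>p. iter_partial disk (replicate a 1 @ replicate b 2) (f p))"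
  have "Ck j T disk (\<lambda>p. iter_partial disk (replicate a 1 @ replicate b 2) (f p))" if "a + b + j \<le> k" for a b j using that
  proof (induction j arbitrary: a b)
    case 0 then show ?case using R by simp
  next
    case (Suc j)
    let ?g = "\<lambda>a b p. iter_partial disk (replicate a 1 @ replicate b 2) (f p)"
    show ?case
    proof (rule Ck_SucI[where D = "\<lambda>c p x. (c $ 1) *\<^sub>R ?g (Suc a) b p x + (c $ 2) *\<^sub>R ?g a (Suc b) p x"])
      show "Ck 0 T disk (?g a b)" using R Suc.prems by simp
      fix p x assume p: "p \<in> topspace T" and x: "x \<in> disk"
      have Cn: "Cn k disk (f p)" for k using f[OF p] by (rule Cinf_disk_Cn)
      have "Cn (Suc 0) disk (?g a b p)" by (rule Cn_iter_partial[OF Cn unique_derivs_disk])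
      from Ck_SucE_partial(1)[OF this unique_derivs_disk _ x, of "()"]
      have "(?g a b p has_derivative (\<lambda>v. \<Sum>i\<in>UNIV. (v $ i) *\<^sub>R partial_within disk i (?g a b p) x)) (at x within disk)" by simp
      moreover have "(\<Sum>i\<in>UNIV. (v $ i) *\<^sub>R partial_within disk i (?g a b p) x)
        = (\<Sum>c\<in>Basis. (v \<bullet> c) *\<^sub>R ((c $ 1) *\<^sub>R ?g (Suc a) b p x + (c $ 2) *\<^sub>R ?g a (Suc b) p x))" for v :: "real^2"
      proof -
        have B: "(Basis :: (real^2) set) = {axis 1 1, axis 2 1}" by (auto simp: Basis_vec_def) (metis exhaust_2)
        have ne: "axis 1 1 \<noteq> (axis 2 1 :: real^2)" by (simp add: axis_eq_axis)
        have "partial_within disk 2 (?g a b p) x = ?g a (Suc b) p x" by (rule iter_partial_replicate_snoc[OF Cn x])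
        moreover have "(axis 1 1 :: real^2) $ 1 = 1" "(axis 1 1 :: real^2) $ 2 = 0" "(axis 2 1 :: real^2) $ 1 = 0" "(axis 2 1 :: real^2) $ 2 = 1"
          by (simp_all add: axis_def)
        ultimately show ?thesis unfolding B using ne by (simp add: sum_2 inner_axis)
      qed
      ultimately show "(?g a b p has_derivative (\<lambda>v. \<Sum>c\<in>Basis. (v \<bullet> c) *\<^sub>R ((c $ 1) *\<^sub>R ?g (Suc a) b p x + (c $ 2) *\<^sub>R ?g a (Suc b) p x))) (at x within disk)"
        by simp
    next
      fix c :: "real^2"
      show "Ck j T disk (\<lambda>p x. (c $ 1) *\<^sub>R ?g (Suc a) b p x + (c $ 2) *\<^sub>R ?g a (Suc b) p x)"
        by (intro Ck_add Ck_scaleR Ck_const' Suc.IH) (use Suc.prems in auto)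
    qed
  qed
  from this[of 0 0 k] show "Ck k T disk f" by simp
qed

lemma continuous_map_into_pullback:
  "continuous_map T (pullback_topology A j Z) f \<longleftrightarrow> f ` topspace T \<subseteq> A \<and> continuous_map T Z (\<lambda>p. j (f p))"
proof
  assume L: "continuous_map T (pullback_topology A j Z) f"
  then have "f ` topspace T \<subseteq> A" by (auto simp: continuous_map_def topspace_pullback_topology)
  moreover have "continuous_map (pullback_topology A j Z) Z j" using continuous_map_pullback[OF continuous_map_id, of A j Z] by (simp add: o_def)
  ultimately show "f ` topspace T \<subseteq> A \<and> continuous_map T Z (\<lambda>p. j (f p))" using continuous_map_compose[OF L] by (auto simp: o_def)
next
  assume R: "f ` topspace T \<subseteq> A \<and> continuous_map T Z (\<lambda>p. j (f p))"
  show "continuous_map T (pullback_topology A j Z) f" unfolding continuous_map_def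
  proof (intro conjI allI impI)
    show "f \<in> topspace T \<rightarrow> topspace (pullback_topology A j Z)" using R by (auto simp: topspace_pullback_topology continuous_map_def)
    fix U assume "openin (pullback_topology A j Z) U"
    then obtain V where V: "openin Z V" "U = j -` V \<inter> A" by (auto simp: openin_pullback_topology)
    have "{x \<in> topspace T. f x \<in> U} = {x \<in> topspace T. j (f x) \<in> V}" using R V by auto
    then show "openin T {x \<in> topspace T. f x \<in> U}" using openin_continuous_map_preimage[OF conjunct2[OF R] V(1)] by simp
  qed
qed

text \<open>The exponential law for the jet prolongation, followed by \<open>Ck_iff_jets\<close>.
  Order 0 is treated apart because there the topology is defined with the disk itself as target
  instead of a jet space.\<close>

lemma continuous_map_weak_topology_fin:
  "continuous_map T (weak_topology_fin k) f \<longleftrightarrow> f ` topspace T \<subseteq> Cinf_disk \<and> Ck k T disk f"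
proof (cases "k = 0")
  case True
  have 1: "f ` topspace T \<subseteq> Cinf_disk \<Longrightarrow> f ` topspace T \<subseteq> extensional disk" by (auto simp: Cinf_disk_def PiE_def)
  have 2: "continuous_map (prod_topology T (top_of_set disk)) (top_of_set disk) (\<lambda>z. f (fst z) (snd z))
     \<longleftrightarrow> continuous_map (prod_topology T (top_of_set disk)) euclidean (\<lambda>z. f (fst z) (snd z))" if "f ` topspace T \<subseteq> Cinf_disk"
    using that by (fastforce simp: continuous_map_in_subtopology Cinf_disk_def PiE_def Pi_iff)
  show ?thesis using 1 2 by (auto simp: True weak_topology_fin_def continuous_map_in_subtopology continuous_map_compact_open Ck.simps)
next
  case False
  have "continuous_map T (compact_open_topology (top_of_set disk) (jet_space k)) (\<lambda>p. jet_prolongation k (f p)) \<longleftrightarrow> Ck k T disk f"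
    if f: "f ` topspace T \<subseteq> Cinf_disk"
  proof -
    let ?P = "prod_topology T (top_of_set disk)"
    let ?j = "\<lambda>z. \<lambda>(a, b)\<in>{(a, b). a + b \<le> k}. iter_partial disk (replicate a 1 @ replicate b 2) (f (fst z)) (snd z)"
    have "continuous_map T (compact_open_topology (top_of_set disk) (jet_space k)) (\<lambda>p. jet_prolongation k (f p))
      \<longleftrightarrow> continuous_map ?P (jet_space k) (\<lambda>z. jet_prolongation k (f (fst z)) (snd z))"
      by (auto simp: continuous_map_compact_open jet_prolongation_def)
    also have "\<dots> \<longleftrightarrow> continuous_map ?P (jet_space k) (\<lambda>z. (snd z, ?j z))"
      by (intro iffI; erule continuous_map_eq) (auto simp: jet_prolongation_def)
    also have "\<dots> \<longleftrightarrow> continuous_map ?P (product_topology (\<lambda>_. euclidean) {(a, b). a + b \<le> k}) ?j"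
      unfolding jet_space_def by (simp add: continuous_map_paired continuous_map_snd)
    also have "\<dots> \<longleftrightarrow> (\<forall>a b. a + b \<le> k \<longrightarrow> Ck 0 T disk (\<lambda>p. iter_partial disk (replicate a 1 @ replicate b 2) (f p)))"
      by (auto simp: continuous_map_componentwise Ck.simps)
    also have "\<dots> \<longleftrightarrow> Ck k T disk f" using f by (intro Ck_iff_jets[symmetric]) auto
    finally show ?thesis .
  qed
  then show ?thesis using False by (auto simp: weak_topology_fin_def continuous_map_into_pullback)
qed

lemma topspace_weak_topology_fin: "topspace (weak_topology_fin k) = Cinf_disk"
proof -
  have "h \<in> topspace (weak_topology_fin k) \<longleftrightarrow> h \<in> Cinf_disk" for h
    using continuous_map_weak_topology_fin[of "discrete_topology {()}" k "\<lambda>_. h"] Cinf_disk_Cn[of h k]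
    by (auto simp add: continuous_map_const simp flip: null_topspace_iff_trivial)
  then show ?thesis by blast
qed

lemma continuous_map_weak_topology:
  "continuous_map T (weak_topology r) f \<longleftrightarrow>
    f ` topspace T \<subseteq> Cinf_disk \<and> (\<forall>k. enat k \<le> r \<longrightarrow> Ck k T disk f)"
proof (cases r)
  case (enat k)
  then show ?thesis unfolding weak_topology_def by (auto simp: continuous_map_weak_topology_fin intro: Ck_mono)
next
  case infinity
  have "continuous_map T (topology_generated_by (\<Union>k. {U. openin (weak_topology_fin k) U})) f
    \<longleftrightarrow> (\<forall>k. continuous_map T (weak_topology_fin k) f)"
  proof -
    have "\<Union>(\<Union>k. {U. openin (weak_topology_fin k) U}) = (\<Union>k. topspace (weak_topology_fin k))" unfolding topspace_def by blast
    then have "\<Union>(\<Union>k. {U. openin (weak_topology_fin k) U}) = Cinf_disk" by (simp add: topspace_weak_topology_fin)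
    moreover have "f -` U \<inter> topspace T = {x \<in> topspace T. f x \<in> U}" for U by auto
    ultimately show ?thesis unfolding continuous_on_generated_topo_iff by (auto simp: continuous_map_def topspace_weak_topology_fin)
  qed
  then show ?thesis using infinity by (simp add: weak_topology_def continuous_map_weak_topology_fin)
qed

lemma topspace_weak_topology: "topspace (weak_topology r) = Cinf_disk"
proof -
  have "h \<in> topspace (weak_topology r) \<longleftrightarrow> h \<in> Cinf_disk" for h
    using continuous_map_weak_topology[of "discrete_topology {()}" r "\<lambda>_. h"] Cinf_disk_Cn[of h]
    by (auto simp add: continuous_map_const simp flip: null_topspace_iff_trivial)
  then show ?thesis by blast
qed

section \<open>Cutoff functions, flows and implicit functions\<close>

text \<open>For \<open>x > 0\<close> this is \<open>exp (- 1 / x)\<close> divided by the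
  \<open>n\<close>-th power of \<open>x\<close>. The power is carried along because differentiation
  raises it.\<close>

definition flat :: "nat \<Rightarrow> real \<Rightarrow> real" where
  "flat n x = (if x > 0 then inverse x ^ n / exp (inverse x) else 0)"

lemma flat_tendsto_0: "(flat n \<longlongrightarrow> 0) (at 0)"
proof -
  have "((\<lambda>x::real. inverse x ^ n / exp (inverse x)) \<longlongrightarrow> 0) (at_right 0)"
    using filterlim_compose[OF tendsto_power_div_exp_0 filterlim_inverse_at_top_right] .
  then have r: "(flat n \<longlongrightarrow> 0) (at_right 0)"
    by (rule Lim_transform_eventually) (auto simp: flat_def eventually_at_right_field intro!: exI[of _ 1])
  have "((\<lambda>_::real. 0::real) \<longlongrightarrow> 0) (at_left 0)" by simp
  then have "(flat n \<longlongrightarrow> 0) (at_left 0)"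
    by (rule Lim_transform_eventually) (auto simp: flat_def eventually_at_left_field intro!: exI[of _ "-1"])
  with r show ?thesis by (simp add: filterlim_split_at)
qed

lemma flat_deriv: "(flat n has_real_derivative (flat (n + 2) x - n * flat (n + 1) x)) (at x)"
proof -
  consider "x > 0" | "x < 0" | "x = 0" by linarith
  then show ?thesis
  proof cases
    case 1
    have "((\<lambda>x. inverse x ^ n / exp (inverse x)) has_real_derivative (flat (n + 2) x - n * flat (n + 1) x)) (at x)"
    proof -
      have "((\<lambda>x. inverse x ^ n) has_real_derivative (n * (- (inverse x * inverse x) * inverse x ^ (n - Suc 0)))) (at x)"
        using 1 by (auto intro!: derivative_eq_intros)
      also have "n * (- (inverse x * inverse x) * inverse x ^ (n - Suc 0)) = - (n * inverse x ^ (n + 1))" by (cases n) auto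
      finally have p: "((\<lambda>x. inverse x ^ n) has_real_derivative - (n * inverse x ^ (n + 1))) (at x)" .
      have e: "((\<lambda>x. exp (- inverse x)) has_real_derivative exp (- inverse x) * (inverse x * inverse x)) (at x)"
        using 1 by (auto intro!: derivative_eq_intros)
      have "((\<lambda>x. inverse x ^ n * exp (- inverse x)) has_real_derivative (flat (n + 2) x - n * flat (n + 1) x)) (at x)"
        by (rule DERIV_cong[OF DERIV_mult[OF p e]]) (use 1 in "simp add: flat_def exp_minus divide_inverse power2_eq_square algebra_simps")
      then show ?thesis by (simp add: exp_minus divide_inverse)
    qed
    then show ?thesis by (rule has_field_derivative_transform_within_open[of _ _ _ "{0<..}"]) (use 1 in "auto simp: flat_def")
  next
    case 2
    have "((\<lambda>x::real. 0::real) has_real_derivative 0) (at x)" by simp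
    then have "(flat n has_real_derivative 0) (at x)" by (rule has_field_derivative_transform_within_open[of _ _ _ "{..<0}"]) (use 2 in "auto simp: flat_def")
    then show ?thesis using 2 by (simp add: flat_def)
  next
    case 3
    have "(flat n (0 + h) - flat n 0) / h = flat (Suc n) h" for h by (simp add: flat_def field_simps)
    then have "(flat n has_real_derivative 0) (at 0)" unfolding DERIV_def using flat_tendsto_0[of "Suc n"] by simp
    then show ?thesis using 3 by (simp add: flat_def)
  qed
qed

lemma Cn_flat: "Cn k UNIV (flat n)"
proof (induction k arbitrary: n)
  case 0
  show ?case unfolding Cn_0_iff by (intro continuous_at_imp_continuous_on ballI DERIV_isCont[OF flat_deriv])
next
  case (Suc k)
  show ?case
  proof (rule Ck_SucI[where D = "\<lambda>_ _ x. flat (n + 2) x - n * flat (n + 1) x"])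
    show "Cn 0 UNIV (flat n)" unfolding Cn_0_iff by (intro continuous_at_imp_continuous_on ballI DERIV_isCont[OF flat_deriv])
    fix x
    show "(flat n has_derivative (lc (\<lambda>b. (flat (n + 2) x - n * flat (n + 1) x)))) (at x)"
      using flat_deriv[of n x] unfolding has_field_derivative_def by (simp add: mult.commute[of _ "flat _ _ - _"])
    show "Cn k UNIV (\<lambda>x. flat (n + 2) x - n * flat (n + 1) x)" by (intro Ck_diff Ck_mult Ck_const' Suc.IH)
  qed
qed

text \<open>The quotient \<open>A / (A + B)\<close>, where \<open>A\<close> vanishes for
  \<open>norm x \<le> r0\<close> and \<open>B\<close> for \<open>r1 \<le> norm x\<close>, hence
  never both. Squared norms keep it smooth at the origin.\<close>

lemma smooth_cutoff:
  assumes "0 \<le> r0" "r0 < r1"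
  shows "\<exists>u :: 'a::euclidean_space \<Rightarrow> real. (\<forall>k. Cn k UNIV u) \<and> (\<forall>x. norm x \<le> r0 \<longrightarrow> u x = 0) \<and>
     (\<forall>x. r1 \<le> norm x \<longrightarrow> u x = 1) \<and> (\<forall>x. 0 \<le> u x \<and> u x \<le> 1)"
proof -
  define A where "A x = flat 0 (x \<bullet> x - r0\<^sup>2)" for x :: 'a
  define B where "B x = flat 0 (r1\<^sup>2 - x \<bullet> x)" for x :: 'a
  have pos: "flat 0 y \<ge> 0" "flat 0 y > 0 \<longleftrightarrow> y > 0" "flat 0 y = 0 \<longleftrightarrow> y \<le> 0" for y by (auto simp: flat_def)
  have sq: "r0\<^sup>2 < r1\<^sup>2" using assms by (intro power_strict_mono) auto
  have AB: "A x + B x > 0" for x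
  proof (cases "x \<bullet> x > r0\<^sup>2")
    case True then show ?thesis unfolding A_def B_def using pos by (intro add_pos_nonneg) auto
  next
    case False then show ?thesis unfolding A_def B_def using pos sq by (intro add_nonneg_pos) auto
  qed
  define u where "u x = A x / (A x + B x)" for x
  have sm: "Cn k UNIV A" "Cn k UNIV B" for k unfolding A_def B_def by (intro Cn_compose[OF Cn_flat] Ck_diff Ck_inner Ck_id Ck_const' UNIV_I)+
  have "Cn k UNIV u" for k unfolding u_def by (rule Ck_divide[OF sm(1) Cn_add[OF sm]]) (use AB less_irrefl in metis)
  moreover have "u x = 0" if "norm x \<le> r0" for x using power_mono[OF that, of 2] by (simp add: u_def A_def pos power2_norm_eq_inner)
  moreover have "u x = 1" if "r1 \<le> norm x" for x
  proof -
    have "B x = 0" using power_mono[OF that, of 2] assms by (simp add: B_def pos power2_norm_eq_inner)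
    then show ?thesis using AB[of x] by (simp add: u_def)
  qed
  moreover have "0 \<le> u x \<and> u x \<le> 1" for x using AB[of x] pos(1) by (simp add: u_def A_def B_def divide_le_eq)
  ultimately show ?thesis by blast
qed

section \<open>Extension of the vector field and its flow\<close>

lemma Cn_open_cover:
  fixes f :: "'a::euclidean_space \<Rightarrow> 'b::real_inner"
  assumes "open S" "\<And>x. x \<in> S \<Longrightarrow> \<exists>W. open W \<and> x \<in> W \<and> W \<subseteq> S \<and> Cn k W f"
  shows "Cn k S f"
proof (rule Ck_local)
  show "unique_derivs S" by (rule unique_derivs_open) fact
  fix p x assume "p \<in> topspace (discrete_topology {()})" "x \<in> S"
  then obtain W where "open W" "x \<in> W" "W \<subseteq> S" "Cn k W f" using assms(2) by blast
  then show "\<exists>Q W. openin (discrete_topology {()}) Q \<and> openin (top_of_set S) W \<and> p \<in> Q \<and> x \<in> W \<and>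
     Ck k (subtopology (discrete_topology {()}) Q) W (\<lambda>_. f)" by (intro exI[of _ UNIV] exI[of _ W]) (auto simp: openin_open)
qed

text \<open>A smooth extension of \<open>F\<close> is cut off outside a slightly larger disk. With
  compact support its derivative is bounded, which yields the global Lipschitz constant that
  solutions for all times require.\<close>

lemma compactly_supported_extension:
  assumes "smooth_on disk F"
  shows "\<exists>G L. (\<forall>k. Cn k UNIV G) \<and> (\<forall>x\<in>disk. G x = F x) \<and> L \<ge> 0 \<and> (\<forall>x y. norm (G x - G y) \<le> L * norm (x - y))"
proof -
  obtain U g where U: "open U" "disk \<subseteq> U" "\<And>x. x \<in> disk \<Longrightarrow> g x = F x" "\<And>k. Cn k U g"
    using assms unfolding smooth_on_iff by (elim exE conjE) blast
  obtain e where e: "e > 0" "(\<Union>x\<in>disk. ball x e) \<subseteq> U" by (rule compact_subset_open_imp_ball_epsilon_subset[OF _ U(1,2)]) auto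
  have inU: "x \<in> U" if "norm x < 1 + e" for x
  proof (cases "norm x \<le> 1")
    case False
    then have "x \<noteq> 0" by auto
    have "dist (x /\<^sub>R norm x) x = norm x - 1"
    proof -
      have "x /\<^sub>R norm x - x = (inverse (norm x) - 1) *\<^sub>R x" by (simp add: scaleR_diff_left)
      then have "dist (x /\<^sub>R norm x) x = \<bar>inverse (norm x) - 1\<bar> * norm x" by (simp add: dist_norm)
      also have "\<dots> = (1 - inverse (norm x)) * norm x" using False by (simp add: inverse_le_1_iff)
      also have "\<dots> = norm x - 1" using \<open>x \<noteq> 0\<close> by (simp add: left_diff_distrib)
      finally show ?thesis .
    qed
    then have "x \<in> ball (x /\<^sub>R norm x) e" using that by simp
    moreover have "x /\<^sub>R norm x \<in> disk" using \<open>x \<noteq> 0\<close> by simp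
    ultimately show ?thesis using e(2) by blast
  qed (use U(2) in auto)
  obtain u :: "real^2 \<Rightarrow> real" where u: "\<And>k. Cn k UNIV u" "\<And>x. norm x \<le> 1 \<Longrightarrow> u x = 0" "\<And>x. 1 + e / 2 \<le> norm x \<Longrightarrow> u x = 1"
    using smooth_cutoff[of 1 "1 + e/2"] e(1) by auto
  define G where "G x = (if x \<in> U then (1 - u x) *\<^sub>R g x else 0)" for x
  have G0: "G x = 0" if "1 + e / 2 \<le> norm x" for x using that u(3) by (simp add: G_def)
  have "Cn k UNIV G" for k
  proof (rule Cn_open_cover)
    fix x :: "real^2"
    show "\<exists>W. open W \<and> x \<in> W \<and> W \<subseteq> UNIV \<and> Cn k W G"
    proof (cases "x \<in> U")
      case True
      have "Cn k U (\<lambda>x. (1 - u x) *\<^sub>R g x)" by (intro Ck_scaleR Ck_diff Ck_const' U(4) Ck_subset[OF u(1)]) auto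
      then have "Cn k U G" by (rule Ck_cong) (simp add: G_def)
      then show ?thesis using U(1) True by blast
    next
      case False
      let ?W = "- cball (0::real^2) (1 + e/2)"
      have "Cn k ?W G" by (rule Ck_cong[of _ _ _ "\<lambda>_ _. 0"]) (auto simp: G0)
      moreover have "x \<in> ?W" using False inU[of x] e(1) by auto
      ultimately show ?thesis by (intro exI[of _ ?W]) auto
    qed
  qed simp
  then have GC: "\<And>k. Cn k UNIV G" .
  from GC[of "Suc 0", unfolded Cn_Suc_iff] obtain D where
    D0: "\<forall>x\<in>UNIV. (G has_derivative lc (\<lambda>b. D b x)) (at x)"
    and D0': "\<forall>b\<in>Basis. Cn 0 UNIV (D b)" by (elim conjE exE)
  have "\<exists>B\<ge>0. \<forall>x. norm (D b x) \<le> B" if b: "b \<in> Basis" for b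
  proof -
    have "compact (D b ` cball 0 (1 + e))"
      by (intro compact_continuous_image continuous_on_subset[OF D0'[rule_format, OF b, unfolded Cn_0_iff] subset_UNIV]) auto
    then obtain B where B: "B > 0" "\<And>x. x \<in> cball 0 (1 + e) \<Longrightarrow> norm (D b x) \<le> B"
      using compact_imp_bounded bounded_pos by (metis imageI)
    have "norm (D b x) \<le> B" for x
    proof (cases "norm x \<le> 1 + e")
      case False
      have "((\<lambda>_. 0) has_derivative lc (\<lambda>b. D b x)) (at x)"
      proof (rule has_derivative_transform_within_open)
        show "(G has_derivative lc (\<lambda>b. D b x)) (at x)" using D0 by blast
        show "open (- cball (0::real^2) (1 + e/2))" by auto
        show "x \<in> - cball 0 (1 + e/2)" using False e(1) by simp
        show "G y = 0" if "y \<in> - cball 0 (1 + e/2)" for y using that by (intro G0) simp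
      qed
      from has_derivative_unique[OF this has_derivative_const]
      have "(lc (\<lambda>c. D c x) b) = 0" by metis
      then show ?thesis using b B(1) by (simp add: sum_Basis_inner_apply)
    qed (use B in auto)
    then show ?thesis using B(1) by (intro exI[of _ B]) auto
  qed
  then obtain B where B: "\<And>b x. b \<in> Basis \<Longrightarrow> norm (D b x) \<le> B b" "\<And>b. b \<in> Basis \<Longrightarrow> B b \<ge> 0" by metis
  define L where "L = (\<Sum>b\<in>Basis. B b)"
  have L: "L \<ge> 0" unfolding L_def by (intro sum_nonneg B)
  have "norm (G x - G y) \<le> L * norm (x - y)" for x y
  proof (rule differentiable_bound[of UNIV G "\<lambda>x v. \<Sum>b\<in>Basis. (v \<bullet> b) *\<^sub>R D b x"])
    fix x
    show "onorm (lc (\<lambda>b. D b x)) \<le> L"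
    proof (rule onorm_bound[OF L])
      fix v :: "real^2"
      have "norm (lc (\<lambda>b. D b x) v) \<le> (\<Sum>b\<in>Basis. norm v * B b)" by (rule sum_norm_le) (auto intro!: mult_mono Basis_le_norm B)
      then show "norm (lc (\<lambda>b. D b x) v) \<le> L * norm v" by (simp add: L_def sum_distrib_left mult.commute)
    qed
  qed (use D0 in auto)
  moreover have "\<forall>x\<in>disk. G x = F x" using U u(2) by (auto simp: G_def)
  ultimately show ?thesis using GC L by blast
qed

lemma ode_unique:
  fixes u v :: "real \<Rightarrow> 'b::euclidean_space"
  assumes lip: "\<And>x y. norm (G x - G y) \<le> L * norm (x - y)" and L: "L \<ge> 0" and G: "continuous_on UNIV G"
    and u: "\<And>t. (u has_vector_derivative G (u t)) (at t)" and v: "\<And>t. (v has_vector_derivative G (v t)) (at t)"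
    and 0: "u 0 = v 0"
  shows "u t = v t"
proof -
  have c: "continuous_on UNIV u" "continuous_on UNIV v" using u v has_vector_derivative_continuous by (blast intro: continuous_at_imp_continuous_on)+
  have "norm ((\<lambda>t. u t - v t) t) \<le> (norm (u 0 - v 0) + 0 * \<bar>t\<bar>) * exp (L * \<bar>t\<bar>)"
    by (rule gronwall[where e' = "\<lambda>t. G (u t) - G (v t)" and N = "\<bar>t\<bar>"])
      (auto intro!: has_vector_derivative_diff u v lip L continuous_on_diff continuous_on_compose2[OF G] c)
  then show ?thesis using 0 by simp
qed

lemma flow_exists:
  fixes G :: "'b::euclidean_space \<Rightarrow> 'b"
  assumes G: "\<And>k. Cn k UNIV G" and lip: "\<And>x y. norm (G x - G y) \<le> L * norm (x - y)" and L: "L \<ge> 0"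
  shows "\<exists>\<Phi>. (\<forall>k. Cn k UNIV \<Phi>) \<and> (\<forall>x. \<Phi> (x, 0) = x) \<and> (\<forall>x t. ((\<lambda>t. \<Phi> (x, t)) has_vector_derivative G (\<Phi> (x, t))) (at t))"
proof -
  have Gc: "continuous_on UNIV G" by (rule Cn_continuous_on[OF G])
  have "\<exists>u. u 0 = x \<and> (\<forall>t. (u has_vector_derivative G (u t)) (at t))" for x
  proof -
    have "continuous_on UNIV (\<lambda>z::real \<times> 'b. G (snd z))" by (intro continuous_on_compose2[OF Gc] continuous_intros) auto
    then obtain u where "u 0 = x" "\<And>t. (u has_vector_derivative G (u t)) (at t)" using picard[of "\<lambda>t. G" L x] lip L by metis
    then show ?thesis by blast
  qed
  then obtain \<phi> where \<phi>: "\<And>x. \<phi> x 0 = x" "\<And>x t. (\<phi> x has_vector_derivative G (\<phi> x t)) (at t)" by metis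
  have "Cn k UNIV (\<lambda>z. \<phi> (fst z) (snd z))" for k
  proof (rule ode_smooth[where f = "\<lambda>z. G (snd z)" and L = L])
    show "Cn k UNIV (\<lambda>z::('b \<times> real) \<times> 'b. G (snd z))" by (intro Cn_compose[OF G] Cn_bounded_linear bounded_linear_snd) auto
  qed (use lip L \<phi> in auto)
  then show ?thesis using \<phi> by (intro exI[of _ "\<lambda>z. \<phi> (fst z) (snd z)"]) auto
qed

text \<open>Only continuity of \<open>a\<close> is given, so its increment is first bounded by
  \<open>C * norm v\<close>; with that bound the linearisation of \<psi> yields the
  derivative.\<close>

lemma implicit_has_derivative:
  fixes \<psi> :: "'a::real_normed_vector \<times> real \<Rightarrow> real" and a :: "'a \<Rightarrow> real"
  assumes d: "(\<psi> has_derivative (\<lambda>v. A (fst v) + snd v * c)) (at (x, a x) within S \<times> UNIV)"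
    and A: "bounded_linear A" and c: "c \<noteq> 0" and cont: "continuous (at x within S) a"
    and z: "\<And>y. y \<in> S \<Longrightarrow> \<psi> (y, a y) = 0" and x: "x \<in> S"
  shows "(a has_derivative (\<lambda>v. - A v / c)) (at x within S)" unfolding has_derivative_within_alt
proof (intro conjI allI impI)
  show "bounded_linear (\<lambda>v. - A v / c)" using bounded_linear_compose[OF bounded_linear_divide bounded_linear_minus[OF A]] .
  fix e :: real assume e: "e > 0"
  obtain K where K: "K > 0" "\<And>v. norm (A v) \<le> norm v * K" using bounded_linear.pos_bounded[OF A] by blast
  define C where "C = (K + \<bar>c\<bar> / 2) / (\<bar>c\<bar> / 2)"
  have C: "C > 0" unfolding C_def using K c by (intro divide_pos_pos add_pos_nonneg) auto
  \<comment> \<open>The first bound keeps the remainder below half of the term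
    \<open>\<Delta> * c\<close>, which gives the Lipschitz estimate with \<open>C\<close>; the
    second makes the final error at most \<open>e * norm v\<close>.\<close>
  define r where "r = min (\<bar>c\<bar> / 2) (e * \<bar>c\<bar> / (1 + C))"
  have r: "r > 0" unfolding r_def using c e C by (auto intro!: divide_pos_pos mult_pos_pos)
  from d[unfolded has_derivative_within_alt] r obtain d1 where d1: "d1 > 0"
    "\<And>w. w \<in> S \<times> UNIV \<Longrightarrow> norm (w - (x, a x)) < d1 \<Longrightarrow>
       norm (\<psi> w - \<psi> (x, a x) - (A (fst (w - (x, a x))) + snd (w - (x, a x)) * c)) \<le> r * norm (w - (x, a x))" by blast
  from cont[unfolded continuous_within_eps_delta] d1(1) obtain d2 where d2: "d2 > 0"
    "\<And>y. y \<in> S \<Longrightarrow> dist y x < d2 \<Longrightarrow> dist (a y) (a x) < d1 / 2" by (metis half_gt_zero)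
  show "\<exists>d>0. \<forall>y\<in>S. norm (y - x) < d \<longrightarrow> norm (a y - a x - - A (y - x) / c) \<le> e * norm (y - x)"
  proof (intro exI[of _ "min (d1 / 2) d2"] conjI ballI impI)
    fix y assume y: "y \<in> S" "norm (y - x) < min (d1 / 2) d2"
    define v where "v = y - x"
    define \<Delta> where "\<Delta> = a y - a x"
    have \<Delta>: "\<bar>\<Delta>\<bar> < d1 / 2" using d2(2)[of y] y by (simp add: \<Delta>_def dist_norm)
    have nv: "norm (v, \<Delta>) \<le> norm v + \<bar>\<Delta>\<bar>" using norm_Pair_le[of v \<Delta>] by simp
    have "norm (\<psi> (y, a y) - \<psi> (x, a x) - (A v + \<Delta> * c)) \<le> r * norm (v, \<Delta>)"
      using d1(2)[of "(y, a y)"] y \<Delta> nv by (simp add: v_def \<Delta>_def)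
    also have "\<dots> \<le> r * (norm v + \<bar>\<Delta>\<bar>)" using r nv by (intro mult_left_mono) auto
    finally have R: "\<bar>A v + \<Delta> * c\<bar> \<le> r * (norm v + \<bar>\<Delta>\<bar>)" using z y x by simp
    have "r * (norm v + \<bar>\<Delta>\<bar>) \<le> \<bar>c\<bar> / 2 * (norm v + \<bar>\<Delta>\<bar>)" by (intro mult_right_mono) (simp_all only: r_def min.cobounded1, simp)
    moreover have "\<bar>\<Delta>\<bar> * \<bar>c\<bar> \<le> \<bar>A v + \<Delta> * c\<bar> + \<bar>A v\<bar>" by (simp add: abs_mult[symmetric])
    ultimately have "\<bar>\<Delta>\<bar> * (\<bar>c\<bar> / 2) \<le> (K + \<bar>c\<bar> / 2) * norm v" using R K(2)[of v] by (simp add: algebra_simps)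
    then have "\<bar>\<Delta>\<bar> \<le> ((K + \<bar>c\<bar> / 2) * norm v) / (\<bar>c\<bar> / 2)" using c by (subst pos_le_divide_eq) auto
    then have "\<bar>\<Delta>\<bar> \<le> C * norm v" by (simp only: C_def times_divide_eq_left)
    then have "r * (norm v + \<bar>\<Delta>\<bar>) \<le> r * ((1 + C) * norm v)" using r by (intro mult_left_mono) (auto simp: algebra_simps)
    also have "\<dots> \<le> (e * \<bar>c\<bar> / (1 + C)) * ((1 + C) * norm v)" using C by (intro mult_right_mono) (auto simp: r_def)
    also have "\<dots> = e * \<bar>c\<bar> * norm v" using C by simp
    finally have R': "\<bar>A v + \<Delta> * c\<bar> \<le> e * \<bar>c\<bar> * norm v" using R by linarith
    have "a y - a x - - A (y - x) / c = (A v + \<Delta> * c) / c" using c by (simp add: v_def \<Delta>_def field_simps)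
    then have "norm (a y - a x - - A (y - x) / c) = \<bar>A v + \<Delta> * c\<bar> / \<bar>c\<bar>" by simp
    also have "\<dots> \<le> e * norm v" using R' c by (simp add: divide_le_eq mult_ac)
    finally show "norm (a y - a x - - A (y - x) / c) \<le> e * norm (y - x)" by (simp add: v_def)
  qed (use d1 d2 in auto)
qed

text \<open>The derivative of \<open>d\<close> is a quotient of derivatives of \<psi> taken at
  \<open>(x, d p x)\<close>. Order \<open>k\<close> for \<open>d\<close> therefore yields order
  \<open>k\<close> for its derivative, that is, order \<open>k + 1\<close> for
  \<open>d\<close>.\<close>

theorem implicit_Ck:
  fixes \<psi> :: "'p \<Rightarrow> 'a::euclidean_space \<times> real \<Rightarrow> real" and d :: "'p \<Rightarrow> 'a \<Rightarrow> real"
  assumes \<psi>: "Ck k T (S \<times> UNIV) \<psi>" and d: "Ck 0 T S d"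
    and z: "\<And>p x. p \<in> topspace T \<Longrightarrow> x \<in> S \<Longrightarrow> \<psi> p (x, d p x) = 0"
    and c: "\<And>p x. p \<in> topspace T \<Longrightarrow> x \<in> S \<Longrightarrow> ((\<lambda>a. \<psi> p (x, a)) has_real_derivative c p x) (at (d p x))"
    and nz: "\<And>p x. p \<in> topspace T \<Longrightarrow> x \<in> S \<Longrightarrow> c p x \<noteq> 0"
  shows "Ck k T S d" using \<psi>
proof (induction k)
  case 0 show ?case by (rule d)
next
  case (Suc k)
  have dk: "Ck k T S d" by (rule Suc.IH[OF Ck_mono_aux[OF Suc.prems]])
  from Suc.prems obtain D where D: "\<And>p w. p \<in> topspace T \<Longrightarrow> w \<in> S \<times> UNIV \<Longrightarrow>
      (\<psi> p has_derivative lc (\<lambda>b. D b p w)) (at w within S \<times> UNIV)"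
    and D': "\<And>b. b \<in> Basis \<Longrightarrow> Ck k T (S \<times> UNIV) (D b)" by (rule Ck_SucE) blast
  have Deq: "D (0, 1) p (x, d p x) = c p x" if px: "p \<in> topspace T" "x \<in> S" for p x
  proof -
    have 1: "((\<lambda>a. (x, a)) has_derivative (\<lambda>h. (0, h))) (at (d p x))" by (auto intro!: derivative_eq_intros)
    have "(\<psi> p has_derivative lc (\<lambda>b. D b p (x, d p x))) (at (x, d p x) within range (Pair x))"
      by (rule has_derivative_subset[OF D[OF px(1)]]) (use px in auto)
    from has_derivative_in_compose[OF 1 this]
    have "((\<lambda>a. \<psi> p (x, a)) has_derivative (\<lambda>h. \<Sum>b\<in>Basis. ((0, h) \<bullet> b) *\<^sub>R D b p (x, d p x))) (at (d p x))" .
    then have "((\<lambda>a. \<psi> p (x, a)) has_real_derivative D (0, 1) p (x, d p x)) (at (d p x))"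
      by (simp add: has_field_derivative_def sum_Basis_prod mult_commute_abs)
    with c[OF px] show ?thesis using DERIV_unique by blast
  qed
  have pair: "Ck k T S (\<lambda>p x. (x, d p x))" by (intro Ck_Pair Ck_id dk)
  show ?case
  proof (rule Ck_SucI[where D = "\<lambda>b p x. - D (b, 0) p (x, d p x) / D (0, 1) p (x, d p x)"])
    show "Ck 0 T S d" by (rule d)
    fix p x assume px: "p \<in> topspace T" "x \<in> S"
    define A where "A v = (lc (\<lambda>i. D (i, 0) p (x, d p x)) v)" for v
    have "(d p has_derivative (\<lambda>v. - A v / D (0, 1) p (x, d p x))) (at x within S)"
    proof (rule implicit_has_derivative[where \<psi> = "\<psi> p"])
      have "(lc (\<lambda>b. D b p (x, d p x)) v) = A (fst v) + snd v * D (0, 1) p (x, d p x)" for v unfolding A_def sum_Basis_Pair0 by simp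
      then show "(\<psi> p has_derivative (\<lambda>v. A (fst v) + snd v * D (0, 1) p (x, d p x))) (at (x, d p x) within S \<times> UNIV)"
        using D[OF px(1), of "(x, d p x)"] px by simp
      show "bounded_linear A" unfolding A_def by (intro bounded_linear_sum bounded_linear_scaleR_const bounded_linear_inner_left)
      show "D (0, 1) p (x, d p x) \<noteq> 0" using Deq nz px by simp
      have "continuous_map (top_of_set S) (prod_topology T (top_of_set S)) (\<lambda>x. (p, x))"
        using px by (simp add: continuous_map_paired continuous_map_const)
      from continuous_map_compose[OF this d[unfolded Ck.simps]] have "continuous_on S (d p)" by (simp add: o_def)
      then show "continuous (at x within S) (d p)" using px by (simp add: continuous_on_eq_continuous_within)
    qed (use z px in auto)
    moreover have "- A v / D (0, 1) p (x, d p x) = (lc (\<lambda>b. (- D (b, 0) p (x, d p x) / D (0, 1) p (x, d p x))) v)" for v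
      by (simp add: A_def sum_divide_distrib sum_negf)
    ultimately show "(d p has_derivative (lc (\<lambda>b. (- D (b, 0) p (x, d p x) / D (0, 1) p (x, d p x))))) (at x within S)" by simp
  next
    fix b :: 'a assume b: "b \<in> Basis"
    show "Ck k T S (\<lambda>p x. - D (b, 0) p (x, d p x) / D (0, 1) p (x, d p x))"
    proof (intro Ck_divide Ck_minus)
      show "Ck k T S (\<lambda>p x. D (b, 0) p (x, d p x))" "Ck k T S (\<lambda>p x. D (0, 1) p (x, d p x))"
        by (rule Ck_compose[OF D' pair]; use b in \<open>simp add: Basis_prod_def\<close>)+
      show "D (0, 1) p (x, d p x) \<noteq> 0" if "p \<in> topspace T" "x \<in> S" for p x using Deq nz that by simp
    qed
  qed
qed

text \<open>Extended by Tietze, \<open>h\<close> is the axis of a tube in which \<psi> strictly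
  decreases in the last variable and has opposite signs at the two ends. The zero in between is
  unique, continuous and then smooth. This is how functions on a closed annulus acquire smooth
  extensions across its boundary circles.\<close>

theorem implicit_extension:
  fixes \<psi> :: "'a::euclidean_space \<times> real \<Rightarrow> real" and h :: "'a \<Rightarrow> real"
  assumes K: "compact K" "K \<noteq> {}" and V: "open V" "K \<subseteq> V" and \<psi>: "\<And>k. Cn k (V \<times> UNIV) \<psi>"
    and h: "continuous_on K h" and z: "\<And>x. x \<in> K \<Longrightarrow> \<psi> (x, h x) = 0"
    and d: "\<And>x a. x \<in> V \<Longrightarrow> ((\<lambda>a. \<psi> (x, a)) has_real_derivative c (x, a)) (at a)"
    and cc: "continuous_on (V \<times> UNIV) c" and neg: "\<And>x. x \<in> K \<Longrightarrow> c (x, h x) < 0"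
  shows "\<exists>W j. open W \<and> K \<subseteq> W \<and> W \<subseteq> V \<and> (\<forall>k. Cn k W j) \<and> (\<forall>x\<in>K. j x = h x) \<and> (\<forall>x\<in>W. \<psi> (x, j x) = 0)"
proof -
  obtain h0 where h0: "continuous_on UNIV h0" "\<And>x. x \<in> K \<Longrightarrow> h0 x = h x"
    using Tietze_unbounded[OF h, of UNIV] K by (auto simp: compact_imp_closed)
  have \<psi>c: "continuous_on (V \<times> UNIV) \<psi>" by (rule Cn_continuous_on[OF \<psi>])
  define N where "N = {w \<in> V \<times> UNIV. c w < 0}"
  have N: "open N"
  proof -
    have "N = (V \<times> UNIV) \<inter> c -` {..<0}" by (auto simp: N_def)
    then show ?thesis using continuous_open_preimage[OF cc] V by (simp add: open_Times)
  qed
  have "compact ((\<lambda>x. (x, h x)) ` K)" using K h by (intro compact_continuous_image continuous_intros)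
  moreover have "(\<lambda>x. (x, h x)) ` K \<subseteq> N" using V neg by (auto simp: N_def)
  ultimately obtain e where e: "e > 0" "(\<Union>w\<in>(\<lambda>x. (x, h x)) ` K. ball w e) \<subseteq> N"
    using compact_subset_open_imp_ball_epsilon_subset N by metis
  \<comment> \<open>Three errors of at most \<open>g\<close> are added in \<open>inN\<close>: moving
    the base point, the variation of \<open>h0\<close>, and the distance of \<open>a\<close> from
    \<open>h0 x\<close>.\<close>
  define g where "g = e / 4"
  have g: "g > 0" using e by (simp add: g_def)
  define W1 where "W1 = V \<inter> (\<Union>y\<in>K. {x. dist x y < g \<and> \<bar>h0 x - h0 y\<bar> < g})"
  have W1: "open W1" unfolding W1_def by (intro open_Int V open_UN ballI open_Collect_conj open_Collect_less continuous_intros h0)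
  have inN: "(x, a) \<in> N" if x: "x \<in> W1" and a: "\<bar>a - h0 x\<bar> \<le> g" for x a
  proof -
    obtain y where y: "y \<in> K" "dist x y < g" "\<bar>h0 x - h0 y\<bar> < g" using x by (auto simp: W1_def)
    have "dist (y, h y) (x, a) \<le> dist y x + dist (h y) a" unfolding dist_norm using norm_Pair_le[of "y - x" "h y - a"] by simp
    also have "dist (h y) a \<le> \<bar>h0 x - h0 y\<bar> + \<bar>a - h0 x\<bar>" unfolding dist_real_def h0(2)[OF y(1)] by linarith
    also have "dist y x + (\<bar>h0 x - h0 y\<bar> + \<bar>a - h0 x\<bar>) < e" using y(2,3) a g unfolding dist_commute[of y x] g_def by linarith
    finally have "(x, a) \<in> ball (y, h y) e" by simp
    then show ?thesis using e(2) y(1) by blast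
  qed
  have dec: "\<psi> (x, b) < \<psi> (x, a)" if x: "x \<in> W1" and ab: "a < b" "h0 x - g \<le> a" "b \<le> h0 x + g" for x a b
  proof (rule DERIV_neg_imp_decreasing[OF ab(1)])
    fix t assume "a \<le> t" "t \<le> b"
    then have "(x, t) \<in> N" using ab by (intro inN[OF x]) auto
    then show "\<exists>y. ((\<lambda>t. \<psi> (x, t)) has_real_derivative y) (at t) \<and> y < 0" using d[of x t] by (auto simp: N_def)
  qed
  have sh: "continuous_on A (\<lambda>x. \<psi> (x, h0 x + s))" if "A \<subseteq> V" for s A
    by (intro continuous_on_compose2[OF \<psi>c] continuous_on_Pair continuous_intros continuous_on_subset[OF h0(1)]) (use that in auto)
  define W where "W = {x \<in> W1. \<psi> (x, h0 x + - g) > 0} \<inter> {x \<in> W1. \<psi> (x, h0 x + g) < 0}"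
  have W1V: "W1 \<subseteq> V" by (auto simp: W1_def)
  have W: "open W"
  proof -
    have eq: "W = (W1 \<inter> (\<lambda>x. \<psi> (x, h0 x + - g)) -` {0<..}) \<inter> (W1 \<inter> (\<lambda>x. \<psi> (x, h0 x + g)) -` {..<0})"
      by (auto simp: W_def)
    show ?thesis unfolding eq
      by (intro open_Int continuous_open_preimage[OF sh[OF W1V] W1 open_greaterThan] continuous_open_preimage[OF sh[OF W1V] W1 open_lessThan])
  qed
  have KW: "K \<subseteq> W"
  proof
    fix x assume x: "x \<in> K"
    then have x1: "x \<in> W1" using V g by (auto simp: W1_def intro!: bexI[of _ x])
    show "x \<in> W" using dec[OF x1, of "h0 x - g" "h0 x"] dec[OF x1, of "h0 x" "h0 x + g"] z[OF x] h0(2)[OF x] g x1 by (simp add: W_def)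
  qed
  have ex: "\<exists>a. \<bar>a - h0 x\<bar> < g \<and> \<psi> (x, a) = 0" if x: "x \<in> W" for x
  proof -
    have x1: "x \<in> V" using x W1V by (auto simp: W_def)
    have "continuous_on {h0 x - g..h0 x + g} (\<lambda>a. \<psi> (x, a))" by (intro continuous_on_compose2[OF \<psi>c] continuous_intros) (use x1 in auto)
    then obtain a where a: "h0 x - g \<le> a" "a \<le> h0 x + g" "\<psi> (x, a) = 0"
      using IVT2'[of "\<lambda>a. \<psi> (x, a)" "h0 x + g" 0 "h0 x - g"] x g by (auto simp: W_def)
    moreover have "a \<noteq> h0 x - g" "a \<noteq> h0 x + g" using x a(3) by (auto simp: W_def)
    ultimately show ?thesis by (intro exI[of _ a]) auto
  qed
  then obtain j where j: "\<And>x. x \<in> W \<Longrightarrow> \<bar>j x - h0 x\<bar> < g" "\<And>x. x \<in> W \<Longrightarrow> \<psi> (x, j x) = 0" by metis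
  have uniq: "a = j x" if x: "x \<in> W" and a: "\<bar>a - h0 x\<bar> \<le> g" "\<psi> (x, a) = 0" for x a
  proof -
    have "x \<in> W1" using x by (auto simp: W_def)
    then show ?thesis using dec[of x a "j x"] dec[of x "j x" a] j[OF x] a by (cases a "j x" rule: linorder_cases) (auto simp: abs_le_iff abs_less_iff)
  qed
  have "continuous_on W j" unfolding continuous_on_eq_continuous_at[OF W] continuous_at_eps_delta
  proof (intro ballI allI impI)
    fix x and r :: real assume x: "x \<in> W" and r: "r > 0"
    define r' where "r' = min (r / 2) (min ((h0 x + g - j x) / 2) ((j x - (h0 x - g)) / 2))"
    have pq: "h0 x + g - j x > 0" "j x - (h0 x - g) > 0" using j(1)[OF x] by (auto simp: abs_less_iff)
    then have "r' > 0" using r by (auto simp: r'_def)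
    moreover have "r' \<le> r / 2" "r' \<le> (h0 x + g - j x) / 2" "r' \<le> (j x - (h0 x - g)) / 2"
      unfolding r'_def by (rule order_refl min.cobounded1 min.coboundedI2)+
    ultimately have rr: "r' > 0" "r' \<le> r / 2" "2 * r' \<le> h0 x + g - j x" "2 * r' \<le> j x - (h0 x - g)" by simp_all
    then have r': "r' > 0" "r' < r" "j x + r' < h0 x + g" "h0 x - g < j x - r'" using r by linarith+
    have x1: "x \<in> W1" using x by (auto simp: W_def)
    have sg: "\<psi> (x, j x - r') > 0" "\<psi> (x, j x + r') < 0" using dec[OF x1, of "j x - r'" "j x"] dec[OF x1, of "j x" "j x + r'"] j(2)[OF x] r' by auto
    let ?Q = "W \<inter> ((\<lambda>y. \<psi> (y, j x - r')) -` {0<..}) \<inter> (W \<inter> ((\<lambda>y. \<psi> (y, j x + r')) -` {..<0}))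
       \<inter> (h0 -` {j x + r' - g<..} \<inter> h0 -` {..<j x - r' + g})"
    have cf: "continuous_on W (\<lambda>y. \<psi> (y, a))" for a by (intro continuous_on_compose2[OF \<psi>c] continuous_intros) (use W1V in "auto simp: W_def")
    have "open ?Q" by (intro open_Int continuous_open_preimage[OF cf W] continuous_open_vimage h0 open_greaterThan open_lessThan)
        (use h0(1) in "auto simp: continuous_on_eq_continuous_at")
    moreover have "x \<in> ?Q" using x sg r' by auto
    ultimately obtain s where s: "s > 0" "ball x s \<subseteq> ?Q" using openE by blast
    have "dist (j y) (j x) < r" if y: "dist y x < s" for y
    proof -
      have yQ: "y \<in> ?Q" using s y by (auto simp: dist_commute)
      then have yW: "y \<in> W" by blast
      have "continuous_on {j x - r'..j x + r'} (\<lambda>a. \<psi> (y, a))"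
        by (intro continuous_on_compose2[OF \<psi>c] continuous_intros) (use yW W1V in "auto simp: W_def")
      then obtain a where a: "j x - r' \<le> a" "a \<le> j x + r'" "\<psi> (y, a) = 0"
        using IVT2'[of "\<lambda>a. \<psi> (y, a)" "j x + r'" 0 "j x - r'"] yQ r'(1) by auto
      have "a = j y" by (rule uniq[OF yW _ a(3)]) (use a yQ in "auto simp: abs_le_iff")
      then show ?thesis using a r' by (simp add: dist_real_def abs_less_iff)
    qed
    then show "\<exists>s>0. \<forall>y. dist y x < s \<longrightarrow> dist (j y) (j x) < r" using s(1) by blast
  qed
  then have jc: "Cn 0 W j" by (simp add: Cn_0_iff)
  have "Cn k W j" for k
  proof (rule implicit_Ck[where \<psi> = "\<lambda>_. \<psi>" and c = "\<lambda>_ x. c (x, j x)", OF _ jc])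
    show "Cn k (W \<times> UNIV) \<psi>" by (rule Ck_subset[OF \<psi>]) (use W1V in "auto simp: W_def")
    fix x assume x: "x \<in> W"
    then have x1: "x \<in> W1" by (auto simp: W_def)
    show "\<psi> (x, j x) = 0" by (rule j(2)[OF x])
    show "((\<lambda>a. \<psi> (x, a)) has_real_derivative c (x, j x)) (at (j x))" using x1 W1V by (intro d) auto
    show "c (x, j x) \<noteq> 0" using inN[OF x1, of "j x"] j(1)[OF x] by (auto simp: N_def)
  qed
  moreover have "j x = h x" if x: "x \<in> K" for x using uniq[of x "h x"] KW x z[OF x] h0(2)[OF x] g by auto
  moreover have "W \<subseteq> V" using W1V by (auto simp: W_def)
  ultimately show ?thesis using W KW j(2) by blast
qed

section \<open>Periods of the orbits\<close>

definition cx :: "real^2 \<Rightarrow> complex" where "cx v = Complex (v $ 1) (v $ 2)"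

lemma bounded_linear_cx: "bounded_linear cx"
proof -
  have "linear cx" by (rule linearI) (auto simp: cx_def complex_eq_iff)
  then show ?thesis by (simp add: linear_conv_bounded_linear)
qed

lemmas has_vector_derivative_cx = bounded_linear.has_vector_derivative[OF bounded_linear_cx]
  and continuous_on_cx = bounded_linear.continuous_on[OF bounded_linear_cx]

lemma norm_cx [simp]: "norm (cx v) = norm v" by (simp add: cx_def complex_norm norm_vec_def L2_set_def sum_2)

lemma cx_eq_iff [simp]: "cx v = cx w \<longleftrightarrow> v = w" by (simp add: cx_def vec_eq_iff forall_2)

lemma cx_0 [simp]: "cx 0 = 0" "cx v = 0 \<longleftrightarrow> v = 0" by (simp_all add: cx_def complex_eq_iff vec_eq_iff forall_2)

text \<open>Orthogonal vectors have a purely imaginary quotient. Applied on the boundary circle,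
  this says that the angular velocity does not vanish.\<close>

lemma Im_cx_divide: "v \<noteq> 0 \<Longrightarrow> v \<bullet> w = 0 \<Longrightarrow> w \<noteq> 0 \<Longrightarrow> Im (cx w / cx v) \<noteq> 0"
proof
  assume v: "v \<noteq> 0" and vw: "v \<bullet> w = 0" and w: "w \<noteq> 0" and I: "Im (cx w / cx v) = 0"
  have "Re (cx w / cx v) = 0" using vw by (simp add: cx_def Re_divide inner_vec_def sum_2 mult.commute)
  with I have "cx w / cx v = 0" by (simp add: complex_eq_iff)
  with v w show False by simp
qed

text \<open>\<Phi> is the flow of a globally Lipschitz extension \<open>G\<close> of
  \<open>F\<close>, hence defined on the whole plane and for all times; on the disk its curves turn
  out to be the integral curves of \<open>F\<close>.\<close>

locale tc_flow =
  fixes F G :: "real^2 \<Rightarrow> real^2" and \<Phi> :: "(real^2) \<times> real \<Rightarrow> real^2" and L :: real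
  assumes TC: "TC_vector_field F"
    and GC: "\<And>k. Cn k UNIV G" and GF: "\<And>x. x \<in> disk \<Longrightarrow> G x = F x"
    and L: "L \<ge> 0" and lip: "\<And>x y. norm (G x - G y) \<le> L * norm (x - y)"
    and \<Phi>C: "\<And>k. Cn k UNIV \<Phi>" and \<Phi>0 [simp]: "\<And>x. \<Phi> (x, 0) = x"
    and \<Phi>d: "\<And>x t. ((\<lambda>t. \<Phi> (x, t)) has_vector_derivative G (\<Phi> (x, t))) (at t)"

lemma tc_flow_exists:
  assumes "TC_vector_field F"
  shows "\<exists>G \<Phi> L. tc_flow F G \<Phi> L"
proof -
  have "smooth_on disk F" using assms by (simp add: TC_vector_field_def)
  from compactly_supported_extension[OF this] obtain G L where G: "\<And>k. Cn k UNIV G" "\<And>x. x \<in> disk \<Longrightarrow> G x = F x"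
    "L \<ge> 0" "\<And>x y. norm (G x - G y) \<le> L * norm (x - y)" by metis
  from flow_exists[OF G(1,4,3)] obtain \<Phi> where "\<forall>k. Cn k UNIV \<Phi>" "\<forall>x. \<Phi> (x, 0) = x"
    "\<forall>x t. ((\<lambda>t. \<Phi> (x, t)) has_vector_derivative G (\<Phi> (x, t))) (at t)" by (elim exE conjE)
  with G assms show ?thesis by (intro exI[of _ G] exI[of _ \<Phi>] exI[of _ L]) (simp add: tc_flow_def)
qed

abbreviation pdisk :: "(real^2) set" where "pdisk \<equiv> disk - {0}"

context tc_flow
begin

lemma G_cont: "continuous_on A G" using Cn_continuous_on[OF GC] continuous_on_subset by blast

lemma \<Phi>_cont: "continuous_on A \<Phi>" using Cn_continuous_on[OF \<Phi>C] continuous_on_subset by blast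

lemma flow_unique:
  assumes "\<And>t. (u has_vector_derivative G (u t)) (at t)" shows "u t = \<Phi> (u 0, t)"
  by (rule ode_unique[where u = u and v = "\<lambda>t. \<Phi> (u 0, t)", OF lip L G_cont assms \<Phi>d]) simp

lemma \<Phi>_add: "\<Phi> (\<Phi> (x, s), t) = \<Phi> (x, s + t)"
proof -
  have "((\<lambda>t. \<Phi> (x, s + t)) has_vector_derivative G (\<Phi> (x, s + t))) (at t)" for t
  proof -
    have "((\<lambda>t. s + t) has_vector_derivative 1) (at t)" by (auto intro!: derivative_eq_intros)
    from vector_diff_chain_at[OF this \<Phi>d] show ?thesis by (simp add: o_def)
  qed
  from flow_unique[OF this] show ?thesis by simp
qed

lemma integral_curve_\<Phi>:
  assumes "integral_curve F \<gamma>" shows "\<gamma> t = \<Phi> (\<gamma> 0, t)" by (rule flow_unique) (use assms in "simp add: integral_curve_def GF")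

text \<open>Without an integral curve the orbit would be empty; but an orbit other than
  \<open>{0}\<close> is the range of a periodic curve.\<close>

lemma integral_curve_through:
  assumes x: "x \<in> disk" shows "\<exists>\<gamma>. integral_curve F \<gamma> \<and> \<gamma> 0 = x"
proof (rule ccontr)
  assume "\<not> ?thesis"
  then have "orbit_of F x = {}" by (auto simp: orbit_of_def)
  moreover have "orbit_of F x \<in> orbits F" using x by (simp add: orbits_def)
  ultimately have "closed_orbit F {}" using TC by (auto simp: TC_vector_field_def)
  then show False by (auto simp: closed_orbit_def)
qed

lemma integral_curve_\<Phi>_disk:
  assumes x: "x \<in> disk" shows "integral_curve F (\<lambda>t. \<Phi> (x, t))"
proof -
  obtain g where g: "integral_curve F g" "g 0 = x" using integral_curve_through[OF x] by blast
  then have "g = (\<lambda>t. \<Phi> (x, t))" using integral_curve_\<Phi>[OF g(1)] by metis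
  with g show ?thesis by simp
qed

lemma \<Phi>_disk: "x \<in> disk \<Longrightarrow> \<Phi> (x, t) \<in> disk" using integral_curve_\<Phi>_disk[of x] by (simp add: integral_curve_def)

lemma orbit_of_eq: "x \<in> disk \<Longrightarrow> orbit_of F x = range (\<lambda>t. \<Phi> (x, t))"
proof (intro equalityI subsetI)
  fix y assume "x \<in> disk" "y \<in> orbit_of F x"
  then obtain g t where "integral_curve F g" "g 0 = x" "y = g t" by (auto simp: orbit_of_def)
  then show "y \<in> range (\<lambda>t. \<Phi> (x, t))" using integral_curve_\<Phi>[of g t] by auto
next
  fix y assume "x \<in> disk" "y \<in> range (\<lambda>t. \<Phi> (x, t))"
  then show "y \<in> orbit_of F x" using integral_curve_\<Phi>_disk[of x] by (auto simp: orbit_of_def intro!: exI[of _ "\<lambda>t. \<Phi> (x, t)"])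
qed

lemma G_nz: "x \<in> pdisk \<Longrightarrow> G x \<noteq> 0" using TC GF by (auto simp: TC_vector_field_def)

lemma G_0: "G 0 = 0"
proof -
  have "F 0 = 0" using TC unfolding TC_vector_field_def by (metis centre_in_cball zero_le_one)
  then show ?thesis using GF[of 0] by simp
qed

lemma \<Phi>_zero [simp]: "\<Phi> (0, t) = 0" using flow_unique[of "\<lambda>_. 0" t] by (simp add: G_0)

lemma \<Phi>_pdisk: "x \<in> pdisk \<Longrightarrow> \<Phi> (x, t) \<in> pdisk" using \<Phi>_disk \<Phi>_add[of x t "-t"] \<Phi>_zero[of "-t"] by fastforce

lemma periodic_ex:
  assumes x: "x \<in> pdisk" shows "\<exists>T>0. \<Phi> (x, T) = x"
proof -
  have "x \<in> orbit_of F x" using x by (subst orbit_of_eq) (auto intro: range_eqI[of _ _ 0])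
  moreover have "orbit_of F x \<in> orbits F" using x by (simp add: orbits_def)
  ultimately have "closed_orbit F (orbit_of F x)" using TC x by (auto simp: TC_vector_field_def)
  then obtain g T where g: "integral_curve F g" "T > 0" "\<And>t. g (t + T) = g t" "orbit_of F x = range g" by (auto simp: closed_orbit_def)
  then obtain s where s: "x = g s" using \<open>x \<in> orbit_of F x\<close> by auto
  have "\<Phi> (g s, T) = g (s + T)" using integral_curve_\<Phi>[OF g(1)] \<Phi>_add by metis
  then show ?thesis using g s by auto
qed

lemma transverse_nbhd:
  assumes x0: "x0 \<in> pdisk"
  shows "\<exists>c>0. \<forall>x t. dist x x0 < c \<longrightarrow> \<bar>t\<bar> < c \<longrightarrow> G (\<Phi> (x, t)) \<bullet> G x0 > 0"
proof -
  let ?f = "\<lambda>w. G (\<Phi> w) \<bullet> G x0"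
  have "continuous_on UNIV ?f" by (intro continuous_intros continuous_on_compose2[OF G_cont \<Phi>_cont]) auto
  then have "isCont ?f (x0, 0)" by (simp add: continuous_on_eq_continuous_at)
  moreover have pos: "?f (x0, 0) > 0" using G_nz[OF x0] by simp
  ultimately obtain d where d: "d > 0" "\<And>w. dist w (x0, 0) < d \<Longrightarrow> dist (?f w) (?f (x0, 0)) < ?f (x0, 0)"
    unfolding continuous_at_eps_delta by metis
  have "?f (x, t) > 0" if "dist x x0 < d / 2" "\<bar>t\<bar> < d / 2" for x t
  proof -
    have "dist (x, t) (x0, 0) \<le> dist x x0 + \<bar>t\<bar>" unfolding dist_norm using norm_Pair_le[of "x - x0" t] by simp
    then show ?thesis using d(2)[of "(x, t)"] that by (simp add: dist_real_def abs_less_iff)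
  qed
  then show ?thesis using d(1) by (intro exI[of _ "d / 2"]) auto
qed

lemma \<Phi>_inner_deriv: "((\<lambda>t. (\<Phi> (x, t) - z) \<bullet> v) has_real_derivative G (\<Phi> (x, t)) \<bullet> v) (at t)"
proof -
  have "((\<lambda>t. \<Phi> (x, t) - z) has_vector_derivative G (\<Phi> (x, t))) (at t)"
    using has_vector_derivative_diff[OF \<Phi>d has_vector_derivative_const] by simp
  from bounded_linear.has_vector_derivative[OF bounded_linear_inner_left this]
  show ?thesis by (simp add: has_real_derivative_iff_has_vector_derivative)
qed

text \<open>For short times the component along \<open>G x0\<close> strictly increases, uniformly
  for starting points near \<open>x0\<close>.\<close>

lemma no_short_period:
  assumes x0: "x0 \<in> pdisk"
  shows "\<exists>c>0. \<forall>x t. dist x x0 < c \<longrightarrow> 0 < t \<longrightarrow> t < c \<longrightarrow> \<Phi> (x, t) \<noteq> x"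
proof -
  obtain c where c: "c > 0" "\<And>x t. dist x x0 < c \<Longrightarrow> \<bar>t\<bar> < c \<Longrightarrow> G (\<Phi> (x, t)) \<bullet> G x0 > 0"
    using transverse_nbhd[OF x0] by blast
  have "\<Phi> (x, t) \<noteq> x" if x: "dist x x0 < c" and t: "0 < t" "t < c" for x t
  proof -
    have "(\<Phi> (x, 0) - 0) \<bullet> G x0 < (\<Phi> (x, t) - 0) \<bullet> G x0"
    proof (rule DERIV_pos_imp_increasing[OF t(1)])
      fix s assume "0 \<le> s" "s \<le> t"
      then show "\<exists>y. ((\<lambda>t. (\<Phi> (x, t) - 0) \<bullet> G x0) has_real_derivative y) (at s) \<and> 0 < y"
        using \<Phi>_inner_deriv[of x 0 "G x0" s] c(2)[OF x, of s] t by (intro exI[of _ "G (\<Phi> (x, s)) \<bullet> G x0"]) simp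
    qed
    then show ?thesis by auto
  qed
  then show ?thesis using c(1) by blast
qed

definition per :: "real^2 \<Rightarrow> real" where "per x = Inf {T. T > 0 \<and> \<Phi> (x, T) = x}"

lemma \<Phi>t_cont: "continuous_on A (\<lambda>t. \<Phi> (x, t))" by (intro continuous_on_compose2[OF \<Phi>_cont] continuous_intros) auto

text \<open>The positive return times form a closed set that stays away from \<open>0\<close> by
  \<open>no_short_period\<close>, so the infimum is attained.\<close>

lemma per:
  assumes x: "x \<in> pdisk"
  shows per_pos: "per x > 0" and \<Phi>_per: "\<Phi> (x, per x) = x" and per_min: "\<And>T. T > 0 \<Longrightarrow> \<Phi> (x, T) = x \<Longrightarrow> per x \<le> T"
proof -
  obtain c where c: "c > 0" "\<And>t. 0 < t \<Longrightarrow> t < c \<Longrightarrow> \<Phi> (x, t) \<noteq> x" using no_short_period[OF x] by auto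
  let ?S = "{T. T > 0 \<and> \<Phi> (x, T) = x}"
  have S: "?S = {c..} \<inter> (\<lambda>t. \<Phi> (x, t)) -` {x}" using c by force
  have "closed ?S" unfolding S by (intro continuous_closed_preimage \<Phi>t_cont) auto
  moreover have ne: "?S \<noteq> {}" using periodic_ex[OF x] by auto
  moreover have bdd: "bdd_below ?S" by (rule bdd_belowI[of _ 0]) auto
  ultimately have "per x \<in> ?S" unfolding per_def by (intro closed_contains_Inf)
  then show "per x > 0" "\<Phi> (x, per x) = x" by auto
  show "per x \<le> T" if "T > 0" "\<Phi> (x, T) = x" for T unfolding per_def using that bdd by (intro cInf_lower) auto
qed

lemma \<Phi>_multiple_period:
  assumes "\<Phi> (x, T) = x" shows "\<Phi> (x, of_int k * T) = x"
proof -
  have nat: "\<Phi> (x, of_nat n * T) = x" for n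
  proof (induction n)
    case (Suc n)
    have "\<Phi> (x, of_nat (Suc n) * T) = \<Phi> (\<Phi> (x, of_nat n * T), T)" by (simp add: \<Phi>_add algebra_simps)
    then show ?case using Suc assms by simp
  qed simp
  show ?thesis
  proof (cases "k \<ge> 0")
    case True then show ?thesis using nat[of "nat k"] by simp
  next
    case False
    have "x = \<Phi> (\<Phi> (x, of_nat (nat (- k)) * T), - (of_nat (nat (- k)) * T))" by (simp add: \<Phi>_add)
    then show ?thesis using nat[of "nat (- k)"] False by simp
  qed
qed

lemma \<Phi>_mod_per:
  assumes x: "x \<in> pdisk" shows "\<exists>s\<in>{0..per x}. \<Phi> (x, s) = \<Phi> (x, t)"
proof -
  define k where "k = \<lfloor>t / per x\<rfloor>"
  have P: "per x > 0" by (rule per_pos[OF x])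
  have "of_int k \<le> t / per x" "t / per x < of_int k + 1" unfolding k_def by linarith+
  then have "t - of_int k * per x \<in> {0..per x}" using P by (auto simp: field_simps)
  moreover have "\<Phi> (x, t - of_int k * per x) = \<Phi> (\<Phi> (x, of_int (- k) * per x), t)" by (simp add: \<Phi>_add)
  then have "\<Phi> (x, t - of_int k * per x) = \<Phi> (x, t)" using \<Phi>_multiple_period[OF \<Phi>_per[OF x], of "- k"] by simp
  ultimately show ?thesis by blast
qed

lemma \<Phi>_eq_iff:
  assumes x: "x \<in> pdisk" shows "\<Phi> (x, t) = x \<longleftrightarrow> (\<exists>k::int. t = of_int k * per x)"
proof
  assume t: "\<Phi> (x, t) = x"
  define k where "k = \<lfloor>t / per x\<rfloor>"
  define s where "s = t - of_int k * per x"
  have P: "per x > 0" by (rule per_pos[OF x])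
  have "of_int k \<le> t / per x" "t / per x < of_int k + 1" unfolding k_def by linarith+
  then have s: "0 \<le> s" "s < per x" unfolding s_def using P by (auto simp: field_simps)
  have "\<Phi> (\<Phi> (x, t), of_int (- k) * per x) = x" using t \<Phi>_multiple_period[OF \<Phi>_per[OF x], of "- k"] by simp
  then have "\<Phi> (x, s) = x" by (simp add: \<Phi>_add s_def)
  then have "s = 0" using per_min[OF x, of s] s by fastforce
  then show "\<exists>k::int. t = of_int k * per x" by (auto simp: s_def)
qed (use \<Phi>_multiple_period[OF \<Phi>_per[OF x]] in auto)

text \<open>The time at which orbits cross the line through \<open>x0\<close> orthogonal to
  \<open>G x0\<close>, continued from the value \<open>T0\<close> at \<open>x0\<close>. Used with
  the period it gives a return map, used with \<open>0\<close> a projection to the transversal along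
  the flow.\<close>

lemma hitting_time:
  assumes x0: "x0 \<in> pdisk" and T0: "\<Phi> (x0, T0) = x0"
  shows "\<exists>W b. open W \<and> x0 \<in> W \<and> (\<forall>k. Cn k W b) \<and> b x0 = T0 \<and> (\<forall>x\<in>W. (\<Phi> (x, b x) - x0) \<bullet> G x0 = 0)"
proof -
  \<comment> \<open>The sign makes \<open>q\<close> decrease in time near the crossing, as
    \<open>implicit_extension\<close> demands.\<close>
  define q where "q w = - ((\<Phi> w - x0) \<bullet> G x0)" for w
  have "\<exists>W b. open W \<and> {x0} \<subseteq> W \<and> W \<subseteq> UNIV \<and> (\<forall>k. Cn k W b) \<and> (\<forall>x\<in>{x0}. b x = T0) \<and> (\<forall>x\<in>W. q (x, b x) = 0)"
  proof (rule implicit_extension[where c = "\<lambda>w. - (G (\<Phi> w) \<bullet> G x0)"])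
    show "Cn k (UNIV \<times> UNIV) q" for k unfolding q_def UNIV_Times_UNIV by (intro Ck_minus Ck_inner Ck_diff \<Phi>C Ck_const')
    show "((\<lambda>a. q (x, a)) has_real_derivative - (G (\<Phi> (x, a)) \<bullet> G x0)) (at a)" for x a
      unfolding q_def by (intro DERIV_minus \<Phi>_inner_deriv)
    show "continuous_on (UNIV \<times> UNIV) (\<lambda>w. - (G (\<Phi> w) \<bullet> G x0))"
      by (intro continuous_intros continuous_on_compose2[OF G_cont \<Phi>_cont]) auto
  qed (use T0 G_nz[OF x0] in "auto simp: q_def")
  then show ?thesis by (auto simp: q_def)
qed

section \<open>The return map to a transversal and continuity of the period\<close>

definition perp :: "real^2 \<Rightarrow> real^2" where "perp v = vector [- v $ 2, v $ 1]"

lemma perp_simps: "perp v $ 1 = - v $ 2" "perp v $ 2 = v $ 1" by (simp_all add: perp_def)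

lemma perp_inner: "v \<bullet> perp v = 0" "perp v \<bullet> v = 0" "perp v \<bullet> perp v = v \<bullet> v" by (simp_all add: inner_vec_def sum_2 perp_simps)

lemma orthogonal_perp:
  assumes "y \<bullet> v = 0" "v \<noteq> 0" shows "y = (y \<bullet> perp v / (v \<bullet> v)) *\<^sub>R perp v"
proof -
  have n: "v $ 1 * v $ 1 + v $ 2 * v $ 2 \<noteq> 0" using assms(2) by (simp add: vec_eq_iff forall_2 sum_squares_eq_zero_iff)
  have e: "y $ 1 * v $ 1 + y $ 2 * v $ 2 = 0" using assms(1) by (simp add: inner_vec_def sum_2)
  have "y $ 1 * (v $ 1 * v $ 1 + v $ 2 * v $ 2) = (- y $ 1 * v $ 2 + y $ 2 * v $ 1) * (- v $ 2)"
    "y $ 2 * (v $ 1 * v $ 1 + v $ 2 * v $ 2) = (- y $ 1 * v $ 2 + y $ 2 * v $ 1) * v $ 1" using e by algebra+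
  then show ?thesis using n by (simp add: vec_eq_iff forall_2 perp_simps inner_vec_def sum_2 nonzero_eq_divide_eq)
qed

text \<open>With \<open>M t\<close> the derivative of the flow for time \<open>t\<close> at
  \<open>x0\<close>, the number \<open>q t\<close> is the determinant of the pair
  \<open>M t v\<close>, \<open>M t (perp v)\<close>. It never vanishes and is positive at
  \<open>t = 0\<close>, hence positive at \<open>T0\<close>; there \<open>M T0 v = v\<close>, which
  turns it into the asserted product.\<close>

lemma return_derivative_pos:
  assumes x0: "x0 \<in> pdisk" and T0: "\<Phi> (x0, T0) = x0"
    and D: "\<And>t. (\<Phi> has_derivative (\<lambda>v. (lc (\<lambda>i. D (i, 0) (x0, t)) (fst v)) + snd v *\<^sub>R D (0, 1) (x0, t))) (at (x0, t))"
    and Dc: "\<And>b. b \<in> Basis \<Longrightarrow> continuous_on UNIV (D b)"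
  shows "(lc (\<lambda>i. D (i, 0) (x0, T0)) (perp (G x0))) \<bullet> perp (G x0) > 0"
proof -
  define M where "M t v = (lc (\<lambda>i. D (i, 0) (x0, t)) v)" for t v
  define v where "v = G x0"
  have v: "v \<noteq> 0" using G_nz[OF x0] by (simp add: v_def)
  have Mlin: "linear (M t)" for t unfolding M_def
    by (intro linear_compose_sum ballI bounded_linear.linear bounded_linear_scaleR_const bounded_linear_inner_left)
  have Md: "((\<lambda>x. \<Phi> (x, t)) has_derivative M t) (at x0)" for t
  proof -
    have "((\<lambda>x. (x, t)) has_derivative (\<lambda>v. (v, 0))) (at x0)" by (auto intro!: derivative_eq_intros)
    from has_derivative_compose[OF this D] show ?thesis by (simp add: M_def[abs_def])
  qed
  \<comment> \<open>Flowing back for time \<open>- t\<close> provides a left inverse of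
    \<open>M t\<close>.\<close>
  have inj: "w = 0" if "M t w = 0" for t w
  proof -
    have "(\<lambda>x. \<Phi> (x, - t)) differentiable (at (\<Phi> (x0, t)))"
    proof -
      obtain E where "(\<Phi> has_derivative E) (at (\<Phi> (x0, t), - t))" using \<Phi>C[of "Suc 0", unfolded Cn_Suc_iff] by blast
      moreover have "((\<lambda>x. (x, - t)) has_derivative (\<lambda>v. (v, 0))) (at (\<Phi> (x0, t)))" by (auto intro!: derivative_eq_intros)
      ultimately show ?thesis using has_derivative_compose[of "\<lambda>x. (x, - t)" _ "\<Phi> (x0, t)" UNIV \<Phi>] unfolding differentiable_def by blast
    qed
    then obtain E where E: "((\<lambda>x. \<Phi> (x, - t)) has_derivative E) (at (\<Phi> (x0, t)))" by (auto simp: differentiable_def)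
    have "((\<lambda>x. x) has_derivative (\<lambda>w. E (M t w))) (at x0)" using has_derivative_compose[OF Md E] by (simp add: \<Phi>_add)
    then have "(\<lambda>w. E (M t w)) = (\<lambda>w. w)" using has_derivative_unique has_derivative_ident by blast
    moreover have "E 0 = 0" using E has_derivative_bounded_linear linear_0 bounded_linear.linear by blast
    ultimately show ?thesis using that by metis
  qed
  define q where "q t = M t (perp v) \<bullet> perp (M t v)" for t
  have q: "q t \<noteq> 0" for t
  proof
    assume "q t = 0"
    define a where "a = M t v"
    have a: "a \<noteq> 0" using inj v by (auto simp: a_def)
    define c where "c = (M t (perp v) \<bullet> a) / (a \<bullet> a)"
    have "(M t (perp v) - c *\<^sub>R a) \<bullet> a = 0" using a by (simp add: c_def inner_diff_left)
    from orthogonal_perp[OF this a] have "M t (perp v) - c *\<^sub>R a = 0" using \<open>q t = 0\<close> by (simp add: q_def a_def inner_diff_left perp_inner)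
    then have "M t (perp v - c *\<^sub>R v) = 0" by (simp add: a_def linear_diff[OF Mlin] linear_scale[OF Mlin])
    then have "perp v = c *\<^sub>R v" using inj by force
    then have "perp v \<bullet> perp v = 0" by (metis perp_inner(2) inner_scaleR_right mult_zero_right)
    with v show False by (simp add: perp_inner)
  qed
  have perp_cont: "continuous_on A (\<lambda>t. perp (f t))" if "continuous_on A f" for f :: "real \<Rightarrow> real^2" and A
  proof -
    have "linear perp" by (rule linearI) (auto simp: vec_eq_iff forall_2 perp_simps)
    then show ?thesis using that linear_continuous_on_compose by (auto simp: linear_conv_bounded_linear intro: bounded_linear.continuous_on)
  qed
  have "continuous_on UNIV (\<lambda>t. D (i, 0) (x0, t))" if "i \<in> Basis" for i
    by (intro continuous_on_compose2[OF Dc] continuous_intros) (use that in "auto simp: Basis_prod_def")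
  then have "continuous_on UNIV (\<lambda>t. M t w)" for w unfolding M_def by (intro continuous_intros) auto
  then have qc: "continuous_on A q" for A unfolding q_def by (intro continuous_intros perp_cont) (auto intro: continuous_on_subset)
  have M0: "M 0 = (\<lambda>w. w)" using has_derivative_unique[OF Md[of 0]] by simp
  have q0: "q 0 > 0" using v by (simp add: q_def M0 perp_inner)
  \<comment> \<open>The identity \<open>\<Phi> (\<Phi> (x0, s), T0) = \<Phi> (x0, s)\<close> is
    differentiated at \<open>s = 0\<close>.\<close>
  have "M T0 v = v"
  proof -
    have "((\<lambda>s. \<Phi> (x0, s)) has_derivative (\<lambda>s. s *\<^sub>R v)) (at 0)"
      using \<Phi>d[of x0 0] by (simp add: has_vector_derivative_def v_def)
    from has_derivative_compose[OF this, of "\<lambda>x. \<Phi> (x, T0)" "M T0"] Md[of T0]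
    have "((\<lambda>s. \<Phi> (\<Phi> (x0, s), T0)) has_derivative (\<lambda>s. M T0 (s *\<^sub>R v))) (at 0)" by simp
    moreover have "\<Phi> (\<Phi> (x0, s), T0) = \<Phi> (x0, s)" for s using T0 \<Phi>_add[of x0 T0 s] \<Phi>_add[of x0 s T0] by (metis add.commute)
    ultimately have "((\<lambda>s. \<Phi> (x0, s)) has_derivative (\<lambda>s. M T0 (s *\<^sub>R v))) (at 0)" by simp
    from has_derivative_unique[OF this \<open>((\<lambda>s. \<Phi> (x0, s)) has_derivative (\<lambda>s. s *\<^sub>R v)) (at 0)\<close>]
    show ?thesis by (metis scaleR_one)
  qed
  moreover have "q T0 > 0"
  proof (rule ccontr)
    assume "\<not> ?thesis"
    then have "q T0 < 0" using q[of T0] by simp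
    have "connected (range q)" using qc by (intro connected_continuous_image connected_UNIV)
    then have "0 \<in> range q" using q0 \<open>q T0 < 0\<close> unfolding connected_iff_interval by (meson less_imp_le rangeI)
    then show False using q by (metis imageE)
  qed
  ultimately show ?thesis by (simp add: q_def M_def v_def)
qed

text \<open>An increasing \<open>p\<close> with \<open>p 0 = 0\<close> moves \<open>s\<close> either
  down or up. Iterating \<open>p\<close> in the first case and taking preimages in the second gives
  a strictly decreasing positive sequence in both.\<close>

lemma monotone_orbit_sequence:
  fixes p :: "real \<Rightarrow> real"
  assumes p: "continuous_on {0..d} p" "p 0 = 0" and inc: "\<And>a b. 0 \<le> a \<Longrightarrow> a < b \<Longrightarrow> b \<le> d \<Longrightarrow> p a < p b"
    and s: "0 < s" "s \<le> d" "p s \<noteq> s"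
  shows "\<exists>c. c 0 = s \<and> (\<forall>n. 0 < c n \<and> c n \<le> d \<and> c (Suc n) < c n \<and> (p (c n) = c (Suc n) \<or> p (c (Suc n)) = c n))"
proof -
  define R where "R a b \<longleftrightarrow> b < a \<and> 0 < b \<and> (p a = b \<or> p b = a) \<and> (p s < s \<longrightarrow> p b < b) \<and> (p s > s \<longrightarrow> p b > b)" for a b
  have step: "\<exists>b. R a b" if a: "0 < a" "a \<le> d" "p s < s \<longrightarrow> p a < a" "p s > s \<longrightarrow> p a > a" for a
  proof (cases "p s < s")
    case True
    have "0 < p a" using inc[of 0 a] a p(2) by simp
    then show ?thesis using True a inc[of "p a" a] by (intro exI[of _ "p a"]) (auto simp: R_def)
  next
    case False
    then have f: "p s > s" "p a > a" using s a by auto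
    obtain b where b: "0 \<le> b" "b \<le> a" "p b = a" using IVT'[of p 0 a a] f a p continuous_on_subset[OF p(1), of "{0..a}"] by auto
    have "b \<noteq> 0" "b \<noteq> a" using b f a p(2) by auto
    then show ?thesis using b f a by (intro exI[of _ b]) (auto simp: R_def)
  qed
  define c where "c = rec_nat s (\<lambda>_ a. SOME b. R a b)"
  have c: "0 < c n \<and> c n \<le> d \<and> (p s < s \<longrightarrow> p (c n) < c n) \<and> (p s > s \<longrightarrow> p (c n) > c n) \<and> R (c n) (c (Suc n))" for n
  proof (induction n)
    case 0
    have "R s (SOME b. R s b)" using step[of s] s by (intro someI_ex[of "R s"]) auto
    then show ?case using s by (simp add: c_def)
  next
    case (Suc n)
    then have 1: "0 < c (Suc n) \<and> c (Suc n) \<le> d \<and> (p s < s \<longrightarrow> p (c (Suc n)) < c (Suc n)) \<and> (p s > s \<longrightarrow> p (c (Suc n)) > c (Suc n))"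
      unfolding R_def by auto
    then have "R (c (Suc n)) (SOME b. R (c (Suc n)) b)" using step by (intro someI_ex[of "R (c (Suc n))"]) auto
    with 1 show ?case by (simp add: c_def)
  qed
  show ?thesis using c by (intro exI[of _ c]) (auto simp: R_def c_def)
qed

text \<open>The return map \<open>p\<close> of a transversal is increasing and fixes
  \<open>0\<close>. If it moved a point of the disk, \<open>monotone_orbit_sequence\<close> would
  put infinitely many points of one closed orbit on the transversal, whereas a compact orbit crosses
  it only finitely often. So \<open>p\<close> is the identity on points of the disk, and the return
  time is a period there.\<close>

lemma local_product:
  assumes x0: "x0 \<in> pdisk"
  shows "\<exists>W w. open W \<and> x0 \<in> W \<and> continuous_on W w \<and> w x0 = per x0 \<and> (\<forall>x\<in>W \<inter> disk. \<Phi> (x, w x) = x)"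
proof -
  define v where "v = G x0"
  define j where "j = perp v"
  have v: "v \<noteq> 0" using G_nz[OF x0] by (simp add: v_def)
  have j: "j \<bullet> j > 0" "j \<bullet> v = 0" using v by (simp_all add: j_def perp_inner)
  obtain W w where W: "open W" "x0 \<in> W" "\<And>k. Cn k W w" "w x0 = per x0" "\<And>x. x \<in> W \<Longrightarrow> (\<Phi> (x, w x) - x0) \<bullet> v = 0"
    using hitting_time[OF x0 \<Phi>_per[OF x0]] unfolding v_def by metis
  obtain W0 w0 where W0: "open W0" "x0 \<in> W0" "\<And>k. Cn k W0 w0" "w0 x0 = 0" "\<And>x. x \<in> W0 \<Longrightarrow> (\<Phi> (x, w0 x) - x0) \<bullet> v = 0"
    using hitting_time[OF x0 \<Phi>0] unfolding v_def by metis
  obtain D where D0: "\<forall>z\<in>UNIV. (\<Phi> has_derivative lc (\<lambda>b. D b z)) (at z)" and Dc: "\<forall>b\<in>Basis. Cn 0 UNIV (D b)"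
    using \<Phi>C[of "Suc 0", unfolded Cn_Suc_iff] by (elim conjE exE)
  define J where "J s = x0 + s *\<^sub>R j" for s
  define p where "p s = (\<Phi> (J s, w (J s)) - x0) \<bullet> j / (j \<bullet> j)" for s
  have RJ: "\<Phi> (x, t) = J ((\<Phi> (x, t) - x0) \<bullet> j / (j \<bullet> j))" if "(\<Phi> (x, t) - x0) \<bullet> v = 0" for x t
    using orthogonal_perp[OF that v] by (simp add: J_def j_def perp_inner algebra_simps)
  have Jc: "continuous_on A J" for A unfolding J_def by (intro continuous_intros)
  have J0: "J 0 = x0" by (simp add: J_def)
  have JW: "open (J -` W)" using continuous_open_preimage[OF Jc[of UNIV] open_UNIV W(1)] by simp
  have pdiff: "\<exists>p'. continuous_on (J -` W) p' \<and> (\<forall>s\<in>J -` W. (p has_real_derivative p' s) (at s))"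
  proof -
    have "Cn (Suc 0) (J -` W) p" unfolding p_def divide_inverse J_def
      by (intro Ck_mult Ck_inner Ck_diff Ck_const' Cn_compose[OF \<Phi>C] Ck_Pair Ck_add Ck_scaleR Ck_id Cn_compose[OF W(3)]) (auto simp: J_def)
    then obtain E where E: "\<forall>s\<in>J -` W. (p has_derivative lc (\<lambda>b. E b s)) (at s within J -` W)"
      "\<forall>b\<in>Basis. Cn 0 (J -` W) (E b)" unfolding Cn_Suc_iff by (elim conjE exE)
    have "(p has_real_derivative E 1 s) (at s)" if "s \<in> J -` W" for s
      using E(1)[rule_format, OF that] at_within_open[OF that JW] by (simp add: has_field_derivative_def mult_commute_abs)
    moreover have "continuous_on (J -` W) (E 1)" using E(2) by (simp add: Cn_0_iff)
    ultimately show ?thesis by blast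
  qed
  then obtain p' where p'c: "continuous_on (J -` W) p'" and p': "\<And>s. s \<in> J -` W \<Longrightarrow> (p has_real_derivative p' s) (at s)" by blast
  have 0: "0 \<in> J -` W" using W(2) by (simp add: J0)
  have p0: "p 0 = 0" by (simp add: p_def J0 W(4) \<Phi>_per[OF x0])
  \<comment> \<open>The variation of the return time contributes a multiple of \<open>v\<close>
    only, which is orthogonal to \<open>j\<close>; what remains is the quantity of
    \<open>return_derivative_pos\<close>.\<close>
  have p'0: "p' 0 > 0"
  proof -
    define M where "M = (lc (\<lambda>i. D (i, 0) (x0, per x0)) j)"
    have M: "M \<bullet> j > 0" unfolding M_def j_def v_def
    proof (rule return_derivative_pos[OF x0 \<Phi>_per[OF x0]])
      show "(\<Phi> has_derivative (\<lambda>v. (lc (\<lambda>i. D (i, 0) (x0, t)) (fst v)) + snd v *\<^sub>R D (0, 1) (x0, t))) (at (x0, t))" for t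
        using D0[rule_format, of "(x0, t)"] by (simp add: sum_Basis_Pair0)
      show "continuous_on UNIV (D b)" if "b \<in> Basis" for b using Dc that Cn_0_iff by blast
    qed
    obtain w' where w': "(w has_derivative w') (at x0)"
    proof -
      have "\<exists>E. (w has_derivative E) (at x0 within W)" using W(3)[of "Suc 0", unfolded Cn_Suc_iff] W(2) by blast
      then show thesis using that at_within_open[OF W(2,1)] by auto
    qed
    have Jd: "(J has_derivative (\<lambda>h. h *\<^sub>R j)) (at 0)" unfolding J_def by (auto intro!: derivative_eq_intros)
    have "((\<lambda>s. w (J s)) has_derivative (\<lambda>h. w' (h *\<^sub>R j))) (at 0)" by (rule has_derivative_compose[OF Jd]) (simp add: J0 w')
    then have "((\<lambda>s. (J s, w (J s))) has_derivative (\<lambda>h. (h *\<^sub>R j, w' (h *\<^sub>R j)))) (at 0)" by (intro has_derivative_Pair Jd)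
    moreover have "(\<Phi> has_derivative lc (\<lambda>b. D b (x0, per x0))) (at (J 0, w (J 0)))"
      using D0[rule_format, of "(x0, per x0)"] by (simp add: J0 W(4))
    ultimately have "((\<lambda>s. \<Phi> (J s, w (J s))) has_derivative (\<lambda>h. \<Sum>b\<in>Basis. ((h *\<^sub>R j, w' (h *\<^sub>R j)) \<bullet> b) *\<^sub>R D b (x0, per x0))) (at 0)"
      by (rule has_derivative_compose)
    then have "((\<lambda>s. \<Phi> (J s, w (J s))) has_derivative (\<lambda>h. (lc (\<lambda>i. D (i, 0) (x0, per x0)) (h *\<^sub>R j)) + w' (h *\<^sub>R j) *\<^sub>R D (0, 1) (x0, per x0))) (at 0)"
      by (simp only: sum_Basis_Pair0 fst_conv snd_conv)
    from has_derivative_inner_left[OF has_derivative_diff[OF this has_derivative_const[of x0]], of "j"]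
    have 1: "((\<lambda>s. (\<Phi> (J s, w (J s)) - x0) \<bullet> j) has_derivative (\<lambda>h. ((lc (\<lambda>i. D (i, 0) (x0, per x0)) (h *\<^sub>R j)) + w' (h *\<^sub>R j) *\<^sub>R D (0, 1) (x0, per x0)) \<bullet> j)) (at 0)"
      by simp
    have D01: "D (0, 1) (x0, per x0) = v"
    proof -
      have "((\<lambda>t. (x0, t)) has_derivative (\<lambda>h. (0, h))) (at (per x0))" by (auto intro!: derivative_eq_intros)
      from has_derivative_compose[OF this D0[rule_format, of "(x0, per x0)", simplified]]
      have "((\<lambda>t. \<Phi> (x0, t)) has_derivative (\<lambda>h. h *\<^sub>R D (0, 1) (x0, per x0))) (at (per x0))" unfolding sum_Basis_Pair0 by simp
      from has_derivative_unique[OF this \<Phi>d[of x0 "per x0", unfolded has_vector_derivative_def]]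
      show ?thesis by (metis scaleR_one \<Phi>_per[OF x0] v_def)
    qed
    have "((\<lambda>s. (\<Phi> (J s, w (J s)) - x0) \<bullet> j) has_real_derivative M \<bullet> j) (at 0)"
    proof -
      have "((lc (\<lambda>i. D (i, 0) (x0, per x0)) (h *\<^sub>R j)) + w' (h *\<^sub>R j) *\<^sub>R D (0, 1) (x0, per x0)) \<bullet> j = (M \<bullet> j) * h" for h
        using j(2) by (simp add: D01 M_def inner_add_left inner_sum_left sum_distrib_left sum_distrib_right inner_commute[of v] mult_ac)
      with 1 show ?thesis unfolding has_field_derivative_def by (simp only:)
    qed
    from DERIV_cdivide[OF this, of "j \<bullet> j"] have "(p has_real_derivative (M \<bullet> j) / (j \<bullet> j)) (at 0)" by (simp add: p_def[abs_def])
    with p'[OF 0] have "p' 0 = (M \<bullet> j) / (j \<bullet> j)" by (rule DERIV_unique)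
    then show ?thesis using M j by simp
  qed
  obtain c where c: "c > 0" "\<And>x t. dist x x0 < c \<Longrightarrow> \<bar>t\<bar> < c \<Longrightarrow> G (\<Phi> (x, t)) \<bullet> v > 0"
    using transverse_nbhd[OF x0] unfolding v_def by blast
  have "\<exists>g>0. \<forall>s. \<bar>s\<bar> \<le> g \<longrightarrow> s \<in> J -` W \<and> p' s > 0 \<and> G (J s) \<bullet> v > 0 \<and> J s \<noteq> 0"
  proof -
    have "open (J -` W \<inter> p' -` {0<..})" by (rule continuous_open_preimage[OF p'c JW]) simp
    moreover have "open (J -` ball x0 c \<inter> J -` (- {0}))" using continuous_open_preimage[OF Jc[of UNIV] open_UNIV] by (intro open_Int) auto
    ultimately have "open (J -` W \<inter> p' -` {0<..} \<inter> (J -` ball x0 c \<inter> J -` (- {0})))" by blast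
    moreover have "0 \<in> J -` W \<inter> p' -` {0<..} \<inter> (J -` ball x0 c \<inter> J -` (- {0}))" using 0 p'0 x0 c(1) by (simp add: J0)
    ultimately obtain e where e: "e > 0" "ball 0 e \<subseteq> J -` W \<inter> p' -` {0<..} \<inter> (J -` ball x0 c \<inter> J -` (- {0}))"
      using openE by blast
    have "s \<in> J -` W \<and> p' s > 0 \<and> G (J s) \<bullet> v > 0 \<and> J s \<noteq> 0" if "\<bar>s\<bar> \<le> e / 2" for s
    proof -
      have "s \<in> ball 0 e" using that e(1) by simp
      then have "s \<in> J -` W \<inter> p' -` {0<..} \<inter> (J -` ball x0 c \<inter> J -` (- {0}))" using e(2) by blast
      then show ?thesis using c(2)[of "J s" 0] c(1) by (simp add: dist_commute)
    qed
    then show ?thesis using e(1) by (intro exI[of _ "e / 2"]) auto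
  qed
  then obtain g where g: "g > 0" "\<And>s. \<bar>s\<bar> \<le> g \<Longrightarrow> s \<in> J -` W" "\<And>s. \<bar>s\<bar> \<le> g \<Longrightarrow> p' s > 0"
    "\<And>s. \<bar>s\<bar> \<le> g \<Longrightarrow> G (J s) \<bullet> v > 0" "\<And>s. \<bar>s\<bar> \<le> g \<Longrightarrow> J s \<noteq> 0" by blast
  have inc: "p a < p b" if "a < b" "\<bar>a\<bar> \<le> g" "\<bar>b\<bar> \<le> g" for a b
  proof (rule DERIV_pos_imp_increasing[OF that(1)])
    fix s assume "a \<le> s" "s \<le> b"
    then have "\<bar>s\<bar> \<le> g" using that by linarith
    then show "\<exists>y. (p has_real_derivative y) (at s) \<and> 0 < y" using p' g by blast
  qed
  have pJ: "\<Phi> (J s, w (J s)) = J (p s)" if "\<bar>s\<bar> \<le> g" for s using RJ[OF W(5)] g(2)[OF that] by (simp add: p_def)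
  \<comment> \<open>All \<open>J (l n)\<close> lie on one periodic orbit, at times in one period. An
    accumulation point \<open>T\<close> of these times would be a zero of \<open>f\<close> that is
    isolated, because the flow crosses the transversal with nonzero speed; so the times of a
    subsequence equal \<open>T\<close> from some index on, against injectivity.\<close>
  have no_seq: False if l: "\<And>n. \<bar>l n\<bar> \<le> g" "\<And>n. l (Suc n) \<noteq> l n" "inj l" "J (l 0) \<in> disk"
     "\<And>n. p (l n) = l (Suc n) \<or> p (l (Suc n)) = l n" for l :: "nat \<Rightarrow> real"
  proof -
    define x where "x = J (l 0)"
    have x: "x \<in> pdisk" using l(1,4) g(5) by (auto simp: x_def)
    have "\<exists>t. \<Phi> (x, t) = J (l n)" for n
    proof (induction n)
      case 0 show ?case by (intro exI[of _ 0]) (simp add: x_def)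
    next
      case (Suc n)
      then obtain t where t: "\<Phi> (x, t) = J (l n)" by blast
      from l(5)[of n] show ?case
      proof
        assume "p (l n) = l (Suc n)"
        then show ?thesis using pJ[OF l(1)[of n]] t \<Phi>_add by metis
      next
        assume "p (l (Suc n)) = l n"
        then have "\<Phi> (J (l (Suc n)), w (J (l (Suc n)))) = \<Phi> (x, t)" using pJ[OF l(1)[of "Suc n"]] t by simp
        then have "\<Phi> (\<Phi> (J (l (Suc n)), w (J (l (Suc n)))), - w (J (l (Suc n)))) = \<Phi> (\<Phi> (x, t), - w (J (l (Suc n))))" by simp
        then show ?thesis by (intro exI[of _ "t - w (J (l (Suc n)))"]) (simp add: \<Phi>_add)
      qed
    qed
    then have "\<exists>t. t \<in> {0..per x} \<and> \<Phi> (x, t) = J (l n)" for n using \<Phi>_mod_per[OF x] by metis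
    then obtain u where u: "\<And>n. u n \<in> {0..per x}" "\<And>n. \<Phi> (x, u n) = J (l n)" by metis
    obtain r T where r: "strict_mono (r :: nat \<Rightarrow> nat)" "(u \<circ> r) \<longlonglongrightarrow> T"
      using compact_imp_seq_compact[OF compact_Icc[of 0 "per x"]] u(1) unfolding seq_compact_def by metis
    obtain r' s where r': "strict_mono (r' :: nat \<Rightarrow> nat)" "(l \<circ> r \<circ> r') \<longlonglongrightarrow> s" "s \<in> {-g..g}"
    proof -
      have "\<And>n. (l \<circ> r) n \<in> {-g..g}" using l(1) by (auto simp: abs_le_iff minus_le_iff)
      then show thesis using that compact_imp_seq_compact[OF compact_Icc[of "-g" g]] unfolding seq_compact_def by metis
    qed
    have T: "(\<lambda>n. u (r (r' n))) \<longlonglongrightarrow> T" using LIMSEQ_subseq_LIMSEQ[OF r(2) r'(1)] by (simp add: o_def)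
    have "(\<lambda>n. \<Phi> (x, u (r (r' n)))) \<longlonglongrightarrow> \<Phi> (x, T)"
      using continuous_on_tendsto_compose[OF \<Phi>t_cont[of UNIV x] T] by simp
    moreover have "(\<lambda>n. J (l (r (r' n)))) \<longlonglongrightarrow> J s" using continuous_on_tendsto_compose[OF Jc[of UNIV] r'(2)] by (simp add: o_def)
    ultimately have Js: "\<Phi> (x, T) = J s" using u(2) LIMSEQ_unique by simp
    define f where "f t = (\<Phi> (x, t) - x0) \<bullet> v" for t
    have f0: "f (u n) = 0" for n using j by (simp add: f_def u(2) J_def)
    have fT: "f T = 0" using j by (simp add: f_def Js J_def)
    have "(f has_real_derivative G (J s) \<bullet> v) (at T)" unfolding f_def Js[symmetric] by (rule \<Phi>_inner_deriv)
    moreover have "\<bar>s\<bar> \<le> g" using r'(3) by (auto simp: abs_le_iff)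
    then have "G (J s) \<bullet> v \<noteq> 0" using g(4)[of s] by simp
    ultimately have "\<forall>\<^sub>F y in at T. (f y - f T) / (y - T) \<noteq> 0" by (intro tendsto_imp_eventually_ne) (auto simp: has_field_derivative_iff)
    then obtain d where d: "d > 0" "\<And>y. y \<noteq> T \<Longrightarrow> dist y T < d \<Longrightarrow> f y \<noteq> 0"
      unfolding eventually_at using fT by auto
    obtain m where m: "\<And>n. n \<ge> m \<Longrightarrow> dist (u (r (r' n))) T < d" using metric_LIMSEQ_D[OF T d(1)] by blast
    have "u (r (r' n)) = T" if "n \<ge> m" for n using d(2)[of "u (r (r' n))"] m[OF that] f0 by blast
    then have "J (l (r (r' m))) = J (l (r (r' (Suc m))))" using u(2) by (metis le_SucI order_refl)
    then have "l (r (r' m)) = l (r (r' (Suc m)))" using j by (auto simp: J_def)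
    then have "r (r' m) = r (r' (Suc m))" using l(3) by (simp add: inj_eq)
    then show False using strict_monoD[OF r(1) strict_monoD[OF r'(1), of m "Suc m"]] by simp
  qed
  have inj_dec: "inj f" if "\<And>n. f (Suc n) < f n" for f :: "nat \<Rightarrow> real"
  proof -
    have "strict_mono (\<lambda>n. - f n)" using that by (simp add: strict_mono_Suc_iff)
    then have "inj (\<lambda>n. - f n)" by (rule strict_mono_imp_inj_on)
    then show ?thesis by (simp add: inj_def)
  qed
  have pc: "continuous_on {-g..g} p"
  proof (intro continuous_at_imp_continuous_on ballI)
    fix s assume "s \<in> {-g..g}"
    then have "\<bar>s\<bar> \<le> g" by (auto simp: abs_le_iff)
    then show "isCont p s" using p'[OF g(2)] DERIV_isCont by blast
  qed
  \<comment> \<open>When \<open>x0\<close> lies on the boundary circle, the transversal leaves the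
    disk, and the argument about closed orbits applies to its points in the disk only.\<close>
  have pid: "p s = s" if s: "\<bar>s\<bar> \<le> g" "J s \<in> disk" for s
  proof (rule ccontr)
    assume ne: "p s \<noteq> s"
    have "s \<noteq> 0" using ne p0 by auto
    then obtain d :: real where d: "d = 1 \<or> d = - 1" "d * s > 0" by (metis linorder_neqE_linordered_idom mult_1 mult_minus1 neg_0_less_iff_less)
    let ?q = "\<lambda>x. d * p (d * x)"
    have "\<exists>u. u 0 = d * s \<and> (\<forall>n. 0 < u n \<and> u n \<le> g \<and> u (Suc n) < u n \<and> (?q (u n) = u (Suc n) \<or> ?q (u (Suc n)) = u n))"
    proof (rule monotone_orbit_sequence)
      show "continuous_on {0..g} ?q" by (intro continuous_on_mult_left continuous_on_compose2[OF pc] continuous_intros) (use d in auto)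
    qed (use d s ne p0 inc in auto)
    then obtain u where u: "u 0 = d * s" "\<And>n. 0 < u n \<and> u n \<le> g \<and> u (Suc n) < u n \<and> (?q (u n) = u (Suc n) \<or> ?q (u (Suc n)) = u n)" by blast
    have "inj u" using u(2) by (intro inj_dec) auto
    show False
    proof (rule no_seq[of "\<lambda>n. d * u n"])
      show "\<bar>d * u n\<bar> \<le> g" "d * u (Suc n) \<noteq> d * u n" "p (d * u n) = d * u (Suc n) \<or> p (d * u (Suc n)) = d * u n" for n
        using u(2)[of n] d(1) by auto
      show "inj (\<lambda>n. d * u n)" using \<open>inj u\<close> d(1) by (auto simp: inj_def)
    qed (use u(1) s d(1) in auto)
  qed
  \<comment> \<open>The position at which the orbit of \<open>x\<close> first meets the transversal
    near time \<open>0\<close>. A period of that point is one of \<open>x\<close>, since both lie on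
    the same orbit.\<close>
  define s where "s x = (\<Phi> (x, w0 x) - x0) \<bullet> j / (j \<bullet> j)" for x
  have y: "\<Phi> (x, w0 x) = J (s x)" if "x \<in> W0" for x using RJ[OF W0(5)[OF that]] by (simp add: s_def)
  have b0c: "continuous_on W0 w0" by (rule Cn_continuous_on[OF W0(3)])
  have sc: "continuous_on W0 s" unfolding s_def by (intro continuous_intros continuous_on_compose2[OF \<Phi>_cont[of UNIV]] b0c) (use j in auto)
  define W' where "W' = W0 \<inter> s -` {-g<..<g}"
  have W': "open W'" unfolding W'_def by (rule continuous_open_preimage[OF sc W0(1)]) simp
  have s0: "s x0 = 0" by (simp add: s_def W0(4))
  have abs: "\<bar>s x\<bar> \<le> g" if "x \<in> W'" for x using that by (auto simp: W'_def)
  show ?thesis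
  proof (intro exI[of _ W'] exI[of _ "\<lambda>x. w (J (s x))"] conjI ballI)
    show "continuous_on W' (\<lambda>x. w (J (s x)))"
      by (intro continuous_on_compose2[OF Cn_continuous_on[OF W(3)]] continuous_on_compose2[OF Jc[of UNIV]] continuous_on_subset[OF sc])
        (use abs g(2) in "auto simp: W'_def")
    fix x assume x: "x \<in> W' \<inter> disk"
    then have "J (s x) \<in> disk" using y[of x] \<Phi>_disk[of x "w0 x"] by (auto simp: W'_def)
    then have 1: "\<Phi> (J (s x), w (J (s x))) = J (s x)" using pJ pid abs x by simp
    have "x = \<Phi> (J (s x), - w0 x)" using y[of x] x \<Phi>_add[of x "w0 x" "- w0 x"] by (simp add: W'_def)
    then show "\<Phi> (x, w (J (s x))) = x" using 1 by (metis \<Phi>_add add.commute)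
  qed (use W' W0(2) g(1) s0 W(4) in "auto simp: W'_def J0")
qed

text \<open>Near \<open>x0\<close> the function from \<open>local_product\<close> is a period close
  to \<open>per x0\<close> and bounds \<open>per\<close> from above. Smaller periods are excluded
  near \<open>0\<close> by \<open>no_short_period\<close>, and on the compact interval
  \<open>I\<close> because the flow displaces \<open>x0\<close> by a definite amount there.\<close>

lemma per_cont: "continuous_on pdisk per" unfolding continuous_on_iff
proof (intro ballI allI impI)
  fix x0 and e :: real assume x0: "x0 \<in> pdisk" and e: "e > 0"
  obtain W b where W: "open W" "x0 \<in> W" "continuous_on W b" "b x0 = per x0" "\<And>x. x \<in> W \<inter> disk \<Longrightarrow> \<Phi> (x, b x) = x"
    using local_product[OF x0] by (elim exE conjE) blast
  obtain c where c: "c > 0" "\<And>x t. dist x x0 < c \<Longrightarrow> 0 < t \<Longrightarrow> t < c \<Longrightarrow> \<Phi> (x, t) \<noteq> x" using no_short_period[OF x0] by blast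
  have P: "per x0 > 0" by (rule per_pos[OF x0])
  define e' where "e' = min e (per x0)"
  have e': "e' > 0" using e P by (simp add: e'_def)
  have "isCont b x0" using W by (simp add: continuous_on_eq_continuous_at)
  then obtain d1 where d1: "d1 > 0" "\<And>x. dist x x0 < d1 \<Longrightarrow> dist (b x) (per x0) < e'"
    unfolding continuous_at_eps_delta W(4) using e' by blast
  obtain d2 where d2: "d2 > 0" "ball x0 d2 \<subseteq> W" using W openE by blast
  define I where "I = {c/2..per x0 - e'}"
  have "\<exists>d3>0. \<forall>x t. dist x x0 < d3 \<longrightarrow> t \<in> I \<longrightarrow> \<Phi> (x, t) \<noteq> x"
  proof (cases "I = {}")
    case True then show ?thesis by (intro exI[of _ 1]) auto
  next
    case False
    let ?g = "\<lambda>w. \<Phi> w - fst w"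
    have "continuous_on I (\<lambda>t. norm (?g (x0, t)))" by (intro continuous_intros continuous_on_compose2[OF \<Phi>_cont[of UNIV]]) auto
    then obtain t0 where t0: "t0 \<in> I" "\<And>t. t \<in> I \<Longrightarrow> norm (?g (x0, t0)) \<le> norm (?g (x0, t))"
      using continuous_attains_inf[of I "\<lambda>t. norm (?g (x0, t))"] False by (auto simp: I_def)
    have "\<Phi> (x0, t0) \<noteq> x0" using per_min[OF x0, of t0] t0(1) c(1) e' by (auto simp: I_def)
    then have pos: "norm (?g (x0, t0)) > 0" by simp
    have "continuous_on UNIV ?g" by (intro continuous_intros \<Phi>_cont)
    from uniform_tube[OF this pos, of x0 "per x0"] obtain d3 where d3: "d3 > 0"
      "\<And>x t. dist x x0 < d3 \<Longrightarrow> \<bar>t\<bar> \<le> per x0 \<Longrightarrow> dist (?g (x, t)) (?g (x0, t)) < norm (?g (x0, t0))" by blast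
    have "\<Phi> (x, t) \<noteq> x" if "dist x x0 < d3" "t \<in> I" for x t
    proof
      assume "\<Phi> (x, t) = x"
      then have "norm (?g (x0, t)) < norm (?g (x0, t0))" using d3(2)[OF that(1), of t] that(2) c(1) e' by (auto simp: I_def dist_norm norm_minus_commute)
      then show False using t0(2)[OF that(2)] by simp
    qed
    then show ?thesis using d3(1) by blast
  qed
  then obtain d3 where d3: "d3 > 0" "\<And>x t. dist x x0 < d3 \<Longrightarrow> t \<in> I \<Longrightarrow> \<Phi> (x, t) \<noteq> x" by blast
  define d where "d = min (min d1 d2) (min d3 c)"
  show "\<exists>d>0. \<forall>x\<in>pdisk. dist x x0 < d \<longrightarrow> dist (per x) (per x0) < e"
  proof (intro exI[of _ d] conjI ballI impI)
    show "d > 0" using d1 d2 d3 c by (simp add: d_def)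
    fix x assume x: "x \<in> pdisk" and dx: "dist x x0 < d"
    have "b x > 0" "b x < per x0 + e'" using d1(2)[of x] dx P by (auto simp: d_def dist_real_def e'_def)
    moreover have "\<Phi> (x, b x) = x" using W(5)[of x] d2(2) dx x by (auto simp: d_def dist_commute)
    ultimately have up: "per x < per x0 + e'" using per_min[OF x, of "b x"] by linarith
    have "per x \<notin> I" using d3(2)[of x "per x"] dx \<Phi>_per[OF x] by (auto simp: d_def)
    moreover have "per x \<ge> c" using c(2)[of x "per x"] dx \<Phi>_per[OF x] per_pos[OF x] by (force simp: d_def)
    ultimately have "per x > per x0 - e'" using c(1) by (auto simp: I_def)
    moreover have "e' \<le> e" by (simp add: e'_def)
    ultimately show "dist (per x) (per x0) < e" using up unfolding dist_real_def by linarith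
  qed
qed

end

section \<open>Rotation along the flow\<close>

text \<open>\<open>l\<close> is an argument of \<open>y / x\<close>.\<close>

definition turn :: "real^2 \<Rightarrow> real^2 \<Rightarrow> real \<Rightarrow> bool" where
  "turn x y l \<longleftrightarrow> (\<exists>r>0. cx y = cx x * (of_real r * cis l))"

lemma cis_eq_imp: "cis a = cis b \<Longrightarrow> \<exists>k::int. a = b + 2 * pi * of_int k"
proof -
  assume "cis a = cis b"
  then have "cos a = cos b \<and> sin a = sin b" by (simp add: complex_eq_iff)
  then have "sin a = sin b \<and> cos a = cos b" by simp
  then show ?thesis using sin_cos_eq_iff[of a b] by (auto simp: mult_ac)
qed

lemma turn_unique:
  assumes "turn x y l" "turn x y m" "x \<noteq> 0" shows "\<exists>k::int. l = m + 2 * pi * of_int k"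
proof -
  obtain r s where r: "r > 0" "s > 0" "cx y = cx x * (of_real r * cis l)" "cx y = cx x * (of_real s * cis m)" using assms by (auto simp: turn_def)
  then have e: "of_real r * cis l = of_real s * cis m" using assms(3) by simp
  then have "norm (of_real r * cis l) = norm (of_real s * cis m)" by simp
  then have "r = s" using r by (simp add: norm_mult)
  with e r have "cis l = cis m" by simp
  then show ?thesis by (rule cis_eq_imp)
qed

lemma turn_shift: "turn x y (l + 2 * pi * of_int k) \<longleftrightarrow> turn x y l"
proof -
  have "cis (2 * pi * of_int k) = 1" by (simp add: complex_eq_iff cos_int_2pin sin_int_2pin)
  then show ?thesis by (simp add: turn_def flip: cis_mult)
qed

lemma turn_0_same_norm: "turn x y (2 * pi * of_int k) \<Longrightarrow> norm x = norm y \<Longrightarrow> x \<noteq> 0 \<Longrightarrow> y = x"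
proof -
  assume t: "turn x y (2 * pi * of_int k)" and n: "norm x = norm y" "x \<noteq> 0"
  then obtain r where r: "r > 0" "cx y = cx x * of_real r" using turn_shift[of x y 0 k] by (auto simp: turn_def)
  then have "norm (cx y) = norm (cx x) * r" by (simp add: norm_mult)
  then have "norm y * r = norm y" using n by simp
  moreover have "norm y \<noteq> 0" using n by auto
  ultimately have "r = 1" by simp
  with r show ?thesis by simp
qed

lemma turn_refl: "turn x x 0" by (auto simp: turn_def intro!: exI[of _ 1])

lemma pdisk_connected: "connected pdisk"
proof (rule connected_convex_diff_countable)
  show "\<not> collinear (disk :: (real^2) set)" by (simp add: collinear_aff_dim aff_dim_cball)
qed auto

definition pt :: "real^2" where "pt = axis 1 1"

lemma pt: "cx pt = 1" "norm pt = 1" "pt \<in> pdisk" "pt \<in> sphere 0 1" "pt \<noteq> 0"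
  by (simp_all add: pt_def cx_def axis_def complex_eq_iff) (simp_all add: norm_axis_1 axis_eq_0_iff flip: axis_def)

context tc_flow
begin

text \<open>The radial component of the field vanishes on the circle, so by the Lipschitz bound it
  is controlled by the distance to the circle. The defect \<open>n\<close> is nonnegative since
  orbits stay in the disk, satisfies a linear differential inequality and starts at
  \<open>0\<close>; Gronwall keeps it at \<open>0\<close>.\<close>

lemma sphere_invariant:
  assumes x: "norm x = 1" shows "norm (\<Phi> (x, t)) = 1"
proof -
  define n where "n t = 1 - \<Phi> (x, t) \<bullet> \<Phi> (x, t)" for t
  have xd: "x \<in> disk" using x by simp
  have nd: "(n has_vector_derivative - (2 * (\<Phi> (x, t) \<bullet> G (\<Phi> (x, t))))) (at t)" for t
  proof -
    have "((\<lambda>t. \<Phi> (x, t) \<bullet> \<Phi> (x, t)) has_vector_derivative (\<Phi> (x, t) \<bullet> G (\<Phi> (x, t)) + G (\<Phi> (x, t)) \<bullet> \<Phi> (x, t))) (at t)"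
      by (rule bounded_bilinear.has_vector_derivative[OF bounded_bilinear_inner \<Phi>d \<Phi>d])
    from has_vector_derivative_diff[OF has_vector_derivative_const this, of 1]
    show ?thesis by (simp add: n_def[abs_def] inner_commute)
  qed
  have bd: "\<bar>y \<bullet> G y\<bar> \<le> L * (1 - y \<bullet> y)" if y: "y \<in> disk" for y
  proof (cases "y = 0")
    case False
    define u where "u = y /\<^sub>R norm y"
    have u: "norm u = 1" "y = norm y *\<^sub>R u" using False by (simp_all add: u_def)
    have ny: "norm y \<le> 1" using y by simp
    have "G u \<bullet> u = 0" using TC GF[of u] u(1) by (simp add: TC_vector_field_def)
    then have "y \<bullet> G y = norm y * (u \<bullet> (G y - G u))" by (subst u(2)) (simp add: inner_diff_right inner_commute)
    then have "\<bar>y \<bullet> G y\<bar> = norm y * \<bar>u \<bullet> (G y - G u)\<bar>" by (simp add: abs_mult)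
    also have "\<dots> \<le> norm y * norm (G y - G u)" using Cauchy_Schwarz_ineq2[of u "G y - G u"] u(1) by (intro mult_left_mono) auto
    also have "\<dots> \<le> norm y * (L * norm (y - u))" by (intro mult_left_mono lip) auto
    also have "norm (y - u) = 1 - norm y"
    proof -
      have "y - u = (norm y - 1) *\<^sub>R u" by (subst u(2)) (simp add: algebra_simps)
      then show ?thesis using u(1) ny by simp
    qed
    also have "norm y * (L * (1 - norm y)) \<le> L * ((1 + norm y) * (1 - norm y))" using L ny by (simp add: mult.left_commute mult_left_mono mult_right_mono)
    also have "(1 + norm y) * (1 - norm y) = 1 - y \<bullet> y" by (simp add: algebra_simps power2_eq_square flip: power2_norm_eq_inner)
    finally show ?thesis .
  qed (use L in simp)
  have pos: "0 \<le> n s" for s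
  proof -
    have "norm (\<Phi> (x, s)) \<le> 1" using \<Phi>_disk[OF xd, of s] by simp
    then have "(norm (\<Phi> (x, s)))\<^sup>2 \<le> 1\<^sup>2" by (intro power_mono) auto
    then show ?thesis by (simp add: n_def power2_norm_eq_inner)
  qed
  have "norm (n t) \<le> (norm (n 0) + 0 * \<bar>t\<bar>) * exp (2 * L * \<bar>t\<bar>)"
  proof (rule gronwall[OF nd, where N = "\<bar>t\<bar>"])
    show "continuous_on UNIV (\<lambda>t. - (2 * (\<Phi> (x, t) \<bullet> G (\<Phi> (x, t)))))"
      by (intro continuous_intros \<Phi>t_cont continuous_on_compose2[OF G_cont[of UNIV]]) auto
    fix s
    show "norm (- (2 * (\<Phi> (x, s) \<bullet> G (\<Phi> (x, s))))) \<le> 2 * L * norm (n s) + 0"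
      using bd[OF \<Phi>_disk[OF xd, of s]] pos[of s] by (simp add: n_def)
  qed (use L in auto)
  moreover have "n 0 = 0" using x by (simp add: n_def norm_eq_1)
  ultimately have "n t = 0" by simp
  then show ?thesis by (simp add: n_def norm_eq_1)
qed

text \<open>A logarithm of \<open>\<Phi> (x, t) / x\<close> in complex notation: the integral of the
  logarithmic derivative along the orbit. Time is rescaled to \<open>{0..1}\<close> so that joint
  continuity follows from that of the integrand.\<close>

definition Wc :: "real^2 \<Rightarrow> real \<Rightarrow> complex" where
  "Wc x t = integral {0..1} (\<lambda>\<sigma>. of_real t * (cx (G (\<Phi> (x, \<sigma> * t))) / cx (\<Phi> (x, \<sigma> * t))))"

abbreviation rate :: "real^2 \<Rightarrow> complex" where "rate y \<equiv> cx (G y) / cx y"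

lemma rate_cont: "continuous_on pdisk rate" by (intro continuous_on_divide continuous_on_cx G_cont continuous_on_id) auto

lemma rate_\<Phi>_cont: "continuous_on A f \<Longrightarrow> (\<And>z. z \<in> A \<Longrightarrow> fst (f z) \<in> pdisk) \<Longrightarrow> continuous_on A (\<lambda>z. rate (\<Phi> (f z)))"
proof (rule continuous_on_compose2[OF rate_cont])
  assume f: "continuous_on A f" and A: "\<And>z. z \<in> A \<Longrightarrow> fst (f z) \<in> pdisk"
  show "continuous_on A (\<lambda>z. \<Phi> (f z))" using continuous_on_compose2[OF \<Phi>_cont[of UNIV] f] by simp
  show "(\<lambda>z. \<Phi> (f z)) ` A \<subseteq> pdisk"
  proof
    fix y assume "y \<in> (\<lambda>z. \<Phi> (f z)) ` A"
    then obtain z where z: "z \<in> A" "y = \<Phi> (f z)" by blast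
    show "y \<in> pdisk" using \<Phi>_pdisk[OF A[OF z(1)], of "snd (f z)"] z(2) by simp
  qed
qed

lemma Wc:
  assumes x: "x \<in> pdisk"
  shows Wc_deriv: "(Wc x has_vector_derivative rate (\<Phi> (x, t))) (at t)" and Wc_0: "Wc x 0 = 0"
proof -
  let ?g = "\<lambda>t. rate (\<Phi> (x, t))"
  have "continuous_on UNIV ?g" by (rule rate_\<Phi>_cont) (use x in "auto intro!: continuous_intros")
  from antiderivative_exists[OF this, of 0] obtain H where H: "H 0 = 0" "\<And>t. (H has_vector_derivative ?g t) (at t)" by blast
  have "Wc x = H"
  proof
    fix t
    have "((\<lambda>a. of_real t * ?g (a * t)) has_integral (H (1 * t) - H (0 * t))) {0..1}"
    proof (rule fundamental_theorem_of_calculus)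
      fix s :: real
      have "((\<lambda>a. a * t) has_vector_derivative t) (at s within {0..1})" by (auto intro!: derivative_eq_intros)
      from vector_diff_chain_within[OF this has_vector_derivative_at_within[OF H(2)]]
      show "((\<lambda>a. H (a * t)) has_vector_derivative of_real t * ?g (s * t)) (at s within {0..1})" by (simp add: o_def scaleR_conv_of_real)
    qed simp
    then show "Wc x t = H t" unfolding Wc_def using H(1) by (simp add: integral_unique)
  qed
  then show "(Wc x has_vector_derivative ?g t) (at t)" "Wc x 0 = 0" using H by auto
qed

lemma Wc_cont: "continuous_on (pdisk \<times> UNIV) (\<lambda>z. Wc (fst z) (snd z))"
proof -
  have "continuous_on (pdisk \<times> UNIV) (\<lambda>z. integral (cbox 0 1) (\<lambda>s. of_real (snd z) * rate (\<Phi> (fst z, s * snd z))))"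
  proof (rule integral_continuous_on_param)
    show "continuous_on ((pdisk \<times> UNIV) \<times> cbox 0 1) (\<lambda>(z, s). of_real (snd z) * rate (\<Phi> (fst z, s * snd z)))"
      unfolding case_prod_unfold by (intro continuous_on_mult rate_\<Phi>_cont continuous_on_of_real) (auto intro!: continuous_intros)
  qed
  then show ?thesis by (simp add: Wc_def cbox_interval)
qed

lemma cx_flow:
  assumes x: "x \<in> pdisk" shows "cx (\<Phi> (x, t)) = cx x * exp (Wc x t)"
proof -
  have d: "((\<lambda>t. cx (\<Phi> (x, t)) * exp (- Wc x t)) has_vector_derivative 0) (at t)" for t
  proof -
    have "((exp \<circ> (\<lambda>t. - Wc x t)) has_vector_derivative (- rate (\<Phi> (x, t))) * exp (- Wc x t)) (at t)"
      by (intro field_vector_diff_chain_at has_vector_derivative_minus Wc_deriv[OF x] DERIV_exp)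
    then have "((\<lambda>t. exp (- Wc x t)) has_vector_derivative (- rate (\<Phi> (x, t))) * exp (- Wc x t)) (at t)" by (simp add: o_def)
    from has_vector_derivative_mult[OF has_vector_derivative_cx[OF \<Phi>d[of x t]] this]
    show ?thesis using \<Phi>_pdisk[OF x, of t] by simp
  qed
  obtain c where c: "\<And>t. cx (\<Phi> (x, t)) * exp (- Wc x t) = c"
    using has_vector_derivative_zero_constant[of UNIV "\<lambda>t. cx (\<Phi> (x, t)) * exp (- Wc x t)"] d by auto
  have "c = cx x" using c[of 0] by (simp add: Wc_0[OF x])
  then have "cx (\<Phi> (x, t)) * (exp (- Wc x t) * exp (Wc x t)) = cx x * exp (Wc x t)" using c[of t] by (metis mult.assoc)
  then show ?thesis by (simp add: exp_minus)
qed

lemma Wc_add: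
  assumes x: "x \<in> pdisk" shows "Wc x (s + t) = Wc x s + Wc (\<Phi> (x, s)) t"
proof -
  note y = \<Phi>_pdisk[OF x, of s]
  have d: "((\<lambda>t. Wc x (s + t) - Wc (\<Phi> (x, s)) t) has_vector_derivative 0) (at t)" for t
  proof -
    have "((\<lambda>t. s + t) has_vector_derivative 1) (at t)" by (auto intro!: derivative_eq_intros)
    from has_vector_derivative_diff[OF vector_diff_chain_at[OF this Wc_deriv[OF x]] Wc_deriv[OF y]]
    show ?thesis by (simp add: o_def \<Phi>_add)
  qed
  obtain c where c: "\<And>t. Wc x (s + t) - Wc (\<Phi> (x, s)) t = c"
    using has_vector_derivative_zero_constant[of UNIV "\<lambda>t. Wc x (s + t) - Wc (\<Phi> (x, s)) t"] d by auto
  from c[of 0] c[of t] show ?thesis by (simp add: Wc_0[OF y] algebra_simps)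
qed

text \<open>The signed angle swept about the centre between the times \<open>0\<close> and
  \<open>t\<close>.\<close>

definition W :: "real^2 \<Rightarrow> real \<Rightarrow> real" where "W x t = Im (Wc x t)"

lemma W_0: "x \<in> pdisk \<Longrightarrow> W x 0 = 0" by (simp add: W_def Wc_0)

lemma W_add: "x \<in> pdisk \<Longrightarrow> W x (s + t) = W x s + W (\<Phi> (x, s)) t" by (simp add: W_def Wc_add)

lemma W_cont: "continuous_on A f \<Longrightarrow> continuous_on A g \<Longrightarrow> (\<And>z. z \<in> A \<Longrightarrow> f z \<in> pdisk) \<Longrightarrow> continuous_on A (\<lambda>z. W (f z) (g z))"
proof -
  assume f: "continuous_on A f" and g: "continuous_on A g" and A: "\<And>z. z \<in> A \<Longrightarrow> f z \<in> pdisk"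
  have "(\<lambda>z. (f z, g z)) ` A \<subseteq> pdisk \<times> UNIV" using A by (simp add: image_subset_iff)
  from continuous_on_compose2[OF Wc_cont continuous_on_Pair[OF f g] this]
  show ?thesis unfolding W_def by (intro continuous_on_Im) simp
qed

lemma turn_W: "x \<in> pdisk \<Longrightarrow> turn x (\<Phi> (x, t)) (W x t)" unfolding turn_def cx_flow W_def
  by (intro exI[of _ "exp (Re (Wc x t))"]) (simp add: exp_eq_polar)

lemma W_int_period:
  assumes x: "x \<in> pdisk" and T: "\<Phi> (x, T) = x" shows "W x (of_int k * T) = of_int k * W x T"
proof (induction k rule: int_induct[of _ 0])
  case base then show ?case using W_0[OF x] by simp
next
  case (step1 i)
  have "W x (of_int (i + 1) * T) = W x (T + of_int i * T)" by (simp add: algebra_simps)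
  also have "\<dots> = of_int (i + 1) * W x T" using W_add[OF x, of T "of_int i * T"] step1 T by (simp add: algebra_simps)
  finally show ?case .
next
  case (step2 i)
  have "W x (of_int i * T) = W x (T + of_int (i - 1) * T)" by (simp add: algebra_simps)
  then show ?case using W_add[OF x, of T "of_int (i - 1) * T"] step2 T by (simp add: algebra_simps)
qed

lemma W_per_add:
  assumes x: "x \<in> pdisk" shows "W x (of_int k * per x + s) = of_int k * W x (per x) + W x s"
  using W_add[OF x, of "of_int k * per x" s] W_int_period[OF x \<Phi>_per[OF x]] \<Phi>_multiple_period[OF \<Phi>_per[OF x]] by simp

lemma W_per_int:
  assumes x: "x \<in> pdisk" shows "\<exists>k::int. W x (per x) = 2 * pi * of_int k"
proof -
  have "x \<noteq> 0" using x by simp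
  then show ?thesis using turn_unique[OF _ turn_refl[of x], of "W x (per x)"] turn_W[OF x, of "per x"] by (simp add: \<Phi>_per[OF x])
qed

text \<open>On the circle the velocity is tangential and nonzero, so the swept angle cannot return
  to \<open>0\<close> and the winding number \<open>k\<close> is not \<open>0\<close>. If it were 2
  or more in absolute value, the angle would reach 2 pi in absolute value before the period is over,
  and the point would have returned too early.\<close>

lemma W_pt: "\<bar>W pt (per pt)\<bar> = 2 * pi"
proof -
  note P = per_pos[OF pt(3)] \<Phi>_per[OF pt(3)]
  define w where "w t = Im (rate (\<Phi> (pt, t)))" for t
  have Wd: "(W pt has_real_derivative w t) (at t)" for t unfolding w_def W_def has_real_derivative_iff_has_vector_derivative
    by (rule bounded_linear.has_vector_derivative[OF bounded_linear_Im Wc_deriv[OF pt(3)]])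
  have wnz: "w t \<noteq> 0" for t unfolding w_def
  proof (rule Im_cx_divide)
    have n: "norm (\<Phi> (pt, t)) = 1" by (rule sphere_invariant) (simp add: pt)
    then show "\<Phi> (pt, t) \<bullet> G (\<Phi> (pt, t)) = 0" using TC GF[of "\<Phi> (pt, t)"] by (simp add: TC_vector_field_def inner_commute)
  qed (use \<Phi>_pdisk[OF pt(3), of t] G_nz in auto)
  have ne: "W pt t \<noteq> 0" if t: "t > 0" for t
  proof
    assume "W pt t = 0"
    then have "W pt 0 = W pt t" using W_0[OF pt(3)] by simp
    moreover have "continuous_on {0..t} (W pt)" using Wd DERIV_isCont continuous_at_imp_continuous_on by blast
    ultimately obtain z where "DERIV (W pt) z :> 0" using Rolle[OF t, of "W pt"] Wd real_differentiable_def by (metis)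
    then show False using DERIV_unique[OF Wd] wnz by metis
  qed
  obtain k :: int where k: "W pt (per pt) = 2 * pi * of_int k" using W_per_int[OF pt(3)] by blast
  have "k \<noteq> 0" using ne[OF P(1)] k by auto
  moreover have "\<bar>k\<bar> < 2"
  proof (rule ccontr)
    assume "\<not> \<bar>k\<bar> < 2"
    then have "2 * pi * 2 \<le> 2 * pi * \<bar>of_int k\<bar>" by (intro mult_left_mono) (linarith, simp)
    then have big: "2 * pi < \<bar>W pt (per pt)\<bar>" using k pi_gt_zero by (simp add: abs_mult)
    have "continuous_on {0..per pt} (\<lambda>t. \<bar>W pt t\<bar>)" by (intro continuous_intros W_cont) (use pt in auto)
    then obtain t where t: "0 \<le> t" "t \<le> per pt" "\<bar>W pt t\<bar> = 2 * pi"
      using IVT'[of "\<lambda>t. \<bar>W pt t\<bar>" 0 "2 * pi" "per pt"] big P(1) W_0[OF pt(3)] by auto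
    then have "turn pt (\<Phi> (pt, t)) (2 * pi * of_int (if W pt t > 0 then 1 else -1))"
    proof (cases "W pt t > 0")
      case False
      then have "W pt t = 2 * pi * of_int (-1)" using t(3) by simp
      then show ?thesis using turn_W[OF pt(3), of t] False by metis
    qed (use turn_W[OF pt(3), of t] t(3) in simp)
    moreover have "norm (\<Phi> (pt, t)) = 1" by (rule sphere_invariant) (simp add: pt)
    ultimately have "\<Phi> (pt, t) = pt" using turn_0_same_norm pt by metis
    moreover have "t > 0" using t W_0[OF pt(3)] by (cases "t = 0") auto
    ultimately have "per pt \<le> t" using per_min[OF pt(3)] by blast
    then show False using t big by simp
  qed
  ultimately have "k = 1 \<or> k = -1" by arith
  then show ?thesis using k by auto
qed

text \<open>A continuous function with values in multiples of 2 pi is constant on the connected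
  punctured disk. So every orbit winds once around the centre, in the same direction as the boundary
  orbit.\<close>

lemma W_per_const: "x \<in> pdisk \<Longrightarrow> W x (per x) = W pt (per pt)"
proof -
  assume x: "x \<in> pdisk"
  have "(\<lambda>x. W x (per x)) constant_on pdisk"
  proof (rule continuous_discrete_range_constant[OF pdisk_connected])
    show "continuous_on pdisk (\<lambda>x. W x (per x))" by (intro W_cont per_cont continuous_on_id) auto
    fix x assume x: "x \<in> pdisk"
    show "\<exists>e>0. \<forall>y. y \<in> pdisk \<and> W y (per y) \<noteq> W x (per x) \<longrightarrow> e \<le> norm (W y (per y) - W x (per x))"
    proof (intro exI[of _ "2 * pi"] conjI allI impI)
      fix y assume y: "y \<in> pdisk \<and> W y (per y) \<noteq> W x (per x)"
      obtain k l :: int where k: "W x (per x) = 2 * pi * of_int k" "W y (per y) = 2 * pi * of_int l" using W_per_int x y by meson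
      then have "l - k \<noteq> 0" using y by auto
      then have "1 \<le> \<bar>of_int (l - k) :: real\<bar>" by linarith
      then have "2 * pi * 1 \<le> 2 * pi * \<bar>of_int (l - k)\<bar>" by (intro mult_left_mono) auto
      also have "\<dots> = norm (W y (per y) - W x (per x))" unfolding k by (simp add: abs_mult flip: right_diff_distrib)
      finally show "2 * pi \<le> norm (W y (per y) - W x (per x))" by simp
    qed simp
  qed
  then show ?thesis using x pt(3) unfolding constant_on_def by metis
qed

text \<open>Times leading from \<open>x\<close> to \<open>y\<close> differ by multiples of the
  period, and each period changes the swept angle by 2 pi in absolute value. Prescribing the angle
  \<open>l\<close> singles out one time, provided that the triple belongs to
  \<open>Rel\<close>.\<close>

definition shift :: "real^2 \<Rightarrow> real^2 \<Rightarrow> real \<Rightarrow> real" where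
  "shift x y l = (THE a. \<Phi> (x, a) = y \<and> W x a = l)"

definition Rel :: "((real^2) \<times> (real^2) \<times> real) set" where
  "Rel = {(x, y, l). x \<in> pdisk \<and> (\<exists>t. \<Phi> (x, t) = y) \<and> turn x y l}"

lemma shift_unique:
  assumes x: "x \<in> pdisk" and "\<Phi> (x, a) = \<Phi> (x, b)" "W x a = W x b" shows "a = b"
proof -
  have "\<Phi> (x, a - b) = \<Phi> (\<Phi> (x, a), - b)" by (simp add: \<Phi>_add)
  also have "\<dots> = x" using assms(2) by (simp add: \<Phi>_add)
  finally obtain k :: int where k: "a - b = of_int k * per x" using \<Phi>_eq_iff[OF x] by blast
  then have "W x a = of_int k * W x (per x) + W x b" using W_per_add[OF x, of k b] by (simp add: algebra_simps)
  then have "k = 0" using assms(3) W_per_const[OF x] W_pt by auto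
  with k show ?thesis by simp
qed

lemma shift_ex:
  assumes "(x, y, l) \<in> Rel" shows "\<exists>a. \<Phi> (x, a) = y \<and> W x a = l"
proof -
  from assms obtain t where x: "x \<in> pdisk" and t: "\<Phi> (x, t) = y" "turn x y l" by (auto simp: Rel_def)
  have "x \<noteq> 0" using x by simp
  obtain k :: int where k: "l = W x t + 2 * pi * of_int k" using turn_unique[OF t(2) _ \<open>x \<noteq> 0\<close>] turn_W[OF x, of t] t(1) by auto
  define w where "w = W x (per x)"
  have w: "\<bar>w\<bar> = 2 * pi" using W_per_const[OF x] W_pt by (simp add: w_def)
  \<comment> \<open>The sign accounts for flows that run clockwise.\<close>
  define j where "j = (if w > 0 then k else - k)"
  have "w = 2 * pi \<or> w = - (2 * pi)" using w by linarith
  then have "of_int j * w = 2 * pi * of_int k" using pi_gt_zero by (auto simp: j_def)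
  then have "W x (of_int j * per x + t) = l" using W_per_add[OF x, of j t] k by (simp add: w_def)
  moreover have "\<Phi> (x, of_int j * per x + t) = y"
    using \<Phi>_multiple_period[OF \<Phi>_per[OF x], of j] \<Phi>_add[of x "of_int j * per x" t] t(1) by simp
  ultimately show ?thesis by blast
qed

lemma shift_eqI: "x \<in> pdisk \<Longrightarrow> \<Phi> (x, a) = y \<Longrightarrow> W x a = l \<Longrightarrow> shift x y l = a"
  unfolding shift_def by (rule the_equality) (auto intro: shift_unique)

lemma shift:
  assumes "(x, y, l) \<in> Rel" shows \<Phi>_shift: "\<Phi> (x, shift x y l) = y" and W_shift: "W x (shift x y l) = l"
proof -
  have x: "x \<in> pdisk" using assms by (simp add: Rel_def)
  obtain a where "\<Phi> (x, a) = y \<and> W x a = l" using shift_ex[OF assms] by blast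
  then show "\<Phi> (x, shift x y l) = y" "W x (shift x y l) = l" using shift_eqI[OF x] by auto
qed

text \<open>Convergent triples have bounded shift times, since a bounded angle allows only a bounded
  number of periods. Every accumulation point of the times satisfies the two equations that
  characterise the limit.\<close>

lemma shift_cont: "continuous_on Rel (\<lambda>(x, y, l). shift x y l)" unfolding continuous_on_sequentially
proof (intro allI ballI impI, elim conjE)
  fix Z z assume z: "z \<in> Rel" and Z: "\<forall>n. Z n \<in> Rel" and lim: "Z \<longlonglongrightarrow> z"
  obtain x y l where zz: "z = (x, y, l)" by (cases z) auto
  define X where "X n = fst (Z n)" for n
  define Y where "Y n = fst (snd (Z n))" for n
  define Ls where "Ls n = snd (snd (Z n))" for n
  have Zn: "Z n = (X n, Y n, Ls n)" for n by (simp add: X_def Y_def Ls_def)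
  have R: "(X n, Y n, Ls n) \<in> Rel" for n using Z Zn by metis
  have X: "X \<longlonglongrightarrow> x" "Y \<longlonglongrightarrow> y" "Ls \<longlonglongrightarrow> l"
    unfolding X_def Y_def Ls_def using tendsto_fst[OF lim] tendsto_fst[OF tendsto_snd[OF lim]] tendsto_snd[OF tendsto_snd[OF lim]] by (simp_all add: zz)
  have xp: "x \<in> pdisk" "X n \<in> pdisk" for n using z R[of n] by (auto simp: zz Rel_def)
  define a where "a n = shift (X n) (Y n) (Ls n)" for n
  define K where "K = insert x (range X)"
  have K: "compact K" "K \<subseteq> pdisk" unfolding K_def using compact_sequence_with_limit[OF X(1)] xp by auto
  obtain Pm where Pm: "\<And>u. u \<in> K \<Longrightarrow> \<bar>per u\<bar> \<le> Pm"
    using compact_imp_bounded[OF compact_continuous_image[OF continuous_on_subset[OF per_cont K(2)] K(1)]] by (auto simp: bounded_iff)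
  have "compact ((\<lambda>u. W (fst u) (snd u)) ` (K \<times> {0..Pm}))"
    by (intro compact_continuous_image W_cont compact_Times K(1) continuous_intros) (use K in auto)
  then obtain B where B: "\<And>u s. u \<in> K \<Longrightarrow> 0 \<le> s \<Longrightarrow> s \<le> Pm \<Longrightarrow> \<bar>W u s\<bar> \<le> B"
    using compact_imp_bounded by (fastforce simp: bounded_iff)
  have "Bseq Ls" using X(3) convergentI convergent_imp_Bseq by blast
  then obtain Bl where Bl: "\<And>n. \<bar>Ls n\<bar> \<le> Bl" unfolding Bseq_def by auto
  \<comment> \<open>A shift time is a number of full periods, each turning by 2 pi, and a rest
    within one period, which turns by at most \<open>B\<close>; the total angle is at most
    \<open>Bl\<close>.\<close>
  define N where "N = (\<bar>(Bl + B) / (2 * pi)\<bar> + 1) * Pm"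
  have aN: "\<bar>a n\<bar> \<le> N" for n
  proof -
    define k where "k = \<lfloor>a n / per (X n)\<rfloor>"
    define s where "s = a n - of_int k * per (X n)"
    have P: "per (X n) > 0" "per (X n) \<le> Pm" using per_pos[OF xp(2)] Pm[of "X n"] by (auto simp: K_def)
    have "of_int k \<le> a n / per (X n)" "a n / per (X n) < of_int k + 1" unfolding k_def by linarith+
    then have s: "0 \<le> s" "s < per (X n)" unfolding s_def using P by (auto simp: field_simps)
    have "Ls n = of_int k * W (X n) (per (X n)) + W (X n) s" using W_per_add[OF xp(2), of n k s] W_shift[OF R[of n]] by (simp add: a_def s_def)
    then have "\<bar>of_int k * W (X n) (per (X n))\<bar> \<le> Bl + B" using Bl[of n] B[of "X n" s] s P by (auto simp: K_def)
    then have "\<bar>of_int k :: real\<bar> * (2 * pi) \<le> Bl + B" using W_per_const[OF xp(2)] W_pt by (simp add: abs_mult)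
    then have "\<bar>of_int k :: real\<bar> \<le> (Bl + B) / (2 * pi)" by (simp add: field_simps)
    then have k: "\<bar>of_int k :: real\<bar> \<le> \<bar>(Bl + B) / (2 * pi)\<bar>" by linarith
    have "\<bar>a n\<bar> \<le> \<bar>of_int k\<bar> * per (X n) + per (X n)"
      using s P abs_triangle_ineq[of "of_int k * per (X n)" s] by (simp add: s_def abs_mult)
    also have "\<dots> = (\<bar>of_int k\<bar> + 1) * per (X n)" by (simp add: algebra_simps)
    also have "\<dots> \<le> N" unfolding N_def using k P by (intro mult_mono) auto
    finally show ?thesis .
  qed
  have sub: "b = shift x y l" if r: "strict_mono (r :: nat \<Rightarrow> nat)" and b: "(a \<circ> r) \<longlonglongrightarrow> b" for r b
  proof -
    have Xr: "(\<lambda>n. X (r n)) \<longlonglongrightarrow> x" "(\<lambda>n. Y (r n)) \<longlonglongrightarrow> y" "(\<lambda>n. Ls (r n)) \<longlonglongrightarrow> l" "(\<lambda>n. a (r n)) \<longlonglongrightarrow> b"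
      using X[THEN LIMSEQ_subseq_LIMSEQ[OF _ r]] b by (auto simp: o_def)
    have "(\<lambda>n. \<Phi> (X (r n), a (r n))) \<longlonglongrightarrow> \<Phi> (x, b)"
      by (rule continuous_on_tendsto_compose[OF \<Phi>_cont[of UNIV]]) (auto intro!: tendsto_Pair Xr)
    then have "\<Phi> (x, b) = y" using LIMSEQ_unique[OF _ Xr(2)] \<Phi>_shift[OF R] by (simp add: a_def)
    moreover have "(\<lambda>n. W (fst (X (r n), a (r n))) (snd (X (r n), a (r n)))) \<longlonglongrightarrow> W (fst (x, b)) (snd (x, b))"
      by (rule continuous_on_tendsto_compose[OF W_cont[of "pdisk \<times> UNIV" fst snd]]) (use xp in "auto intro!: tendsto_Pair Xr continuous_intros")
    then have "W x b = l" using LIMSEQ_unique[OF _ Xr(3)] W_shift[OF R] by (simp add: a_def)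
    ultimately show ?thesis using shift_eqI[OF xp(1)] by simp
  qed
  have "a \<longlonglongrightarrow> shift x y l"
  proof (rule ccontr)
    assume "\<not> ?thesis"
    then have "\<exists>e>0. \<forall>m. \<exists>n\<ge>m. \<not> dist (a n) (shift x y l) < e" unfolding lim_sequentially by blast
    then obtain e where e: "e > 0" "\<And>m. \<exists>n\<ge>m. \<not> dist (a n) (shift x y l) < e" by blast
    then have "infinite {n. \<not> dist (a n) (shift x y l) < e}" unfolding infinite_nat_iff_unbounded_le by simp
    from infinite_enumerate[OF this] obtain r where r: "strict_mono (r :: nat \<Rightarrow> nat)" "\<forall>n. r n \<in> {n. \<not> dist (a n) (shift x y l) < e}"
      by (elim exE conjE)
    have "\<And>n. (a \<circ> r) n \<in> {-N..N}" using aN by (auto simp: abs_le_iff minus_le_iff)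
    then obtain b r' where b: "strict_mono (r' :: nat \<Rightarrow> nat)" "((a \<circ> r) \<circ> r') \<longlonglongrightarrow> b"
      using compact_imp_seq_compact[OF compact_Icc[of "-N" N], unfolded seq_compact_def, rule_format, of "a \<circ> r"] by blast
    have "b = shift x y l" using sub[of "r \<circ> r'" b] r b by (simp add: strict_mono_o o_assoc)
    then obtain n where "dist (a (r (r' n))) (shift x y l) < e" using metric_LIMSEQ_D[OF b(2) e(1)] by (auto simp: o_def)
    then show False using r(2) by simp
  qed
  then show "((\<lambda>(x, y, l). shift x y l) \<circ> Z) \<longlonglongrightarrow> (case z of (x, y, l) \<Rightarrow> shift x y l)"
    by (simp add: zz o_def Zn a_def[abs_def])
qed

text \<open>\<open>W pt\<close> takes arbitrarily large positive and negative values at multiples of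
  the period, hence every value, and a point of the unit circle is determined by its
  argument.\<close>

lemma sphere_orbit:
  assumes "norm x = 1" shows "\<exists>t. \<Phi> (pt, t) = x"
proof -
  obtain l where l: "cx x = cis l" using assms by (metis complex_norm_eq_1_exp cis_conv_exp norm_cx)
  have x0: "turn pt x l" unfolding turn_def by (intro exI[of _ 1]) (simp add: l pt)
  define w where "w = W pt (per pt)"
  define k where "k = \<lceil>\<bar>l\<bar> / (2 * pi)\<rceil>"
  have "\<bar>l\<bar> / (2 * pi) \<le> of_int k" by (simp add: k_def)
  then have k: "\<bar>l\<bar> \<le> 2 * pi * of_int k" by (simp add: field_simps)
  have Wk: "W pt (of_int k * per pt) = of_int k * w" "W pt (of_int (- k) * per pt) = - (of_int k * w)"
    using W_int_period[OF pt(3) \<Phi>_per[OF pt(3)], of k] W_int_period[OF pt(3) \<Phi>_per[OF pt(3)], of "-k"] by (simp_all add: w_def)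
  have "connected (range (W pt))" by (intro connected_continuous_image connected_UNIV W_cont continuous_intros) (use pt in auto)
  moreover have "of_int k * w \<in> range (W pt)" "- (of_int k * w) \<in> range (W pt)" using Wk by (metis rangeI)+
  moreover have "w = 2 * pi \<or> w = - (2 * pi)" using W_pt by (simp add: w_def) linarith
  then have "of_int k * w = 2 * pi * of_int k \<or> of_int k * w = - (2 * pi * of_int k)" by auto
  then have "(- (of_int k * w) \<le> l \<and> l \<le> of_int k * w) \<or> (of_int k * w \<le> l \<and> l \<le> - (of_int k * w))" using k by linarith
  ultimately have "l \<in> range (W pt)" unfolding connected_iff_interval by meson
  then obtain t where t: "W pt t = l" by auto
  then obtain r where r: "r > 0" "cx (\<Phi> (pt, t)) = of_real r * cis l" using turn_W[OF pt(3), of t] by (auto simp: turn_def pt)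
  have "norm (\<Phi> (pt, t)) = 1" by (rule sphere_invariant) (simp add: pt)
  then have "norm (cx (\<Phi> (pt, t))) = 1" by simp
  then have "r = 1" unfolding r(2) using r(1) by (simp add: norm_mult)
  then have "cx (\<Phi> (pt, t)) = cx x" using r l by simp
  then show ?thesis by (intro exI[of _ t]) simp
qed

lemma per_sphere:
  assumes "norm x = 1" shows "\<Phi> (x, of_int k * per pt) = x"
proof -
  obtain t where t: "\<Phi> (pt, t) = x" using sphere_orbit[OF assms] by blast
  have "\<Phi> (x, of_int k * per pt) = \<Phi> (\<Phi> (pt, of_int k * per pt), t)" unfolding t[symmetric] by (simp add: \<Phi>_add add.commute)
  then show ?thesis using t \<Phi>_multiple_period[OF \<Phi>_per[OF pt(3)]] by simp
qed

end

section \<open>Orbit-preserving maps as shifts\<close>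

lemma discrete_valued_constant:
  fixes d :: "'a::topological_space \<Rightarrow> real"
  assumes C: "connected C" and dc: "continuous_on C d" and dint: "\<And>x. x \<in> C \<Longrightarrow> \<exists>k::int. d x = 2 * pi * of_int k"
    and x: "x \<in> C" "x0 \<in> C"
  shows "d x = d x0"
proof -
  have "d constant_on C"
  proof (rule continuous_discrete_range_constant[OF C dc])
    fix x assume x: "x \<in> C"
    show "\<exists>e>0. \<forall>y. y \<in> C \<and> d y \<noteq> d x \<longrightarrow> e \<le> norm (d y - d x)"
    proof (intro exI[of _ "2 * pi"] conjI allI impI)
      fix y assume y: "y \<in> C \<and> d y \<noteq> d x"
      obtain k j :: int where k: "d x = 2 * pi * of_int k" "d y = 2 * pi * of_int j" using dint x y by meson
      then have "j - k \<noteq> 0" using y by auto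
      then have "1 \<le> \<bar>of_int (j - k) :: real\<bar>" by linarith
      then have "2 * pi * 1 \<le> 2 * pi * \<bar>of_int (j - k)\<bar>" by (intro mult_left_mono) auto
      also have "\<dots> = norm (d y - d x)" unfolding k by (simp add: abs_mult flip: right_diff_distrib)
      finally show "2 * pi \<le> norm (d y - d x)" by simp
    qed simp
  qed
  then show ?thesis using x unfolding constant_on_def by metis
qed

text \<open>For \<open>p\<close> near \<open>p0\<close> the tube lemma puts
  \<open>q p x / q p0 x\<close> into the right half plane for all \<open>x\<close> in the compact
  set. There \<open>l p\<close> equals \<open>l p0\<close> plus the principal argument of this
  quotient, since the difference is a constant multiple of 2 pi that is too small at
  \<open>x0\<close> to be nonzero; and this expression is jointly continuous.\<close>

lemma lift_family_continuous:
  fixes q :: "'p \<Rightarrow> 'a::euclidean_space \<Rightarrow> complex" and l :: "'p \<Rightarrow> 'a \<Rightarrow> real"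
  assumes C: "compact C" "connected C" "x0 \<in> C" and q: "Ck 0 T C q"
    and nz: "\<And>p x. p \<in> topspace T \<Longrightarrow> x \<in> C \<Longrightarrow> q p x \<noteq> 0"
    and lc: "\<And>p. p \<in> topspace T \<Longrightarrow> continuous_on C (l p)"
    and arg: "\<And>p x. p \<in> topspace T \<Longrightarrow> x \<in> C \<Longrightarrow> q p x = of_real (norm (q p x)) * cis (l p x)"
    and base: "continuous_map T euclideanreal (\<lambda>p. l p x0)"
  shows "Ck 0 T C l" unfolding Ck.simps
proof (rule continuous_map_openin_cover)
  fix p0 x1 assume p0: "p0 \<in> topspace T" and x1: "x1 \<in> C"
  have q0: "Ck 0 T C (\<lambda>_. q p0)" by (rule Ck_restrict[OF q]) (use p0 in "auto simp: continuous_map_const")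
  then have q0c: "continuous_on C (q p0)"
  proof -
    have "continuous_map (top_of_set C) (prod_topology T (top_of_set C)) (\<lambda>x. (p0, x))"
      using p0 by (simp add: continuous_map_paired continuous_map_const)
    from continuous_map_compose[OF this q[unfolded Ck.simps]] show ?thesis by (simp add: o_def)
  qed
  have rat: "Ck 0 T C (\<lambda>p x. q p x * inverse (q p0 x))" by (rule C0_comp2[OF q C0_comp_on[OF q0, of "- {0}" inverse], where h = times])
      (use nz p0 in "auto intro!: continuous_intros")
  define Wr where "Wr = {z \<in> topspace (prod_topology T (top_of_set C)). q (fst z) (snd z) * inverse (q p0 (snd z)) \<in> {w. Re w > 0}}"
  have W: "openin (prod_topology T (top_of_set C)) Wr" unfolding Wr_def
    by (rule openin_continuous_map_preimage[OF rat[unfolded Ck.simps]]) (auto intro!: open_halfspace_Re_gt)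
  have sub: "{p0} \<times> C \<subseteq> Wr"
  proof
    fix z assume "z \<in> {p0} \<times> C"
    then obtain x where x: "z = (p0, x)" "x \<in> C" by blast
    have "q p0 x * inverse (q p0 x) = 1" using nz[OF p0 x(2)] by (rule right_inverse)
    then have "0 < Re (q p0 x * inverse (q p0 x))" by (simp only: one_complex.sel zero_less_one)
    then show "z \<in> Wr" using x p0 unfolding Wr_def by (simp del: times_complex.sel inverse_complex.sel)
  qed
  have WrD: "Re (q p x * inverse (q p0 x)) > 0" if "(p, x) \<in> Wr" for p x using that unfolding Wr_def by (simp only: mem_Collect_eq fst_conv snd_conv)
  have c: "compactin T {p0}" "compactin (top_of_set C) C" using p0 C(1) by (auto simp: compactin_subtopology)
  obtain Q V where Q: "openin T Q" "{p0} \<subseteq> Q" "C \<subseteq> V" "Q \<times> V \<subseteq> Wr"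
    by (rule Wallace_theorem_prod_topology[OF c W sub]) (rule that)
  \<comment> \<open>Together with the bound pi on \<open>Arg\<close>, the radius pi keeps the
    difference at \<open>x0\<close> strictly below 2 pi.\<close>
  define Q' where "Q' = Q \<inter> {p \<in> topspace T. l p x0 \<in> ball (l p0 x0) pi}"
  have Q': "openin T Q'" unfolding Q'_def using Q(1) openin_continuous_map_preimage[OF base, of "ball (l p0 x0) pi"] by auto
  have Q'T: "Q' \<subseteq> topspace T" by (auto simp: Q'_def)
  have re: "Re (q p x * inverse (q p0 x)) > 0" if "p \<in> Q'" "x \<in> C" for p x by (rule WrD) (use Q that in "auto simp: Q'_def")
  have arg_c: "continuous_on {w. Re w > 0} Arg" by (intro continuous_at_imp_continuous_on ballI continuous_at_Arg) (auto simp: complex_nonpos_Reals_iff)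
  have eq: "l p x = l p0 x + Arg (q p x * inverse (q p0 x))" if p: "p \<in> Q'" and x: "x \<in> C" for p x
  proof -
    have pT: "p \<in> topspace T" using p Q'T by blast
    define d where "d x = l p x - l p0 x - Arg (q p x * inverse (q p0 x))" for x
    have qpc: "continuous_on C (q p)"
    proof -
      have "continuous_map (top_of_set C) (prod_topology T (top_of_set C)) (\<lambda>x. (p, x))"
        using pT by (simp add: continuous_map_paired continuous_map_const)
      from continuous_map_compose[OF this q[unfolded Ck.simps]] show ?thesis by (simp add: o_def)
    qed
    have dc: "continuous_on C d" unfolding d_def by (intro continuous_intros lc pT p0 continuous_on_compose2[OF arg_c] qpc q0c) (use nz p0 re[OF p] in auto)
    have sg: "sgn z = cis m" if "z \<noteq> 0" "z = of_real (norm z) * cis m" for z m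
    proof -
      have "sgn z = z / of_real (norm z)" by (simp add: sgn_div_norm scaleR_conv_of_real divide_inverse mult.commute)
      also have "\<dots> = of_real (norm z) * cis m / of_real (norm z)" by (subst that(2)) (rule refl)
      also have "\<dots> = cis m" using that(1) by simp
      finally show ?thesis .
    qed
    have dint: "\<exists>k::int. d x = 2 * pi * of_int k" if x: "x \<in> C" for x
    proof -
      have z: "q p x * inverse (q p0 x) \<noteq> 0" using nz pT p0 x by simp
      have "cis (Arg (q p x * inverse (q p0 x))) = sgn (q p x * inverse (q p0 x))" using z by (rule cis_Arg)
      also have "\<dots> = sgn (q p x) * inverse (sgn (q p0 x))" by (simp add: sgn_mult sgn_inverse)
      also have "\<dots> = cis (l p x) * inverse (cis (l p0 x))" using sg[OF nz[OF pT x] arg[OF pT x]] sg[OF nz[OF p0 x] arg[OF p0 x]] by (simp only:)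
      also have "\<dots> = cis (l p x - l p0 x)" by (simp only: cis_divide[symmetric] divide_inverse)
      finally have *: "cis (Arg (q p x * inverse (q p0 x))) = cis (l p x - l p0 x)" .
      have "cis (d x) = cis (l p x - l p0 x) / cis (Arg (q p x * inverse (q p0 x)))" unfolding d_def by (simp only: cis_divide)
      then have "cis (d x) = cis 0" unfolding * by simp
      from cis_eq_imp[OF this] show ?thesis by simp
    qed
    have "d x = d x0" by (rule discrete_valued_constant[OF C(2) dc _ x C(3)]) (rule dint)
    moreover have "d x0 = 0"
    proof -
      obtain k :: int where k: "d x0 = 2 * pi * of_int k" using dint C(3) by blast
      have "\<bar>l p x0 - l p0 x0\<bar> < pi" using p by (simp add: Q'_def dist_real_def abs_minus_commute)
      then have "\<bar>d x0\<bar> < 2 * pi" using Arg_bounded[of "q p x0 * inverse (q p0 x0)"] unfolding d_def by linarith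
      then have "2 * pi * \<bar>of_int k :: real\<bar> < 2 * pi * 1" unfolding k abs_mult by simp
      then have "\<bar>of_int k :: real\<bar> < 1" by (rule mult_left_less_imp_less) simp
      then have "k = 0" by linarith
      with k show ?thesis by simp
    qed
    ultimately show ?thesis by (simp add: d_def)
  qed
  have QT: "topspace (subtopology T Q') = Q'" unfolding topspace_subtopology using Q'T by (rule Int_absorb1)
  have s: "continuous_map (subtopology T Q') T id" by (simp add: continuous_map_from_subtopology)
  have "Ck 0 (subtopology T Q') C (\<lambda>p x. l p0 x + Arg (q p x * inverse (q p0 x)))"
  proof (intro Ck_add)
    have "Cn 0 C (l p0)" using lc[OF p0] by (simp add: Cn_0_iff)
    then show "Ck 0 (subtopology T Q') C (\<lambda>p. l p0)" by (rule Cn_Ck)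
    show "Ck 0 (subtopology T Q') C (\<lambda>p x. Arg (q p x * inverse (q p0 x)))"
      by (rule C0_comp_on[OF Ck_param[OF rat s, unfolded id_apply] arg_c]) (use re QT in auto)
  qed
  then have "Ck 0 (subtopology T Q') C l" by (rule Ck_cong) (use eq QT in auto)
  then show "\<exists>Q W. openin T Q \<and> openin (top_of_set C) W \<and> p0 \<in> Q \<and> x1 \<in> W \<and>
      continuous_map (prod_topology (subtopology T Q) (top_of_set W)) euclidean (\<lambda>z. l (fst z) (snd z))"
    using Q' Q(2) x1 p0 by (intro exI[of _ Q'] exI[of _ C]) (auto simp: Q'_def Ck.simps)
qed

text \<open>The derivative is bound explicitly, so that the condition includes differentiability and
  can be transported along local equality, composition and inversion.\<close>

definition pos0 :: "(real^2 \<Rightarrow> real^2) \<Rightarrow> bool" where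
  "pos0 f \<longleftrightarrow> (\<exists>A. (f has_derivative A) (at 0) \<and> det (matrix A) > 0)"

lemma pos0_cong:
  assumes "pos0 f" "open U" "0 \<in> U" "\<And>x. x \<in> U \<Longrightarrow> f x = g x" shows "pos0 g"
  using assms has_derivative_transform_within_open[of f _ 0 UNIV U g] unfolding pos0_def by blast

lemma pos0_jacobian:
  assumes "f differentiable (at 0)" shows "pos0 f \<longleftrightarrow> det (jacobian f (at 0)) > 0"
proof -
  have d: "(f has_derivative frechet_derivative f (at 0)) (at 0)" using assms frechet_derivative_works by blast
  show ?thesis unfolding pos0_def jacobian_def using d has_derivative_unique by blast
qed

lemma pos0_compose:
  assumes "pos0 f" "pos0 g" "g 0 = 0" shows "pos0 (\<lambda>x. f (g x))"
proof -
  obtain A B where A: "(f has_derivative A) (at 0)" "det (matrix A) > 0" and B: "(g has_derivative B) (at 0)" "det (matrix B) > 0"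
    using assms unfolding pos0_def by blast
  have "((\<lambda>x. f (g x)) has_derivative (\<lambda>v. A (B v))) (at 0)" using has_derivative_compose[OF B(1), of f A] A(1) assms(3) by simp
  moreover have "matrix (\<lambda>v. A (B v)) = matrix A ** matrix B"
    using matrix_compose[OF has_derivative_linear[OF B(1)] has_derivative_linear[OF A(1)]] by (simp add: o_def)
  ultimately show ?thesis unfolding pos0_def using A(2) B(2) by (auto simp: det_mul)
qed

lemma pos0_id: "pos0 (\<lambda>x. x)" unfolding pos0_def by (intro exI[of _ "\<lambda>x. x"]) (simp add: matrix_id_mat_1 flip: id_def)

lemma smooth_on_subset: "smooth_on S f \<Longrightarrow> S' \<subseteq> S \<Longrightarrow> smooth_on S' f" unfolding smooth_on_def by blast

lemma smooth_on_differentiable: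
  assumes "smooth_on U f" "open U" "x \<in> U" shows "f differentiable (at x)"
proof -
  have "Cn (Suc 0) U f" by (rule smooth_on_Cn) fact
  then obtain E where "(f has_derivative E) (at x within U)" unfolding Cn_Suc_iff using assms(3) by blast
  then show ?thesis using at_within_open[OF assms(3,2)] by (auto simp: differentiable_def)
qed

lemma smooth_on_openI: "open U \<Longrightarrow> (\<And>k. Cn k U f) \<Longrightarrow> smooth_on U f"
  unfolding smooth_on_iff by (intro exI[of _ U] exI[of _ f]) auto

lemma local_diffeo_differentiable: "local_diffeo_at h x \<Longrightarrow> h differentiable (at x)"
  unfolding local_diffeo_at_def using smooth_on_differentiable by blast

lemma local_diffeo_smaller:
  assumes "local_diffeo_at h x" "open N" "x \<in> N"
  shows "\<exists>U V k. open U \<and> x \<in> U \<and> U \<subseteq> N \<and> open V \<and> homeomorphism U V h k \<and> smooth_on U h \<and> smooth_on V k"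
proof -
  obtain U V k where U: "open U" "x \<in> U" "open V" "homeomorphism U V h k" "smooth_on U h" "smooth_on V k"
    using assms(1) unfolding local_diffeo_at_def by blast
  have "openin (top_of_set V) (h ` (U \<inter> N))" by (rule homeomorphism_imp_open_map[OF U(4)]) (use assms(2) in "auto simp: openin_open")
  then have "open (h ` (U \<inter> N))" using openin_open_trans U(3) by blast
  moreover have "homeomorphism (U \<inter> N) (h ` (U \<inter> N)) h k" by (rule homeomorphism_of_subsets[OF U(4)]) auto
  moreover have "h ` (U \<inter> N) \<subseteq> V" using U(4) by (auto simp: homeomorphism_def)
  ultimately show ?thesis using U assms(2,3) by (intro exI[of _ "U \<inter> N"] exI[of _ "h ` (U \<inter> N)"] exI[of _ k]) (auto intro: smooth_on_subset)
qed

lemma smooth_on_cong: "smooth_on S f \<Longrightarrow> (\<And>x. x \<in> S \<Longrightarrow> f x = g x) \<Longrightarrow> smooth_on S g"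
  unfolding smooth_on_def by metis

lemma local_diffeo_cong:
  assumes "local_diffeo_at f x" "open N" "x \<in> N" "\<And>y. y \<in> N \<Longrightarrow> f y = g y"
  shows "local_diffeo_at g x"
proof -
  obtain U V k where U: "open U" "x \<in> U" "U \<subseteq> N" "open V" "homeomorphism U V f k" "smooth_on U f" "smooth_on V k"
    using local_diffeo_smaller[OF assms(1-3)] by blast
  have "homeomorphism U V g k" by (rule homeomorphism_cong[OF U(5)]) (use assms(4) U(3) in auto)
  moreover have "smooth_on U g" by (rule smooth_on_cong[OF U(6)]) (use assms(4) U(3) in auto)
  ultimately show ?thesis unfolding local_diffeo_at_def using U by blast
qed

lemma smooth_on_compose_open:
  assumes "smooth_on U f" "smooth_on V g" "open U" "open V" "f ` U \<subseteq> V"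
  shows "smooth_on U (\<lambda>x. g (f x))"
  by (rule smooth_on_openI[OF assms(3)], rule Cn_compose[OF smooth_on_Cn[OF assms(2)] smooth_on_Cn[OF assms(1)]]) (use assms(5) in auto)

lemma local_diffeo_compose:
  assumes f: "local_diffeo_at f x" and g: "local_diffeo_at g (f x)" shows "local_diffeo_at (\<lambda>x. g (f x)) x"
proof -
  obtain U V k where U: "open U" "x \<in> U" "open V" "homeomorphism U V f k" "smooth_on U f" "smooth_on V k" using f unfolding local_diffeo_at_def by blast
  have "f x \<in> V" using U by (auto simp: homeomorphism_def)
  then obtain U' V' k' where U': "open U'" "f x \<in> U'" "U' \<subseteq> V" "open V'" "homeomorphism U' V' g k'" "smooth_on U' g" "smooth_on V' k'"
    using local_diffeo_smaller[OF g U(3)] by blast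
  have "openin (top_of_set V) U'" by (rule open_openin_trans[OF U(3) U'(1,3)])
  then have "openin (top_of_set U) (k ` U')" by (rule homeomorphism_imp_open_map[OF homeomorphism_symD[OF U(4)]])
  then have kV: "open (k ` U')" using U(1) by (rule openin_open_trans)
  have "f (k y) = y" if "y \<in> U'" for y using homeomorphism_apply2[OF U(4)] U'(3) that by blast
  then have fk: "f ` (k ` U') = U'" by (simp add: image_image)
  have h1: "homeomorphism (k ` U') U' f k" by (rule homeomorphism_of_subsets[OF U(4)]) (use U(4) U'(3) fk in "auto simp: homeomorphism_def")
  have kU: "k ` U' \<subseteq> U" using U(4) U'(3) by (auto simp: homeomorphism_def)
  show ?thesis unfolding local_diffeo_at_def
  proof (intro exI conjI)
    show "homeomorphism (k ` U') V' (\<lambda>x. g (f x)) (\<lambda>y. k (k' y))" using homeomorphism_compose[OF h1 U'(5)] by (simp add: o_def)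
    show "x \<in> k ` U'" using U U'(2) by (metis homeomorphism_apply1 image_eqI)
    show "smooth_on (k ` U') (\<lambda>x. g (f x))" by (rule smooth_on_compose_open[OF smooth_on_subset[OF U(5) kU] U'(6) kV U'(1)]) (use fk in auto)
    show "smooth_on V' (\<lambda>y. k (k' y))" by (rule smooth_on_compose_open[OF U'(7) U(6) U'(4) U(3)]) (use U'(3,5) in "auto simp: homeomorphism_def")
  qed (use kV U'(4) in auto)
qed

lemma local_diffeo_id: "local_diffeo_at (\<lambda>x. x) x" unfolding local_diffeo_at_def
  by (intro exI[of _ UNIV] exI[of _ "\<lambda>x. x"]) (auto simp: homeomorphism_def intro: smooth_on_openI Cn_id)

context tc_flow
begin

lemma orbits_cases: "c \<in> orbits F \<longleftrightarrow> (\<exists>x\<in>disk. c = range (\<lambda>t. \<Phi> (x, t)))"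
  unfolding orbits_def using orbit_of_eq by auto

lemma E_mapsD:
  assumes h: "h \<in> E_maps F"
  shows E_Cinf: "h \<in> Cinf_disk" and E_orbit: "\<And>x. x \<in> disk \<Longrightarrow> \<exists>t. \<Phi> (x, t) = h x" and E_0: "h 0 = 0"
    and E_pdisk: "\<And>x. x \<in> pdisk \<Longrightarrow> h x \<in> pdisk" and E_local: "local_diffeo_at h 0"
proof -
  show "h \<in> Cinf_disk" "local_diffeo_at h 0" using h by (auto simp: E_maps_def)
  show *: "\<exists>t. \<Phi> (x, t) = h x" if x: "x \<in> disk" for x
  proof -
    have "h ` range (\<lambda>t. \<Phi> (x, t)) = range (\<lambda>t. \<Phi> (x, t))" using h orbits_cases[THEN iffD2, OF bexI[OF refl x]] unfolding E_maps_def by blast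
    moreover have "x \<in> range (\<lambda>t. \<Phi> (x, t))" by (rule range_eqI[of _ _ 0]) simp
    ultimately show ?thesis by (metis (mono_tags, lifting) imageI imageE)
  qed
  show "h 0 = 0" using *[of 0] by auto
  show "h x \<in> pdisk" if "x \<in> pdisk" for x using *[of x] \<Phi>_pdisk[OF that] that by (metis DiffD1)
qed

lemma E_plus_iff: "h \<in> E_plus F \<longleftrightarrow> h \<in> E_maps F \<and> pos0 h"
  unfolding E_plus_def using pos0_jacobian[OF local_diffeo_differentiable[OF E_local]] by auto

text \<open>In the time parameter of an orbit the map is
  \<open>t \<mapsto> t + b (\<Phi> (x, t))\<close>. Its displacement is bounded because the orbit is
  compact, so it is onto by the intermediate value theorem.\<close>

lemma shift_map_orbits:
  assumes b: "continuous_on pdisk b" and h: "\<And>x. x \<in> pdisk \<Longrightarrow> h x = \<Phi> (x, b x)" "h 0 = 0" and c: "c \<in> orbits F"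
  shows "h ` c = c"
proof -
  obtain x where x: "x \<in> disk" "c = range (\<lambda>t. \<Phi> (x, t))" using c orbits_cases by blast
  show ?thesis
  proof (cases "x = 0")
    case True then show ?thesis using x h(2) by simp
  next
    case False
    then have xp: "x \<in> pdisk" using x by simp
    define a where "a t = t + b (\<Phi> (x, t))" for t
    have ha: "h (\<Phi> (x, t)) = \<Phi> (x, a t)" for t using h(1)[OF \<Phi>_pdisk[OF xp]] by (simp add: \<Phi>_add a_def)
    have bc: "continuous_on A (\<lambda>t. b (\<Phi> (x, t)))" for A by (rule continuous_on_compose2[OF b \<Phi>t_cont]) (use \<Phi>_pdisk[OF xp] in auto)
    have "compact ((\<lambda>t. b (\<Phi> (x, t))) ` {0..per x})" by (intro compact_continuous_image bc) simp
    then obtain B where B: "\<And>t. 0 \<le> t \<Longrightarrow> t \<le> per x \<Longrightarrow> \<bar>b (\<Phi> (x, t))\<bar> \<le> B" using compact_imp_bounded by (fastforce simp: bounded_iff)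
    have B: "\<bar>b (\<Phi> (x, t))\<bar> \<le> B" for t using \<Phi>_mod_per[OF xp, of t] B by (metis atLeastAtMost_iff)
    have "\<exists>t. a t = s" for s
    proof -
      have "a (s - B) \<le> s" "s \<le> a (s + B)" "s - B \<le> s + B" using B[of "s - B"] B[of "s + B"] by (auto simp: a_def abs_le_iff)
      moreover have "continuous_on {s - B..s + B} a" unfolding a_def by (intro continuous_intros bc)
      ultimately show ?thesis using IVT'[of a "s - B" s "s + B"] by blast
    qed
    then have "range (\<lambda>t. \<Phi> (x, a t)) = range (\<lambda>t. \<Phi> (x, t))" by (auto simp: image_iff) metis
    then show ?thesis unfolding x(2) image_image ha .
  qed
qed

text \<open>Paired with \<open>G (f p x)\<close>, the vector equation for the shift time becomes a
  scalar one, whose time derivative at the solution is the squared length of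
  \<open>G (f p x)\<close>. The implicit function theorem raises continuity to order
  \<open>k\<close>.\<close>

lemma shift_smooth_family:
  assumes f: "Ck k T S f" and a: "Ck 0 T S a"
    and eq: "\<And>p x. p \<in> topspace T \<Longrightarrow> x \<in> S \<Longrightarrow> \<Phi> (x, a p x) = f p x"
    and S: "\<And>p x. p \<in> topspace T \<Longrightarrow> x \<in> S \<Longrightarrow> f p x \<in> pdisk"
  shows "Ck k T S a"
proof (rule implicit_Ck[where \<psi> = "\<lambda>p w. (\<Phi> w - f p (fst w)) \<bullet> G (f p (fst w))"
      and c = "\<lambda>p x. G (f p x) \<bullet> G (f p x)"])
  have "Ck k T (S \<times> UNIV) (\<lambda>p w. f p (fst w))" by (rule Ck_compose[OF f]) (auto intro: Ck_fst[OF Ck_id])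
  then show "Ck k T (S \<times> UNIV) (\<lambda>p w. (\<Phi> w - f p (fst w)) \<bullet> G (f p (fst w)))"
    by (intro Ck_inner Ck_diff Ck_compose[OF Cn_Ck[OF GC]] Ck_compose[OF Cn_Ck[OF \<Phi>C] Ck_id]) auto
  fix p x assume px: "p \<in> topspace T" "x \<in> S"
  show "((\<lambda>t. (\<Phi> (x, t) - f p (fst (x, t))) \<bullet> G (f p (fst (x, t)))) has_real_derivative G (f p x) \<bullet> G (f p x)) (at (a p x))"
    using \<Phi>_inner_deriv[of x "f p x" "G (f p x)" "a p x"] eq[OF px] by simp
  show "G (f p x) \<bullet> G (f p x) \<noteq> 0" using G_nz[OF S[OF px]] by simp
qed (use eq a in auto)

text \<open>The same scalar equation, with the sign that \<open>implicit_extension\<close> demands.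
  Off \<open>K\<close> the new function solves only the scalar equation, which suffices for an
  extension.\<close>

lemma shift_extension:
  assumes K: "compact K" "K \<noteq> {}" and U: "open U" "K \<subseteq> U" and f: "\<And>k. Cn k U f"
    and a: "continuous_on K a" and eq: "\<And>x. x \<in> K \<Longrightarrow> \<Phi> (x, a x) = f x" and p: "\<And>x. x \<in> K \<Longrightarrow> f x \<in> pdisk"
  shows "\<exists>V b. open V \<and> K \<subseteq> V \<and> (\<forall>k. Cn k V b) \<and> (\<forall>x\<in>K. b x = a x)"
proof -
  have "\<exists>V b. open V \<and> K \<subseteq> V \<and> V \<subseteq> U \<and> (\<forall>k. Cn k V b) \<and> (\<forall>x\<in>K. b x = a x) \<and>
     (\<forall>x\<in>V. - ((\<Phi> (x, b x) - f (fst (x, b x))) \<bullet> G (f (fst (x, b x)))) = 0)"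
  proof (rule implicit_extension[OF K U, where c = "\<lambda>w. - (G (\<Phi> w) \<bullet> G (f (fst w)))"])
    have "Cn k (U \<times> UNIV) (\<lambda>w. f (fst w))" for k by (rule Cn_compose[OF f]) (auto intro: Ck_fst[OF Ck_id])
    then show "Cn k (U \<times> UNIV) (\<lambda>w. - ((\<Phi> w - f (fst w)) \<bullet> G (f (fst w))))" for k
      by (intro Ck_minus Ck_inner Ck_diff Cn_compose[OF GC] Ck_subset[OF \<Phi>C]) auto
    show "((\<lambda>t. - ((\<Phi> (x, t) - f (fst (x, t))) \<bullet> G (f (fst (x, t))))) has_real_derivative - (G (\<Phi> (x, t)) \<bullet> G (f (fst (x, t))))) (at t)" for x t
      using DERIV_minus[OF \<Phi>_inner_deriv[of x "f x" "G (f x)" t]] by simp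
    have "continuous_on (U \<times> UNIV) (\<lambda>w. f (fst w))" by (rule continuous_on_compose2[OF Cn_continuous_on[OF f]]) (auto intro!: continuous_intros)
    then show "continuous_on (U \<times> UNIV) (\<lambda>w. - (G (\<Phi> w) \<bullet> G (f (fst w))))"
      by (intro continuous_intros continuous_on_compose2[OF G_cont[of UNIV]] \<Phi>_cont) auto
    fix x assume x: "x \<in> K"
    show "- (G (\<Phi> (x, a x)) \<bullet> G (f (fst (x, a x)))) < 0" using G_nz[OF p[OF x]] eq[OF x] by simp
  qed (use a eq in auto)
  then show ?thesis by blast
qed

text \<open>Outside a neighbourhood of the centre the map is given by a smooth shift, near the centre by \<open>f\<close>.\<close>

lemma shift_map_E_plus:
  assumes b: "continuous_on pdisk b" and h: "\<And>x. x \<in> pdisk \<Longrightarrow> h x = \<Phi> (x, b x)" "h 0 = 0" "h \<in> extensional disk"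
    and r: "0 < r" "r < 1"
    and U: "open U" "cball 0 r \<subseteq> U" "U \<subseteq> ball 0 1" "smooth_on U f" "\<And>x. x \<in> U \<Longrightarrow> h x = f x"
    and f: "local_diffeo_at f 0" "pos0 f"
    and V: "open V" "\<And>x. r \<le> norm x \<Longrightarrow> norm x \<le> 1 \<Longrightarrow> x \<in> V" "\<And>k. Cn k V b'"
      "\<And>x. r \<le> norm x \<Longrightarrow> norm x \<le> 1 \<Longrightarrow> b' x = b x"
  shows "h \<in> E_plus F"
proof -
  have 0: "0 \<in> U" using U(2) r by auto
  \<comment> \<open>On the overlap with \<open>U\<close> the norm lies strictly between
    \<open>r\<close> and \<open>1\<close>, where \<open>b'\<close> is \<open>b\<close>; so the two
    local formulas agree.\<close>
  define V' where "V' = V \<inter> - cball 0 r"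
  have V': "open V'" using V(1) by (auto simp: V'_def)
  define g where "g x = (if x \<in> U then f x else \<Phi> (x, b' x))" for x
  have gV: "g x = \<Phi> (x, b' x)" if "x \<in> V'" for x
  proof (cases "x \<in> U")
    case True
    then have "norm x < 1" "r < norm x" using U(3) that by (auto simp: V'_def)
    then have "x \<noteq> 0" using r by auto
    then show ?thesis using h(1)[of x] U(5)[OF True] True V(4)[of x] r \<open>norm x < 1\<close> \<open>r < norm x\<close> by (simp add: g_def)
  qed (simp add: g_def)
  have "Cn k (U \<union> V') g" for k
  proof (rule Cn_open_cover)
    fix x assume "x \<in> U \<union> V'"
    have "Cn k U g" by (rule Ck_cong[OF smooth_on_Cn[OF U(4)]]) (simp add: g_def)
    moreover have "Cn k V' (\<lambda>x. \<Phi> (x, b' x))" by (intro Cn_compose[OF \<Phi>C] Ck_Pair Ck_id Ck_subset[OF V(3)]) (auto simp: V'_def)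
    then have "Cn k V' g" by (rule Ck_cong) (simp add: gV)
    ultimately show "\<exists>W. open W \<and> x \<in> W \<and> W \<subseteq> U \<union> V' \<and> Cn k W g" using \<open>x \<in> U \<union> V'\<close> U(1) V' by blast
  qed (use U(1) V' in auto)
  moreover have "disk \<subseteq> U \<union> V'" using subsetD[OF U(2)] V(2) by (auto simp: V'_def) (meson mem_cball_0 le_cases)+
  moreover have "g x = h x" if "x \<in> disk" for x
  proof (cases "x \<in> U")
    case False
    then have "r < norm x" using subsetD[OF U(2), of x] by (meson mem_cball_0 not_le)
    then have "x \<noteq> 0" using r by auto
    with that have "x \<in> pdisk" by simp
    then show ?thesis using False V(4)[of x] h(1)[of x] \<open>r < norm x\<close> that by (simp add: g_def)
  qed (simp add: g_def U(5))
  ultimately have "smooth_on disk h" unfolding smooth_on_iff using U(1) V' by (intro exI[of _ "U \<union> V'"] exI[of _ g]) auto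
  moreover have "h x \<in> disk" if "x \<in> disk" for x using h \<Phi>_disk[OF that] that by (cases "x = 0") auto
  ultimately have "h \<in> Cinf_disk" using h(3) by (auto simp: Cinf_disk_def PiE_def)
  moreover have "local_diffeo_at h 0" by (rule local_diffeo_cong[OF f(1) U(1) 0]) (simp add: U(5))
  ultimately have "h \<in> E_maps F" using shift_map_orbits[OF b h(1,2)] by (simp add: E_maps_def)
  moreover have "pos0 h" by (rule pos0_cong[OF f(2) U(1) 0]) (simp add: U(5))
  ultimately show ?thesis by (simp add: E_plus_iff)
qed

end

section \<open>A logarithm of h x / x on the punctured disk\<close>

abbreviation "circ s \<equiv> cis (2 * pi * s)"

lemma cx_add: "cx (v + w) = cx v + cx w" and cx_scaleR: "cx (c *\<^sub>R v) = of_real c * cx v" by (simp_all add: cx_def complex_eq_iff)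

text \<open>Every real linear map of the plane is \<open>z \<mapsto> a * z + b * cnj z\<close>. A
  positive determinant means that \<open>a\<close> dominates \<open>b\<close>, so that
  \<open>b\<close> can be scaled to \<open>0\<close> through invertible maps.\<close>

lemma linear_cx_form:
  assumes A: "linear A"
  shows "\<exists>a b. (\<forall>x. cx (A x) = a * cx x + b * cnj (cx x)) \<and> (norm a)\<^sup>2 - (norm b)\<^sup>2 = det (matrix A)"
proof -
  define u v where "u = cx (A (axis 1 1))" and "v = cx (A (axis 2 1))"
  define a b where "a = (u - \<i> * v) / 2" and "b = (u + \<i> * v) / 2"
  have "cx (A x) = a * cx x + b * cnj (cx x)" for x
  proof -
    have "x = (x $ 1) *\<^sub>R axis 1 1 + (x $ 2) *\<^sub>R axis 2 1" by (simp add: vec_eq_iff forall_2 axis_def)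
    then have "A x = (x $ 1) *\<^sub>R A (axis 1 1) + (x $ 2) *\<^sub>R A (axis 2 1)" using linear_add[OF A] linear_cmul[OF A] by metis
    then have "cx (A x) = of_real (x $ 1) * u + of_real (x $ 2) * v" by (simp add: u_def v_def cx_add cx_scaleR)
    moreover have "cx x = of_real (x $ 1) + \<i> * of_real (x $ 2)" by (simp add: cx_def complex_eq_iff)
    ultimately show ?thesis by (simp add: a_def b_def complex_eq_iff field_simps)
  qed
  moreover have "(norm a)\<^sup>2 - (norm b)\<^sup>2 = det (matrix A)"
  proof -
    have "Re u = A (axis 1 1) $ 1" "Im u = A (axis 1 1) $ 2" "Re v = A (axis 2 1) $ 1" "Im v = A (axis 2 1) $ 2" by (simp_all add: u_def v_def cx_def)
    then have "det (matrix A) = Re u * Im v - Re v * Im u" by (simp add: det_2 matrix_def)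
    then show ?thesis unfolding a_def b_def cmod_power2 by (simp add: power2_eq_square field_simps)
  qed
  ultimately show ?thesis by blast
qed

text \<open>As a map into the punctured plane, \<open>h x / x\<close> is deformed through
  \<open>h (t x) / (t x)\<close> to \<open>A x / x\<close>, with \<open>A\<close> the derivative at
  the centre, and then, shrinking the antiholomorphic part of \<open>A\<close>, to a constant. A map
  homotopic to a constant has a continuous logarithm.\<close>

lemma continuous_log_punctured:
  assumes h: "continuous_on disk h" "h 0 = 0" "\<And>x. x \<in> pdisk \<Longrightarrow> h x \<noteq> 0" and p: "pos0 h"
  shows "\<exists>g. continuous_on pdisk g \<and> (\<forall>x\<in>pdisk. cx (h x) / cx x = exp (g x))"
proof -
  obtain A where A: "(h has_derivative A) (at 0)" "det (matrix A) > 0" using p unfolding pos0_def by blast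
  note lin = has_derivative_linear[OF A(1)]
  obtain a b where ab: "\<And>x. cx (A x) = a * cx x + b * cnj (cx x)" "(norm a)\<^sup>2 - (norm b)\<^sup>2 = det (matrix A)"
    using linear_cx_form[OF lin] by blast
  have "(norm b)\<^sup>2 < (norm a)\<^sup>2" using ab(2) A(2) by simp
  then have nab: "norm b < norm a" by (rule power_less_imp_less_base) simp
  have Ac: "continuous_on S A" for S using has_derivative_bounded_linear[OF A(1)] by (rule linear_continuous_on)
  \<comment> \<open>Differentiability makes this quotient continuous at \<open>0\<close>, where its
    value is \<open>0\<close> because the inverse of \<open>0\<close> is \<open>0\<close>.\<close>
  define r where "r y = (h y - A y) /\<^sub>R norm y" for y
  have rc: "continuous_on disk r" unfolding continuous_on_eq_continuous_within
  proof
    fix y :: "real^2" assume y: "y \<in> disk"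
    show "continuous (at y within disk) r"
    proof (cases "y = 0")
      case True
      have "((\<lambda>y. (h y - A y) /\<^sub>R norm y) \<longlongrightarrow> 0) (at 0)"
        using A(1) h(2) unfolding has_derivative_def by (simp add: divide_inverse)
      then have "(r \<longlongrightarrow> r 0) (at 0)" by (simp add: r_def[abs_def])
      then show ?thesis unfolding True continuous_within by (rule tendsto_within_subset) auto
    next
      case False
      have "continuous_on pdisk r" unfolding r_def[abs_def] by (intro continuous_intros continuous_on_subset[OF h(1)] Ac) auto
      then have "continuous (at y within pdisk) r" using y False by (simp add: continuous_on_eq_continuous_within)
      moreover have "at y within pdisk = at y within disk" by (rule at_within_nhd[of _ "- {0}"]) (use False in auto)
      ultimately show ?thesis by simp
    qed
  qed
  have hA: "h y = A y + norm y *\<^sub>R r y" for y using h(2) linear_0[OF lin] by (cases "y = 0") (auto simp: r_def)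
  \<comment> \<open>This is \<open>h (t x) / (t x)\<close> written without division by
    \<open>t\<close>, so that it makes sense and is continuous at \<open>t = 0\<close>.\<close>
  define Q where "Q = (\<lambda>z :: real \<times> (real^2). cx (A (snd z)) / cx (snd z) + of_real (norm (snd z)) * cx (r (fst z *\<^sub>R snd z)) / cx (snd z))"
  have lin_eq: "cx (A x) / cx x = a + b * (cnj (cx x) / cx x)" if "x \<noteq> 0" for x using that by (simp add: ab(1) add_divide_distrib)
  have nz: "a + of_real s * b * (cnj (cx x) / cx x) \<noteq> 0" if "x \<noteq> 0" "0 \<le> s" "s \<le> 1" for x s
  proof
    assume "a + of_real s * b * (cnj (cx x) / cx x) = 0"
    then have "norm a = norm (of_real s * b * (cnj (cx x) / cx x))" by (metis add_eq_0_iff norm_minus_cancel)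
    also have "\<dots> = s * norm b" using that by (simp add: norm_mult norm_divide)
    also have "\<dots> \<le> 1 * norm b" using that by (intro mult_right_mono) auto
    finally show False using nab by simp
  qed
  have Qnz: "Q (t, x) \<noteq> 0" if t: "0 \<le> t" "t \<le> 1" and x: "x \<in> pdisk" for t x
  proof (cases "t = 0")
    case True
    then have "Q (t, x) = cx (A x) / cx x" using linear_0[OF lin] h(2) by (simp add: Q_def r_def)
    then show ?thesis using lin_eq[of x] nz[of x 1] x by simp
  next
    case False
    have tx: "t *\<^sub>R x \<in> pdisk" using False t x by (auto intro: mult_le_one)
    have "h (t *\<^sub>R x) = t *\<^sub>R (A x + norm x *\<^sub>R r (t *\<^sub>R x))"
      using hA[of "t *\<^sub>R x"] t linear_cmul[OF lin] by (simp add: scaleR_add_right)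
    then have "A x + norm x *\<^sub>R r (t *\<^sub>R x) \<noteq> 0" using h(3)[OF tx] by auto
    moreover have "Q (t, x) = cx (A x + norm x *\<^sub>R r (t *\<^sub>R x)) / cx x" by (simp add: Q_def cx_add cx_scaleR add_divide_distrib)
    ultimately show ?thesis using x by simp
  qed
  have sc: "a * norm x \<le> 1" if "0 \<le> a" "a \<le> 1" "norm x \<le> 1" for a and x :: "real^2" using that by (intro mult_le_one) auto
  have Qc: "continuous_on ({0..1} \<times> pdisk) Q" unfolding Q_def
    by (intro continuous_intros continuous_on_cx continuous_on_compose2[OF Ac[of UNIV]] continuous_on_compose2[OF rc]) (auto simp: sc)
  have Qim: "Q ` ({0..1} \<times> pdisk) \<subseteq> - {0}"
  proof (rule image_subsetI)
    fix z :: "real \<times> (real^2)" assume "z \<in> {0..1} \<times> pdisk"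
    then show "Q z \<in> - {0}" using Qnz[of "fst z" "snd z"] by (cases z) simp
  qed
  have "homotopic_with_canon (\<lambda>h. True) pdisk (- {0}) (\<lambda>x. Q (0, x)) (\<lambda>x. Q (1, x))" unfolding homotopic_with_def
    by (rule exI[of _ Q]) (use Qc Qim in "auto simp: continuous_map_in_subtopology prod_topology_subtopology_eu simp del: insert_Diff_single Compl_iff singleton_iff Diff_iff")
  then have 1: "homotopic_with_canon (\<lambda>h. True) pdisk (- {0}) (\<lambda>x. Q (1, x)) (\<lambda>x. Q (0, x))" by (rule homotopic_with_symD)
  define R where "R = (\<lambda>z :: real \<times> (real^2). a + of_real (1 - fst z) * b * (cnj (cx (snd z)) / cx (snd z)))"
  have Rc: "continuous_on ({0..1} \<times> pdisk) R" unfolding R_def by (intro continuous_intros continuous_on_cx) auto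
  have Rnz: "R (t, x) \<noteq> 0" if "0 \<le> t" "t \<le> 1" "x \<in> pdisk" for t x using nz[of x "1 - t"] that by (simp add: R_def)
  have Rim: "R ` ({0..1} \<times> pdisk) \<subseteq> - {0}"
  proof (rule image_subsetI)
    fix z :: "real \<times> (real^2)" assume "z \<in> {0..1} \<times> pdisk"
    then show "R z \<in> - {0}" using Rnz[of "fst z" "snd z"] by (cases z) simp
  qed
  have 2: "homotopic_with_canon (\<lambda>h. True) pdisk (- {0}) (\<lambda>x. R (0, x)) (\<lambda>x. R (1, x))" unfolding homotopic_with_def
    by (rule exI[of _ R]) (use Rc Rim in "auto simp: continuous_map_in_subtopology prod_topology_subtopology_eu simp del: insert_Diff_single Compl_iff singleton_iff Diff_iff")
  have "homotopic_with_canon (\<lambda>h. True) pdisk (- {0}) (\<lambda>x. Q (0, x)) (\<lambda>x. R (1, x))"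
  proof (rule homotopic_with_eq[OF 2])
    show "Q (0, x) = R (0, x)" if "x \<in> topspace (top_of_set pdisk)" for x using that lin_eq[of x] linear_0[OF lin] h(2) by (simp add: Q_def R_def r_def)
  qed auto
  from homotopic_with_trans[OF 1 this]
  have "\<exists>c. homotopic_with_canon (\<lambda>h. True) pdisk (- {0}) (\<lambda>x. Q (1, x)) (\<lambda>x. c)" by (auto simp: R_def)
  then obtain g where g: "continuous_on pdisk g" "\<And>x. x \<in> pdisk \<Longrightarrow> Q (1, x) = exp (g x)"
    unfolding inessential_eq_continuous_logarithm by blast
  have "cx (h x) / cx x = exp (g x)" if x: "x \<in> pdisk" for x
  proof -
    have "Q (1, x) = cx (A x + norm x *\<^sub>R r x) / cx x" by (simp add: Q_def cx_add cx_scaleR add_divide_distrib)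
    then show ?thesis using g(2)[OF x] hA[of x] by simp
  qed
  with g(1) show ?thesis by blast
qed

lemma annulus:
  fixes r :: real assumes "0 < r" "r < 1"
  shows "compact {x :: real^2. r \<le> norm x \<and> norm x \<le> 1}" "connected {x :: real^2. r \<le> norm x \<and> norm x \<le> 1}"
    "{x :: real^2. r \<le> norm x \<and> norm x \<le> 1} \<subseteq> pdisk" "pt \<in> {x. r \<le> norm x \<and> norm x \<le> 1}"
proof -
  have "{x :: real^2. r \<le> norm x \<and> norm x \<le> 1} = disk - ball 0 r" by (auto simp: not_less)
  then show "compact {x :: real^2. r \<le> norm x \<and> norm x \<le> 1}" by (simp add: compact_diff)
  show "connected {x :: real^2. r \<le> norm x \<and> norm x \<le> 1}" using connected_annulus(4)[of r "0 :: real^2" 1] by simp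
qed (use assms pt in auto)

context tc_flow
begin

lemma log_exists:
  assumes h: "h \<in> E_plus F" shows "\<exists>l. continuous_on pdisk l \<and> (\<forall>x\<in>pdisk. turn x (h x) (l x))"
proof -
  have hE: "h \<in> E_maps F" "pos0 h" using h by (auto simp: E_plus_iff)
  have hc: "continuous_on disk h" by (rule Cn_continuous_on[OF Cinf_disk_Cn[OF E_Cinf[OF hE(1)], of 0]])
  obtain g where g: "continuous_on pdisk g" "\<And>x. x \<in> pdisk \<Longrightarrow> cx (h x) / cx x = exp (g x)"
    using continuous_log_punctured[OF hc E_0[OF hE(1)] _ hE(2)] E_pdisk[OF hE(1)] by blast
  have "turn x (h x) (Im (g x))" if x: "x \<in> pdisk" for x unfolding turn_def
  proof (intro exI[of _ "exp (Re (g x))"] conjI)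
    have "cx (h x) = cx x * exp (g x)" using g(2)[OF x] x by (simp add: field_simps)
    then show "cx (h x) = cx x * (of_real (exp (Re (g x))) * cis (Im (g x)))" by (simp add: exp_eq_polar)
  qed simp
  then show ?thesis using g(1) by (intro exI[of _ "\<lambda>x. Im (g x)"]) (auto intro!: continuous_intros)
qed

section \<open>The shift function of a map with a chosen argument\<close>

definition e_pt :: "(real^2 \<Rightarrow> real^2) \<Rightarrow> complex" where "e_pt h = cx (h pt)"

text \<open>A continuous argument of \<open>h x / x\<close>, selected by its value at
  \<open>pt\<close>. It exists when \<open>(h, s)\<close> is a point of the cyclic cover, and it is
  unique because the punctured disk is connected.\<close>

definition lang :: "(real^2 \<Rightarrow> real^2) \<Rightarrow> real \<Rightarrow> real^2 \<Rightarrow> real" where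
  "lang h s = (SOME l. continuous_on pdisk l \<and> (\<forall>x\<in>pdisk. turn x (h x) (l x)) \<and> l pt = 2 * pi * s)"

lemma E_sphere: "h \<in> E_maps F \<Longrightarrow> norm x = 1 \<Longrightarrow> norm (h x) = 1"
  using E_orbit[of h x] sphere_invariant[of x] by (metis mem_cball_0 order_refl)

lemma turn_log_normalise:
  assumes l: "continuous_on pdisk l" "\<forall>x\<in>pdisk. turn x (h x) (l x)" and x0: "x0 \<in> pdisk" "turn x0 (h x0) m"
  shows "\<exists>l. continuous_on pdisk l \<and> (\<forall>x\<in>pdisk. turn x (h x) (l x)) \<and> l x0 = m"
proof -
  have "x0 \<noteq> 0" using x0 by simp
  then obtain k :: int where k: "m = l x0 + 2 * pi * of_int k" using turn_unique[OF x0(2)] l(2) x0(1) by blast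
  show ?thesis by (rule exI[of _ "\<lambda>x. l x + 2 * pi * of_int k"]) (use l in "auto simp: turn_shift k intro!: continuous_intros")
qed

lemma lang:
  assumes h: "h \<in> E_plus F" and s: "e_pt h = circ s"
  shows lang_cont: "continuous_on pdisk (lang h s)" and turn_lang: "\<And>x. x \<in> pdisk \<Longrightarrow> turn x (h x) (lang h s x)"
    and lang_pt: "lang h s pt = 2 * pi * s"
proof -
  have "turn pt (h pt) (2 * pi * s)" unfolding turn_def by (intro exI[of _ 1]) (use s in "simp add: pt e_pt_def")
  then have "\<exists>l. continuous_on pdisk l \<and> (\<forall>x\<in>pdisk. turn x (h x) (l x)) \<and> l pt = 2 * pi * s"
    using log_exists[OF h] turn_log_normalise[of _ h pt] pt(3) by blast
  from someI_ex[OF this] show "continuous_on pdisk (lang h s)" "\<And>x. x \<in> pdisk \<Longrightarrow> turn x (h x) (lang h s x)"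
    "lang h s pt = 2 * pi * s" by (auto simp: lang_def)
qed

definition ang :: "(real^2 \<Rightarrow> real^2) \<Rightarrow> real \<Rightarrow> real^2 \<Rightarrow> real" where
  "ang h s x = shift x (h x) (lang h s x)"

lemma ang:
  assumes h: "h \<in> E_plus F" and s: "e_pt h = circ s" and x: "x \<in> pdisk"
  shows "(x, h x, lang h s x) \<in> Rel" "\<Phi> (x, ang h s x) = h x" "W x (ang h s x) = lang h s x"
proof -
  have "h \<in> E_maps F" using h by (simp add: E_plus_iff)
  then show *: "(x, h x, lang h s x) \<in> Rel" using turn_lang[OF h s x] x E_orbit[of h x] by (auto simp: Rel_def)
  show "\<Phi> (x, ang h s x) = h x" "W x (ang h s x) = lang h s x" unfolding ang_def using shift[OF *] by auto
qed

text \<open>Joint continuity of arguments is available over compact sets, so the punctured disk is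
  exhausted by closed annuli. All of them reach the boundary circle and contain \<open>pt\<close>,
  where the arguments are normalised.\<close>

lemma lang_family:
  assumes f: "Ck 0 T disk f" and E: "\<And>p. p \<in> topspace T \<Longrightarrow> f p \<in> E_plus F"
    and s: "\<And>p. p \<in> topspace T \<Longrightarrow> e_pt (f p) = circ (s p)" and sc: "continuous_map T euclideanreal s"
  shows "Ck 0 T pdisk (\<lambda>p. lang (f p) (s p))" unfolding Ck.simps
proof (rule continuous_map_openin_cover)
  fix p x assume p: "p \<in> topspace T" and x: "x \<in> pdisk"
  define r where "r = norm x / 2"
  have r: "0 < r" "r < 1" "r < norm x" using x by (auto simp: r_def)
  let ?C = "{x :: real^2. r \<le> norm x \<and> norm x \<le> 1}"
  have "Ck 0 T ?C (\<lambda>p. lang (f p) (s p))"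
  proof (rule lift_family_continuous[OF annulus(1,2,4)[OF r(1,2)], where q = "\<lambda>p x. cx (f p x) * inverse (cx x)"])
    have "Ck 0 T ?C (\<lambda>p x. cx (f p x))" by (rule C0_comp[OF Ck_subset[OF f]]) (auto intro!: continuous_on_cx continuous_intros)
    moreover have "Ck 0 T ?C (\<lambda>p x. inverse (cx x))" by (rule Cn_Ck) (use r(1) in "auto simp: Cn_0_iff intro!: continuous_on_cx continuous_intros")
    ultimately show "Ck 0 T ?C (\<lambda>p x. cx (f p x) * inverse (cx x))" by (rule C0_comp2) (intro continuous_intros)
    fix p assume p: "p \<in> topspace T"
    show "continuous_on ?C (lang (f p) (s p))" by (rule continuous_on_subset[OF lang_cont[OF E[OF p] s[OF p]] annulus(3)[OF r(1,2)]])
    fix x assume "x \<in> ?C"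
    then have x: "x \<in> pdisk" using annulus(3)[OF r(1,2)] by blast
    show "cx (f p x) * inverse (cx x) \<noteq> 0" using x E[OF p] E_pdisk[of "f p" x] by (simp add: E_plus_iff)
    obtain q where q: "q > 0" "cx (f p x) = cx x * (of_real q * cis (lang (f p) (s p) x))" using turn_lang[OF E[OF p] s[OF p] x] by (auto simp: turn_def)
    then have "cx (f p x) * inverse (cx x) = of_real q * cis (lang (f p) (s p) x)" using x by simp
    then show "cx (f p x) * inverse (cx x) = of_real (norm (cx (f p x) * inverse (cx x))) * cis (lang (f p) (s p) x)"
      using q(1) by (simp add: norm_mult del: norm_inverse)
  next
    show "continuous_map T euclideanreal (\<lambda>p. lang (f p) (s p) pt)"
    proof (rule continuous_map_eq)
      show "continuous_map T euclideanreal (\<lambda>p. 2 * pi * s p)" using sc by (intro continuous_intros)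
    qed (simp add: lang_pt[OF E s])
  qed
  then have "Ck 0 (subtopology T (topspace T)) {x \<in> pdisk. r < norm x} (\<lambda>p. lang (f p) (s p))"
    unfolding subtopology_topspace by (rule Ck_subset) auto
  moreover have "openin (top_of_set pdisk) {x \<in> pdisk. r < norm x}" unfolding openin_open by (intro exI[of _ "- cball 0 r"]) auto
  ultimately show "\<exists>Q W. openin T Q \<and> openin (top_of_set pdisk) W \<and> p \<in> Q \<and> x \<in> W \<and>
      continuous_map (prod_topology (subtopology T Q) (top_of_set W)) euclidean (\<lambda>z. lang (f (fst z)) (s (fst z)) (snd z))"
    using p x r by (intro exI[of _ "topspace T"] exI[of _ "{x \<in> pdisk. r < norm x}"]) (auto simp: Ck.simps)
qed

text \<open>Continuity comes from that of \<open>shift\<close> on \<open>Rel\<close>, and the order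
  of differentiability from \<open>shift_smooth_family\<close>.\<close>

lemma ang_family:
  assumes f: "Ck k T disk f" and E: "\<And>p. p \<in> topspace T \<Longrightarrow> f p \<in> E_plus F"
    and s: "\<And>p. p \<in> topspace T \<Longrightarrow> e_pt (f p) = circ (s p)" and sc: "continuous_map T euclideanreal s"
  shows "Ck k T pdisk (\<lambda>p. ang (f p) (s p))"
proof (rule shift_smooth_family)
  show fp: "Ck k T pdisk f" by (rule Ck_subset[OF f]) auto
  have "Ck 0 T pdisk (\<lambda>p x. (x, f p x, lang (f p) (s p) x))" by (intro C0_pair Ck_id Ck_0[OF fp] lang_family[OF Ck_0[OF f] E s sc])
  from C0_comp_on[OF this shift_cont ang(1)[OF E s]]
  show "Ck 0 T pdisk (\<lambda>p. ang (f p) (s p))" by (simp add: ang_def[abs_def])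
qed (use ang(2)[OF E s] E E_pdisk in "auto simp: E_plus_iff")

lemma ang_Cn:
  assumes h: "h \<in> E_plus F" and s: "e_pt h = circ s" shows "Cn k pdisk (ang h s)"
proof (rule ang_family[where f = "\<lambda>_. h" and s = "\<lambda>_. s"])
  show "Cn k disk h" by (rule Cinf_disk_Cn[OF E_Cinf]) (use h in "simp add: E_plus_iff")
qed (use h s in "auto simp: continuous_map_const")

lemma ang_cont: "h \<in> E_plus F \<Longrightarrow> e_pt h = circ s \<Longrightarrow> continuous_on pdisk (ang h s)"
  by (rule Cn_continuous_on[OF ang_Cn[where k = 0]])

lemma shift_function_extension:
  assumes h: "h \<in> Cinf_disk" "\<And>x. x \<in> pdisk \<Longrightarrow> h x \<in> pdisk" and a: "continuous_on pdisk a" "\<And>x. x \<in> pdisk \<Longrightarrow> \<Phi> (x, a x) = h x"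
    and r: "0 < r" "r < 1"
  shows "\<exists>V b. open V \<and> {x. r \<le> norm x \<and> norm x \<le> 1} \<subseteq> V \<and> (\<forall>k. Cn k V b) \<and> (\<forall>x. r \<le> norm x \<and> norm x \<le> 1 \<longrightarrow> b x = a x)"
proof -
  let ?K = "{x :: real^2. r \<le> norm x \<and> norm x \<le> 1}"
  note K = annulus[OF r]
  obtain U g where U: "open U" "disk \<subseteq> U" "\<forall>x\<in>disk. g x = h x" "\<forall>k. Cn k U g"
    using h(1) by (auto simp: Cinf_disk_def smooth_on_iff)
  have "\<exists>V b. open V \<and> ?K \<subseteq> V \<and> (\<forall>k. Cn k V b) \<and> (\<forall>x\<in>?K. b x = a x)"
  proof (rule shift_extension[of ?K U g])
    show "continuous_on ?K a" by (rule continuous_on_subset[OF a(1) K(3)])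
    fix x assume "x \<in> ?K"
    then have x: "x \<in> pdisk" using K(3) by blast
    show "\<Phi> (x, a x) = g x" "g x \<in> pdisk" using U(3) a(2)[OF x] h(2)[OF x] x by auto
  qed (use K U in auto)
  then show ?thesis by simp
qed

section \<open>Maps given by a shift function\<close>

definition smap :: "(real^2 \<Rightarrow> real) \<Rightarrow> real^2 \<Rightarrow> real^2" where
  "smap b = restrict (\<lambda>x. \<Phi> (x, b x)) disk"

text \<open>The shift function may be singular at the centre, so near it the regularity is taken
  from \<open>f\<close>, and elsewhere from the flow.\<close>

lemma smap_family:
  assumes b: "Ck k T pdisk b" and r: "r > 0" and f: "Ck k T (ball 0 r \<inter> disk) f"
    and eq: "\<And>p x. p \<in> topspace T \<Longrightarrow> norm x < r \<Longrightarrow> norm x \<le> 1 \<Longrightarrow> \<Phi> (x, b p x) = f p x"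
  shows "Ck k T disk (\<lambda>p. smap (b p))"
proof (rule Ck_local[OF unique_derivs_disk])
  fix p x assume p: "p \<in> topspace T" and x: "x \<in> (disk :: (real^2) set)"
  show "\<exists>Q W. openin T Q \<and> openin (top_of_set disk) W \<and> p \<in> Q \<and> x \<in> W \<and> Ck k (subtopology T Q) W (\<lambda>p. smap (b p))"
  proof (cases "norm x < r")
    case True
    have "Ck k T (ball 0 r \<inter> disk) (\<lambda>p. smap (b p))" by (rule Ck_cong[OF f]) (use eq in "auto simp: smap_def")
    then show ?thesis using p x True by (intro exI[of _ "topspace T"] exI[of _ "ball 0 r \<inter> disk"]) (auto simp: openin_open)
  next
    case False
    have "Ck k T pdisk (\<lambda>p x. \<Phi> (x, b p x))" by (rule Ck_compose[OF Cn_Ck[OF \<Phi>C] Ck_Pair[OF Ck_id b]]) auto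
    then have "Ck k T pdisk (\<lambda>p. smap (b p))" by (rule Ck_cong) (auto simp: smap_def)
    moreover have "openin (top_of_set disk) pdisk" unfolding openin_open by (intro exI[of _ "- {0}"]) auto
    ultimately show ?thesis using p x False r by (intro exI[of _ "topspace T"] exI[of _ pdisk]) auto
  qed
qed

lemma smap_E_plus:
  assumes b: "continuous_on pdisk b" and r: "0 < r" "r < r'" "r' \<le> 1"
    and f: "smooth_on (ball 0 r') f" "local_diffeo_at f 0" "pos0 f" "\<And>x. norm x < r' \<Longrightarrow> \<Phi> (x, b x) = f x"
    and V: "open V" "{x. r \<le> norm x \<and> norm x \<le> 1} \<subseteq> V" "\<And>k. Cn k V b'"
      "\<And>x. r \<le> norm x \<Longrightarrow> norm x \<le> 1 \<Longrightarrow> b' x = b x"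
  shows "smap b \<in> E_plus F" by (rule shift_map_E_plus[OF b _ _ _ r(1) _ open_ball[of 0 r'] _ _ f(1) _ f(2,3) V(1) _ V(3,4)])
    (use r f V(2) in "auto simp: smap_def")

end

definition cutoff :: "real^2 \<Rightarrow> real" where
  "cutoff = (SOME \<mu>. (\<forall>k. Cn k UNIV \<mu>) \<and> (\<forall>x. norm x \<le> 1/3 \<longrightarrow> \<mu> x = 0) \<and> (\<forall>x. 2/3 \<le> norm x \<longrightarrow> \<mu> x = 1) \<and>
     (\<forall>x. 0 \<le> \<mu> x \<and> \<mu> x \<le> 1))"

lemma cutoff:
  shows cutoff_Cn: "Cn k S cutoff" and cutoff_0: "norm x \<le> 1/3 \<Longrightarrow> cutoff x = 0" and cutoff_1: "2/3 \<le> norm x \<Longrightarrow> cutoff x = 1"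
proof -
  have "\<exists>u :: real^2 \<Rightarrow> real. (\<forall>k. Cn k UNIV u) \<and> (\<forall>x. norm x \<le> 1/3 \<longrightarrow> u x = 0) \<and> (\<forall>x. 2/3 \<le> norm x \<longrightarrow> u x = 1) \<and>
     (\<forall>x. 0 \<le> u x \<and> u x \<le> 1)" by (rule smooth_cutoff) auto
  note * = someI_ex[OF this, folded cutoff_def]
  show "Cn k S cutoff" by (rule Ck_subset[of k _ UNIV]) (use * in auto)
  show "norm x \<le> 1/3 \<Longrightarrow> cutoff x = 0" "2/3 \<le> norm x \<Longrightarrow> cutoff x = 1" using * by auto
qed

lemma cutoff_cont: "continuous_on S cutoff" by (rule Cn_continuous_on[OF cutoff_Cn[where k = 0]])

lemma pos0_inverse:
  assumes h: "pos0 h" "h 0 = 0" and k: "k differentiable (at 0)" and U: "open U" "0 \<in> U" "\<And>x. x \<in> U \<Longrightarrow> k (h x) = x"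
  shows "pos0 k"
proof -
  obtain A where A: "(h has_derivative A) (at 0)" "det (matrix A) > 0" using h unfolding pos0_def by blast
  obtain B where B: "(k has_derivative B) (at 0)" using k unfolding differentiable_def by blast
  have "((\<lambda>x. k (h x)) has_derivative (\<lambda>v. B (A v))) (at 0)" using has_derivative_compose[OF A(1), of k B] B h(2) by simp
  then have "((\<lambda>x. x) has_derivative (\<lambda>v. B (A v))) (at 0)" by (rule has_derivative_transform_within_open[OF _ U(1,2)]) (use U(3) in auto)
  then have "(\<lambda>v. B (A v)) = (\<lambda>v. v)" by (rule has_derivative_unique) (rule has_derivative_ident)
  moreover have "matrix (\<lambda>v. B (A v)) = matrix B ** matrix A"
    using matrix_compose[OF has_derivative_linear[OF A(1)] has_derivative_linear[OF B(1)]] by (simp add: o_def)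
  ultimately have "matrix B ** matrix A = mat 1" by (simp add: matrix_id_mat_1 flip: id_def)
  then have "det (matrix B) * det (matrix A) = 1" by (metis det_I det_mul)
  then have "det (matrix B) > 0" using A(2) by (metis zero_less_mult_pos2 zero_less_one)
  then show ?thesis unfolding pos0_def using B by blast
qed

section \<open>The deformation to the boundary-fixing maps, twists and composition\<close>

context tc_flow
begin

lemma E_plus_maps: "h \<in> E_plus F \<Longrightarrow> h \<in> E_maps F" by (simp add: E_plus_def)

lemma E_plus_ext: "h \<in> E_plus F \<Longrightarrow> x \<notin> disk \<Longrightarrow> h x = undefined"
  using E_Cinf[OF E_plus_maps, of h] by (auto simp: Cinf_disk_def PiE_def extensional_def)

lemma E_plus_disk: "h \<in> E_plus F \<Longrightarrow> x \<in> disk \<Longrightarrow> h x \<in> disk"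
  using E_Cinf[OF E_plus_maps, of h] by (auto simp: Cinf_disk_def)

lemma E_plus_eqI: "g \<in> E_plus F \<Longrightarrow> h \<in> E_plus F \<Longrightarrow> (\<And>x. x \<in> disk \<Longrightarrow> g x = h x) \<Longrightarrow> g = h"
  by (rule ext) (metis E_plus_ext)

lemma norm_e_pt: "h \<in> E_plus F \<Longrightarrow> norm (e_pt h) = 1" using E_sphere[OF E_plus_maps, of h pt] by (simp add: e_pt_def pt)

lemma e_pt_cis: "h \<in> E_plus F \<Longrightarrow> \<exists>s. e_pt h = circ s"
proof -
  assume "h \<in> E_plus F"
  from norm_e_pt[OF this] obtain t where "e_pt h = cis t" by (metis complex_norm_eq_1_exp cis_conv_exp)
  then show ?thesis by (intro exI[of _ "t / (2 * pi)"]) simp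
qed

lemma ang_extension:
  assumes h: "h \<in> E_plus F" and s: "e_pt h = circ s" and r: "0 < r" "r < 1"
  shows "\<exists>V b. open V \<and> {x. r \<le> norm x \<and> norm x \<le> 1} \<subseteq> V \<and> (\<forall>k. Cn k V b) \<and> (\<forall>x. r \<le> norm x \<and> norm x \<le> 1 \<longrightarrow> b x = ang h s x)"
  by (rule shift_function_extension[OF E_Cinf[OF E_plus_maps[OF h]] _ ang_cont[OF h s] _ r],
      erule E_pdisk[OF E_plus_maps[OF h]], erule ang(2)[OF h s])

definition contr :: "real \<Rightarrow> (real^2 \<Rightarrow> real^2) \<Rightarrow> real \<Rightarrow> real^2 \<Rightarrow> real^2" where
  "contr t h s = smap (\<lambda>x. (1 - t * cutoff x) * ang h s x)"

lemma ang_flow: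
  assumes "h \<in> E_plus F" "e_pt h = circ s" "x \<in> disk" shows "\<Phi> (x, ang h s x) = h x"
  using ang(2)[OF assms(1,2), of x] E_0[OF E_plus_maps[OF assms(1)]] assms(3) by (cases "x = 0") auto

lemma contr_family:
  assumes f: "Ck k T disk f" and E: "\<And>p. p \<in> topspace T \<Longrightarrow> f p \<in> E_plus F"
    and s: "\<And>p. p \<in> topspace T \<Longrightarrow> e_pt (f p) = circ (s p)" and sc: "continuous_map T euclideanreal s"
    and t: "continuous_map T euclideanreal t"
  shows "Ck k T disk (\<lambda>p. contr (t p) (f p) (s p))" unfolding contr_def
proof (rule smap_family)
  show "Ck k T pdisk (\<lambda>p x. (1 - t p * cutoff x) * ang (f p) (s p) x)"
    by (intro Ck_mult Ck_diff Ck_const' Ck_const t Cn_Ck[OF cutoff_Cn] ang_family f s sc E)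
  show "Ck k T (ball 0 (1/3) \<inter> disk) f" by (rule Ck_subset[OF f]) auto
  show "\<Phi> (x, (1 - t p * cutoff x) * ang (f p) (s p) x) = f p x" if "p \<in> topspace T" "norm x < 1/3" "norm x \<le> 1" for p x
    using ang_flow[OF E s] that by (simp add: cutoff_0)
qed simp

lemma contr_E_plus:
  assumes h: "h \<in> E_plus F" and s: "e_pt h = circ s" shows "contr t h s \<in> E_plus F"
proof -
  note hE = E_plus_maps[OF h]
  \<comment> \<open>The radius 1/4 is below 1/3, where the cutoff starts to act, so the ball on
    which the map is still \<open>h\<close> overlaps the annulus on which it is a smooth
    shift.\<close>
  have rr: "(0::real) < 1/4" "1/4 < (1::real)" by auto
  obtain V b where V: "open V" "{x. 1/4 \<le> norm x \<and> norm x \<le> 1} \<subseteq> V" "\<forall>k. Cn k V b" "\<forall>x. 1/4 \<le> norm x \<and> norm x \<le> 1 \<longrightarrow> b x = ang h s x"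
    using ang_extension[OF h s rr] by (elim exE conjE)
  show ?thesis unfolding contr_def
  proof (rule smap_E_plus[where r = "1/4" and r' = "1/3" and f = h and V = V and b' = "\<lambda>x. (1 - t * cutoff x) * b x"])
    show "continuous_on pdisk (\<lambda>x. (1 - t * cutoff x) * ang h s x)" by (intro continuous_intros ang_cont[OF h s] cutoff_cont)
    show "smooth_on (ball 0 (1/3)) h" using E_Cinf[OF hE] by (auto simp: Cinf_disk_def intro: smooth_on_subset)
    show "local_diffeo_at h 0" "pos0 h" using h E_local[OF hE] by (auto simp: E_plus_iff)
    show "\<Phi> (x, (1 - t * cutoff x) * ang h s x) = h x" if "norm x < 1/3" for x using ang_flow[OF h s] that by (simp add: cutoff_0)
    show "Cn k V (\<lambda>x. (1 - t * cutoff x) * b x)" for k using V(3) by (intro Ck_mult Ck_diff Ck_const' cutoff_Cn) auto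
  qed (use V in auto)
qed

lemma contr_0: "h \<in> E_plus F \<Longrightarrow> e_pt h = circ s \<Longrightarrow> contr 0 h s = h"
  by (rule E_plus_eqI[OF contr_E_plus]) (simp_all add: contr_def smap_def ang_flow)

lemma contr_1: "h \<in> E_plus F \<Longrightarrow> e_pt h = circ s \<Longrightarrow> contr 1 h s \<in> E_bdry F"
  unfolding E_bdry_def using contr_E_plus[of h s 1] by (auto simp: contr_def smap_def cutoff_1)

lemma ang_eq_0:
  assumes h: "h \<in> E_plus F" and s: "e_pt h = circ s" and x: "x \<in> pdisk" "h x = x" "lang h s x = 0"
  shows "ang h s x = 0" by (rule shift_unique[OF x(1)]) (use ang[OF h s x(1)] W_0[OF x(1)] x in auto)

lemma lang_int:
  assumes h: "h \<in> E_plus F" and s: "e_pt h = circ s" and x: "x \<in> pdisk" "h x = x"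
  shows "\<exists>k::int. lang h s x = 2 * pi * of_int k" using turn_unique[of x x "lang h s x" 0] turn_lang[OF h s x(1)] turn_refl[of x] x by simp

text \<open>On the boundary circle, fixed by \<open>h\<close>, the argument is a multiple of 2 pi,
  hence constant, hence \<open>0\<close> by its value at \<open>pt\<close>. The shift function
  therefore vanishes there, and multiplying it by any factor leaves the circle fixed.\<close>

lemma contr_bdry:
  assumes h: "h \<in> E_bdry F" and s: "e_pt h = circ 0" shows "contr t h 0 \<in> E_bdry F"
proof -
  have hE: "h \<in> E_plus F" and hb: "\<And>x. norm x = 1 \<Longrightarrow> h x = x" using h by (auto simp: E_bdry_def)
  have "contr t h 0 x = x" if x: "norm x = 1" for x
  proof -
    have sub: "sphere 0 1 \<subseteq> pdisk" by auto
    have "lang h 0 x = lang h 0 pt"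
    proof (rule discrete_valued_constant[where d = "lang h 0" and C = "sphere 0 1"])
      show "connected (sphere (0::real^2) 1)" by (rule connected_sphere) simp
      show "continuous_on (sphere 0 1) (lang h 0)" by (rule continuous_on_subset[OF lang_cont[OF hE s] sub])
      show "\<exists>k::int. lang h 0 y = 2 * pi * of_int k" if "y \<in> sphere 0 1" for y by (rule lang_int[OF hE s]) (use that sub hb in auto)
    qed (use x pt in auto)
    then have "lang h 0 x = 0" using lang_pt[OF hE s] by simp
    then have "ang h 0 x = 0" using hb[OF x] x by (intro ang_eq_0[OF hE s]) auto
    then show ?thesis using x by (simp add: contr_def smap_def)
  qed
  then show ?thesis using contr_E_plus[OF hE s] by (simp add: E_bdry_def)
qed

lemma id_E_plus: "id_disk \<in> E_plus F"
proof -
  have "smap (\<lambda>_. 0) \<in> E_plus F" by (rule smap_E_plus[where r = "1/4" and r' = "1/3" and f = "\<lambda>x. x" and V = UNIV and b' = "\<lambda>_. 0"])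
      (auto simp: smooth_on_Cn local_diffeo_id pos0_id intro!: smooth_on_openI Cn_id Ck_const')
  moreover have "smap (\<lambda>_. 0) = id_disk" by (simp add: smap_def)
  ultimately show ?thesis by simp
qed

lemma id_E_bdry: "id_disk \<in> E_bdry F" using id_E_plus by (auto simp: E_bdry_def)

lemma e_pt_bdry: "h \<in> E_bdry F \<Longrightarrow> e_pt h = 1" using pt by (auto simp: E_bdry_def e_pt_def)

text \<open>Normalised by \<open>0\<close> at \<open>pt\<close>, the argument of the identity
  vanishes on the whole connected punctured disk, and so does its shift function.\<close>

lemma contr_id: "contr t id_disk 0 = id_disk"
proof -
  have s: "e_pt id_disk = circ 0" using e_pt_bdry[OF id_E_bdry] by simp
  have "ang id_disk 0 x = 0" if x: "x \<in> pdisk" for x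
  proof (rule ang_eq_0[OF id_E_plus s x])
    have "lang id_disk 0 x = lang id_disk 0 pt"
      by (rule discrete_valued_constant[OF pdisk_connected lang_cont[OF id_E_plus s] lang_int[OF id_E_plus s] x pt(3)]) auto
    then show "lang id_disk 0 x = 0" using lang_pt[OF id_E_plus s] by simp
  qed (use x in auto)
  then have "\<Phi> (x, (1 - t * cutoff x) * ang id_disk 0 x) = x" if "x \<in> disk" for x using that by (cases "x = 0") auto
  then show ?thesis unfolding contr_def smap_def by (auto simp: restrict_def fun_eq_iff)
qed

text \<open>The shift is by \<open>c\<close> near the boundary and by nothing near the centre. For
  \<open>c\<close> a multiple of the boundary period this is a Dehn twist fixing the circle; letting
  \<open>c\<close> grow from \<open>0\<close> connects it to the identity while \<open>e_pt\<close>
  winds, which gives the paths between different levels of the cyclic cover.\<close>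

definition twist :: "real \<Rightarrow> real^2 \<Rightarrow> real^2" where
  "twist c = smap (\<lambda>x. c * cutoff x)"

lemma twist_E_plus: "twist c \<in> E_plus F" unfolding twist_def
  by (rule smap_E_plus[where r = "1/4" and r' = "1/3" and f = "\<lambda>x. x" and V = UNIV and b' = "\<lambda>x. c * cutoff x"])
    (auto simp: cutoff_0 local_diffeo_id pos0_id intro!: smooth_on_openI Cn_id Ck_const' Ck_mult cutoff_Cn
      continuous_intros cutoff_cont)

lemma twist_family: "continuous_map T euclideanreal c \<Longrightarrow> Ck k T disk (\<lambda>p. twist (c p))" unfolding twist_def
  by (rule smap_family[where r = "1/3" and f = "\<lambda>_ x. x"]) (auto simp: cutoff_0 intro!: Ck_mult Ck_const Ck_id Cn_Ck[OF cutoff_Cn])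

lemma twist_0: "twist 0 = id_disk" by (simp add: twist_def smap_def)

lemma twist_bdry: "twist (of_int k * per pt) \<in> E_bdry F" using twist_E_plus by (auto simp: E_bdry_def twist_def smap_def cutoff_1 per_sphere)

lemma e_pt_twist: "e_pt (twist c) = cis (W pt c)"
proof -
  have t: "twist c pt = \<Phi> (pt, c)" using pt by (simp add: twist_def smap_def cutoff_1)
  obtain r where r: "r > 0" "cx (\<Phi> (pt, c)) = of_real r * cis (W pt c)" using turn_W[OF pt(3), of c] by (auto simp: turn_def pt)
  have "norm (cx (\<Phi> (pt, c))) = 1" using sphere_invariant[of pt c] pt by simp
  then have "r = 1" unfolding r(2) using r(1) by (simp add: norm_mult)
  then show ?thesis using r t by (simp add: e_pt_def)
qed

lemma E_plus_compose:
  assumes g: "g \<in> E_plus F" and h: "h \<in> E_plus F" shows "compose disk g h \<in> E_plus F"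
proof -
  note gE = E_plus_maps[OF g] and hE = E_plus_maps[OF h]
  obtain U g' where U: "open U" "disk \<subseteq> U" "\<forall>x\<in>disk. g' x = g x" "\<forall>k. Cn k U g'"
    using E_Cinf[OF gE] by (auto simp: Cinf_disk_def smooth_on_iff)
  obtain V h' where V: "open V" "disk \<subseteq> V" "\<forall>x\<in>disk. h' x = h x" "\<forall>k. Cn k V h'"
    using E_Cinf[OF hE] by (auto simp: Cinf_disk_def smooth_on_iff)
  define N where "N = V \<inter> h' -` U"
  have N: "open N" unfolding N_def using continuous_on_open_vimage[OF V(1)] Cn_continuous_on[of 0 V h'] V(4) U(1) by (metis inf_commute)
  have "disk \<subseteq> N" using V(2,3) subsetD[OF U(2) E_plus_disk[OF h]] by (auto simp: N_def)
  moreover have "Cn k N (\<lambda>x. g' (h' x))" for k by (rule Cn_compose[of k U g' N h']) (use U(4) V(4) in "auto simp: N_def intro: Ck_subset")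
  ultimately have "smooth_on disk (compose disk g h)" unfolding smooth_on_iff
    using N U(3) V(3) E_plus_disk[OF h] by (intro exI[of _ N] exI[of _ "\<lambda>x. g' (h' x)"]) (auto simp: compose_def)
  then have "compose disk g h \<in> Cinf_disk" using E_plus_disk[OF h] E_plus_disk[OF g] by (auto simp: Cinf_disk_def compose_def)
  moreover have "compose disk g h ` c = c" if c: "c \<in> orbits F" for c
  proof -
    have "c \<subseteq> disk" using c orbits_cases \<Phi>_disk by auto
    then have "compose disk g h ` c = g ` (h ` c)" unfolding image_image by (intro image_cong) (auto simp: compose_def)
    then show ?thesis using gE hE c by (simp add: E_maps_def)
  qed
  moreover have "local_diffeo_at (compose disk g h) 0" by (rule local_diffeo_cong[OF local_diffeo_compose[of h 0 g] open_ball[of 0 1]])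
      (use E_local[OF gE] E_local[OF hE] E_0[OF hE] in "auto simp: compose_def")
  moreover have "pos0 (compose disk g h)" by (rule pos0_cong[OF pos0_compose[of g h] open_ball[of 0 1]]) (use g h E_0[OF hE] in "auto simp: compose_def E_plus_iff")
  ultimately show ?thesis by (simp add: E_plus_iff E_maps_def)
qed

lemma E_bdry_compose: "g \<in> E_bdry F \<Longrightarrow> h \<in> E_bdry F \<Longrightarrow> compose disk g h \<in> E_bdry F"
  using E_plus_compose by (auto simp: E_bdry_def compose_def)

lemma e_pt_compose: "g \<in> E_bdry F \<Longrightarrow> h \<in> E_plus F \<Longrightarrow> e_pt (compose disk g h) = e_pt h"
  using E_sphere[OF E_plus_maps, of h pt] pt by (simp add: e_pt_def compose_def E_bdry_def)

section \<open>The topological monoid of maps and its inverses up to homotopy\<close>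

abbreviation "XT r \<equiv> subtopology (weak_topology r) (E_plus F)"

lemma topspace_XT: "topspace (XT r) = E_plus F" using E_Cinf[OF E_plus_maps] by (auto simp: topspace_weak_topology)

lemma continuous_map_XT:
  "continuous_map T (XT r) f \<longleftrightarrow> (\<forall>p\<in>topspace T. f p \<in> E_plus F) \<and> (\<forall>k. enat k \<le> r \<longrightarrow> Ck k T disk f)"
  using E_Cinf[OF E_plus_maps] by (auto simp: continuous_map_in_subtopology continuous_map_weak_topology Pi_iff)

lemma XT_family: "continuous_map T (XT r) f \<Longrightarrow> enat k \<le> r \<Longrightarrow> Ck k T disk f" by (simp add: continuous_map_XT)

lemma XT_E_plus: "continuous_map T (XT r) f \<Longrightarrow> p \<in> topspace T \<Longrightarrow> f p \<in> E_plus F" by (simp add: continuous_map_XT)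

lemma compose_continuous:
  "continuous_map (prod_topology (XT r) (XT r)) (XT r) (\<lambda>z. compose disk (fst z) (snd z))" unfolding continuous_map_XT
proof (intro conjI ballI allI impI)
  let ?T = "prod_topology (XT r) (XT r)"
  fix k assume k: "enat k \<le> r"
  have "Ck k ?T disk (\<lambda>z x. fst z (snd z x))" by (rule Ck_compose[OF XT_family[OF continuous_map_fst k] XT_family[OF continuous_map_snd k]])
      (auto simp: topspace_XT simp del: topspace_subtopology dest: E_plus_disk)
  then show "Ck k ?T disk (\<lambda>z. compose disk (fst z) (snd z))" by (rule Ck_cong) (simp add: compose_def)
qed (auto simp: topspace_XT simp del: topspace_subtopology intro: E_plus_compose)

lemma e_pt_continuous: "continuous_map (XT r) euclidean e_pt"
proof -
  have "Ck 0 (XT r) disk (\<lambda>h. h)" by (rule XT_family[of _ r]) (simp_all add: continuous_map_XT[symmetric] zero_enat_def[symmetric])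
  from C0_comp[OF this, of cx]
  have "continuous_map (prod_topology (XT r) (top_of_set disk)) euclidean (\<lambda>z. cx (fst z (snd z)))" by (simp add: Ck.simps continuous_on_cx)
  moreover have "continuous_map (XT r) (prod_topology (XT r) (top_of_set disk)) (\<lambda>h. (h, pt))"
    using pt by (simp add: continuous_map_paired continuous_map_const)
  ultimately show ?thesis using continuous_map_compose[of "XT r" _ "\<lambda>h. (h, pt)"] by (fastforce simp: o_def e_pt_def[abs_def])
qed

text \<open>Members of \<open>E_plus F\<close> need not be injective, so \<open>h\<close> is
  inverted near the centre only. There the local inverse \<open>k\<close> is itself a shift; cutting
  its shift function off to \<open>0\<close> gives a member of \<open>E_plus F\<close> that agrees
  with \<open>k\<close> near the centre.\<close>

lemma left_inverse_exists:
  assumes h: "h \<in> E_plus F"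
  shows "\<exists>g\<in>E_plus F. \<exists>d>0. d < 1 \<and> (\<forall>x. norm x < d \<longrightarrow> compose disk g h x = x)"
proof -
  note hE = E_plus_maps[OF h]
  obtain U V k where U: "open U" "0 \<in> U" "U \<subseteq> ball 0 1" "open V" "homeomorphism U V h k" "smooth_on U h" "smooth_on V k"
    using local_diffeo_smaller[OF E_local[OF hE] open_ball[of 0 1]] by (auto simp del: ball_subset_ball_iff)
  have kh: "\<And>x. x \<in> U \<Longrightarrow> k (h x) = x" "\<And>y. y \<in> V \<Longrightarrow> h (k y) = y" "\<And>x. x \<in> U \<Longrightarrow> h x \<in> V" "\<And>y. y \<in> V \<Longrightarrow> k y \<in> U"
    using U(5) by (auto simp: homeomorphism_def)
  note h0 = E_0[OF hE]
  have 0: "0 \<in> V" "k 0 = 0" using kh(3)[OF U(2)] kh(1)[OF U(2)] h0 by simp_all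
  obtain c1 where c1: "c1 > 0" "ball 0 c1 \<subseteq> V" using U(4) 0(1) open_contains_ball by blast
  define c where "c = min c1 1"
  have c: "c > 0" "c \<le> 1" "ball 0 c \<subseteq> V" using c1 by (auto simp: c_def)
  have r23: "0 \<le> c / 3" "c / 3 < 2 * c / 3" using c by auto
  obtain u :: "real^2 \<Rightarrow> real" where u: "\<And>k. Cn k UNIV u" "\<And>x. norm x \<le> c / 3 \<Longrightarrow> u x = 0" "\<And>x. 2 * c / 3 \<le> norm x \<Longrightarrow> u x = 1"
    using smooth_cutoff[OF r23] by metis
  obtain s where s: "e_pt h = circ s" using e_pt_cis[OF h] by blast
  let ?S = "ball 0 c - {0} :: (real^2) set"
  \<comment> \<open>From \<open>y = \<Phi> (k y, ang h s (k y))\<close> the point \<open>k y\<close>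
    is reached by reversing time.\<close>
  define a where "a y = - ang h s (k y)" for y
  have kp: "k y \<in> pdisk" if "y \<in> ?S" for y
  proof -
    have "y \<in> V" using that c(3) by blast
    then have "k y \<in> ball 0 1" "h (k y) = y" using kh U(3) by blast+
    then show ?thesis using that h0 by auto
  qed
  have a\<Phi>: "\<Phi> (y, a y) = k y" if y: "y \<in> ?S" for y
  proof -
    have "y \<in> V" using y c(3) by blast
    then have "y = \<Phi> (k y, ang h s (k y))" using ang(2)[OF h s kp[OF y]] kh(2) by simp
    then have "\<Phi> (y, a y) = \<Phi> (\<Phi> (k y, ang h s (k y)), a y)" by simp
    then show ?thesis by (simp add: \<Phi>_add a_def)
  qed
  have kC: "Cn j ?S k" for j by (rule Ck_subset[OF smooth_on_Cn[OF U(7)]]) (use c(3) in auto)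
  have "continuous_on ?S a" unfolding a_def
    by (intro continuous_intros continuous_on_compose2[OF ang_cont[OF h s] Cn_continuous_on[OF kC[of 0]]]) (use kp in auto)
  then have aC: "Cn j ?S a" for j
  proof -
    assume "continuous_on ?S a"
    then have "Cn 0 ?S a" by (simp only: Cn_0_iff)
    then show ?thesis by (rule shift_smooth_family[OF kC]) (erule a\<Phi>, erule kp)
  qed
  \<comment> \<open>\<open>u\<close> is \<open>1\<close> from radius \<open>2 * c / 3\<close> on, so
    the two cases join smoothly; up to radius \<open>c / 3\<close> it is \<open>0\<close>, and the
    shift by \<open>b\<close> is \<open>k\<close>.\<close>
  define b where "b y = (if norm y < c then (1 - u y) * a y else 0)" for y
  have bC: "Cn j (- {0}) b" for j
  proof (rule Cn_open_cover)
    fix y :: "real^2" assume y: "y \<in> - {0}"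
    have 1: "Cn j ?S b" by (rule Ck_cong[OF Ck_mult[OF Ck_diff[OF Ck_const' Ck_subset[OF u(1)]] aC]]) (auto simp: b_def)
    have 2: "Cn j (- cball 0 (2 * c / 3)) b" by (rule Ck_cong[OF Ck_const'[of _ _ _ 0]]) (auto simp: b_def u(3))
    show "\<exists>W. open W \<and> y \<in> W \<and> W \<subseteq> - {0} \<and> Cn j W b"
    proof (cases "norm y < c")
      case True
      then show ?thesis using 1 y by (intro exI[of _ ?S]) auto
    next
      case False
      then show ?thesis using 2 y c(1) by (intro exI[of _ "- cball 0 (2 * c / 3)"]) auto
    qed
  qed auto
  have near: "\<Phi> (y, b y) = k y" if "norm y < c / 3" for y
  proof (cases "y = 0")
    case False
    then show ?thesis using that u(2)[of y] a\<Phi>[of y] c(1) by (simp add: b_def)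
  qed (simp add: 0)
  have kld: "local_diffeo_at k 0" unfolding local_diffeo_at_def using U 0 homeomorphism_symD[OF U(5)] by blast
  have "smap b \<in> E_plus F"
  proof (rule smap_E_plus[where r = "c / 4" and r' = "c / 3" and f = k and V = "- {0}" and b' = b])
    show "continuous_on pdisk b" by (rule continuous_on_subset[OF Cn_continuous_on[OF bC[of 0]]]) auto
    show "smooth_on (ball 0 (c / 3)) k" by (rule smooth_on_subset[OF U(7)]) (use c in auto)
    show "pos0 k" by (rule pos0_inverse[OF _ h0 local_diffeo_differentiable[OF kld] U(1,2) kh(1)]) (use h in "auto simp: E_plus_iff")
  qed (use c kld near bC in auto)
  moreover have "\<exists>d>0. d < 1 \<and> (\<forall>x. norm x < d \<longrightarrow> compose disk (smap b) h x = x)"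
  proof -
    have "open (U \<inter> h -` ball 0 (c / 3))"
      using Cn_continuous_on[OF smooth_on_Cn[OF U(6), where k = 0]] continuous_on_open_vimage[OF U(1), of h] by (simp add: inf_commute)
    moreover have "0 \<in> U \<inter> h -` ball 0 (c / 3)" using U(2) h0 c(1) by simp
    ultimately obtain d where d: "d > 0" "ball 0 d \<subseteq> U \<inter> h -` ball 0 (c / 3)" using open_contains_ball by blast
    have "compose disk (smap b) h x = x" if "norm x < min d (1/2)" for x
    proof -
      have x: "x \<in> U" "norm (h x) < c / 3" "x \<in> disk" using that subsetD[OF d(2), of x] by auto
      then show ?thesis using near[of "h x"] kh(1) c by (simp add: compose_def smap_def)
    qed
    then show ?thesis using d(1) by (intro exI[of _ "min d (1/2)"]) auto
  qed
  ultimately show ?thesis by blast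
qed

text \<open>Where the map is the identity its argument is a multiple of 2 pi. With a suitable point
  of the cyclic cover over it this multiple is \<open>0\<close> near the centre, and so is the shift
  function, which can then be scaled by \<open>t\<close> without harm to smoothness at
  \<open>0\<close>.\<close>

lemma path_to_id:
  assumes u: "u \<in> E_plus F" and d: "0 < d" "d < 1" "\<And>x. norm x < d \<Longrightarrow> u x = x"
  shows "path_component_of (XT r) u id_disk"
proof -
  obtain s where s: "e_pt u = circ s" using e_pt_cis[OF u] by blast
  define x0 where "x0 = (d / 2) *\<^sub>R pt"
  have n0: "norm x0 = d / 2" using d pt by (simp add: x0_def)
  then have "x0 \<noteq> 0" using d(1) by auto
  then have x0: "x0 \<in> pdisk" "x0 \<in> ball 0 d - {0}" using n0 d by auto
  obtain j :: int where j: "lang u s x0 = 2 * pi * of_int j" using lang_int[OF u s x0(1) d(3)] n0 d(1) by auto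
  \<comment> \<open>Another point of the cover over the same \<open>u\<close>, chosen so that the
    argument vanishes at \<open>x0\<close>.\<close>
  define s' where "s' = s - of_int j"
  have "circ s' = circ s / circ (of_int j)" unfolding cis_divide s'_def by (simp add: right_diff_distrib)
  also have "circ (of_int j) = 1" by (simp add: complex_eq_iff cos_int_2pin sin_int_2pin)
  finally have s': "e_pt u = circ s'" using s by simp
  have "lang u s' x0 - lang u s x0 = lang u s' pt - lang u s pt"
  proof (rule discrete_valued_constant[OF pdisk_connected _ _ x0(1) pt(3)])
    show "continuous_on pdisk (\<lambda>x. lang u s' x - lang u s x)" by (intro continuous_intros lang_cont u s s')
    show "\<exists>k::int. lang u s' x - lang u s x = 2 * pi * of_int k" if "x \<in> pdisk" for x
      using turn_unique[OF turn_lang[OF u s' that] turn_lang[OF u s that]] that by auto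
  qed
  moreover have "2 * pi * s' = 2 * pi * s - 2 * pi * of_int j" by (simp add: s'_def algebra_simps)
  ultimately have l0: "lang u s' x0 = 0" using j lang_pt[OF u s] lang_pt[OF u s'] by linarith
  have "connected (ball 0 d - {0} :: (real^2) set)" using connected_punctured_ball[of "0 :: real^2" d] by simp
  then have "lang u s' x = 0" if "x \<in> ball 0 d - {0}" for x
  proof -
    have sub: "ball 0 d - {0} \<subseteq> pdisk" using d(2) by auto
    have "lang u s' x = lang u s' x0"
      by (rule discrete_valued_constant[OF \<open>connected _\<close> continuous_on_subset[OF lang_cont[OF u s'] sub] lang_int[OF u s'] that x0(2)])
        (use sub d(3) in auto)
    then show ?thesis using l0 by simp
  qed
  then have a0: "\<Phi> (x, t * ang u s' x) = x" if "norm x < d" for x t using that ang_eq_0[OF u s', of x] d(2) d(3)[of x] by (cases "x = 0") auto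
  define H where "H t = smap (\<lambda>x. t * ang u s' x)" for t
  note uE = E_plus_maps[OF u]
  have HE: "H t \<in> E_plus F" for t
  proof -
    have rr: "0 < d / 2" "d / 2 < 1" using d by auto
    obtain V b where V: "open V" "{x. d / 2 \<le> norm x \<and> norm x \<le> 1} \<subseteq> V" "\<forall>k. Cn k V b" "\<forall>x. d / 2 \<le> norm x \<and> norm x \<le> 1 \<longrightarrow> b x = ang u s' x"
      using ang_extension[OF u s' rr] by (elim exE conjE)
    show ?thesis unfolding H_def by (rule smap_E_plus[where r = "d / 2" and r' = d and f = "\<lambda>x. x" and V = V and b' = "\<lambda>x. t * b x"])
        (use d V a0 in "auto simp: local_diffeo_id pos0_id intro!: smooth_on_openI Cn_id Ck_const' Ck_mult continuous_intros ang_cont[OF u s']")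
  qed
  have HC: "Ck k (top_of_set {0..1}) disk H" for k unfolding H_def
  proof (rule smap_family[where r = d and f = "\<lambda>_ x. x"])
    show "Ck k (top_of_set {0..1}) pdisk (\<lambda>t x. t * ang u s' x)" by (intro Ck_mult Ck_const Cn_Ck[OF ang_Cn[OF u s']]) auto
  qed (use d a0 in "auto intro: Ck_id")
  have "pathin (XT r) H" unfolding pathin_def continuous_map_XT using HE HC by blast
  moreover have "H 0 = id_disk" by (simp add: H_def smap_def)
  moreover have "H 1 = u" by (rule E_plus_eqI[OF HE u]) (simp add: H_def smap_def ang_flow[OF u s'])
  ultimately have "path_component_of (XT r) id_disk u" unfolding path_component_of_def by blast
  then show ?thesis by (simp add: path_component_of_sym)
qed

end

section \<open>Homotopies of spheroids in topological monoids\<close>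

abbreviation I01 :: "real topology" where "I01 \<equiv> top_of_set {0..1}"
abbreviation "icube n \<equiv> topspace (cube n)"
abbreviation "cyl n \<equiv> prod_topology I01 (cube n)"

lemma in_cube: "s \<in> icube n \<longleftrightarrow> s \<in> extensional {..<n} \<and> (\<forall>i<n. 0 \<le> s i \<and> s i \<le> 1)"
  by (auto simp: cube_def PiE_def Pi_iff)

lemma continuous_map_cube:
  "continuous_map T (cube n) f \<longleftrightarrow> f ` topspace T \<subseteq> icube n \<and> (\<forall>i<n. continuous_map T euclideanreal (\<lambda>q. f q i))"
  unfolding cube_def continuous_map_componentwise by (auto simp: continuous_map_in_subtopology PiE_iff extensional_def image_subset_iff Pi_iff)

lemma cube_coord: "continuous_map T (cube n) f \<Longrightarrow> i < n \<Longrightarrow> continuous_map T euclideanreal (\<lambda>q. f q i)"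
  by (simp add: continuous_map_cube)

lemma cube_upd: "s \<in> icube n \<Longrightarrow> i < n \<Longrightarrow> 0 \<le> c \<Longrightarrow> c \<le> 1 \<Longrightarrow> s(i := c) \<in> icube n"
  by (auto simp: in_cube extensional_def)

lemma continuous_map_cube_upd:
  assumes "continuous_map T (cube n) f" "i < n" "continuous_map T euclideanreal c" "\<And>q. q \<in> topspace T \<Longrightarrow> 0 \<le> c q \<and> c q \<le> 1"
  shows "continuous_map T (cube n) (\<lambda>q. (f q)(i := c q))" using assms cube_upd[of _ n i] unfolding continuous_map_cube by (auto simp: image_subset_iff)

lemma boundaryI: "s \<in> icube n \<Longrightarrow> i < n \<Longrightarrow> s i = 0 \<or> s i = 1 \<Longrightarrow> s \<in> cube_boundary n"
  by (auto simp: cube_boundary_def)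

lemma boundaryE: "s \<in> cube_boundary n \<Longrightarrow> (\<And>i. s \<in> icube n \<Longrightarrow> i < n \<Longrightarrow> s i = 0 \<or> s i = 1 \<Longrightarrow> P) \<Longrightarrow> P"
  by (auto simp: cube_boundary_def)

text \<open>Homotopies of maps of the cube whose value at \<open>s\<close> stays in \<open>Z s\<close>; both kinds of spheroids are instances.\<close>

definition homotopic_in :: "nat \<Rightarrow> 'a topology \<Rightarrow> ((nat \<Rightarrow> real) \<Rightarrow> 'a set) \<Rightarrow> ((nat \<Rightarrow> real) \<Rightarrow> 'a) \<Rightarrow> ((nat \<Rightarrow> real) \<Rightarrow> 'a) \<Rightarrow> bool" where
  "homotopic_in n X Z = homotopic_with (\<lambda>f. \<forall>s\<in>icube n. f s \<in> Z s) (cube n) X"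

definition abs_vals :: "nat \<Rightarrow> 'a \<Rightarrow> (nat \<Rightarrow> real) \<Rightarrow> 'a set" where
  "abs_vals n p s = (if s \<in> cube_boundary n then {p} else UNIV)"

definition rel_vals :: "nat \<Rightarrow> 'a set \<Rightarrow> 'a \<Rightarrow> (nat \<Rightarrow> real) \<Rightarrow> 'a set" where
  "rel_vals n A p s = (if s \<in> cube_box n then {p} else if s \<in> cube_boundary n then A else UNIV)"

lemma cube_box_boundary: "cube_box n \<subseteq> cube_boundary n" "cube_boundary n \<subseteq> icube n" by (auto simp: cube_box_def cube_boundary_def)

lemma homotopic_spheroids_in: "homotopic_spheroids n X p = homotopic_in n X (abs_vals n p)"
proof -
  have "(\<lambda>f. f ` cube_boundary n \<subseteq> {p}) = (\<lambda>f. \<forall>s\<in>icube n. f s \<in> abs_vals n p s)"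
    using cube_box_boundary(2)[of n] by (auto simp: abs_vals_def fun_eq_iff)
  then show ?thesis by (simp add: homotopic_spheroids_def homotopic_in_def)
qed

lemma homotopic_rel_spheroids_in: "p \<in> A \<Longrightarrow> homotopic_rel_spheroids n X A p = homotopic_in n X (rel_vals n A p)"
proof -
  assume "p \<in> A"
  then have "(\<lambda>f. f ` cube_boundary n \<subseteq> A \<and> f ` cube_box n \<subseteq> {p}) = (\<lambda>f. \<forall>s\<in>icube n. f s \<in> rel_vals n A p s)"
    using cube_box_boundary[of n] by (fastforce simp: rel_vals_def fun_eq_iff)
  then show ?thesis by (simp add: homotopic_rel_spheroids_def homotopic_in_def)
qed

definition htpy :: "nat \<Rightarrow> 'a topology \<Rightarrow> ((nat \<Rightarrow> real) \<Rightarrow> 'a set) \<Rightarrow> ((nat \<Rightarrow> real) \<Rightarrow> 'a) \<Rightarrow> ((nat \<Rightarrow> real) \<Rightarrow> 'a) \<Rightarrow> (real \<Rightarrow> (nat \<Rightarrow> real) \<Rightarrow> 'a) \<Rightarrow> bool" where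
  "htpy n X Z f g H \<longleftrightarrow> continuous_map (cyl n) X (\<lambda>z. H (fst z) (snd z)) \<and>
     (\<forall>s\<in>icube n. H 0 s = f s) \<and> (\<forall>s\<in>icube n. H 1 s = g s) \<and> (\<forall>t\<in>{0..1}. \<forall>s\<in>icube n. H t s \<in> Z s)"

lemma htpyD:
  assumes "htpy n X Z f g H"
  shows "continuous_map (cyl n) X (\<lambda>z. H (fst z) (snd z))" "\<forall>s\<in>icube n. H 0 s = f s" "\<forall>s\<in>icube n. H 1 s = g s"
    "\<forall>t\<in>{0..1}. \<forall>s\<in>icube n. H t s \<in> Z s" using assms by (auto simp: htpy_def)

lemma homotopic_in_iff: "homotopic_in n X Z f g \<longleftrightarrow> (\<exists>H. htpy n X Z f g H)"
proof -
  have *: "homotopic_in n X Z f g \<longleftrightarrow> (\<exists>h. continuous_map (cyl n) X h \<and>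
     (\<forall>s\<in>icube n. h (0, s) = f s) \<and> (\<forall>s\<in>icube n. h (1, s) = g s) \<and> (\<forall>t\<in>{0..1}. \<forall>s\<in>icube n. h (t, s) \<in> Z s))"
    unfolding homotopic_in_def by (rule homotopic_with) auto
  show ?thesis
  proof
    assume "homotopic_in n X Z f g"
    then obtain h where "continuous_map (cyl n) X h"
      "\<forall>s\<in>icube n. h (0, s) = f s" "\<forall>s\<in>icube n. h (1, s) = g s"
      "\<forall>t\<in>{0..1}. \<forall>s\<in>icube n. h (t, s) \<in> Z s" unfolding * by (elim exE conjE)
    then have "htpy n X Z f g (\<lambda>t s. h (t, s))" by (simp add: htpy_def)
    then show "\<exists>H. htpy n X Z f g H" by blast
  next
    assume "\<exists>H. htpy n X Z f g H"
    then obtain H where "htpy n X Z f g H" by (elim exE)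
    then show "homotopic_in n X Z f g" by (intro *[THEN iffD2] exI[of _ "\<lambda>z. H (fst z) (snd z)"]) (simp add: htpy_def)
  qed
qed

lemma homotopic_inI:
  assumes "continuous_map (cyl n) X (\<lambda>z. H (fst z) (snd z))"
    "\<And>s. s \<in> icube n \<Longrightarrow> H 0 s = f s" "\<And>s. s \<in> icube n \<Longrightarrow> H 1 s = g s"
    "\<And>t s. 0 \<le> t \<Longrightarrow> t \<le> 1 \<Longrightarrow> s \<in> icube n \<Longrightarrow> H t s \<in> Z s"
  shows "homotopic_in n X Z f g" unfolding homotopic_in_iff htpy_def using assms by (intro exI[of _ H]) auto

lemma homotopic_in_sym: "homotopic_in n X Z f g \<Longrightarrow> homotopic_in n X Z g f" unfolding homotopic_in_def by (rule homotopic_with_symD)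

lemma homotopic_in_trans: "homotopic_in n X Z f g \<Longrightarrow> homotopic_in n X Z g h \<Longrightarrow> homotopic_in n X Z f h"
  unfolding homotopic_in_def by (rule homotopic_with_trans)

lemma homotopic_in_refl_iff: "homotopic_in n X Z f f \<longleftrightarrow> continuous_map (cube n) X f \<and> (\<forall>s\<in>icube n. f s \<in> Z s)"
  unfolding homotopic_in_def homotopic_with_refl by auto

lemma homotopic_in_refl1: "homotopic_in n X Z f g \<Longrightarrow> homotopic_in n X Z f f" using homotopic_in_sym homotopic_in_trans by blast

lemma homotopic_in_refl2: "homotopic_in n X Z f g \<Longrightarrow> homotopic_in n X Z g g" using homotopic_in_sym homotopic_in_trans by blast

lemma homotopic_in_eq:
  "homotopic_in n X Z f f \<Longrightarrow> (\<And>s. s \<in> icube n \<Longrightarrow> f s = g s) \<Longrightarrow> homotopic_in n X Z f g"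
  unfolding homotopic_in_refl_iff by (rule homotopic_inI[where H = "\<lambda>_. f"]) (auto intro: continuous_map_compose[OF continuous_map_snd, unfolded o_def])

lemma homotopic_in_mono:
  assumes "homotopic_in n (subtopology X S) Z f g" and Z: "\<And>s. Z s \<inter> S \<subseteq> Z' s" shows "homotopic_in n X Z' f g"
proof -
  obtain H where H: "htpy n (subtopology X S) Z f g H" using assms(1) unfolding homotopic_in_iff by blast
  note H = htpyD[OF H]
  have "H t s \<in> Z' s" if "t \<in> {0..1}" "s \<in> icube n" for t s
  proof -
    have "H t s \<in> S" using continuous_map_funspace[OF H(1)] that by (auto simp: Pi_iff)
    moreover have "H t s \<in> Z s" using H(4) that by blast
    ultimately show ?thesis using Z by blast
  qed
  then show ?thesis using H by (intro homotopic_inI[where H = H]) (auto simp: continuous_map_in_subtopology)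
qed

definition hclass :: "nat \<Rightarrow> 'a topology \<Rightarrow> ((nat \<Rightarrow> real) \<Rightarrow> 'a set) \<Rightarrow> ((nat \<Rightarrow> real) \<Rightarrow> 'a) \<Rightarrow> ((nat \<Rightarrow> real) \<Rightarrow> 'a) set" where
  "hclass n X Z f = {g. homotopic_in n X Z f g}"

definition hclasses :: "nat \<Rightarrow> 'a topology \<Rightarrow> ((nat \<Rightarrow> real) \<Rightarrow> 'a set) \<Rightarrow> ((nat \<Rightarrow> real) \<Rightarrow> 'a) set set" where
  "hclasses n X Z = {f. homotopic_in n X Z f f} // {(f, g). homotopic_in n X Z f g}"

lemma hclasses_iff: "\<alpha> \<in> hclasses n X Z \<longleftrightarrow> (\<exists>f. homotopic_in n X Z f f \<and> \<alpha> = hclass n X Z f)"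
  by (auto simp: hclasses_def quotient_def hclass_def)

lemma hclass_eq: "homotopic_in n X Z f g \<Longrightarrow> hclass n X Z f = hclass n X Z g"
  unfolding hclass_def using homotopic_in_sym homotopic_in_trans by blast

lemma hclass_eq_iff: "homotopic_in n X Z f f \<Longrightarrow> hclass n X Z f = hclass n X Z g \<longleftrightarrow> homotopic_in n X Z f g"
  using hclass_eq[of n X Z f g] homotopic_in_sym[of n X Z g f] by (auto simp: hclass_def)

lemma hclass_incl:
  assumes "\<And>g. homotopic_in n X Z f g \<Longrightarrow> homotopic_in n Y Z' f g" "homotopic_in n X Z f f"
  shows "{g. \<exists>f'\<in>hclass n X Z f. homotopic_in n Y Z' f' g} = hclass n Y Z' f"
  unfolding hclass_def using assms homotopic_in_sym homotopic_in_trans by blast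

lemma pi_incl_hclass:
  assumes f: "homotopic_in n (subtopology X A) (abs_vals n p) f f"
  shows "pi_incl n X p (hclass n (subtopology X A) (abs_vals n p) f) = hclass n X (abs_vals n p) f"
  unfolding pi_incl_def homotopic_spheroids_in by (rule hclass_incl[OF _ f]) (erule homotopic_in_mono, auto)

lemma rel_vals_1: "rel_vals 1 A p s = (if s \<in> icube 1 \<and> s 0 = 1 then {p} else if s \<in> icube 1 \<and> s 0 = 0 then A else UNIV)"
  by (auto simp: rel_vals_def cube_box_def cube_boundary_def)

definition pc :: "'a topology \<Rightarrow> 'a \<Rightarrow> 'a set" where "pc X x = {y. path_component_of X x y}"

lemma path_components_pc: "C \<in> path_components_of X \<longleftrightarrow> (\<exists>x\<in>topspace X. C = pc X x)"
  by (auto simp: path_components_of_def pc_def)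

lemma pc_eq: "path_component_of X x y \<Longrightarrow> pc X x = pc X y" unfolding pc_def
  by (intro Collect_cong iffI) (erule (1) path_component_of_trans[OF path_component_of_sym], erule (1) path_component_of_trans)

lemma pc_eq_iff: "x \<in> topspace X \<Longrightarrow> pc X x = pc X y \<longleftrightarrow> path_component_of X x y"
  using pc_eq[of X x y] path_component_of_refl[of X x] path_component_of_sym[of X y x] by (auto simp: pc_def)

lemma path_component_subtopology: "path_component_of (subtopology X A) x y \<Longrightarrow> path_component_of X x y"
  by (auto simp: path_component_of_def pathin_def continuous_map_in_subtopology)

lemma path_component_of_image: "path_component_of X x y \<Longrightarrow> continuous_map X Y f \<Longrightarrow> path_component_of Y (f x) (f y)"
  unfolding path_component_of_def pathin_def by (elim exE conjE) (rule_tac x = "f \<circ> g" in exI, auto intro: continuous_map_compose)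

lemma pi0_incl_pc: "x \<in> A \<Longrightarrow> x \<in> topspace X \<Longrightarrow> pi0_incl X (pc (subtopology X A) x) = pc X x"
proof -
  assume x: "x \<in> A" "x \<in> topspace X"
  have "path_component_of (subtopology X A) x x" using x by (simp add: path_component_of_refl)
  then show ?thesis unfolding pi0_incl_def pc_def by (auto intro: path_component_of_trans dest: path_component_subtopology)
qed

section \<open>Homotopy groups of a topological monoid by pointwise products\<close>

locale top_monoid =
  fixes X :: "'a topology" and m :: "'a \<Rightarrow> 'a \<Rightarrow> 'a" and p :: 'a
  assumes m_cont: "continuous_map (prod_topology X X) X (\<lambda>z. m (fst z) (snd z))"
    and m_assoc: "\<And>x y z. x \<in> topspace X \<Longrightarrow> y \<in> topspace X \<Longrightarrow> z \<in> topspace X \<Longrightarrow> m (m x y) z = m x (m y z)"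
    and p_top: "p \<in> topspace X"
    and m_unit: "\<And>x. x \<in> topspace X \<Longrightarrow> m p x = x" "\<And>x. x \<in> topspace X \<Longrightarrow> m x p = x"
begin

abbreviation "hin n \<equiv> homotopic_in n X"
abbreviation "RX n \<equiv> homotopic_in n X (abs_vals n p)"
abbreviation "clX n \<equiv> hclass n X (abs_vals n p)"

lemma m_continuous: "continuous_map T X f \<Longrightarrow> continuous_map T X g \<Longrightarrow> continuous_map T X (\<lambda>q. m (f q) (g q))"
  using continuous_map_compose[OF _ m_cont, of T "\<lambda>q. (f q, g q)"] by (simp add: continuous_map_paired o_def)

lemma m_top: "x \<in> topspace X \<Longrightarrow> y \<in> topspace X \<Longrightarrow> m x y \<in> topspace X"
  using continuous_map_funspace[OF m_cont] by (auto simp: Pi_iff)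

definition pw :: "((nat \<Rightarrow> real) \<Rightarrow> 'a) \<Rightarrow> ((nat \<Rightarrow> real) \<Rightarrow> 'a) \<Rightarrow> (nat \<Rightarrow> real) \<Rightarrow> 'a" where
  "pw f g = (\<lambda>s. m (f s) (g s))"

definition closed_vals :: "((nat \<Rightarrow> real) \<Rightarrow> 'a set) \<Rightarrow> bool" where
  "closed_vals Z \<longleftrightarrow> (\<forall>s. p \<in> Z s \<and> (\<forall>x\<in>Z s. \<forall>y\<in>Z s. m x y \<in> Z s))"

lemma closed_vals_abs: "closed_vals (abs_vals n p)" using m_unit p_top by (auto simp: closed_vals_def abs_vals_def)

lemma homotopic_pw:
  assumes "hin n Z f f'" "hin n Z g g'" "closed_vals Z"
  shows "hin n Z (pw f g) (pw f' g')"
proof -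
  obtain H where H: "htpy n X Z f f' H" using assms(1) unfolding homotopic_in_iff by blast
  note H = htpyD[OF H]
  obtain K where K: "htpy n X Z g g' K" using assms(2) unfolding homotopic_in_iff by blast
  note K = htpyD[OF K]
  show ?thesis by (rule homotopic_inI[where H = "\<lambda>t s. m (H t s) (K t s)"]) (use H K assms(3) in "auto simp: pw_def closed_vals_def intro!: m_continuous")
qed

lemma homotopic_const: "closed_vals Z \<Longrightarrow> hin n Z (\<lambda>_. p) (\<lambda>_. p)"
  using p_top by (simp add: homotopic_in_refl_iff closed_vals_def continuous_map_const)

text \<open>The operation \<open>c\<close> is left open in order to cover both concatenation, which
  defines absolute groups, and the pointwise product, which defines the relative monoid.\<close>

lemma hclass_pw:
  assumes f: "hin n Z f f" and g: "hin n Z g g" and Z: "closed_vals Z"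
    and c: "\<And>f g. hin n Z f f \<Longrightarrow> hin n Z g g \<Longrightarrow> hin n Z (c f g) (pw f g)"
  shows "{h. \<exists>f'\<in>hclass n X Z f. \<exists>g'\<in>hclass n X Z g. hin n Z (c f' g') h} = hclass n X Z (pw f g)"
proof (intro Set.set_eqI iffI)
  fix h assume "h \<in> {h. \<exists>f'\<in>hclass n X Z f. \<exists>g'\<in>hclass n X Z g. hin n Z (c f' g') h}"
  then obtain f' g' where fg: "hin n Z f f'" "hin n Z g g'" "hin n Z (c f' g') h" by (auto simp: hclass_def)
  have "hin n Z (pw f g) (pw f' g')" by (rule homotopic_pw[OF fg(1,2) Z])
  moreover have "hin n Z (pw f' g') (c f' g')" by (rule homotopic_in_sym[OF c[OF homotopic_in_refl2[OF fg(1)] homotopic_in_refl2[OF fg(2)]]])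
  ultimately show "h \<in> hclass n X Z (pw f g)" unfolding hclass_def using fg(3) homotopic_in_trans by blast
next
  fix h assume "h \<in> hclass n X Z (pw f g)"
  then have "hin n Z (c f g) h" using homotopic_in_trans[OF c[OF f g]] by (simp add: hclass_def)
  then show "h \<in> {h. \<exists>f'\<in>hclass n X Z f. \<exists>g'\<in>hclass n X Z g. hin n Z (c f' g') h}" using f g by (auto simp: hclass_def)
qed

text \<open>A common description of \<open>homotopy_group\<close> and \<open>rel_pi1_monoid\<close>,
  whose products are defined differently, so that the monoid laws are proved once.\<close>

definition pw_monoid :: "nat \<Rightarrow> ((nat \<Rightarrow> real) \<Rightarrow> 'a set) \<Rightarrow> ((nat \<Rightarrow> real) \<Rightarrow> 'a) set monoid \<Rightarrow> bool" where
  "pw_monoid n Z G \<longleftrightarrow> carrier G = hclasses n X Z \<and> \<one>\<^bsub>G\<^esub> = hclass n X Z (\<lambda>_. p) \<and>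
     (\<forall>f g. hin n Z f f \<longrightarrow> hin n Z g g \<longrightarrow> hclass n X Z f \<otimes>\<^bsub>G\<^esub> hclass n X Z g = hclass n X Z (pw f g))"

lemma pw_assoc:
  assumes "hin n Z f f" "hin n Z g g" "hin n Z h h" "closed_vals Z"
  shows "hin n Z (pw (pw f g) h) (pw f (pw g h))"
proof (rule homotopic_in_eq)
  show "hin n Z (pw (pw f g) h) (pw (pw f g) h)" by (intro homotopic_pw assms)
  have "continuous_map (cube n) X f" "continuous_map (cube n) X g" "continuous_map (cube n) X h" using assms unfolding homotopic_in_refl_iff by blast+
  then show "pw (pw f g) h s = pw f (pw g h) s" if "s \<in> icube n" for s
    using that continuous_map_funspace[of "cube n" X] by (auto simp: pw_def Pi_iff intro!: m_assoc)
qed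

lemma pw_unit:
  assumes "hin n Z f f"
  shows "hin n Z (pw (\<lambda>_. p) f) f" "hin n Z (pw f (\<lambda>_. p)) f"
proof -
  have "continuous_map (cube n) X f" using assms unfolding homotopic_in_refl_iff by blast
  then have "f s \<in> topspace X" if "s \<in> icube n" for s using that by (auto dest!: continuous_map_funspace)
  then show "hin n Z (pw (\<lambda>_. p) f) f" "hin n Z (pw f (\<lambda>_. p)) f"
    by (auto intro!: homotopic_in_sym[OF homotopic_in_eq[OF assms]] simp: pw_def m_unit)
qed

lemma pw_monoid_monoid:
  assumes G: "pw_monoid n Z G" and Z: "closed_vals Z" shows "monoid G"
proof -
  have G: "carrier G = hclasses n X Z" "\<one>\<^bsub>G\<^esub> = hclass n X Z (\<lambda>_. p)"
    and mult: "\<And>f g. hin n Z f f \<Longrightarrow> hin n Z g g \<Longrightarrow> hclass n X Z f \<otimes>\<^bsub>G\<^esub> hclass n X Z g = hclass n X Z (pw f g)"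
    using G by (auto simp: pw_monoid_def)
  note ref = homotopic_pw[OF _ _ Z]
  show ?thesis
  proof (rule monoidI)
    show "\<one>\<^bsub>G\<^esub> \<in> carrier G" using homotopic_const[OF Z] unfolding G hclasses_iff by blast
    fix a assume "a \<in> carrier G"
    then obtain f where f: "hin n Z f f" "a = hclass n X Z f" unfolding G hclasses_iff by blast
    show "\<one>\<^bsub>G\<^esub> \<otimes>\<^bsub>G\<^esub> a = a" "a \<otimes>\<^bsub>G\<^esub> \<one>\<^bsub>G\<^esub> = a"
      unfolding G(2) f(2) mult[OF f(1) homotopic_const[OF Z]] mult[OF homotopic_const[OF Z] f(1)]
      by (rule hclass_eq[OF pw_unit(1)[OF f(1)]], rule hclass_eq[OF pw_unit(2)[OF f(1)]])
    fix b assume "b \<in> carrier G"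
    then obtain g where g: "hin n Z g g" "b = hclass n X Z g" unfolding G hclasses_iff by blast
    show "a \<otimes>\<^bsub>G\<^esub> b \<in> carrier G" unfolding f(2) g(2) mult[OF f(1) g(1)] using ref[OF f(1) g(1)] unfolding G hclasses_iff by blast
    fix c assume "c \<in> carrier G"
    then obtain h where h: "hin n Z h h" "c = hclass n X Z h" unfolding G hclasses_iff by blast
    show "a \<otimes>\<^bsub>G\<^esub> b \<otimes>\<^bsub>G\<^esub> c = a \<otimes>\<^bsub>G\<^esub> (b \<otimes>\<^bsub>G\<^esub> c)"
      unfolding f(2) g(2) h(2) mult[OF f(1) g(1)] mult[OF g(1) h(1)] mult[OF ref[OF f(1) g(1)] h(1)] mult[OF f(1) ref[OF g(1) h(1)]]
      by (rule hclass_eq[OF pw_assoc[OF f(1) g(1) h(1) Z]])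
  qed
qed

lemma sph_val: "RX n f f \<Longrightarrow> s \<in> cube_boundary n \<Longrightarrow> f s = p"
  unfolding homotopic_in_refl_iff using subsetD[OF cube_box_boundary(2)] by (fastforce simp: abs_vals_def)

lemma sph_cont: "hin n Z f f \<Longrightarrow> continuous_map (cube n) X f" by (simp add: homotopic_in_refl_iff)

lemma sph_top: "hin n Z f f \<Longrightarrow> s \<in> icube n \<Longrightarrow> f s \<in> topspace X" using continuous_map_funspace[OF sph_cont] by blast

lemma homotopy_coord:
  assumes f: "continuous_map (cube n) X f" and i: "i < n" and c: "continuous_map (cyl n) euclideanreal (\<lambda>z. c (fst z) (snd z))"
    "\<And>t s. 0 \<le> t \<Longrightarrow> t \<le> 1 \<Longrightarrow> s \<in> icube n \<Longrightarrow> 0 \<le> c t s \<and> c t s \<le> 1"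
  shows "continuous_map (cyl n) X (\<lambda>z. f ((snd z)(i := c (fst z) (snd z))))"
  by (rule continuous_map_compose[OF continuous_map_cube_upd[OF continuous_map_snd i c(1)] f, unfolded o_def]) (use c(2) in auto)

lemma interp_cont:
  fixes a b :: "real \<Rightarrow> real"
  assumes "continuous_on UNIV a" "continuous_on UNIV b" "0 < n"
  shows "continuous_map (cyl n) euclideanreal (\<lambda>z. (1 - fst z) * a (snd z 0) + fst z * b (snd z 0))"
proof -
  have 1: "continuous_map (cyl n) euclideanreal fst" by (rule continuous_map_fst[of "I01" "cube n", unfolded continuous_map_in_subtopology, THEN conjunct1])
  have 2: "continuous_map (cyl n) euclideanreal (\<lambda>z. snd z 0)" by (rule cube_coord[OF continuous_map_snd assms(3)])
  have "continuous_map euclideanreal euclideanreal a" "continuous_map euclideanreal euclideanreal b" using assms by auto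
  then have "continuous_map (cyl n) euclideanreal (\<lambda>z. a (snd z 0))"
      "continuous_map (cyl n) euclideanreal (\<lambda>z. b (snd z 0))" by (auto intro!: continuous_map_compose[OF 2, unfolded o_def])
  with 1 show ?thesis by (intro continuous_intros)
qed

lemma upd_boundary: "s \<in> cube_boundary n \<Longrightarrow> i < n \<Longrightarrow> 0 \<le> c \<Longrightarrow> c \<le> 1 \<Longrightarrow> (s i = 0 \<Longrightarrow> c = 0) \<Longrightarrow> (s i = 1 \<Longrightarrow> c = 1) \<Longrightarrow> s(i := c) \<in> cube_boundary n"
  using cube_upd[of s n i c] by (elim boundaryE) (rule_tac i = ia in boundaryI, auto)

text \<open>The reparametrisations \<open>a\<close> and \<open>b\<close> of the first coordinate are
  moved linearly to the identity. They keep the end points of the coordinate, and the condition on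
  \<open>Z\<close> says that such changes respect the prescribed values.\<close>

lemma reparam_pw:
  fixes a b :: "real \<Rightarrow> real"
  assumes n: "0 < n" and f: "hin n Z f f" and g: "hin n Z g g" and Z: "closed_vals Z"
    and Zr: "\<And>s c. s \<in> icube n \<Longrightarrow> 0 \<le> c \<Longrightarrow> c \<le> 1 \<Longrightarrow> (s 0 = 0 \<Longrightarrow> c = 0) \<Longrightarrow> (s 0 = 1 \<Longrightarrow> c = 1) \<Longrightarrow> Z (s(0 := c)) \<subseteq> Z s"
    and a: "continuous_on UNIV a" "a 0 = 0" "a 1 = 1" "\<And>x. 0 \<le> x \<Longrightarrow> x \<le> 1 \<Longrightarrow> 0 \<le> a x \<and> a x \<le> 1"
    and b: "continuous_on UNIV b" "b 0 = 0" "b 1 = 1" "\<And>x. 0 \<le> x \<Longrightarrow> x \<le> 1 \<Longrightarrow> 0 \<le> b x \<and> b x \<le> 1"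
  shows "hin n Z (\<lambda>s. m (f (s(0 := a (s 0)))) (g (s(0 := b (s 0))))) (pw f g)"
proof -
  have ab: "0 \<le> (1 - t) * a x + t * x \<and> (1 - t) * a x + t * x \<le> 1" "0 \<le> (1 - t) * b x + t * x \<and> (1 - t) * b x + t * x \<le> 1"
    if "0 \<le> t" "t \<le> 1" "0 \<le> x" "x \<le> 1" for t x
    using that a(4)[of x] b(4)[of x] by (auto intro!: convex_bound_le add_nonneg_nonneg mult_nonneg_nonneg)
  note s0 = in_cube[of _ n, THEN iffD1, THEN conjunct2, rule_format, OF _ n]
  show ?thesis
  proof (rule homotopic_inI[where H = "\<lambda>t s. m (f (s(0 := (1 - t) * a (s 0) + t * s 0))) (g (s(0 := (1 - t) * b (s 0) + t * s 0)))"])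
    show "continuous_map (cyl n) X (\<lambda>z. m (f ((snd z)(0 := (1 - fst z) * a (snd z 0) + fst z * snd z 0)))
        (g ((snd z)(0 := (1 - fst z) * b (snd z 0) + fst z * snd z 0))))"
      by (intro m_continuous homotopy_coord[where c = "\<lambda>t s. (1 - t) * a (s 0) + t * s 0"]
          homotopy_coord[where c = "\<lambda>t s. (1 - t) * b (s 0) + t * s 0"] sph_cont[OF f] sph_cont[OF g] n ab interp_cont a(1) b(1))
        (auto simp: s0 intro!: continuous_intros)
    show "m (f (s(0 := (1 - t) * a (s 0) + t * s 0))) (g (s(0 := (1 - t) * b (s 0) + t * s 0))) \<in> Z s"
      if t: "0 \<le> t" "t \<le> 1" and s: "s \<in> icube n" for t s
    proof -
      let ?c = "(1 - t) * a (s 0) + t * s 0" and ?d = "(1 - t) * b (s 0) + t * s 0"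
      have cd: "0 \<le> ?c \<and> ?c \<le> 1" "0 \<le> ?d \<and> ?d \<le> 1" using ab[OF t] s0[OF s] by blast+
      have "f (s(0 := ?c)) \<in> Z (s(0 := ?c))" "g (s(0 := ?d)) \<in> Z (s(0 := ?d))" using f g cube_upd[OF s n] cd unfolding homotopic_in_refl_iff by blast+
      moreover have "Z (s(0 := ?c)) \<subseteq> Z s" "Z (s(0 := ?d)) \<subseteq> Z s" using Zr[OF s] cd a(2,3) b(2,3) by auto
      ultimately show ?thesis using Z unfolding closed_vals_def by blast
    qed
  qed (simp_all add: pw_def)
qed

text \<open>The Eckmann-Hilton argument: concatenation is the product of \<open>f\<close>, run in
  the first half, and \<open>g\<close>, run in the second, each resting at \<open>p\<close>
  otherwise. Undoing the reparametrisations leaves the pointwise product.\<close>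

lemma concat_pw:
  assumes n: "0 < n" and f: "RX n f f" and g: "RX n g g"
  shows "RX n (concat_spheroids f g) (pw f g)"
proof -
  define a b where "a x = min (2 * x) 1" and "b x = max (2 * x - 1) 0" for x :: real
  note s0 = in_cube[of _ n, THEN iffD1, THEN conjunct2, rule_format, OF _ n]
  have "RX n (\<lambda>s. m (f (s(0 := a (s 0)))) (g (s(0 := b (s 0))))) (pw f g)"
  proof (rule reparam_pw[OF n f g closed_vals_abs])
    show "abs_vals n p (s(0 := c)) \<subseteq> abs_vals n p s"
      if "s \<in> icube n" "0 \<le> c" "c \<le> 1" "s 0 = 0 \<Longrightarrow> c = 0" "s 0 = 1 \<Longrightarrow> c = 1" for s c
      using upd_boundary[OF _ n, of s c] that by (auto simp: abs_vals_def)
  qed (auto simp: a_def[abs_def] b_def[abs_def] intro!: continuous_intros)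
  moreover have "m (f (s(0 := a (s 0)))) (g (s(0 := b (s 0)))) = concat_spheroids f g s" if s: "s \<in> icube n" for s
  proof (cases "s 0 \<le> 1/2")
    case True
    have "s(0 := 0) \<in> cube_boundary n" by (rule boundaryI[OF cube_upd[OF s n] n]) auto
    moreover have "f (s(0 := 2 * s 0)) \<in> topspace X" using sph_top[OF f cube_upd[OF s n]] True s0[OF s] by simp
    ultimately show ?thesis using True sph_val[OF g] by (simp add: concat_spheroids_def a_def b_def m_unit)
  next
    case False
    have "s(0 := 1) \<in> cube_boundary n" by (rule boundaryI[OF cube_upd[OF s n] n]) auto
    moreover have "g (s(0 := 2 * s 0 - 1)) \<in> topspace X" using sph_top[OF g cube_upd[OF s n]] False s0[OF s] by simp
    ultimately show ?thesis using False sph_val[OF f] by (simp add: concat_spheroids_def a_def b_def m_unit)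
  qed
  ultimately show ?thesis using homotopic_in_trans[OF homotopic_in_sym[OF homotopic_in_eq[OF homotopic_in_refl1]]] by blast
qed

lemma homotopy_group_pw_monoid:
  assumes n: "0 < n" shows "pw_monoid n (abs_vals n p) (homotopy_group n X p)" unfolding pw_monoid_def
proof (intro conjI allI impI)
  show "carrier (homotopy_group n X p) = hclasses n X (abs_vals n p)"
    "\<one>\<^bsub>homotopy_group n X p\<^esub> = clX n (\<lambda>_. p)"
    by (simp_all add: homotopy_group_def homotopic_spheroids_in hclasses_def hclass_def)
  fix f g assume "RX n f f" "RX n g g"
  from hclass_pw[OF this closed_vals_abs concat_pw[OF n]]
  show "clX n f \<otimes>\<^bsub>homotopy_group n X p\<^esub> clX n g = clX n (pw f g)"
    by (simp add: homotopy_group_def homotopic_spheroids_in)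
qed

text \<open>The inverse is the reversal in the first coordinate. The concatenation of the reversal
  with \<open>f\<close> is \<open>f\<close> read at \<open>\<bar>2 * x - 1\<bar>\<close>, and
  pushing this coordinate to \<open>1\<close>, where \<open>f\<close> is \<open>p\<close>, contracts
  it.\<close>

lemma homotopy_group_group:
  assumes n: "0 < n" shows "group (homotopy_group n X p)"
proof -
  let ?G = "homotopy_group n X p" and ?R = "RX n" and ?c = "clX n"
  note G = homotopy_group_pw_monoid[OF n, unfolded pw_monoid_def]
  interpret monoid ?G by (rule pw_monoid_monoid[OF homotopy_group_pw_monoid[OF n] closed_vals_abs])
  note s0 = in_cube[of _ n, THEN iffD1, THEN conjunct2, rule_format, OF _ n]
  have inv: "\<exists>g. ?R g g \<and> ?R (pw g f) (\<lambda>_. p)" if f: "?R f f" for f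
  proof -
    define g where "g s = f (s(0 := 1 - s 0))" for s
    have "continuous_map (cube n) X g" unfolding g_def
      by (rule continuous_map_compose[OF continuous_map_cube_upd[OF continuous_map_id[unfolded id_def] n] sph_cont[OF f], unfolded o_def])
        (use cube_coord[OF continuous_map_id[unfolded id_def] n] s0 in "auto intro!: continuous_intros")
    moreover have "g s = p" if s: "s \<in> cube_boundary n" for s
    proof -
      have sc: "s \<in> icube n" using s cube_box_boundary(2) by blast
      have "s(0 := 1 - s 0) \<in> icube n" using cube_upd[OF sc n, of "1 - s 0"] s0[OF sc] by simp
      then have "s(0 := 1 - s 0) \<in> cube_boundary n" using s by (elim boundaryE) (rule_tac i = i in boundaryI, auto)
      then show ?thesis using sph_val[OF f] by (simp add: g_def)
    qed
    ultimately have g: "?R g g" by (auto simp: homotopic_in_refl_iff abs_vals_def)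
    define a where "a x = \<bar>2 * x - 1\<bar>" for x :: real
    have a01: "0 \<le> (1 - t) * a x + t * 1 \<and> (1 - t) * a x + t * 1 \<le> 1" if "0 \<le> t" "t \<le> 1" "0 \<le> x" "x \<le> 1" for t x
    proof -
      have "0 \<le> a x" "a x \<le> 1" using that by (auto simp: a_def)
      then show ?thesis using that mult_left_le[of "a x" "1 - t"] by simp
    qed
    have "?R (concat_spheroids g f) (\<lambda>_. p)"
    proof (rule homotopic_inI[where H = "\<lambda>t s. f (s(0 := (1 - t) * a (s 0) + t * 1))"])
      show "continuous_map (cyl n) X (\<lambda>z. f ((snd z)(0 := (1 - fst z) * a (snd z 0) + fst z * 1)))"
        by (intro homotopy_coord[where c = "\<lambda>t s. (1 - t) * a (s 0) + t * 1"] sph_cont[OF f] n a01 interp_cont[where b = "\<lambda>_. 1"])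
          (auto simp: a_def[abs_def] s0 intro!: continuous_intros)
      show "f (s(0 := (1 - 0) * a (s 0) + 0 * 1)) = concat_spheroids g f s" for s by (simp add: concat_spheroids_def a_def g_def)
      show "f (s(0 := (1 - 1) * a (s 0) + 1 * 1)) = p" if s: "s \<in> icube n" for s using sph_val[OF f boundaryI[OF cube_upd[OF s n, of 1] n]] by simp
      show "f (s(0 := (1 - t) * a (s 0) + t * 1)) \<in> abs_vals n p s" if t: "0 \<le> t" "t \<le> 1" and s: "s \<in> icube n" for t s
      proof (cases "s \<in> cube_boundary n")
        case True
        let ?s = "s(0 := (1 - t) * a (s 0) + t * 1)"
        have "?s \<in> icube n" using cube_upd[OF s n] a01[OF t] s0[OF s] by blast
        moreover obtain i where i: "i < n" "s i = 0 \<or> s i = 1" using True by (rule boundaryE)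
        have "?s 0 = 1 \<or> i \<noteq> 0" using i(2) by (auto simp: a_def)
        then have "?s 0 = 1 \<or> ?s i = 0 \<or> ?s i = 1" using i(2) by auto
        ultimately have "?s \<in> cube_boundary n" using boundaryI[OF _ n] boundaryI[OF _ i(1)] by metis
        then show ?thesis using sph_val[OF f] True by (simp add: abs_vals_def)
      qed (simp add: abs_vals_def)
    qed
    then show ?thesis using g homotopic_in_trans[OF homotopic_in_sym[OF concat_pw[OF n g f]]] by blast
  qed
  show ?thesis
  proof (rule groupI)
    fix d assume "d \<in> carrier ?G"
    then obtain f where f: "?R f f" "d = ?c f" using G unfolding hclasses_iff[symmetric] by (metis hclasses_iff)
    obtain g where g: "?R g g" "?R (pw g f) (\<lambda>_. p)" using inv[OF f(1)] by blast
    have "?c g \<in> carrier ?G" using g(1) G hclasses_iff by metis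
    moreover have "?c g \<otimes>\<^bsub>?G\<^esub> d = \<one>\<^bsub>?G\<^esub>" using G f g hclass_eq[OF g(2)] by metis
    ultimately show "\<exists>y\<in>carrier ?G. y \<otimes>\<^bsub>?G\<^esub> d = \<one>\<^bsub>?G\<^esub>" by blast
  qed (auto simp: m_assoc)
qed

lemma path_component_m:
  assumes "path_component_of X x x'" "path_component_of X y y'" shows "path_component_of X (m x y) (m x' y')"
proof -
  obtain f g where "pathin X f" "f 0 = x" "f 1 = x'" "pathin X g" "g 0 = y" "g 1 = y'" using assms by (auto simp: path_component_of_def)
  then show ?thesis unfolding path_component_of_def pathin_def by (intro exI[of _ "\<lambda>t. m (f t) (g t)"]) (auto intro: m_continuous)
qed

lemma pi0_mult: "x \<in> topspace X \<Longrightarrow> y \<in> topspace X \<Longrightarrow> pc X x \<otimes>\<^bsub>pi0_monoid X m p\<^esub> pc X y = pc X (m x y)"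
proof -
  assume xy: "x \<in> topspace X" "y \<in> topspace X"
  have "path_component_of X x x" "path_component_of X y y" using xy by (auto simp: path_component_of_refl)
  then have "{z. \<exists>x'\<in>pc X x. \<exists>y'\<in>pc X y. path_component_of X (m x' y') z} = pc X (m x y)"
    unfolding pc_def by (auto intro: path_component_of_trans path_component_m)
  then show ?thesis by (simp add: pi0_monoid_def)
qed

lemma pi0_carrier: "C \<in> carrier (pi0_monoid X m p) \<longleftrightarrow> (\<exists>x\<in>topspace X. C = pc X x)"
  by (simp add: pi0_monoid_def path_components_pc)

lemma pi0_one: "\<one>\<^bsub>pi0_monoid X m p\<^esub> = pc X p" by (simp add: pi0_monoid_def pc_def)

lemma pi0_group:
  assumes "\<And>x. x \<in> topspace X \<Longrightarrow> \<exists>g\<in>topspace X. path_component_of X (m g x) p"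
  shows "group (pi0_monoid X m p)"
proof (rule groupI)
  show "\<one>\<^bsub>pi0_monoid X m p\<^esub> \<in> carrier (pi0_monoid X m p)" unfolding pi0_carrier pi0_one using p_top by blast
  fix C assume "C \<in> carrier (pi0_monoid X m p)"
  then obtain x where x: "x \<in> topspace X" "C = pc X x" unfolding pi0_carrier by blast
  show "\<one>\<^bsub>pi0_monoid X m p\<^esub> \<otimes>\<^bsub>pi0_monoid X m p\<^esub> C = C" by (simp add: x pi0_one pi0_mult p_top m_unit)
  obtain g where g: "g \<in> topspace X" "path_component_of X (m g x) p" using assms[OF x(1)] by blast
  show "\<exists>D\<in>carrier (pi0_monoid X m p). D \<otimes>\<^bsub>pi0_monoid X m p\<^esub> C = \<one>\<^bsub>pi0_monoid X m p\<^esub>"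
    by (rule bexI[of _ "pc X g"]) (use g x in "auto simp: pi0_mult pi0_one pi0_carrier pc_eq")
  fix D assume "D \<in> carrier (pi0_monoid X m p)"
  then obtain y where y: "y \<in> topspace X" "D = pc X y" unfolding pi0_carrier by blast
  show "C \<otimes>\<^bsub>pi0_monoid X m p\<^esub> D \<in> carrier (pi0_monoid X m p)" unfolding x(2) y(2) pi0_mult[OF x(1) y(1)] pi0_carrier using m_top[OF x(1) y(1)] by blast
  fix B assume "B \<in> carrier (pi0_monoid X m p)"
  then obtain z where z: "z \<in> topspace X" "B = pc X z" unfolding pi0_carrier by blast
  show "C \<otimes>\<^bsub>pi0_monoid X m p\<^esub> D \<otimes>\<^bsub>pi0_monoid X m p\<^esub> B = C \<otimes>\<^bsub>pi0_monoid X m p\<^esub> (D \<otimes>\<^bsub>pi0_monoid X m p\<^esub> B)"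
    by (simp add: x y z pi0_mult m_top m_assoc)
qed

end

section \<open>Pairs with a cyclic cover deforming to the submonoid\<close>

text \<open>The contracting map is kept as data, because lifts are built along its tracks
  \<open>t \<mapsto> c t q\<close>.\<close>

definition contraction :: "'p topology \<Rightarrow> 'p \<Rightarrow> (real \<Rightarrow> 'p \<Rightarrow> 'p) \<Rightarrow> bool" where
  "contraction T q0 c \<longleftrightarrow> continuous_map (prod_topology I01 T) T (\<lambda>z. c (fst z) (snd z)) \<and>
     q0 \<in> topspace T \<and> (\<forall>q\<in>topspace T. c 0 q = q0 \<and> c 1 q = q)"

lemma continuous_map_fst_I01: "continuous_map (prod_topology I01 T) euclideanreal fst"
  by (rule continuous_map_fst[of I01 T, unfolded continuous_map_in_subtopology, THEN conjunct1])

lemma contraction_I01: "contraction I01 0 times" unfolding contraction_def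
  by (auto simp: continuous_map_in_subtopology intro!: continuous_intros continuous_map_fst_I01
      continuous_map_snd[of I01 I01, unfolded continuous_map_in_subtopology, THEN conjunct1] mult_le_one)

lemma contraction_cube: "contraction (cube n) (\<lambda>i\<in>{..<n}. 0) (\<lambda>t s. \<lambda>i\<in>{..<n}. t * s i)" unfolding contraction_def
proof (intro conjI ballI)
  show "continuous_map (cyl n) (cube n) (\<lambda>z. \<lambda>i\<in>{..<n}. fst z * snd z i)" unfolding continuous_map_cube
    by (auto simp: in_cube intro!: continuous_intros continuous_map_fst_I01 cube_coord[OF continuous_map_snd] mult_le_one)
qed (auto simp: in_cube extensional_def fun_eq_iff)

lemma contraction_prod:
  assumes S: "contraction S p0 c" and T: "contraction T q0 d"
  shows "contraction (prod_topology S T) (p0, q0) (\<lambda>t z. (c t (fst z), d t (snd z)))"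
proof -
  have 1: "continuous_map (prod_topology I01 (prod_topology S T)) S (\<lambda>z. c (fst z) (fst (snd z)))"
    using continuous_map_compose[of "prod_topology I01 (prod_topology S T)" "prod_topology I01 S" "\<lambda>z. (fst z, fst (snd z))" S "\<lambda>z. c (fst z) (snd z)"] S
    by (simp add: contraction_def o_def continuous_map_paired continuous_map_fst continuous_map_fst_of[unfolded o_def] continuous_map_compose[OF continuous_map_snd continuous_map_fst, unfolded o_def])
  have 2: "continuous_map (prod_topology I01 (prod_topology S T)) T (\<lambda>z. d (fst z) (snd (snd z)))"
    using continuous_map_compose[of "prod_topology I01 (prod_topology S T)" "prod_topology I01 T" "\<lambda>z. (fst z, snd (snd z))" T "\<lambda>z. d (fst z) (snd z)"] T
    by (simp add: contraction_def o_def continuous_map_paired continuous_map_fst continuous_map_compose[OF continuous_map_snd continuous_map_snd, unfolded o_def])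
  show ?thesis using S T 1 2 by (auto simp: contraction_def continuous_map_paired)
qed

text \<open>Each track of the contraction starts at \<open>q0\<close>, and along it the
  circle-valued map is lifted from one fixed value. These lifts are jointly continuous by
  \<open>lift_family_continuous\<close>, and their values at time \<open>1\<close> form a lift on
  \<open>T\<close>, which an integer shift adjusts at \<open>v\<close>.\<close>

lemma lift_contractible:
  assumes c: "contraction T q0 c"
    and u: "continuous_map T euclidean u" "\<And>q. q \<in> topspace T \<Longrightarrow> norm (u q) = 1"
    and v: "v \<in> topspace T" "u v = circ s"
  shows "\<exists>l. continuous_map T euclideanreal l \<and> (\<forall>q\<in>topspace T. u q = circ (l q)) \<and> l v = s"
proof -
  have c: "continuous_map (prod_topology I01 T) T (\<lambda>z. c (fst z) (snd z))" "q0 \<in> topspace T"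
    "\<And>q. q \<in> topspace T \<Longrightarrow> c 0 q = q0" "\<And>q. q \<in> topspace T \<Longrightarrow> c 1 q = q" using c by (auto simp: contraction_def)
  have ctop: "c t q \<in> topspace T" if "t \<in> {0..1}" "q \<in> topspace T" for t q using continuous_map_funspace[OF c(1)] that by (auto simp: Pi_iff)
  have swap: "continuous_map (prod_topology T I01) (prod_topology I01 T) (\<lambda>z. (snd z, fst z))"
    by (simp add: continuous_map_paired continuous_map_fst continuous_map_snd)
  have q: "Ck 0 T {0..1} (\<lambda>p t. u (c t p))"
    unfolding Ck.simps using continuous_map_compose[OF continuous_map_compose[OF swap c(1)] u(1)] by (simp add: o_def)
  obtain s0 where s0: "u q0 = cis s0" using u(2)[OF c(2)] by (metis complex_norm_eq_1_exp cis_conv_exp)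
  have "\<exists>l. continuous_on {0..1} l \<and> (\<forall>t\<in>{0..1}. u (c t p) = cis (l t)) \<and> l 0 = s0" if p: "p \<in> topspace T" for p
  proof -
    have "continuous_map I01 (prod_topology T I01) (\<lambda>t. (p, t))" using p by (simp add: continuous_map_paired continuous_map_const)
    from continuous_map_compose[OF this q[unfolded Ck.simps]] have pc: "continuous_on {0..1} (\<lambda>t. u (c t p))" by (simp add: o_def)
    have n1: "norm (u (c t p)) = 1" if "t \<in> {0..1}" for t using u(2)[OF ctop[OF that p]] .
    obtain g where g: "continuous_on {0..1} g" "\<And>t. t \<in> {0..1} \<Longrightarrow> u (c t p) = exp (g t)"
      using continuous_logarithm_on_contractible[OF pc] n1 by (metis convex_imp_contractible convex_real_interval(5) norm_zero zero_neq_one)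
    have cg: "u (c t p) = cis (Im (g t))" if "t \<in> {0..1}" for t
    proof -
      have "exp (Re (g t)) = 1" using n1[OF that] g(2)[OF that] by simp
      then show ?thesis using g(2)[OF that] by (simp add: exp_eq_polar)
    qed
    have "cis (Im (g 0)) = cis s0" using cg[of 0] s0 c(3)[OF p] by simp
    then obtain k :: int where k: "Im (g 0) = s0 + 2 * pi * of_int k" using cis_eq_imp by blast
    have "cis (Im (g t) - 2 * pi * of_int k) = cis (Im (g t))" for t by (simp add: complex_eq_iff cos_diff sin_diff cos_int_2pin sin_int_2pin)
    then show ?thesis using k cg by (intro exI[of _ "\<lambda>t. Im (g t) - 2 * pi * of_int k"]) (auto intro!: continuous_intros g(1))
  qed
  then obtain L where L: "\<And>p. p \<in> topspace T \<Longrightarrow> continuous_on {0..1} (L p)"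
    "\<And>p t. p \<in> topspace T \<Longrightarrow> t \<in> {0..1} \<Longrightarrow> u (c t p) = cis (L p t)" "\<And>p. p \<in> topspace T \<Longrightarrow> L p 0 = s0" by metis
  have "Ck 0 T {0..1} L"
  proof (rule lift_family_continuous[OF _ _ _ q, where ?x0.0 = 0])
    fix p x assume px: "p \<in> topspace T" "x \<in> {0..1 :: real}"
    have n1: "norm (u (c x p)) = 1" using u(2)[OF ctop[OF px(2,1)]] .
    then show "u (c x p) \<noteq> 0" by auto
    show "u (c x p) = of_real (norm (u (c x p))) * cis (L p x)" using L(2)[OF px] n1 by simp
  next
    show "continuous_map T euclideanreal (\<lambda>p. L p 0)" by (rule continuous_map_eq[of _ _ "\<lambda>_. s0"]) (simp_all add: L(3) continuous_map_const)
  qed (use L(1) in auto)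
  moreover have "continuous_map T (prod_topology T I01) (\<lambda>p. (p, 1))" by (simp add: continuous_map_paired continuous_map_const)
  ultimately have Lc: "continuous_map T euclideanreal (\<lambda>p. L p 1)"
    using continuous_map_compose[of T "prod_topology T I01" "\<lambda>p. (p, 1)"] by (fastforce simp: Ck.simps o_def)
  have u1: "u q = cis (L q 1)" if "q \<in> topspace T" for q using L(2)[OF that, of 1] c(4)[OF that] by simp
  then have "cis (L v 1) = circ s" using v by metis
  then obtain k :: int where k: "L v 1 = 2 * pi * s + 2 * pi * of_int k" using cis_eq_imp by blast
  have *: "cis (L q 1 - 2 * pi * of_int k) = cis (L q 1)" for q by (simp add: complex_eq_iff cos_diff sin_diff cos_int_2pin sin_int_2pin)
  show ?thesis
  proof (intro exI[of _ "\<lambda>q. (L q 1 - 2 * pi * of_int k) / (2 * pi)"] conjI ballI)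
    show "continuous_map T euclideanreal (\<lambda>q. (L q 1 - 2 * pi * of_int k) / (2 * pi))" using Lc by (intro continuous_intros) auto
    show "(L v 1 - 2 * pi * of_int k) / (2 * pi) = s" using k by simp
    show "u q = circ ((L q 1 - 2 * pi * of_int k) / (2 * pi))" if "q \<in> topspace T" for q using u1[OF that] * by simp
  qed
qed

lemma path_int_const:
  assumes g: "pathin T \<gamma>" and l: "continuous_map T euclideanreal l" and i: "\<And>t. 0 \<le> t \<Longrightarrow> t \<le> 1 \<Longrightarrow> \<exists>k::int. l (\<gamma> t) = of_int k"
  shows "l (\<gamma> 0) = l (\<gamma> 1)"
proof -
  have "continuous_on {0..1} (\<lambda>t. 2 * pi * l (\<gamma> t))"
    using continuous_map_compose[OF g[unfolded pathin_def] l] by (intro continuous_intros) (simp add: o_def)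
  then have "2 * pi * l (\<gamma> 0) = 2 * pi * l (\<gamma> 1)" by (rule discrete_valued_constant[of "{0..1}", rotated]) (use i in auto)
  then show ?thesis by simp
qed

lemma cube_path:
  assumes "s \<in> icube n" "s' \<in> icube n" "0 \<le> t" "t \<le> 1"
  shows "(\<lambda>i\<in>{..<n}. (1 - t) * s i + t * s' i) \<in> icube n"
  using assms by (auto simp: in_cube intro!: convex_bound_le add_nonneg_nonneg mult_nonneg_nonneg)

lemma pathin_cube:
  assumes "s \<in> icube n" "s' \<in> icube n"
  shows "pathin (cube n) (\<lambda>t. \<lambda>i\<in>{..<n}. (1 - t) * s i + t * s' i)"
  unfolding pathin_def continuous_map_cube using cube_path[OF assms] by (auto intro!: continuous_intros)

lemma cube_restrict: "s \<in> icube n \<Longrightarrow> (\<lambda>i\<in>{..<n}. s i) = s" by (auto simp: in_cube extensional_restrict)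

lemma cube_segment_int:
  assumes s: "s \<in> icube n" "s' \<in> icube n" and l: "continuous_map (cube n) euclideanreal l"
    and i: "\<And>t. 0 \<le> t \<Longrightarrow> t \<le> 1 \<Longrightarrow> \<exists>k::int. l (\<lambda>i\<in>{..<n}. (1 - t) * s i + t * s' i) = of_int k"
  shows "l s = l s'"
  using path_int_const[where T = "cube n" and \<gamma> = "\<lambda>t. \<lambda>i\<in>{..<n}. (1 - t) * s i + t * s' i" and l = l, OF pathin_cube[OF s] l i]
  by (simp add: cube_restrict s)

definition vtx :: "nat \<Rightarrow> real \<Rightarrow> nat \<Rightarrow> real" where "vtx n c = (\<lambda>i\<in>{..<n}. c)"

lemma vtx_cube: "0 \<le> c \<Longrightarrow> c \<le> 1 \<Longrightarrow> vtx n c \<in> icube n" by (auto simp: vtx_def in_cube)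

lemma vtx_boundary: "0 < n \<Longrightarrow> c = 0 \<or> c = 1 \<Longrightarrow> vtx n c \<in> cube_boundary n"
  by (rule boundaryI[where i = 0], rule vtx_cube) (auto simp: vtx_def)

lemma cube_1: "s \<in> icube 1 \<Longrightarrow> s = vtx 1 (s 0)" by (auto simp: in_cube vtx_def extensional_def fun_eq_iff)

lemma vtx_1_0 [simp]: "vtx 1 c 0 = c" by (simp add: vtx_def)

lemma vtx_1_upd: "(vtx 1 c)(0 := d) = vtx 1 d" by (auto simp: vtx_def fun_eq_iff)

text \<open>In dimension at least 2 the boundary of the cube is connected: within the face of
  \<open>s\<close> all coordinates but the face coordinate \<open>i\<close> move to
  \<open>1\<close>, then \<open>i\<close> itself moves while another coordinate rests at
  \<open>1\<close>. Along such segments an integral function is constant.\<close>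

lemma boundary_int_const:
  assumes n: "2 \<le> n" and l: "continuous_map (cube n) euclideanreal l" and i: "\<And>s. s \<in> cube_boundary n \<Longrightarrow> \<exists>k::int. l s = of_int k"
    and s: "s \<in> cube_boundary n"
  shows "l s = l (vtx n 1)"
proof -
  obtain i where si: "s \<in> icube n" "i < n" "s i = 0 \<or> s i = 1" using s by (rule boundaryE)
  let ?v = "(vtx n 1)(i := s i)"
  have v: "?v \<in> icube n" by (rule cube_upd[OF vtx_cube si(2)]) (use si(3) in auto)
  have "l s = l ?v"
  proof (rule cube_segment_int[OF si(1) v l assms(3)])
    fix t :: real assume "0 \<le> t" "t \<le> 1"
    then show "(\<lambda>i'\<in>{..<n}. (1 - t) * s i' + t * ?v i') \<in> cube_boundary n" by (intro boundaryI[OF cube_path[OF si(1) v] si(2)]) (use si in auto)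
  qed
  also have "\<dots> = l (vtx n 1)"
  proof (rule cube_segment_int[OF v vtx_cube l assms(3)])
    fix t :: real assume t: "0 \<le> t" "t \<le> 1"
    obtain j where j: "j < n" "j \<noteq> i" using n by (metis less_2_cases_iff less_le_trans one_less_numeral_iff zero_less_numeral zero_neq_one semiring_norm(76))
    show "(\<lambda>i'\<in>{..<n}. (1 - t) * ?v i' + t * vtx n 1 i') \<in> cube_boundary n"
      by (intro boundaryI[OF cube_path[OF v vtx_cube] j(1)]) (use t j in "auto simp: vtx_def")
  qed auto
  finally show ?thesis .
qed

section \<open>The cyclic cover and absolute homotopy groups\<close>

definition total_space :: "'a topology \<Rightarrow> ('a \<Rightarrow> complex) \<Rightarrow> ('a \<times> real) topology" where
  "total_space X e = subtopology (prod_topology X euclideanreal) {z. e (fst z) = circ (snd z)}"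

lemma continuous_map_total_space:
  "continuous_map T (total_space X e) f \<longleftrightarrow> continuous_map T X (\<lambda>q. fst (f q)) \<and> continuous_map T euclideanreal (\<lambda>q. snd (f q)) \<and>
     (\<forall>q\<in>topspace T. e (fst (f q)) = circ (snd (f q)))"
  unfolding total_space_def by (auto simp: continuous_map_in_subtopology continuous_map_pairwise o_def Pi_iff)

text \<open>The total space is the infinite cyclic cover of \<open>X\<close> pulled back from the circle along \<open>e\<close>; the deformation \<open>D\<close> makes \<open>A\<close> a
  deformation retract of it.\<close>

locale circle_pair = top_monoid +
  fixes A :: "'a set" and e :: "'a \<Rightarrow> complex" and D :: "real \<Rightarrow> 'a \<Rightarrow> real \<Rightarrow> 'a"
  assumes A_top: "A \<subseteq> topspace X" and p_A: "p \<in> A" and m_A: "\<And>x y. x \<in> A \<Longrightarrow> y \<in> A \<Longrightarrow> m x y \<in> A"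
    and e_cont: "continuous_map X euclidean e" and e_norm: "\<And>x. x \<in> topspace X \<Longrightarrow> norm (e x) = 1"
    and e_A: "\<And>x. x \<in> A \<Longrightarrow> e x = 1" and e_m: "\<And>a x. a \<in> A \<Longrightarrow> x \<in> topspace X \<Longrightarrow> e (m a x) = e x"
    and D_cont: "continuous_map (prod_topology euclideanreal (total_space X e)) X (\<lambda>z. D (fst z) (fst (snd z)) (snd (snd z)))"
    and D_0: "\<And>x s. x \<in> topspace X \<Longrightarrow> e x = circ s \<Longrightarrow> D 0 x s = x"
    and D_1: "\<And>x s. x \<in> topspace X \<Longrightarrow> e x = circ s \<Longrightarrow> D 1 x s \<in> A"
    and D_A: "\<And>x t. x \<in> A \<Longrightarrow> D t x 0 \<in> A" and D_p: "\<And>t. D t p 0 = p"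
    and loops: "\<And>k::int. \<exists>a\<in>A. path_component_of (total_space X e) (p, 0) (a, of_int k)"
    and left_inv: "\<And>x. x \<in> topspace X \<Longrightarrow> \<exists>g\<in>topspace X. path_component_of X (m g x) p"
begin

abbreviation "Y \<equiv> subtopology X A"
abbreviation "E \<equiv> total_space X e"
abbreviation "RY n \<equiv> homotopic_in n Y (abs_vals n p)"
abbreviation "clY n \<equiv> hclass n Y (abs_vals n p)"

lemma topspace_Y: "topspace Y = A" using A_top by auto

sublocale Y: top_monoid Y m p
proof
  show "continuous_map (prod_topology Y Y) Y (\<lambda>z. m (fst z) (snd z))" unfolding continuous_map_in_subtopology
    by (intro conjI m_continuous continuous_map_into_fulltopology[OF continuous_map_fst] continuous_map_into_fulltopology[OF continuous_map_snd]) (auto simp: m_A)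
qed (use p_A A_top m_assoc m_unit in auto)

lemma D_continuous:
  assumes "continuous_map T euclideanreal t" "continuous_map T X f" "continuous_map T euclideanreal s"
    "\<And>q. q \<in> topspace T \<Longrightarrow> e (f q) = circ (s q)"
  shows "continuous_map T X (\<lambda>q. D (t q) (f q) (s q))"
proof -
  have "continuous_map T (prod_topology euclideanreal E) (\<lambda>q. (t q, f q, s q))"
    using assms by (simp add: continuous_map_paired continuous_map_total_space)
  from continuous_map_compose[OF this D_cont] show ?thesis by (simp add: o_def)
qed

lemma e_A_int: "x \<in> A \<Longrightarrow> e x = circ s \<Longrightarrow> \<exists>k::int. s = of_int k"
proof -
  assume "x \<in> A" "e x = circ s"
  then have "circ s = cis 0" using e_A by simp
  then obtain k :: int where "2 * pi * s = 2 * pi * of_int k" using cis_eq_imp[of "2 * pi * s" 0] by auto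
  then show ?thesis by auto
qed

lemma cis_int: "circ (of_int k + x) = circ x" by (simp add: distrib_left complex_eq_iff cos_add sin_add cos_int_2pin sin_int_2pin)

lemma lift:
  assumes "contraction T q0 c" "continuous_map T X f" "v \<in> topspace T" "e (f v) = circ s"
  shows "\<exists>l. continuous_map T euclideanreal l \<and> (\<forall>q\<in>topspace T. e (f q) = circ (l q)) \<and> l v = s"
proof (rule lift_contractible[where u = "\<lambda>q. e (f q)", OF assms(1) _ _ assms(3,4)])
  show "continuous_map T euclidean (\<lambda>q. e (f q))" using continuous_map_compose[OF assms(2) e_cont] by (simp add: o_def)
  show "norm (e (f q)) = 1" if "q \<in> topspace T" for q using e_norm continuous_map_funspace[OF assms(2)] that by blast
qed

lemma lift_path:
  assumes "path_component_of X x y" "e x = circ s" shows "\<exists>s'. path_component_of E (x, s) (y, s')"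
proof -
  obtain g where g: "pathin X g" "g 0 = x" "g 1 = y" using assms(1) by (auto simp: path_component_of_def)
  obtain l where l: "continuous_map I01 euclideanreal l" "\<forall>t\<in>{0..1}. e (g t) = circ (l t)" "l 0 = s"
    using lift[OF contraction_I01 g(1)[unfolded pathin_def], of 0] g(2) assms(2) by auto
  then have "pathin E (\<lambda>t. (g t, l t))" using g(1) by (simp add: pathin_def continuous_map_total_space)
  then show ?thesis using g l(3) unfolding path_component_of_def by (intro exI[of _ "l 1"] exI[of _ "\<lambda>t. (g t, l t)"]) simp
qed

lemma E_proj: "continuous_map E X fst" "continuous_map E euclideanreal snd" "z \<in> topspace E \<Longrightarrow> e (fst z) = circ (snd z)"
  "z \<in> topspace E \<Longrightarrow> fst z \<in> topspace X"
proof -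
  have "continuous_map E E (\<lambda>z. z)" by simp
  then show "continuous_map E X fst" "continuous_map E euclideanreal snd" unfolding continuous_map_total_space by blast+
  assume "z \<in> topspace E"
  then show "e (fst z) = circ (snd z)" "fst z \<in> topspace X" unfolding total_space_def by auto
qed

lemma E_end: "path_component_of E (x, s) (y, s') \<Longrightarrow> y \<in> topspace X \<and> e y = circ s'"
  using path_component_in_topspace[of E "(x, s)" "(y, s')"] by (simp add: total_space_def)

lemma E_to_X: "path_component_of E (x, s) (y, s') \<Longrightarrow> path_component_of X x y"
proof -
  assume "path_component_of E (x, s) (y, s')"
  from path_component_of_image[OF this E_proj(1)] show ?thesis by simp
qed

lemma D_path: "x \<in> topspace X \<Longrightarrow> e x = circ s \<Longrightarrow> path_component_of X x (D 1 x s)" unfolding path_component_of_def pathin_def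
  by (intro exI[of _ "\<lambda>t. D t x s"] conjI D_continuous) (auto simp: D_0 continuous_map_const)

text \<open>Time \<open>1\<close> of the deformation maps the whole cover to \<open>A\<close>. At
  level \<open>0\<close> the deformation moves points of \<open>A\<close> within \<open>A\<close>
  only, which takes care of the end points.\<close>

lemma E_to_A:
  assumes "path_component_of E (x, 0) (y, 0)" "x \<in> A" "y \<in> A" shows "path_component_of Y x y"
proof -
  have "continuous_map E Y (\<lambda>z. D 1 (fst z) (snd z))" unfolding continuous_map_in_subtopology
    by (intro conjI D_continuous E_proj(1,2)) (auto simp: continuous_map_const dest: E_proj(3,4) intro!: D_1)
  from path_component_of_image[OF assms(1) this] have "path_component_of Y (D 1 x 0) (D 1 y 0)" by simp
  moreover have "path_component_of Y x (D 1 x 0)" if "x \<in> A" for x unfolding path_component_of_def pathin_def continuous_map_in_subtopology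
    by (intro exI[of _ "\<lambda>t. D t x 0"] conjI D_continuous) (use that A_top e_A D_A in "auto simp: D_0 continuous_map_const")
  ultimately show ?thesis using assms(2,3) path_component_of_sym path_component_of_trans by metis
qed

lemma e_cis: "x \<in> topspace X \<Longrightarrow> \<exists>s. e x = circ s"
proof -
  assume "x \<in> topspace X"
  from e_norm[OF this] obtain t where "e x = cis t" by (metis complex_norm_eq_1_exp cis_conv_exp)
  then show ?thesis by (intro exI[of _ "t / (2 * pi)"]) simp
qed

text \<open>A left inverse in \<open>X\<close> is deformed into \<open>A\<close>. The path from the
  product to \<open>p\<close> lifts to one that ends over \<open>p\<close> at some integer level;
  multiplying by the element of \<open>A\<close> that \<open>loops\<close> provides for this integer
  brings the end to level \<open>0\<close>, where \<open>E_to_A\<close> applies.\<close>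

lemma left_inv_A:
  assumes a: "a \<in> A" shows "\<exists>g\<in>A. path_component_of Y (m g a) p"
proof -
  have aX: "a \<in> topspace X" using a A_top by blast
  obtain g0 where g0: "g0 \<in> topspace X" "path_component_of X (m g0 a) p" using left_inv[OF aX] by blast
  obtain s where s: "e g0 = circ s" using e_cis[OF g0(1)] by blast
  define g where "g = D 1 g0 s"
  have g: "g \<in> A" "g \<in> topspace X" using D_1[OF g0(1) s] A_top by (auto simp: g_def)
  have "path_component_of X (m g0 a) (m g a)" unfolding g_def by (rule path_component_m[OF D_path[OF g0(1) s]]) (simp add: path_component_of_refl aX)
  then have "path_component_of X (m g a) p" using g0(2) path_component_of_sym path_component_of_trans by metis
  moreover have "e (m g a) = circ 0" using e_A[OF m_A[OF g(1) a]] by simp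
  ultimately obtain s' where s': "path_component_of E (m g a, 0) (p, s')" using lift_path by blast
  then obtain k :: int where k: "s' = of_int k" using e_A_int[OF p_A] E_end by blast
  obtain b where b: "b \<in> A" "path_component_of E (p, 0) (b, of_int k)" using loops by blast
  have bX: "b \<in> topspace X" using b A_top by blast
  have "continuous_map E E (\<lambda>z. (m b (fst z), snd z))" unfolding continuous_map_total_space
    using bX b(1) by (auto intro!: m_continuous E_proj(1,2) simp: continuous_map_const e_m E_proj(3,4))
  from path_component_of_image[OF s' this] have "path_component_of E (m b (m g a), 0) (m b p, s')" by simp
  then have "path_component_of E (m (m b g) a, 0) (b, of_int k)" by (simp add: m_assoc m_unit bX g(2) aX k)
  then have "path_component_of E (m (m b g) a, 0) (p, 0)" using b(2) path_component_of_sym path_component_of_trans by metis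
  then have "path_component_of Y (m (m b g) a) p" by (rule E_to_A) (use m_A b g a p_A in auto)
  then show ?thesis using m_A[OF b(1) g(1)] by blast
qed

text \<open>\<open>D\<close> fixes \<open>p\<close> at level \<open>0\<close>. A spheroid whose lift
  vanishes on the boundary thus remains a spheroid during the deformation and ends in
  \<open>A\<close>.\<close>

lemma abs_deform:
  assumes f: "RX n f f" and l: "continuous_map (cube n) euclideanreal l"
    "\<And>s. s \<in> icube n \<Longrightarrow> e (f s) = circ (l s)" "\<And>s. s \<in> cube_boundary n \<Longrightarrow> l s = 0"
  shows "RX n f (\<lambda>s. D 1 (f s) (l s))" "RY n (\<lambda>s. D 1 (f s) (l s)) (\<lambda>s. D 1 (f s) (l s))"
    "f ` icube n \<subseteq> A \<Longrightarrow> (\<And>s. s \<in> icube n \<Longrightarrow> l s = 0) \<Longrightarrow> RY n f (\<lambda>s. D 1 (f s) (l s))"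
proof -
  have c: "continuous_map (cyl n) X (\<lambda>z. D (fst z) (f (snd z)) (l (snd z)))"
    by (intro D_continuous continuous_map_fst_I01 continuous_map_compose[OF continuous_map_snd sph_cont[OF f], unfolded o_def]
        continuous_map_compose[OF continuous_map_snd l(1), unfolded o_def]) (use l(2) in auto)
  have b: "D t (f s) (l s) \<in> abs_vals n p s" if "s \<in> icube n" for s t using sph_val[OF f, of s] l(3)[of s] D_p by (auto simp: abs_vals_def)
  show 1: "RX n f (\<lambda>s. D 1 (f s) (l s))" by (rule homotopic_inI[OF c]) (use b sph_top[OF f] l(2) D_0 in auto)
  show "RY n (\<lambda>s. D 1 (f s) (l s)) (\<lambda>s. D 1 (f s) (l s))"
    using homotopic_in_refl2[OF 1] D_1[OF sph_top[OF f] l(2)] by (auto simp: homotopic_in_refl_iff continuous_map_in_subtopology)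
  show "RY n f (\<lambda>s. D 1 (f s) (l s))" if "f ` icube n \<subseteq> A" "\<And>s. s \<in> icube n \<Longrightarrow> l s = 0"
    by (rule homotopic_inI[where H = "\<lambda>t s. D t (f s) (l s)"])
      (use c b that l(2) D_0 A_top D_A in "auto simp: continuous_map_in_subtopology image_subset_iff subset_iff")
qed

text \<open>The lift of a homotopy in \<open>X\<close> is integral wherever the homotopy is in
  \<open>A\<close>: at both ends and over the boundary of the cube. These pieces hang together, so
  the lift vanishes on all of them, and \<open>D\<close> moves the homotopy into
  \<open>A\<close>.\<close>

lemma abs_incl_inj:
  assumes n: "0 < n" and f: "RY n f f" and g: "RY n g g"
    and fg: "RX n f g"
  shows "RY n f g"
proof -
  obtain H where H: "htpy n X (abs_vals n p) f g H" using fg unfolding homotopic_in_iff by blast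
  note H = htpyD[OF H]
  let ?v = "vtx n 1"
  have v: "?v \<in> icube n" "?v \<in> cube_boundary n" using vtx_cube vtx_boundary[OF n] by auto
  have Hb: "H t s = p" if "t \<in> {0..1}" "s \<in> cube_boundary n" for t s
  proof -
    have "s \<in> icube n" using that(2) cube_box_boundary(2) by blast
    then have "H t s \<in> abs_vals n p s" using H(4) that(1) by blast
    then show ?thesis using that(2) by (simp add: abs_vals_def)
  qed
  obtain L where L: "continuous_map (cyl n) euclideanreal L"
    "\<forall>q\<in>topspace (cyl n). e (H (fst q) (snd q)) = circ (L q)" "L (0, ?v) = 0"
    using lift[OF contraction_prod[OF contraction_I01 contraction_cube] H(1), of "(0, ?v)" 0] v Hb e_A[OF p_A] by auto
  have Le: "e (H t s) = circ (L (t, s))" if "t \<in> {0..1}" "s \<in> icube n" for t s using L(2) that by auto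
  have fA: "f s \<in> A" "g s \<in> A" if "s \<in> icube n" for s using Y.sph_top[OF f that] Y.sph_top[OF g that] by auto
  have slice: "continuous_map (cube n) euclideanreal (\<lambda>s. L (t, s))" if "t \<in> {0..1}" for t
    using continuous_map_compose[OF _ L(1), of "cube n" "\<lambda>s. (t, s)"] that by (simp add: continuous_map_paired continuous_map_const o_def)
  have slice': "continuous_map I01 euclideanreal (\<lambda>t. L (t, s))" if "s \<in> icube n" for s
    using continuous_map_compose[OF _ L(1), of I01 "\<lambda>t. (t, s)"] that by (simp add: continuous_map_paired continuous_map_const o_def)
  have const: "L (t, s) = L (t, ?v)" if t: "t = 0 \<or> t = 1" and s: "s \<in> icube n" for t s
  proof (rule cube_segment_int[OF s v(1), where l = "\<lambda>s. L (t, s)"])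
    show "continuous_map (cube n) euclideanreal (\<lambda>s. L (t, s))" using t by (intro slice) auto
    fix a :: real assume "0 \<le> a" "a \<le> 1"
    then have c: "(\<lambda>i\<in>{..<n}. (1 - a) * s i + a * ?v i) \<in> icube n" by (rule cube_path[OF s v(1)])
    then have "H t (\<lambda>i\<in>{..<n}. (1 - a) * s i + a * ?v i) \<in> A" using t H(2,3) fA by auto
    then show "\<exists>k::int. L (t, \<lambda>i\<in>{..<n}. (1 - a) * s i + a * ?v i) = of_int k" by (rule e_A_int) (use Le c t in auto)
  qed
  have Lside: "L (t, s) = L (0, s)" if s: "s \<in> cube_boundary n" and t: "t \<in> {0..1}" for t s
  proof -
    have sc: "s \<in> icube n" using s cube_box_boundary(2) by blast
    have "L (0 * t, s) = L (1 * t, s)"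
    proof (rule path_int_const[of I01 "\<lambda>a. a * t" "\<lambda>t. L (t, s)"])
      show "pathin I01 (\<lambda>a. a * t)" using t by (auto simp: pathin_def continuous_map_in_subtopology intro!: continuous_intros mult_le_one)
      fix a :: real assume "0 \<le> a" "a \<le> 1"
      then have "a * t \<in> {0..1}" using t by (auto intro: mult_le_one)
      then show "\<exists>k::int. L (a * t, s) = of_int k" using e_A_int[OF p_A] Le[OF _ sc] Hb[OF _ s] by metis
    qed (rule slice'[OF sc])
    then show ?thesis by simp
  qed
  have L0: "L (0, s) = 0" if "s \<in> icube n" for s using const[of 0 s] that L(3) by simp
  have L1: "L (1, s) = 0" if "s \<in> icube n" for s using const[of 1 s] that Lside[OF v(2), of 1] L(3) by simp
  have Lb: "L (t, s) = 0" if "s \<in> cube_boundary n" "t \<in> {0..1}" for t s using Lside[OF that] L0[of s] that(1) cube_box_boundary(2)[of n] by auto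
  have fX: "RX n f f" "RX n g g" using fg homotopic_in_refl1 homotopic_in_refl2 by blast+
  have lf: "e (f s) = circ 0" "e (g s) = circ 0" if "s \<in> icube n" for s using fA[OF that] e_A by simp_all
  have 1: "RY n f (\<lambda>s. D 1 (f s) 0)"
    by (rule abs_deform(3)[OF fX(1), where l = "\<lambda>_. 0"]) (use lf fA in "auto simp: continuous_map_const")
  have 2: "RY n g (\<lambda>s. D 1 (g s) 0)"
    by (rule abs_deform(3)[OF fX(2), where l = "\<lambda>_. 0"]) (use lf fA in "auto simp: continuous_map_const")
  have HX: "H t s \<in> topspace X" if "t \<in> {0..1}" "s \<in> icube n" for t s using continuous_map_funspace[OF H(1)] that by (auto simp: Pi_iff)
  have 3: "RY n (\<lambda>s. D 1 (f s) 0) (\<lambda>s. D 1 (g s) 0)"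
  proof (rule homotopic_inI[where H = "\<lambda>t s. D 1 (H t s) (L (t, s))"])
    have "continuous_map (cyl n) X (\<lambda>z. D 1 (H (fst z) (snd z)) (L (fst z, snd z)))"
      by (intro D_continuous H(1)) (use L Le in "auto simp: continuous_map_const")
    then show "continuous_map (cyl n) Y (\<lambda>z. D 1 (H (fst z) (snd z)) (L (fst z, snd z)))" using D_1 HX Le by (auto simp: continuous_map_in_subtopology)
    show "D 1 (H t s) (L (t, s)) \<in> abs_vals n p s" if "0 \<le> t" "t \<le> 1" for t s using Hb[of t s] Lb[of s t] D_p that by (auto simp: abs_vals_def)
  qed (use H(2,3) L0 L1 in auto)
  show ?thesis using homotopic_in_trans[OF 1 homotopic_in_trans[OF 3 homotopic_in_sym[OF 2]]] .
qed

end

declare One_nat_def [simp del]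

section \<open>Relative spheroids and their degree\<close>

context circle_pair
begin

abbreviation "relv n \<equiv> rel_vals n A p"

lemma closed_vals_rel: "closed_vals (relv n)" using m_unit p_top p_A m_A by (auto simp: closed_vals_def rel_vals_def)

text \<open>With a lift that vanishes on the boundary, \<open>D\<close> moves the spheroid into
  \<open>A\<close> and respects both boundary conditions. Inside \<open>A\<close> the free face
  imposes nothing further, and pushing the last coordinate to \<open>1\<close> slides the cube to a
  face on which the value is \<open>p\<close>.\<close>

lemma rel_deform:
  assumes n: "0 < n" and f: "hin n (relv n) f f" and l: "continuous_map (cube n) euclideanreal l"
    "\<And>s. s \<in> icube n \<Longrightarrow> e (f s) = circ (l s)" "\<And>s. s \<in> cube_boundary n \<Longrightarrow> l s = 0"
  shows "hin n (relv n) f (\<lambda>_. p)"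
proof -
  have fv: "f s \<in> relv n s" if "s \<in> icube n" for s using f that by (simp add: homotopic_in_refl_iff)
  have box: "f s = p" if "s \<in> cube_box n" for s using fv[of s] that cube_box_boundary[of n] by (auto simp: rel_vals_def)
  have bdry: "f s \<in> A" if "s \<in> cube_boundary n" for s using fv[of s] that cube_box_boundary[of n] p_A by (auto simp: rel_vals_def split: if_splits)
  define g where "g s = D 1 (f s) (l s)" for s
  have 1: "hin n (relv n) f g"
  proof (rule homotopic_inI[where H = "\<lambda>t s. D t (f s) (l s)"])
    show "continuous_map (cyl n) X (\<lambda>z. D (fst z) (f (snd z)) (l (snd z)))"
      by (intro D_continuous continuous_map_fst_I01 continuous_map_compose[OF continuous_map_snd sph_cont[OF f], unfolded o_def]
        continuous_map_compose[OF continuous_map_snd l(1), unfolded o_def]) (use l(2) in auto)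
    show "D t (f s) (l s) \<in> relv n s" for t s using box[of s] bdry[of s] l(3)[of s] D_p D_A cube_box_boundary(1)[of n] by (auto simp: rel_vals_def)
  qed (use sph_top[OF f] l(2) D_0 in "auto simp: g_def")
  have gA: "g s \<in> A" if "s \<in> icube n" for s unfolding g_def by (rule D_1[OF sph_top[OF f that] l(2)[OF that]])
  have gbox: "g s = p" if "s \<in> cube_box n" for s using box[OF that] l(3)[of s] that cube_box_boundary(1)[of n] D_p by (auto simp: g_def)
  define i where "i = n - 1"
  have i: "i < n" "Suc i = n" using n by (auto simp: i_def)
  have c01: "0 \<le> (1 - t) * s i + t \<and> (1 - t) * s i + t \<le> 1" if "0 \<le> t" "t \<le> 1" "s \<in> icube n" for t and s :: "nat \<Rightarrow> real"
  proof -
    have "0 \<le> s i" "s i \<le> 1" using that i by (auto simp: in_cube)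
    then show ?thesis using that mult_left_le[of "s i" "1 - t"] by simp
  qed
  have 2: "hin n (relv n) g (\<lambda>_. p)"
  proof (rule homotopic_inI[where H = "\<lambda>t s. g (s(i := (1 - t) * s i + t))"])
    show "continuous_map (cyl n) X (\<lambda>z. g ((snd z)(i := (1 - fst z) * snd z i + fst z)))"
      by (rule homotopy_coord[where c = "\<lambda>t s. (1 - t) * s i + t", OF sph_cont[OF homotopic_in_refl2[OF 1]] i(1)])
        (use c01 in "auto intro!: continuous_intros continuous_map_fst_I01 cube_coord[OF continuous_map_snd i(1)]")
    show "g (s(i := (1 - 1) * s i + 1)) = p" if "s \<in> icube n" for s using cube_upd[OF that i(1), of 1] i by (intro gbox) (auto simp: cube_box_def)
    show "g (s(i := (1 - t) * s i + t)) \<in> relv n s" if t: "0 \<le> t" "t \<le> 1" and s: "s \<in> icube n" for t s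
    proof (cases "s \<in> cube_box n")
      case True
      then obtain j where j: "j < n" "s j = 1 \<or> s j = 0 \<and> Suc j \<noteq> n" by (auto simp: cube_box_def)
      let ?s = "s(i := (1 - t) * s i + t)"
      have "?s \<in> icube n" using cube_upd[OF s i(1)] c01[OF t s] by blast
      moreover have "?s j = 1 \<or> ?s j = 0 \<and> Suc j \<noteq> n" using j i(2) by (cases "j = i") auto
      ultimately have "?s \<in> cube_box n" using j(1) unfolding cube_box_def by blast
      then show ?thesis using True gbox by (simp add: rel_vals_def)
    next
      case False
      then show ?thesis using gA[OF cube_upd[OF s i(1)]] c01[OF t s] by (auto simp: rel_vals_def)
    qed
  qed auto
  show ?thesis by (rule homotopic_in_trans[OF 1 2])
qed

text \<open>The lift is integral on the boundary, which is connected in these dimensions, and can be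
  chosen to be \<open>0\<close> at a vertex of the box.\<close>

lemma rel_trivial:
  assumes n: "2 \<le> n" and f: "hin n (relv n) f f" shows "hin n (relv n) f (\<lambda>_. p)"
proof -
  have n0: "0 < n" using n by simp
  have v: "vtx n 1 \<in> icube n" by (simp add: vtx_cube)
  then have "vtx n 1 \<in> cube_box n" using n0 by (auto simp: cube_box_def vtx_def)
  then have "f (vtx n 1) = p" using f v by (auto simp: homotopic_in_refl_iff rel_vals_def)
  then have "e (f (vtx n 1)) = circ 0" using e_A[OF p_A] by simp
  then obtain l where l: "continuous_map (cube n) euclideanreal l" "\<And>s. s \<in> icube n \<Longrightarrow> e (f s) = circ (l s)" "l (vtx n 1) = 0"
    using lift[OF contraction_cube sph_cont[OF f] v] by blast
  have z: "l s = 0" if s: "s \<in> cube_boundary n" for s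
  proof -
    have "l s = l (vtx n 1)"
    proof (rule boundary_int_const[OF n l(1) _ s])
      fix s assume s: "s \<in> cube_boundary n"
      then have sc: "s \<in> icube n" using cube_box_boundary(2) by blast
      then have "f s \<in> A" using f s p_A by (auto simp: homotopic_in_refl_iff rel_vals_def split: if_splits)
      then show "\<exists>k::int. l s = of_int k" using e_A_int l(2)[OF sc] by blast
    qed
    then show ?thesis using l(3) by simp
  qed
  show ?thesis by (rule rel_deform[OF n0 f l(1)]) (use l(2) z in auto)
qed

abbreviation "R1 \<equiv> hin 1 (relv 1)"

lemma vtx1_cube: "vtx 1 0 \<in> icube 1" "vtx 1 1 \<in> icube 1" by (simp_all add: vtx_cube)

lemma relv_1: "relv 1 (vtx 1 0) = A" "relv 1 (vtx 1 1) = {p}"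
  "0 < c \<Longrightarrow> c < 1 \<Longrightarrow> relv 1 (vtx 1 c) = UNIV" using vtx1_cube by (auto simp: rel_vals_1)

lemma cube_1_cases: "s \<in> icube 1 \<Longrightarrow> s = vtx 1 0 \<or> s = vtx 1 1 \<or> (\<exists>c. 0 < c \<and> c < 1 \<and> s = vtx 1 c)"
proof -
  assume s: "s \<in> icube 1"
  then have "0 \<le> s 0" "s 0 \<le> 1" by (auto simp: in_cube)
  then show ?thesis using cube_1[OF s] by (metis less_eq_real_def)
qed

lemma R1_iff: "R1 f f \<longleftrightarrow> continuous_map (cube 1) X f \<and> f (vtx 1 0) \<in> A \<and> f (vtx 1 1) = p"
proof
  assume "R1 f f"
  then have "continuous_map (cube 1) X f" and v: "\<And>s. s \<in> icube 1 \<Longrightarrow> f s \<in> relv 1 s" by (auto simp: homotopic_in_refl_iff)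
  then show "continuous_map (cube 1) X f \<and> f (vtx 1 0) \<in> A \<and> f (vtx 1 1) = p" using v[OF vtx1_cube(1)] v[OF vtx1_cube(2)] by (simp add: relv_1)
next
  assume f: "continuous_map (cube 1) X f \<and> f (vtx 1 0) \<in> A \<and> f (vtx 1 1) = p"
  have "f s \<in> relv 1 s" if "s \<in> icube 1" for s using cube_1_cases[OF that] f by (elim disjE exE conjE) (simp_all add: relv_1)
  with f show "R1 f f" unfolding homotopic_in_refl_iff by blast
qed

lemma boundary_1: "s \<in> cube_boundary 1 \<Longrightarrow> s = vtx 1 0 \<or> s = vtx 1 1" using cube_1[of s] by (auto simp: cube_boundary_def)

text \<open>The winding of \<open>e\<close> along a relative path, counted from the end at
  \<open>p\<close> to the end in \<open>A\<close>. It is a relation because existence and homotopy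
  invariance of the number are the subject of \<open>deg_ex\<close> and
  \<open>deg_homotopy\<close>.\<close>

definition deg :: "((nat \<Rightarrow> real) \<Rightarrow> 'a) \<Rightarrow> int \<Rightarrow> bool" where
  "deg f k \<longleftrightarrow> (\<exists>l. continuous_map (cube 1) euclideanreal l \<and> (\<forall>s\<in>icube 1. e (f s) = circ (l s)) \<and>
     l (vtx 1 1) = 0 \<and> l (vtx 1 0) = of_int k)"

lemma deg_ex: "R1 f f \<Longrightarrow> \<exists>k. deg f k"
proof -
  assume f: "R1 f f"
  then have "e (f (vtx 1 1)) = circ 0" using e_A[OF p_A] by (simp add: R1_iff)
  then obtain l where l: "continuous_map (cube 1) euclideanreal l" "\<forall>s\<in>icube 1. e (f s) = circ (l s)" "l (vtx 1 1) = 0"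
    using lift[OF contraction_cube sph_cont[OF f] vtx1_cube(2)] by blast
  have "f (vtx 1 0) \<in> A" using f by (simp add: R1_iff)
  then obtain k :: int where "l (vtx 1 0) = of_int k" using e_A_int l(2) vtx1_cube(1) by blast
  with l show ?thesis unfolding deg_def by blast
qed

lemma lift_unique:
  assumes "continuous_map (cube n) euclideanreal l" "continuous_map (cube n) euclideanreal l'"
    "\<And>s. s \<in> icube n \<Longrightarrow> circ (l s) = circ (l' s)" "v \<in> icube n" "l v = l' v" "s \<in> icube n"
  shows "l s = l' s"
proof -
  have "l s - l' s = l v - l' v"
  proof (rule cube_segment_int[OF assms(6,4), where l = "\<lambda>s. l s - l' s"])
    show "continuous_map (cube n) euclideanreal (\<lambda>s. l s - l' s)" using assms(1,2) by (intro continuous_intros)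
    fix t :: real assume "0 \<le> t" "t \<le> 1"
    then have "(\<lambda>i\<in>{..<n}. (1 - t) * s i + t * v i) \<in> icube n" by (rule cube_path[OF assms(6,4)])
    from cis_eq_imp[OF assms(3)[OF this]]
    obtain k :: int where "2 * pi * l (\<lambda>i\<in>{..<n}. (1 - t) * s i + t * v i) = 2 * pi * (l' (\<lambda>i\<in>{..<n}. (1 - t) * s i + t * v i) + of_int k)"
      by (auto simp: distrib_left)
    then show "\<exists>k::int. l (\<lambda>i\<in>{..<n}. (1 - t) * s i + t * v i) - l' (\<lambda>i\<in>{..<n}. (1 - t) * s i + t * v i) = of_int k" by auto
  qed
  then show ?thesis using assms(5) by simp
qed

text \<open>During the homotopy one end stays at \<open>p\<close> and the other in \<open>A\<close>,
  so the lift of the homotopy is integral along both tracks and hence constant there.\<close>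

lemma deg_homotopy:
  assumes fg: "R1 f g" and k: "deg f k" "deg g j" shows "k = j"
proof -
  obtain H where H: "htpy 1 X (relv 1) f g H" using fg unfolding homotopic_in_iff by blast
  note H = htpyD[OF H]
  have H1: "H t (vtx 1 1) = p" "H t (vtx 1 0) \<in> A" if "t \<in> {0..1}" for t using H(4) that vtx1_cube relv_1(1,2) by blast+
  obtain L where L: "continuous_map (cyl 1) euclideanreal L"
    "\<forall>q\<in>topspace (cyl 1). e (H (fst q) (snd q)) = circ (L q)" "L (0, vtx 1 1) = 0"
    using lift[OF contraction_prod[OF contraction_I01 contraction_cube] H(1), of "(0, vtx 1 1)" 0] vtx1_cube(2) H1(1)[of 0] e_A[OF p_A] by auto
  have Le: "e (H t s) = circ (L (t, s))" if "t \<in> {0..1}" "s \<in> icube 1" for t s using L(2) that by auto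
  have slice: "continuous_map (cube 1) euclideanreal (\<lambda>s. L (t, s))" if "t \<in> {0..1}" for t
    using continuous_map_compose[OF _ L(1), of "cube 1" "\<lambda>s. (t, s)"] that by (simp add: continuous_map_paired continuous_map_const o_def)
  have side: "L (0, s) = L (1, s)" if s: "s \<in> icube 1" "\<And>t. t \<in> {0..1} \<Longrightarrow> H t s \<in> A" for s
  proof (rule path_int_const[of I01 "\<lambda>t. t" "\<lambda>t. L (t, s)"])
    show "continuous_map I01 euclideanreal (\<lambda>t. L (t, s))"
      using continuous_map_compose[OF _ L(1), of I01 "\<lambda>t. (t, s)"] s(1) by (simp add: continuous_map_paired continuous_map_const o_def)
    show "\<exists>k::int. L (t, s) = of_int k" if "0 \<le> t" "t \<le> 1" for t using e_A_int[OF s(2) Le[OF _ s(1)]] that by simp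
  qed (simp add: pathin_def)
  have s1: "L (1, vtx 1 1) = 0" using side[OF vtx1_cube(2)] H1(1) p_A L(3) by simp
  have s0: "L (0, vtx 1 0) = L (1, vtx 1 0)" by (rule side[OF vtx1_cube(1) H1(2)])
  have end_eq: "L (t, vtx 1 0) = of_int i" if t: "t \<in> {0..1}" "L (t, vtx 1 1) = 0" and d: "deg q i" and q: "\<forall>s\<in>icube 1. H t s = q s" for t q i
  proof -
    obtain l where l: "continuous_map (cube 1) euclideanreal l" "\<forall>s\<in>icube 1. e (q s) = circ (l s)"
      "l (vtx 1 1) = 0" "l (vtx 1 0) = of_int i" using d unfolding deg_def by blast
    have "L (t, vtx 1 0) = l (vtx 1 0)" by (rule lift_unique[where l = "\<lambda>s. L (t, s)", OF slice[OF t(1)] l(1) _ vtx1_cube(2) _ vtx1_cube(1)])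
        (use t l q Le[OF t(1)] in "simp_all")
    then show ?thesis using l(4) by simp
  qed
  have "(of_int k :: real) = of_int j" using end_eq[OF _ L(3) k(1) H(2)] end_eq[OF _ s1 k(2) H(3)] s0 by simp
  then show ?thesis by simp
qed

lemma deg_0_trivial: "R1 f f \<Longrightarrow> deg f 0 \<Longrightarrow> R1 f (\<lambda>_. p)"
proof -
  assume f: "R1 f f" and "deg f 0"
  then obtain l where l: "continuous_map (cube 1) euclideanreal l" "\<forall>s\<in>icube 1. e (f s) = circ (l s)"
    "l (vtx 1 1) = 0" "l (vtx 1 0) = of_int 0" unfolding deg_def by blast
  show ?thesis by (rule rel_deform[OF _ f l(1)]) (use l in "auto dest!: boundary_1")
qed

text \<open>\<open>e\<close> is not multiplicative; it only ignores left factors in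
  \<open>A\<close>. So the product is reparametrised: in the first half \<open>g\<close> runs while
  \<open>f\<close> rests at its end in \<open>A\<close>, in the second half \<open>f\<close> runs
  while \<open>g\<close> rests at \<open>p\<close>. Now the lifts add.\<close>

lemma deg_pw:
  assumes f: "R1 f f" "deg f k" and g: "R1 g g" "deg g j" shows "deg (pw f g) (k + j)"
proof -
  define a b where "a x = max (2 * x - 1) 0" and "b x = min (2 * x) 1" for x :: real
  define K where "K s = m (f (s(0 := a (s 0)))) (g (s(0 := b (s 0))))" for s
  have K: "R1 K (pw f g)" unfolding K_def
  proof (rule reparam_pw[OF _ f(1) g(1) closed_vals_rel])
    show "relv 1 (s(0 := c)) \<subseteq> relv 1 s"
      if "s \<in> icube 1" "0 \<le> c" "c \<le> 1" "s 0 = 0 \<Longrightarrow> c = 0" "s 0 = 1 \<Longrightarrow> c = 1" for s c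
      using that cube_upd[of s 1 0 c] by (auto simp: rel_vals_1)
  qed (auto simp: a_def[abs_def] b_def[abs_def] intro!: continuous_intros)
  obtain l where l: "continuous_map (cube 1) euclideanreal l" "\<forall>s\<in>icube 1. e (f s) = circ (l s)"
      "l (vtx 1 1) = 0" "l (vtx 1 0) = of_int k" using f(2) unfolding deg_def by blast
  obtain l' where l': "continuous_map (cube 1) euclideanreal l'" "\<forall>s\<in>icube 1. e (g s) = circ (l' s)"
      "l' (vtx 1 1) = 0" "l' (vtx 1 0) = of_int j" using g(2) unfolding deg_def by blast
  have f1: "f (vtx 1 0) \<in> A" "f (vtx 1 1) = p" and g1: "g (vtx 1 0) \<in> A" "g (vtx 1 1) = p" using f(1) g(1) by (simp_all add: R1_iff)
  have "deg K (k + j)" unfolding deg_def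
  proof (intro exI[of _ "\<lambda>s. l (s(0 := a (s 0))) + l' (s(0 := b (s 0)))"] conjI ballI)
    have c: "continuous_map (cube 1) (cube 1) (\<lambda>s. s(0 := q (s 0)))" if "continuous_on UNIV q" "\<And>x. 0 \<le> x \<Longrightarrow> x \<le> 1 \<Longrightarrow> 0 \<le> q x \<and> q x \<le> 1" for q :: "real \<Rightarrow> real"
    proof (rule continuous_map_cube_upd)
      show "continuous_map (cube 1) (cube 1) (\<lambda>s. s)" by simp
      have "continuous_map (cube 1) euclideanreal (\<lambda>s. s 0)" by (rule cube_coord[of _ 1]) auto
      then show "continuous_map (cube 1) euclideanreal (\<lambda>s. q (s 0))"
        using continuous_map_compose[of _ _ _ euclideanreal q] that(1) by (fastforce simp: o_def)
    qed (use that(2) in "auto simp: in_cube")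
    have "continuous_map (cube 1) (cube 1) (\<lambda>s. s(0 := a (s 0)))" "continuous_map (cube 1) (cube 1) (\<lambda>s. s(0 := b (s 0)))"
      by (rule c; auto simp: a_def[abs_def] b_def[abs_def] intro!: continuous_intros)+
    then show "continuous_map (cube 1) euclideanreal (\<lambda>s. l (s(0 := a (s 0))) + l' (s(0 := b (s 0))))"
      using continuous_map_compose[OF _ l(1)] continuous_map_compose[OF _ l'(1)] by (intro continuous_intros) (auto simp: o_def)
    fix s assume "s \<in> icube 1"
    then obtain x where x: "s = vtx 1 x" "0 \<le> x" "x \<le> 1" using cube_1[of s] by (auto simp: in_cube)
    show "e (K s) = circ (l (s(0 := a (s 0))) + l' (s(0 := b (s 0))))"
    proof (cases "x \<le> 1/2")
      case True
      have y: "vtx 1 (2 * x) \<in> icube 1" using True x by (intro vtx_cube) auto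
      have "e (K s) = e (g (vtx 1 (2 * x)))" using True e_m[OF f1(1) sph_top[OF g(1) y]] by (simp add: K_def x vtx_1_upd a_def b_def)
      then show ?thesis using l'(2) y True l(4) by (simp add: x vtx_1_upd a_def b_def cis_int)
    next
      case False
      have y: "vtx 1 (2 * x - 1) \<in> icube 1" using False x by (intro vtx_cube) auto
      have "K s = f (vtx 1 (2 * x - 1))" using False m_unit(2)[OF sph_top[OF f(1) y]] g1(2) by (simp add: K_def x vtx_1_upd a_def b_def)
      then show ?thesis using l(2) y False l'(3) by (simp add: x vtx_1_upd a_def b_def)
    qed
  qed (use l l' in "simp_all add: vtx_1_upd a_def b_def")
  moreover obtain i where "deg (pw f g) i" using deg_ex[OF homotopic_in_refl2[OF K]] by blast
  ultimately show ?thesis using deg_homotopy[OF K] by metis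
qed

text \<open>With its converse \<open>deg_path\<close> this describes relative paths of degree
  \<open>k\<close> as paths in the cover from level \<open>k\<close> over \<open>A\<close> to the
  base point.\<close>

lemma deg_of_path:
  assumes a: "a \<in> A" and c: "path_component_of E (a, of_int k) (p, 0)"
  shows "\<exists>f. R1 f f \<and> deg f k \<and> f (vtx 1 0) = a"
proof -
  obtain g where g: "pathin E g" "g 0 = (a, of_int k)" "g 1 = (p, 0)" using c by (auto simp: path_component_of_def)
  have c: "continuous_map (cube 1) I01 (\<lambda>s. s 0)"
    using cube_coord[of "cube 1" 1 "\<lambda>s. s" 0] by (auto simp: continuous_map_in_subtopology in_cube)
  from continuous_map_compose[OF this g(1)[unfolded pathin_def]]
  have "continuous_map (cube 1) E (\<lambda>s. g (s 0))" by (simp add: o_def)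
  then have gc: "continuous_map (cube 1) X (\<lambda>s. fst (g (s 0)))" "continuous_map (cube 1) euclideanreal (\<lambda>s. snd (g (s 0)))"
    "\<And>s. s \<in> icube 1 \<Longrightarrow> e (fst (g (s 0))) = circ (snd (g (s 0)))" unfolding continuous_map_total_space by auto
  show ?thesis
  proof (intro exI[of _ "\<lambda>s. fst (g (s 0))"] conjI)
    show "R1 (\<lambda>s. fst (g (s 0))) (\<lambda>s. fst (g (s 0)))" using gc(1) g(2,3) a by (simp add: R1_iff)
    show "deg (\<lambda>s. fst (g (s 0))) k" unfolding deg_def by (rule exI[of _ "\<lambda>s. snd (g (s 0))"]) (use gc g in auto)
  qed (simp add: g)
qed

lemma deg_path:
  assumes f: "R1 f f" "deg f k" shows "path_component_of E (f (vtx 1 0), of_int k) (p, 0)"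
proof -
  obtain l where l: "continuous_map (cube 1) euclideanreal l" "\<forall>s\<in>icube 1. e (f s) = circ (l s)"
      "l (vtx 1 1) = 0" "l (vtx 1 0) = of_int k" using f(2) unfolding deg_def by blast
  have v: "continuous_map I01 (cube 1) (vtx 1)" unfolding continuous_map_cube
  proof (intro conjI allI impI image_subsetI)
    show "vtx 1 t \<in> icube 1" if "t \<in> topspace I01" for t using that by (intro vtx_cube) auto
  qed (simp add: vtx_def)
  have "pathin E (\<lambda>t. (f (vtx 1 t), l (vtx 1 t)))" unfolding pathin_def continuous_map_total_space
    using continuous_map_compose[OF v sph_cont[OF f(1)]] continuous_map_compose[OF v l(1)] l(2) vtx_cube[of _ 1] by (auto simp: o_def)
  then show ?thesis unfolding path_component_of_def by (rule exI[of _ "\<lambda>t. (f (vtx 1 t), l (vtx 1 t))", OF conjI]) (use l f(1) in "simp add: R1_iff")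
qed

lemma deg_surj: "\<exists>f. R1 f f \<and> deg f k"
proof -
  obtain a where "a \<in> A" "path_component_of E (p, 0) (a, of_int k)" using loops by blast
  then show ?thesis using deg_of_path[of a k] path_component_of_sym by metis
qed

abbreviation "M \<equiv> rel_pi1_monoid X A m p"
abbreviation "rcl \<equiv> hclass 1 X (relv 1)"

lemma rel_pw_monoid: "pw_monoid 1 (relv 1) M" unfolding pw_monoid_def
proof (intro conjI allI impI)
  show "carrier M = hclasses 1 X (relv 1)" "\<one>\<^bsub>M\<^esub> = rcl (\<lambda>_. p)"
    by (simp_all add: rel_pi1_monoid_def rel_homotopy_set_def rel_trivial_class_def homotopic_rel_spheroids_in[OF p_A] hclasses_def hclass_def)
  fix f g assume "R1 f f" "R1 g g"
  from hclass_pw[OF this closed_vals_rel homotopic_pw[OF _ _ closed_vals_rel]]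
  show "rcl f \<otimes>\<^bsub>M\<^esub> rcl g = rcl (pw f g)" by (simp add: rel_pi1_monoid_def homotopic_rel_spheroids_in[OF p_A] pw_def)
qed

lemma M_carrier: "\<alpha> \<in> carrier M \<longleftrightarrow> (\<exists>f. R1 f f \<and> \<alpha> = rcl f)"
  and M_one: "\<one>\<^bsub>M\<^esub> = rcl (\<lambda>_. p)"
  and M_mult: "R1 f f \<Longrightarrow> R1 g g \<Longrightarrow> rcl f \<otimes>\<^bsub>M\<^esub> rcl g = rcl (pw f g)"
  using rel_pw_monoid by (simp_all add: pw_monoid_def hclasses_iff)

definition \<phi> :: "((nat \<Rightarrow> real) \<Rightarrow> 'a) set \<Rightarrow> int" where
  "\<phi> \<alpha> = (THE k. \<exists>f. R1 f f \<and> \<alpha> = rcl f \<and> deg f k)"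

lemma \<phi>_eq:
  assumes "R1 f f" "deg f k" shows "\<phi> (rcl f) = k" unfolding \<phi>_def
proof (rule the_equality)
  fix j assume "\<exists>g. R1 g g \<and> rcl f = rcl g \<and> deg g j"
  then obtain g where g: "rcl f = rcl g" "deg g j" by blast
  then have "R1 f g" using hclass_eq_iff[OF assms(1)] by blast
  then show "j = k" using deg_homotopy assms(2) g(2) by metis
qed (use assms in blast)

text \<open>A homomorphism from a monoid onto a group with trivial kernel is injective once inverses lift: an element of value
  \<open>k\<close> is determined by multiplying with fixed elements of value \<open>- k\<close> and \<open>k\<close>.\<close>

lemma \<phi>_iso: "\<phi> \<in> iso M integer_group"
proof -
  interpret M: monoid M by (rule pw_monoid_monoid[OF rel_pw_monoid closed_vals_rel])
  have hom: "\<phi> (a \<otimes>\<^bsub>M\<^esub> b) = \<phi> a + \<phi> b" if ab: "a \<in> carrier M" "b \<in> carrier M" for a b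
  proof -
    obtain f where f: "R1 f f" "a = rcl f" using ab(1) unfolding M_carrier by blast
    obtain g where g: "R1 g g" "b = rcl g" using ab(2) unfolding M_carrier by blast
    obtain k j where k: "deg f k" "deg g j" using deg_ex f(1) g(1) by blast
    show ?thesis unfolding f(2) g(2) M_mult[OF f(1) g(1)] \<phi>_eq[OF f(1) k(1)] \<phi>_eq[OF g(1) k(2)]
      by (rule \<phi>_eq[OF homotopic_pw[OF f(1) g(1) closed_vals_rel] deg_pw[OF f(1) k(1) g(1) k(2)]])
  qed
  have ker: "a = \<one>\<^bsub>M\<^esub>" if a: "a \<in> carrier M" "\<phi> a = 0" for a
  proof -
    obtain f where f: "R1 f f" "a = rcl f" using a(1) unfolding M_carrier by blast
    obtain k where k: "deg f k" using deg_ex f(1) by blast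
    then have "deg f 0" using \<phi>_eq[OF f(1) k] a(2) f(2) by simp
    then show ?thesis unfolding f(2) M_one by (rule hclass_eq[OF deg_0_trivial[OF f(1)]])
  qed
  have sur: "\<exists>a\<in>carrier M. \<phi> a = k" for k
  proof -
    obtain f where "R1 f f" "deg f k" using deg_surj by blast
    then show ?thesis using \<phi>_eq[of f k] by (intro bexI[of _ "rcl f"]) (auto simp: M_carrier)
  qed
  have inj: "inj_on \<phi> (carrier M)"
  proof (rule inj_onI)
    fix x y assume xy: "x \<in> carrier M" "y \<in> carrier M" "\<phi> x = \<phi> y"
    obtain t u where t: "t \<in> carrier M" "\<phi> t = - \<phi> x" and u: "u \<in> carrier M" "\<phi> u = \<phi> x" using sur by meson
    have ut: "u \<otimes>\<^bsub>M\<^esub> t = \<one>\<^bsub>M\<^esub>" by (rule ker) (simp_all add: t u hom)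
    have "z = u" if z: "z \<in> carrier M" "\<phi> z = \<phi> x" for z
    proof -
      have "t \<otimes>\<^bsub>M\<^esub> z = \<one>\<^bsub>M\<^esub>" by (rule ker) (simp_all add: t z hom)
      then have "u \<otimes>\<^bsub>M\<^esub> (t \<otimes>\<^bsub>M\<^esub> z) = u" using u(1) by simp
      moreover have "u \<otimes>\<^bsub>M\<^esub> t \<otimes>\<^bsub>M\<^esub> z = z" unfolding ut using z(1) by (rule M.l_one)
      ultimately show ?thesis using M.m_assoc[OF u(1) t(1) z(1)] by simp
    qed
    then show "x = y" using xy by metis
  qed
  have "\<phi> ` carrier M = UNIV" using sur by (metis UNIV_eq_I imageI)
  then show ?thesis unfolding iso_def bij_betw_def using hom inj by (simp add: hom_def)
qed

lemma boundary_rcl: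
  assumes f: "R1 f f" shows "rel_pi1_boundary X A (rcl f) = pc Y (f (vtx 1 0))"
proof -
  have same: "path_component_of Y (f (vtx 1 0)) (g (vtx 1 0))" if "R1 f g" for g
  proof -
    obtain H where H: "htpy 1 X (relv 1) f g H" using \<open>R1 f g\<close> unfolding homotopic_in_iff by blast
  note H = htpyD[OF H]
    have "continuous_map I01 (cyl 1) (\<lambda>t. (t, vtx 1 0))" using vtx1_cube by (simp add: continuous_map_paired continuous_map_const)
    from continuous_map_compose[OF this H(1)] have "continuous_map I01 X (\<lambda>t. H t (vtx 1 0))" by (simp add: o_def)
    moreover have "H t (vtx 1 0) \<in> A" if "t \<in> {0..1}" for t using H(4) that vtx1_cube(1) relv_1(1) by blast
    ultimately have "pathin Y (\<lambda>t. H t (vtx 1 0))" by (auto simp: pathin_def continuous_map_in_subtopology)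
    then show ?thesis unfolding path_component_of_def using H(2,3) vtx1_cube by blast
  qed
  have "rel_pi1_boundary X A (rcl f) = {y. \<exists>g\<in>rcl f. path_component_of Y (g (vtx 1 0)) y}" by (simp add: rel_pi1_boundary_def vtx_def)
  also have "\<dots> = pc Y (f (vtx 1 0))" using same f unfolding hclass_def pc_def by (auto intro: path_component_of_trans)
  finally show ?thesis .
qed

lemma pi1_to_rel_hclass:
  assumes f: "RX 1 f f" shows "pi1_to_rel X A p (clX 1 f) = rcl f"
  and abs_rel: "R1 f f"
proof -
  have sub: "abs_vals 1 p s \<subseteq> relv 1 s" for s using p_A subsetD[OF cube_box_boundary(1), of s 1] by (auto simp: abs_vals_def rel_vals_def)
  have *: "R1 f g" if "RX 1 f g" for g using homotopic_in_mono[of 1 X UNIV "abs_vals 1 p" f g "relv 1"] that sub by simp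
  show "pi1_to_rel X A p (clX 1 f) = rcl f" unfolding pi1_to_rel_def homotopic_rel_spheroids_in[OF p_A] by (rule hclass_incl[OF * f])
  show "R1 f f" by (rule *[OF f])
qed

lemma abs_1_iff: "RX 1 f f \<longleftrightarrow> R1 f f \<and> f (vtx 1 0) = p"
proof
  assume f: "RX 1 f f"
  then show "R1 f f \<and> f (vtx 1 0) = p" using abs_rel[OF f] sph_val[OF f] vtx_boundary[of 1 0] by auto
next
  assume "R1 f f \<and> f (vtx 1 0) = p"
  then show "RX 1 f f" unfolding homotopic_in_refl_iff[of 1 X "abs_vals 1 p"] R1_iff by (auto simp: abs_vals_def dest: boundary_1)
qed

section \<open>The inclusion and the exact sequence\<close>

abbreviation "GX n \<equiv> homotopy_group n X p"
abbreviation "GY n \<equiv> homotopy_group n Y p"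

lemma RY_RX: "RY n f g \<Longrightarrow> RX n f g" by (erule homotopic_in_mono) auto

lemma GX_iff: "0 < n \<Longrightarrow> \<alpha> \<in> carrier (GX n) \<longleftrightarrow> (\<exists>f. RX n f f \<and> \<alpha> = clX n f)"
  using homotopy_group_pw_monoid[of n] by (simp add: pw_monoid_def hclasses_iff)

lemma GY_iff: "0 < n \<Longrightarrow> \<alpha> \<in> carrier (GY n) \<longleftrightarrow> (\<exists>f. RY n f f \<and> \<alpha> = clY n f)"
  using Y.homotopy_group_pw_monoid[of n] by (simp add: Y.pw_monoid_def hclasses_iff)

lemma GX_mult: "0 < n \<Longrightarrow> RX n f f \<Longrightarrow> RX n g g \<Longrightarrow> clX n f \<otimes>\<^bsub>GX n\<^esub> clX n g = clX n (pw f g)"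
  using homotopy_group_pw_monoid[of n] by (simp add: pw_monoid_def)

lemma GY_mult: "0 < n \<Longrightarrow> RY n f f \<Longrightarrow> RY n g g \<Longrightarrow> clY n f \<otimes>\<^bsub>GY n\<^esub> clY n g = clY n (pw f g)"
  using Y.homotopy_group_pw_monoid[of n] by (simp add: Y.pw_monoid_def pw_def Y.pw_def)

lemma RY_pw: "RY n f f \<Longrightarrow> RY n g g \<Longrightarrow> RY n (pw f g) (pw f g)"
  using Y.homotopic_pw[OF _ _ Y.closed_vals_abs] by (simp add: pw_def Y.pw_def)

lemma incl_hom: "0 < n \<Longrightarrow> pi_incl n X p \<in> hom (GY n) (GX n)"
proof (rule homI)
  assume n: "0 < n"
  fix a assume "a \<in> carrier (GY n)"
  then obtain f where f: "RY n f f" "a = clY n f" using n by (auto simp: GY_iff)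
  show "pi_incl n X p a \<in> carrier (GX n)" using RY_RX[OF f(1)] n unfolding f(2) pi_incl_hclass[OF f(1)] by (auto simp: GX_iff)
  fix b assume "b \<in> carrier (GY n)"
  then obtain g where g: "RY n g g" "b = clY n g" using n by (auto simp: GY_iff)
  show "pi_incl n X p (a \<otimes>\<^bsub>GY n\<^esub> b) = pi_incl n X p a \<otimes>\<^bsub>GX n\<^esub> pi_incl n X p b"
    by (simp only: f(2) g(2) GY_mult[OF n f(1) g(1)] pi_incl_hclass[OF f(1)] pi_incl_hclass[OF g(1)]
        pi_incl_hclass[OF RY_pw[OF f(1) g(1)]] GX_mult[OF n RY_RX[OF f(1)] RY_RX[OF g(1)]])
qed

lemma incl_inj: "0 < n \<Longrightarrow> inj_on (pi_incl n X p) (carrier (GY n))"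
proof (rule inj_onI)
  fix a b assume n: "0 < n" and ab: "a \<in> carrier (GY n)" "b \<in> carrier (GY n)" "pi_incl n X p a = pi_incl n X p b"
  obtain f where f: "RY n f f" "a = clY n f" using ab(1) n by (auto simp: GY_iff)
  obtain g where g: "RY n g g" "b = clY n g" using ab(2) n by (auto simp: GY_iff)
  have "clX n f = clX n g" using ab(3) f g by (simp add: pi_incl_hclass)
  then have "RX n f g" using hclass_eq_iff[OF RY_RX[OF f(1)]] by blast
  then show "a = b" unfolding f(2) g(2) by (intro hclass_eq abs_incl_inj[OF n f(1) g(1)])
qed

lemma incl_image:
  assumes n: "0 < n" and f: "RX n f f" and l: "continuous_map (cube n) euclideanreal l"
    "\<And>s. s \<in> icube n \<Longrightarrow> e (f s) = circ (l s)" "\<And>s. s \<in> cube_boundary n \<Longrightarrow> l s = 0"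
  shows "clX n f \<in> pi_incl n X p ` carrier (GY n)"
proof -
  have d: "RX n f (\<lambda>s. D 1 (f s) (l s))" "RY n (\<lambda>s. D 1 (f s) (l s)) (\<lambda>s. D 1 (f s) (l s))"
    using abs_deform(1,2)[OF f l(1)] l(2,3) by blast+
  have "clX n f = pi_incl n X p (clY n (\<lambda>s. D 1 (f s) (l s)))" by (simp add: pi_incl_hclass[OF d(2)] hclass_eq[OF d(1)])
  moreover have "clY n (\<lambda>s. D 1 (f s) (l s)) \<in> carrier (GY n)" using d(2) n by (auto simp: GY_iff)
  ultimately show ?thesis by (rule image_eqI)
qed

text \<open>For \<open>n \<ge> 2\<close> the boundary is connected, so the lift of an absolute
  spheroid, integral there and \<open>0\<close> at a vertex, vanishes on it and the spheroid deforms
  into \<open>A\<close>. For \<open>n = 1\<close> the lift may differ by an integer at the two ends,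
  which is the degree.\<close>

lemma incl_iso:
  assumes n: "2 \<le> n" shows "pi_incl n X p \<in> iso (GY n) (GX n)"
proof -
  have n0: "0 < n" using n by simp
  have "clX n f \<in> pi_incl n X p ` carrier (GY n)" if f: "RX n f f" for f
  proof -
    have "e (f (vtx n 1)) = circ 0" using sph_val[OF f] vtx_boundary[OF n0] e_A[OF p_A] by simp
    then obtain l where l: "continuous_map (cube n) euclideanreal l" "\<And>s. s \<in> icube n \<Longrightarrow> e (f s) = circ (l s)" "l (vtx n 1) = 0"
      using lift[OF contraction_cube sph_cont[OF f], of "vtx n 1" 0] vtx_cube[of 1 n] by auto
    have i: "\<exists>k::int. l s = of_int k" if "s \<in> cube_boundary n" for s
    proof -
      have "s \<in> icube n" using that cube_box_boundary(2) by blast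
      then show ?thesis using sph_val[OF f that] e_A_int[OF p_A] l(2) by metis
    qed
    show ?thesis using boundary_int_const[OF n l(1) i] l(3) by (intro incl_image[OF n0 f l(1,2)]) auto
  qed
  then have "carrier (GX n) \<subseteq> pi_incl n X p ` carrier (GY n)" using n0 by (auto simp: GX_iff)
  then show ?thesis unfolding iso_def bij_betw_def using incl_hom[OF n0] incl_inj[OF n0] by (auto simp: hom_def Pi_iff)
qed

abbreviation "PX \<equiv> pi0_monoid X m p"
abbreviation "PY \<equiv> pi0_monoid Y m p"

text \<open>Everything is read off paths in the cover: \<open>d k\<close> is the component of any
  \<open>a\<close> in \<open>A\<close> for which \<open>(a, of_int k)\<close> can be joined to
  \<open>(p, 0)\<close>, and absolute loops are the case \<open>a = p\<close>. Exactness at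
  \<open>GX 1\<close> uses that a loop of degree \<open>0\<close> has a lift vanishing at both
  ends.\<close>

lemma exact_sequence:
  defines "j \<equiv> \<phi> \<circ> pi1_to_rel X A p" and "d \<equiv> rel_pi1_boundary X A \<circ> inv_into (carrier M) \<phi>"
  shows "group_hom (GY 1) (GX 1) (pi_incl 1 X p)" "group_hom (GX 1) integer_group j" "group_hom integer_group PY d"
    "group_hom PY PX (pi0_incl X)" "exact_at (GY 1) (pi_incl 1 X p) (GX 1) j integer_group" "exact_at (GX 1) j integer_group d PY"
    "exact_at integer_group d PY (pi0_incl X) PX" "pi0_incl X ` carrier PY = carrier PX"
proof -
  have n1: "(0::nat) < 1" by simp
  interpret GX: group "GX 1" by (rule homotopy_group_group[OF n1])
  interpret GY: group "GY 1" by (rule Y.homotopy_group_group[OF n1])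
  interpret PX: group PX by (rule pi0_group[OF left_inv])
  interpret PY: group PY by (rule Y.pi0_group) (use left_inv_A topspace_Y in auto)
  interpret Z: group integer_group by (rule group_integer_group)
  have AX: "x \<in> topspace X" if "x \<in> A" for x using that A_top by blast
  have jf: "j (clX 1 f) = k" if "RX 1 f f" "deg f k" for f k
    unfolding j_def o_apply pi1_to_rel_hclass[OF that(1)] by (rule \<phi>_eq[OF abs_rel[OF that(1)] that(2)])
  have df: "d k = pc Y (f (vtx 1 0))" if f: "R1 f f" "deg f k" for f k
  proof -
    have "inv_into (carrier M) \<phi> k = rcl f" by (rule inv_into_f_eq) (use \<phi>_iso f \<phi>_eq M_carrier in "auto simp: iso_def bij_betw_def")
    then show ?thesis by (simp add: d_def boundary_rcl[OF f(1)])
  qed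
  have dA: "\<exists>f. R1 f f \<and> deg f k \<and> d k = pc Y (f (vtx 1 0)) \<and> f (vtx 1 0) \<in> A" for k
  proof -
    obtain f where f: "R1 f f" "deg f k" using deg_surj by blast
    then show ?thesis using df[OF f] by (auto simp: R1_iff)
  qed
  show "group_hom (GY 1) (GX 1) (pi_incl 1 X p)" by (intro group_hom.intro group_hom_axioms.intro incl_hom n1 GX.is_group GY.is_group)
  show "group_hom (GX 1) integer_group j"
  proof (intro group_hom.intro group_hom_axioms.intro GX.is_group Z.is_group homI)
    fix c n assume ab: "c \<in> carrier (GX 1)" "n \<in> carrier (GX 1)"
    obtain f where f: "RX 1 f f" "c = clX 1 f" using ab(1) n1 by (auto simp: GX_iff)
    obtain g where g: "RX 1 g g" "n = clX 1 g" using ab(2) n1 by (auto simp: GX_iff)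
    obtain k i where k: "deg f k" "deg g i" using deg_ex abs_rel f(1) g(1) by meson
    have "j (clX 1 (pw f g)) = k + i" by (rule jf[OF homotopic_pw[OF f(1) g(1) closed_vals_abs] deg_pw[OF abs_rel[OF f(1)] k(1) abs_rel[OF g(1)] k(2)]])
    then show "j (c \<otimes>\<^bsub>GX 1\<^esub> n) = j c \<otimes>\<^bsub>integer_group\<^esub> j n"
      by (simp add: f(2) g(2) GX_mult[OF n1 f(1) g(1)] jf[OF f(1) k(1)] jf[OF g(1) k(2)])
  qed simp
  show "group_hom integer_group PY d"
  proof (intro group_hom.intro group_hom_axioms.intro PY.is_group Z.is_group homI)
    fix k i :: int
    obtain f where f: "R1 f f" "deg f k" "d k = pc Y (f (vtx 1 0))" "f (vtx 1 0) \<in> A" using dA by blast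
    obtain g where g: "R1 g g" "deg g i" "d i = pc Y (g (vtx 1 0))" "g (vtx 1 0) \<in> A" using dA by blast
    show "d k \<in> carrier PY" unfolding Y.pi0_carrier topspace_Y using f by blast
    have "d (k + i) = pc Y (pw f g (vtx 1 0))" by (rule df[OF homotopic_pw[OF f(1) g(1) closed_vals_rel] deg_pw[OF f(1,2) g(1,2)]])
    also have "\<dots> = d k \<otimes>\<^bsub>PY\<^esub> d i" unfolding f(3) g(3) using f(4) g(4) topspace_Y by (subst Y.pi0_mult) (simp_all add: pw_def)
    finally show "d (k \<otimes>\<^bsub>integer_group\<^esub> i) = d k \<otimes>\<^bsub>PY\<^esub> d i" by simp
  qed
  have i0: "pi0_incl X (pc Y x) = pc X x" if "x \<in> A" for x by (rule pi0_incl_pc[OF that AX[OF that]])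
  show "group_hom PY PX (pi0_incl X)"
  proof (intro group_hom.intro group_hom_axioms.intro PY.is_group PX.is_group homI)
    fix C assume "C \<in> carrier PY"
    then obtain x where x: "x \<in> A" "C = pc Y x" unfolding Y.pi0_carrier topspace_Y by blast
    show "pi0_incl X C \<in> carrier PX" unfolding x(2) i0[OF x(1)] pi0_carrier using AX[OF x(1)] by blast
    fix B assume "B \<in> carrier PY"
    then obtain y where y: "y \<in> A" "B = pc Y y" unfolding Y.pi0_carrier topspace_Y by blast
    have "C \<otimes>\<^bsub>PY\<^esub> B = pc Y (m x y)" unfolding x(2) y(2) by (rule Y.pi0_mult) (use x y topspace_Y in auto)
    then show "pi0_incl X (C \<otimes>\<^bsub>PY\<^esub> B) = pi0_incl X C \<otimes>\<^bsub>PX\<^esub> pi0_incl X B"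
      by (simp add: x(2) y(2) i0 x(1) y(1) m_A pi0_mult AX)
  qed
  show "pi0_incl X ` carrier PY = carrier PX"
  proof (intro equalityI subsetI)
    fix C assume "C \<in> pi0_incl X ` carrier PY"
    then obtain x where "x \<in> A" "C = pc X x" using i0 by (auto simp: Y.pi0_carrier topspace_Y)
    then show "C \<in> carrier PX" unfolding pi0_carrier using AX by blast
  next
    fix C assume "C \<in> carrier PX"
    then obtain x where x: "x \<in> topspace X" "C = pc X x" unfolding pi0_carrier by blast
    obtain s where s: "e x = circ s" using e_cis[OF x(1)] by blast
    have a: "D 1 x s \<in> A" by (rule D_1[OF x(1) s])
    have "C = pi0_incl X (pc Y (D 1 x s))" unfolding i0[OF a] x(2) by (rule pc_eq[OF D_path[OF x(1) s]])
    then show "C \<in> pi0_incl X ` carrier PY" using a unfolding image_iff bex_simps Y.pi0_carrier Bex_def topspace_Y by blast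
  qed
  show "exact_at (GY 1) (pi_incl 1 X p) (GX 1) j integer_group" unfolding exact_at_def
  proof (intro equalityI subsetI)
    fix c assume "c \<in> pi_incl 1 X p ` carrier (GY 1)"
    then obtain f where f: "RY 1 f f" "c = clX 1 f" by (auto simp: GY_iff pi_incl_hclass)
    have fX: "RX 1 f f" by (rule RY_RX[OF f(1)])
    have "deg f 0" unfolding deg_def by (rule exI[of _ "\<lambda>_. 0"]) (use Y.sph_top[OF f(1)] e_A in "auto simp: continuous_map_const")
    then show "c \<in> kernel (GX 1) integer_group j" using fX jf[OF fX] f(2) by (auto simp: kernel_def GX_iff)
  next
    fix c assume "c \<in> kernel (GX 1) integer_group j"
    then obtain f where f: "RX 1 f f" "c = clX 1 f" "j (clX 1 f) = 0" by (auto simp: kernel_def GX_iff)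
    obtain k where "deg f k" using deg_ex[OF abs_rel[OF f(1)]] by blast
    then have "deg f 0" using jf[OF f(1)] f(3) by metis
    then obtain l where l: "continuous_map (cube 1) euclideanreal l" "\<forall>s\<in>icube 1. e (f s) = circ (l s)"
      "l (vtx 1 1) = 0" "l (vtx 1 0) = of_int 0" unfolding deg_def by blast
    show "c \<in> pi_incl 1 X p ` carrier (GY 1)" unfolding f(2) by (rule incl_image[OF n1 f(1) l(1)]) (use l in "auto dest!: boundary_1")
  qed
  show "exact_at (GX 1) j integer_group d PY" unfolding exact_at_def
  proof (intro equalityI subsetI)
    fix k assume "k \<in> j ` carrier (GX 1)"
    then obtain f where f: "RX 1 f f" "k = j (clX 1 f)" by (auto simp: GX_iff)
    obtain i where i: "deg f i" using deg_ex[OF abs_rel[OF f(1)]] by blast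
    have "d i = pc Y p" using df[OF abs_rel[OF f(1)] i] f(1) abs_1_iff by simp
    then show "k \<in> kernel integer_group PY d" using jf[OF f(1) i] f(2) by (simp add: kernel_def Y.pi0_one)
  next
    fix k assume "k \<in> kernel integer_group PY d"
    then have dk: "d k = pc Y p" by (simp add: kernel_def Y.pi0_one)
    obtain f where f: "R1 f f" "deg f k" "d k = pc Y (f (vtx 1 0))" "f (vtx 1 0) \<in> A" using dA by blast
    then have "path_component_of Y p (f (vtx 1 0))" using pc_eq_iff[of p Y "f (vtx 1 0)"] dk p_A AX[OF p_A] by simp
    then obtain g where g: "pathin Y g" "g 0 = p" "g 1 = f (vtx 1 0)" by (auto simp: path_component_of_def)
    have gX: "continuous_map I01 X g" "\<And>t. t \<in> {0..1} \<Longrightarrow> g t \<in> A" using g(1) by (auto simp: pathin_def continuous_map_in_subtopology)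
    \<comment> \<open>A path in \<open>A\<close> lifts to any constant integral level. Followed by
      the path of \<open>f\<close> down to level \<open>0\<close> it becomes an absolute loop of
      degree \<open>k\<close>.\<close>
    have "pathin E (\<lambda>t. (g t, of_int k))" unfolding pathin_def continuous_map_total_space
      using gX e_A cis_int[of k 0] by (auto simp: continuous_map_const)
    then have "path_component_of E (p, of_int k) (f (vtx 1 0), of_int k)" unfolding path_component_of_def using g(2,3) by (intro exI[of _ "\<lambda>t. (g t, of_int k)"]) simp
    from path_component_of_trans[OF this deg_path[OF f(1,2)]]
    obtain h where h: "R1 h h" "deg h k" "h (vtx 1 0) = p" using deg_of_path[OF p_A] by blast
    then have hX: "RX 1 h h" using abs_1_iff by blast
    show "k \<in> j ` carrier (GX 1)" by (rule image_eqI[of _ _ "clX 1 h"]) (use jf[OF hX h(2)] hX in "auto simp: GX_iff")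
  qed
  show "exact_at integer_group d PY (pi0_incl X) PX" unfolding exact_at_def
  proof (intro equalityI subsetI)
    fix C assume "C \<in> d ` carrier integer_group"
    then obtain k where k: "C = d k" by auto
    obtain f where f: "R1 f f" "deg f k" "d k = pc Y (f (vtx 1 0))" "f (vtx 1 0) \<in> A" using dA by blast
    have "pc X (f (vtx 1 0)) = pc X p" by (rule pc_eq[OF E_to_X[OF deg_path[OF f(1,2)]]])
    then have "pi0_incl X C = \<one>\<^bsub>PX\<^esub>" unfolding k f(3) i0[OF f(4)] pi0_one .
    moreover have "C \<in> carrier PY" unfolding k f(3) Y.pi0_carrier topspace_Y using f(4) by blast
    ultimately show "C \<in> kernel PY PX (pi0_incl X)" by (simp add: kernel_def)
  next
    fix C assume C: "C \<in> kernel PY PX (pi0_incl X)"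
    then obtain x where x: "x \<in> A" "C = pc Y x" unfolding kernel_def Y.pi0_carrier topspace_Y by blast
    then have "pc X x = pc X p" using C i0[OF x(1)] by (simp add: kernel_def pi0_one)
    then have "path_component_of X p x" using pc_eq_iff[OF p_top] by metis
    moreover have "e p = circ 0" using e_A[OF p_A] by simp
    \<comment> \<open>The lift of a path from \<open>p\<close> to \<open>x\<close> ends over
      \<open>A\<close>, hence at an integral level; read backwards it is a relative path with
      boundary \<open>x\<close>.\<close>
    ultimately obtain s where s: "path_component_of E (p, 0) (x, s)" using lift_path by blast
    obtain k :: int where k: "s = of_int k" using e_A_int[OF x(1)] E_end[OF s] by blast
    obtain b where b: "b \<in> A" "path_component_of E (p, 0) (b, of_int (- k))" using loops by blast
    have "path_component_of E (x, of_int k) (p, 0)" using s k path_component_of_sym by metis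
    then obtain f where f: "R1 f f" "deg f k" "f (vtx 1 0) = x" using deg_of_path[OF x(1)] by blast
    then have "C = d k" using df x(2) by simp
    then show "C \<in> d ` carrier integer_group" by simp
  qed
qed

lemma rel_homotopy_set_trivial: "2 \<le> n \<Longrightarrow> rel_homotopy_set n X A p = {rel_trivial_class n X A p}"
proof -
  assume n: "2 \<le> n"
  have "rel_homotopy_set n X A p = hclasses n X (relv n)" by (simp add: rel_homotopy_set_def homotopic_rel_spheroids_in[OF p_A] hclasses_def)
  moreover have "rel_trivial_class n X A p = hclass n X (relv n) (\<lambda>_. p)"
    by (simp add: rel_trivial_class_def homotopic_rel_spheroids_in[OF p_A] hclass_def)
  moreover have "a \<in> hclasses n X (relv n) \<longleftrightarrow> a = hclass n X (relv n) (\<lambda>_. p)" for a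
    unfolding hclasses_iff using hclass_eq[OF rel_trivial[OF n]] homotopic_const[OF closed_vals_rel] by metis
  ultimately show ?thesis by (simp add: set_eq_iff)
qed

lemma path_components_meet: "C \<in> path_components_of X \<Longrightarrow> C \<inter> A \<noteq> {}"
proof -
  assume "C \<in> path_components_of X"
  then obtain x where x: "x \<in> topspace X" "C = pc X x" unfolding path_components_pc by blast
  obtain s where s: "e x = circ s" using e_cis[OF x(1)] by blast
  then have "D 1 x s \<in> C \<inter> A" using D_1[OF x(1) s] D_path[OF x(1) s] x(2) by (simp add: pc_def)
  then show ?thesis by blast
qed

end

section \<open>The mapping spaces as a pair over the circle\<close>

context tc_flow
begin

lemma circle_pair_E: "circle_pair (XT r) (compose disk) id_disk (E_bdry F) e_pt contr"
proof
  have sub: "E_bdry F \<subseteq> E_plus F" by (auto simp: E_bdry_def)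
  let ?E = "total_space (XT r) e_pt"
  have top: "x \<in> topspace (XT r) \<longleftrightarrow> x \<in> E_plus F" for x by (simp only: topspace_XT)
  show "continuous_map (prod_topology (XT r) (XT r)) (XT r) (\<lambda>z. compose disk (fst z) (snd z))" by (rule compose_continuous)
  show "id_disk \<in> topspace (XT r)" unfolding top by (rule id_E_plus)
  show "compose disk (compose disk x y) z = compose disk x (compose disk y z)"
    if "x \<in> topspace (XT r)" "y \<in> topspace (XT r)" "z \<in> topspace (XT r)" for x y z
    using that E_plus_disk unfolding top by (auto simp: compose_def fun_eq_iff restrict_def)
  show "compose disk id_disk x = x" "compose disk x id_disk = x" if "x \<in> topspace (XT r)" for x
    using that E_plus_disk unfolding top by (auto simp: compose_def fun_eq_iff restrict_def E_plus_ext)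
  show "E_bdry F \<subseteq> topspace (XT r)" using sub unfolding topspace_XT .
  show "id_disk \<in> E_bdry F" by (rule id_E_bdry)
  show "compose disk x y \<in> E_bdry F" if "x \<in> E_bdry F" "y \<in> E_bdry F" for x y by (rule E_bdry_compose[OF that])
  show "continuous_map (XT r) euclidean e_pt" by (rule e_pt_continuous)
  show "norm (e_pt x) = 1" if "x \<in> topspace (XT r)" for x using that unfolding top by (rule norm_e_pt)
  show "e_pt x = 1" if "x \<in> E_bdry F" for x by (rule e_pt_bdry[OF that])
  show "e_pt (compose disk a x) = e_pt x" if "a \<in> E_bdry F" "x \<in> topspace (XT r)" for a x using that e_pt_compose unfolding top by blast
  show "continuous_map (prod_topology euclideanreal ?E) (XT r) (\<lambda>z. contr (fst z) (fst (snd z)) (snd (snd z)))"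
  proof -
    let ?T = "prod_topology euclideanreal ?E"
    have "continuous_map ?T ?E snd" by (rule continuous_map_snd)
    then have s: "continuous_map ?T (XT r) (\<lambda>z. fst (snd z))" "continuous_map ?T euclideanreal (\<lambda>z. snd (snd z))"
      "\<And>z. z \<in> topspace ?T \<Longrightarrow> e_pt (fst (snd z)) = circ (snd (snd z))" unfolding continuous_map_total_space by blast+
    show ?thesis unfolding continuous_map_XT
      by (intro conjI ballI allI impI contr_E_plus contr_family XT_family[OF s(1)] XT_E_plus[OF s(1)] s(2,3) continuous_map_fst)
  qed
  show "contr 0 x s = x" "contr 1 x s \<in> E_bdry F" if "x \<in> topspace (XT r)" "e_pt x = circ s" for x s using that contr_0 contr_1 unfolding top by blast+
  show "contr t x 0 \<in> E_bdry F" if "x \<in> E_bdry F" for x t using contr_bdry[OF that] e_pt_bdry[OF that] by simp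
  show "contr t id_disk 0 = id_disk" for t by (rule contr_id)
  show "\<exists>a\<in>E_bdry F. path_component_of ?E (id_disk, 0) (a, of_int k)" for k :: int
  proof -
    define w where "w = W pt (per pt)"
    have w: "w = 2 * pi \<or> w = - (2 * pi)" using W_pt by (auto simp: w_def)
    \<comment> \<open>For a clockwise flow one boundary period turns by - 2 pi, so the number of
      twists has the opposite sign of the level to be reached.\<close>
    define j where "j = (if w > 0 then k else - k)"
    have "of_int j * w = 2 * pi * of_int k" using w pi_gt_zero by (auto simp: j_def)
    then have Wj: "W pt (of_int j * per pt) = 2 * pi * of_int k" using W_int_period[OF pt(3) \<Phi>_per[OF pt(3)], of j] by (simp add: w_def)
    let ?g = "\<lambda>c. (twist (c * (of_int j * per pt)), W pt (c * (of_int j * per pt)) / (2 * pi))"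
    have c: "continuous_map I01 euclideanreal (\<lambda>c. c * (of_int j * per pt))" by (auto intro!: continuous_intros)
    have "pathin ?E ?g" unfolding pathin_def continuous_map_total_space
      by (auto simp: continuous_map_XT twist_E_plus e_pt_twist pt intro!: twist_family c W_cont continuous_intros)
    moreover have "?g 0 = (id_disk, 0)" "?g 1 = (twist (of_int j * per pt), of_int k)" by (simp_all add: twist_0 W_0 pt Wj)
    ultimately show ?thesis using twist_bdry[of j] unfolding path_component_of_def by blast
  qed
  show "\<exists>g\<in>topspace (XT r). path_component_of (XT r) (compose disk g x) id_disk" if "x \<in> topspace (XT r)" for x
  proof -
    have x: "x \<in> E_plus F" using that unfolding top .
    obtain g d where g: "g \<in> E_plus F" "0 < d" "d < 1" "\<forall>y. norm y < d \<longrightarrow> compose disk g x y = y"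
      using left_inverse_exists[OF x] by blast
    have "path_component_of (XT r) (compose disk g x) id_disk" by (rule path_to_id[OF E_plus_compose[OF g(1) x] g(2,3)]) (use g(4) in blast)
    then show ?thesis using g(1) unfolding Bex_def top by blast
  qed
qed

end

theorem theorem2p3:
  fixes F :: "real^2 \<Rightarrow> real^2" and r :: enat
    and X Y :: "(real^2 \<Rightarrow> real^2) topology"
  assumes "TC_vector_field F"
  defines "X \<equiv> subtopology (weak_topology r) (E_plus F)"
    and "Y \<equiv> subtopology (weak_topology r) (E_bdry F)"
  shows "(\<forall>C\<in>path_components_of X. C \<inter> E_bdry F \<noteq> {}) \<and>
    rel_pi1_monoid X (E_bdry F) (compose disk) id_disk \<cong> integer_group \<and>
    (\<forall>n\<ge>2. rel_homotopy_set n X (E_bdry F) id_disk = {rel_trivial_class n X (E_bdry F) id_disk}) \<and>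
    (\<forall>n\<ge>2. pi_incl n X id_disk \<in> iso (homotopy_group n Y id_disk) (homotopy_group n X id_disk)) \<and>
    (\<exists>\<phi>\<in>iso (rel_pi1_monoid X (E_bdry F) (compose disk) id_disk) integer_group.
       let G1 = homotopy_group 1 Y id_disk;
           G2 = homotopy_group 1 X id_disk;
           G4 = pi0_monoid Y (compose disk) id_disk;
           G5 = pi0_monoid X (compose disk) id_disk;
           i1 = pi_incl 1 X id_disk;
           j = \<phi> \<circ> pi1_to_rel X (E_bdry F) id_disk;
           d = rel_pi1_boundary X (E_bdry F) \<circ>
                 inv_into (carrier (rel_pi1_monoid X (E_bdry F) (compose disk) id_disk)) \<phi>;
           i0 = pi0_incl X
       in group_hom G1 G2 i1 \<and> group_hom G2 integer_group j \<and>
          group_hom integer_group G4 d \<and> group_hom G4 G5 i0 \<and>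
          inj_on i1 (carrier G1) \<and>
          exact_at G1 i1 G2 j integer_group \<and>
          exact_at G2 j integer_group d G4 \<and>
          exact_at integer_group d G4 i0 G5 \<and>
          i0 ` carrier G4 = carrier G5)"
proof -
  obtain G \<Phi> L where "tc_flow F G \<Phi> L" using tc_flow_exists[OF assms(1)] by blast
  then interpret tc_flow F G \<Phi> L .
  interpret C: circle_pair X "compose disk" id_disk "E_bdry F" e_pt contr unfolding X_def by (rule circle_pair_E)
  have "E_plus F \<inter> E_bdry F = E_bdry F" by (auto simp: E_bdry_def)
  then have Y: "Y = subtopology X (E_bdry F)" by (simp add: X_def Y_def subtopology_subtopology)
  have "rel_pi1_monoid X (E_bdry F) (compose disk) id_disk \<cong> integer_group" using C.\<phi>_iso by (rule is_isoI)
  then show ?thesis unfolding Y Let_def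
    by (intro conjI ballI allI impI bexI[of _ C.\<phi>] C.exact_sequence C.\<phi>_iso C.incl_iso C.incl_inj C.path_components_meet C.rel_homotopy_set_trivial)
      simp_all
qed

end
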